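(* Let $(G,\Gamma)$ be a Hecke pair with reduction $(G_r,\Gamma_r)$ and Schlichting completion $(\overline{G},\overline{\Gamma})$, and let $p=\chi_{\overline{\Gamma}}$. If one of the groups $G$, $G_r$ (as discrete groups) or $\overline{G}$ (in its totally disconnected locally compact topology) has subexponential growth, then $$C^*(L^1(G,\Gamma))\cong pC^*(\overline{G})p\cong C^*_r(G,\Gamma),$$ i.e. the canonical surjections $C^*(L^1(G,\Gamma))\to pC^*(\overline{G})p\to C^*_r(G,\Gamma)$ are isomorphisms.
   Context: A locally compact group $H$ with Haar measure $\mu$ has subexponential growth if $\limsup_{n\to\infty}\mu(V^n)^{1/n}=1$ for every compact neighbourhood $V$ of $e$. A Hecke pair $(G,\Gamma)$ is a (discrete) group $G$ with a subgroup $\Gamma$ such that every double coset $\Gamma g\Gamma$ is a union of finitely many left (and right) cosets of $\Gamma$. Put $R^\Gamma=\bigcap_{g\in G}g\Gamma g^{-1}$; the reduction is $(G_r,\Gamma_r)=(G/R^\Gamma,\Gamma/R^\Gamma)$. Schlichting completion: $\overline{G}$ is the closure of the image of $G$ in the permutation group of the set $G/\Gamma$ (action by left multiplication, topology of pointwise convergence with $G/\Gamma$ discrete), and $\overline{\Gamma}$ is the closure of the image of $\Gamma$. Then $\overline{G}$ is a totally disconnected locally compact group, $\overline{\Gamma}$ is a compact open subgroup, $G_r$ embeds densely in $\overline{G}$, and $\Gamma\backslash G/\Gamma\to\overline{\Gamma}\backslash\overline{G}/\overline{\Gamma}$ is a bijection. Use the left Haar measure $\mu$ on $\overline{G}$ with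 $\mu(\overline{\Gamma})=1$ and the usual Banach $^*$-algebra $L^1(\overline{G})$; $p:=\chi_{\overline{\Gamma}}\in C_c(\overline{G})$ is a projection. Hecke algebra: $\mathcal{H}(G,\Gamma)$ is the $^*$-algebra of finitely supported functions $\Gamma\backslash G/\Gamma\to\mathbb{C}$ with $(f_1*f_2)(\Gamma g\Gamma)=\sum_{h\Gamma\in G/\Gamma}f_1(\Gamma h\Gamma)f_2(\Gamma h^{-1}g\Gamma)$ and $f^*(\Gamma g\Gamma)=\Delta(g^{-1})\overline{f(\Gamma g^{-1}\Gamma)}$, where $\Delta(g)=L(g)/R(g)$, $L(g)=|\Gamma g\Gamma/\Gamma|$, $R(g)=|\Gamma\backslash\Gamma g\Gamma|$. It is canonically $^*$-isomorphic to $pC_c(\overline{G})p$. $L^1(G,\Gamma)$ is its completion in the norm $\|f\|_{L^1}=\sum_{\Gamma g\Gamma}|f(\Gamma g\Gamma)|L(g)$; canonically $L^1(G,\Gamma)\cong pL^1(\overline{G})p$. $C^*$-completions of $\mathcal{H}(G,\Gamma)$: $C^*(L^1(G,\Gamma))$ is the enveloping $C^*$-algebra of $L^1(G,\Gamma)$; $pC^*(\overline{G})p$ is the corner of the full group $C^*$-algebra; $C^*_r(G,\Gamma)$ is the completion in the norm of the left regular representation, i.e. the closure of $\mathcal{H}(G,\Gamma)\cong pC_c(\overline{G})p$ under the left regular representation of $L^1(\overline{G})$ on $L^2(\overline{G})$. The identity on $\mathcal{H}(G,\Gamma)$ induces canonical surjections $C^*(L^1(G,\Gamma))\to pC^*(\overline{G})p\to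 C^*_r(G,\Gamma)$. *)

theory Defs
  imports "HOL-Analysis.Analysis" "HOL-Algebra.Left_Coset" "HOL-Algebra.Bij"
begin

section \<open>Normed *-algebras with explicit carriers\<close>

text \<open>No axioms are bundled with the record; \<open>nrm\<close> may also be a mere seminorm.\<close>

record 'x star_alg = "'x partial_object" +
  vadd :: "'x \<Rightarrow> 'x \<Rightarrow> 'x"
  scal :: "complex \<Rightarrow> 'x \<Rightarrow> 'x"
  vmul :: "'x \<Rightarrow> 'x \<Rightarrow> 'x"
  star :: "'x \<Rightarrow> 'x"
  nrm  :: "'x \<Rightarrow> real"

definition vdiff :: "'x star_alg \<Rightarrow> 'x \<Rightarrow> 'x \<Rightarrow> 'x" where
  "vdiff A a b = vadd A a (scal A (-1) b)"

definition star_hom :: "'x star_alg \<Rightarrow> 'y star_alg \<Rightarrow> ('x \<Rightarrow> 'y) \<Rightarrow> bool" where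
  "star_hom A B \<Phi> \<longleftrightarrow>
     (\<forall>a\<in>carrier A. \<Phi> a \<in> carrier B) \<and>
     (\<forall>a\<in>carrier A. \<forall>b\<in>carrier A. \<Phi> (vadd A a b) = vadd B (\<Phi> a) (\<Phi> b)) \<and>
     (\<forall>c. \<forall>a\<in>carrier A. \<Phi> (scal A c a) = scal B c (\<Phi> a)) \<and>
     (\<forall>a\<in>carrier A. \<forall>b\<in>carrier A. \<Phi> (vmul A a b) = vmul B (\<Phi> a) (\<Phi> b)) \<and>
     (\<forall>a\<in>carrier A. \<Phi> (star A a) = star B (\<Phi> a))"

definition star_iso :: "'x star_alg \<Rightarrow> 'y star_alg \<Rightarrow> ('x \<Rightarrow> 'y) \<Rightarrow> bool" where
  "star_iso A B \<Phi> \<longleftrightarrow> star_hom A B \<Phi> \<and> bij_betw \<Phi> (carrier A) (carrier B) \<and>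
     (\<forall>a\<in>carrier A. nrm B (\<Phi> a) = nrm A a)"

text \<open>
  \<open>i\<close> and \<open>j\<close> map a *-algebra with carrier \<open>X\<close> onto dense *-subalgebras of \<open>A\<close> and \<open>B\<close>; a
  canonical surjection is one induced by the identity of \<open>X\<close>.  By density and continuity it is
  unique on \<open>carrier A\<close>.  (A *-homomorphism of C*-algebras is automatically contractive.)
\<close>

definition canonical_surjection ::
  "'z set \<Rightarrow> ('z \<Rightarrow> 'x) \<Rightarrow> 'x star_alg \<Rightarrow> ('z \<Rightarrow> 'y) \<Rightarrow> 'y star_alg \<Rightarrow> ('x \<Rightarrow> 'y) \<Rightarrow> bool" where
  "canonical_surjection X i A j B \<Phi> \<longleftrightarrow> star_hom A B \<Phi> \<and> \<Phi> ` carrier A = carrier B \<and>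
     (\<forall>a\<in>carrier A. nrm B (\<Phi> a) \<le> nrm A a) \<and> (\<forall>x\<in>X. \<Phi> (i x) = j x)"

definition cauchy_in :: "'x star_alg \<Rightarrow> (nat \<Rightarrow> 'x) \<Rightarrow> bool" where
  "cauchy_in A s \<longleftrightarrow> range s \<subseteq> carrier A \<and>
     (\<forall>e>0. \<exists>N. \<forall>m\<ge>N. \<forall>n\<ge>N. nrm A (vdiff A (s m) (s n)) < e)"

definition cauchy_class :: "'x star_alg \<Rightarrow> (nat \<Rightarrow> 'x) \<Rightarrow> (nat \<Rightarrow> 'x) set" where
  "cauchy_class A s =
     {t. cauchy_in A t \<and> (\<lambda>n. nrm A (vdiff A (s n) (t n))) \<longlonglongrightarrow> 0}"

definition class_rep :: "(nat \<Rightarrow> 'x) set \<Rightarrow> nat \<Rightarrow> 'x" where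
  "class_rep X = (SOME s. s \<in> X)"

text \<open>Hausdorff completion: Cauchy sequences for \<open>nrm\<close> modulo null sequences.\<close>

definition completion :: "'x star_alg \<Rightarrow> (nat \<Rightarrow> 'x) set star_alg" where
  "completion A =
    \<lparr>carrier = cauchy_class A ` {s. cauchy_in A s},
     vadd = \<lambda>X Y. cauchy_class A (\<lambda>n. vadd A (class_rep X n) (class_rep Y n)),
     scal = \<lambda>c X. cauchy_class A (\<lambda>n. scal A c (class_rep X n)),
     vmul = \<lambda>X Y. cauchy_class A (\<lambda>n. vmul A (class_rep X n) (class_rep Y n)),
     star = \<lambda>X. cauchy_class A (\<lambda>n. star A (class_rep X n)),
     nrm = \<lambda>X. lim (\<lambda>n. nrm A (class_rep X n))\<rparr>"

definition completion_map :: "'x star_alg \<Rightarrow> 'x \<Rightarrow> (nat \<Rightarrow> 'x) set" where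
  "completion_map A a = cauchy_class A (\<lambda>_. a)"

text \<open>
  The C*-seminorms on a Banach *-algebra \<open>A\<close> are exactly the functions \<open>a \<mapsto> \<parallel>\<phi> a\<parallel>\<close> for
  *-homomorphisms \<open>\<phi>\<close> from \<open>A\<close> to C*-algebras (equivalently, for *-representations on Hilbert
  spaces).  The bound by \<open>nrm A\<close> is automatic on a Banach *-algebra with isometric involution.
\<close>

definition cstar_seminorm :: "'x star_alg \<Rightarrow> ('x \<Rightarrow> real) \<Rightarrow> bool" where
  "cstar_seminorm A N \<longleftrightarrow>
     (\<forall>a\<in>carrier A. 0 \<le> N a \<and> N a \<le> nrm A a) \<and>
     (\<forall>a\<in>carrier A. \<forall>b\<in>carrier A. N (vadd A a b) \<le> N a + N b) \<and>
     (\<forall>c. \<forall>a\<in>carrier A. N (scal A c a) = cmod c * N a) \<and>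
     (\<forall>a\<in>carrier A. \<forall>b\<in>carrier A. N (vmul A a b) \<le> N a * N b) \<and>
     (\<forall>a\<in>carrier A. N (vmul A (star A a) a) = (N a)\<^sup>2)"

definition with_max_cstar_norm :: "'x star_alg \<Rightarrow> 'x star_alg" where
  "with_max_cstar_norm A = A\<lparr>nrm := \<lambda>a. Sup {N a | N. cstar_seminorm A N}\<rparr>"

definition enveloping_cstar :: "'x star_alg \<Rightarrow> (nat \<Rightarrow> 'x) set star_alg" where
  "enveloping_cstar A = completion (with_max_cstar_norm A)"

definition enveloping_map :: "'x star_alg \<Rightarrow> 'x \<Rightarrow> (nat \<Rightarrow> 'x) set" where
  "enveloping_map A = completion_map (with_max_cstar_norm A)"

definition corner :: "'x \<Rightarrow> 'x star_alg \<Rightarrow> 'x star_alg" where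
  "corner p A = A\<lparr>carrier := (\<lambda>a. vmul A (vmul A p a) p) ` carrier A\<rparr>"

section \<open>Haar measure, growth and group algebras\<close>

text \<open>
  A locally compact group is given by a group \<open>H\<close> and a topology \<open>T\<close> with
  \<open>topspace T = carrier H\<close>.  \<open>H\<close> need not be second countable or \<open>\<sigma>\<close>-compact, hence the
  regularity conditions.
\<close>

definition left_haar_measure :: "('g, 'm) monoid_scheme \<Rightarrow> 'g topology \<Rightarrow> 'g measure \<Rightarrow> bool" where
  "left_haar_measure H T \<mu> \<longleftrightarrow>
     space \<mu> = topspace T \<and>
     sets \<mu> = sigma_sets (topspace T) {U. openin T U} \<and>
     (\<exists>E\<in>sets \<mu>. emeasure \<mu> E \<noteq> 0) \<and>
     (\<forall>K. compactin T K \<longrightarrow> emeasure \<mu> K < \<infinity>) \<and>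
     (\<forall>x\<in>carrier H. \<forall>E\<in>sets \<mu>. emeasure \<mu> (x <#\<^bsub>H\<^esub> E) = emeasure \<mu> E) \<and>
     (\<forall>E\<in>sets \<mu>. emeasure \<mu> E = Inf {emeasure \<mu> U | U. openin T U \<and> E \<subseteq> U}) \<and>
     (\<forall>U. openin T U \<longrightarrow> emeasure \<mu> U = Sup {emeasure \<mu> K | K. compactin T K \<and> K \<subseteq> U})"

fun set_power :: "('g, 'm) monoid_scheme \<Rightarrow> 'g set \<Rightarrow> nat \<Rightarrow> 'g set" where
  "set_power H V 0 = {\<one>\<^bsub>H\<^esub>}"
| "set_power H V (Suc n) = set_power H V n <#>\<^bsub>H\<^esub> V"

text \<open>
  The Haar measure is unique up to a positive factor, which does not affect the growth condition.
  Discrete groups are covered by the discrete topology, for which \<open>\<mu>\<close> is a multiple of counting.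
\<close>

definition subexponential_growth :: "('g, 'm) monoid_scheme \<Rightarrow> 'g topology \<Rightarrow> bool" where
  "subexponential_growth H T \<longleftrightarrow>
     (\<exists>\<mu>. left_haar_measure H T \<mu> \<and>
       (\<forall>V. compactin T V \<and> \<one>\<^bsub>H\<^esub> \<in> T interior_of V \<longrightarrow>
          limsup (\<lambda>n. ereal (root n (measure \<mu> (set_power H V n)))) = 1))"

text \<open>The modular function \<open>\<Delta>\<close>, normalised by \<open>\<mu>(E x) = \<Delta>(x) \<mu>(E)\<close>.\<close>

definition modular_fun :: "('g, 'm) monoid_scheme \<Rightarrow> 'g measure \<Rightarrow> 'g \<Rightarrow> real" where
  "modular_fun H \<mu> x =
     (THE c. 0 < c \<and> (\<forall>E\<in>sets \<mu>. emeasure \<mu> (E #>\<^bsub>H\<^esub> x) = ennreal c * emeasure \<mu> E))"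

definition convolution ::
  "('g, 'm) monoid_scheme \<Rightarrow> 'g measure \<Rightarrow> ('g \<Rightarrow> complex) \<Rightarrow> ('g \<Rightarrow> complex) \<Rightarrow> 'g \<Rightarrow> complex" where
  "convolution H \<mu> f h =
     (\<lambda>x. if x \<in> carrier H then (\<integral>y. f y * h (inv\<^bsub>H\<^esub> y \<otimes>\<^bsub>H\<^esub> x) \<partial>\<mu>) else 0)"

text \<open>\<open>C\<^sub>c(H)\<close> with the norm of \<open>L\<^sup>1(H)\<close>; functions are extended by \<open>0\<close> outside the carrier.
  \<open>C\<^sub>c(H)\<close> is dense in \<open>L\<^sup>1(H)\<close>, so \<open>L\<^sup>1(H)\<close> is its completion.\<close>

definition Cc_alg ::
  "('g, 'm) monoid_scheme \<Rightarrow> 'g topology \<Rightarrow> 'g measure \<Rightarrow> ('g \<Rightarrow> complex) star_alg" where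
  "Cc_alg H T \<mu> =
    \<lparr>carrier = {f. continuous_map T euclidean f \<and>
                   (\<exists>K. compactin T K \<and> (\<forall>x. x \<notin> K \<longrightarrow> f x = 0))},
     vadd = \<lambda>f h x. f x + h x,
     scal = \<lambda>c f x. c * f x,
     vmul = convolution H \<mu>,
     star = \<lambda>f x. if x \<in> carrier H
                  then of_real (modular_fun H \<mu> (inv\<^bsub>H\<^esub> x)) * cnj (f (inv\<^bsub>H\<^esub> x)) else 0,
     nrm = \<lambda>f. \<integral>x. cmod (f x) \<partial>\<mu>\<rparr>"

definition L1_group ::
  "('g, 'm) monoid_scheme \<Rightarrow> 'g topology \<Rightarrow> 'g measure \<Rightarrow> (nat \<Rightarrow> 'g \<Rightarrow> complex) set star_alg" where
  "L1_group H T \<mu> = completion (Cc_alg H T \<mu>)"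

definition cstar_group ::
  "('g, 'm) monoid_scheme \<Rightarrow> 'g topology \<Rightarrow> 'g measure \<Rightarrow>
     (nat \<Rightarrow> (nat \<Rightarrow> 'g \<Rightarrow> complex) set) set star_alg" where
  "cstar_group H T \<mu> = enveloping_cstar (L1_group H T \<mu>)"

definition Cc_to_cstar ::
  "('g, 'm) monoid_scheme \<Rightarrow> 'g topology \<Rightarrow> 'g measure \<Rightarrow> ('g \<Rightarrow> complex) \<Rightarrow>
     (nat \<Rightarrow> (nat \<Rightarrow> 'g \<Rightarrow> complex) set) set" where
  "Cc_to_cstar H T \<mu> f = enveloping_map (L1_group H T \<mu>) (completion_map (Cc_alg H T \<mu>) f)"

definition L2_functions :: "'g measure \<Rightarrow> ('g \<Rightarrow> complex) set" where
  "L2_functions \<mu> = {\<xi>. \<xi> \<in> borel_measurable \<mu> \<and> integrable \<mu> (\<lambda>x. (cmod (\<xi> x))\<^sup>2)}"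

definition L2_norm_fun :: "'g measure \<Rightarrow> ('g \<Rightarrow> complex) \<Rightarrow> real" where
  "L2_norm_fun \<mu> \<xi> = sqrt (\<integral>x. (cmod (\<xi> x))\<^sup>2 \<partial>\<mu>)"

text \<open>The operator norm of \<open>\<xi> \<mapsto> f * \<xi>\<close> on \<open>L\<^sup>2(H)\<close>.\<close>

definition regular_rep_norm ::
  "('g, 'm) monoid_scheme \<Rightarrow> 'g measure \<Rightarrow> ('g \<Rightarrow> complex) \<Rightarrow> real" where
  "regular_rep_norm H \<mu> f =
     Sup {L2_norm_fun \<mu> (convolution H \<mu> f \<xi>) | \<xi>. \<xi> \<in> L2_functions \<mu> \<and> L2_norm_fun \<mu> \<xi> \<le> 1}"

section \<open>Hecke pairs and Hecke algebras\<close>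

definition double_coset :: "('a, 'm) monoid_scheme \<Rightarrow> 'a set \<Rightarrow> 'a \<Rightarrow> 'a set" where
  "double_coset G \<Gamma> g = \<Gamma> <#>\<^bsub>G\<^esub> (g <#\<^bsub>G\<^esub> \<Gamma>)"

definition double_cosets :: "('a, 'm) monoid_scheme \<Rightarrow> 'a set \<Rightarrow> 'a set set" where
  "double_cosets G \<Gamma> = double_coset G \<Gamma> ` carrier G"

definition hecke_pair :: "('a, 'm) monoid_scheme \<Rightarrow> 'a set \<Rightarrow> bool" where
  "hecke_pair G \<Gamma> \<longleftrightarrow> group G \<and> subgroup \<Gamma> G \<and>
     (\<forall>D\<in>double_cosets G \<Gamma>.
        (\<exists>F\<subseteq>lcosets\<^bsub>G\<^esub> \<Gamma>. finite F \<and> D = \<Union>F) \<and> (\<exists>F\<subseteq>rcosets\<^bsub>G\<^esub> \<Gamma>. finite F \<and> D = \<Union>F))"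

definition hecke_L :: "('a, 'm) monoid_scheme \<Rightarrow> 'a set \<Rightarrow> 'a \<Rightarrow> nat" where
  "hecke_L G \<Gamma> g = card {C \<in> lcosets\<^bsub>G\<^esub> \<Gamma>. C \<subseteq> double_coset G \<Gamma> g}"

definition hecke_R :: "('a, 'm) monoid_scheme \<Rightarrow> 'a set \<Rightarrow> 'a \<Rightarrow> nat" where
  "hecke_R G \<Gamma> g = card {C \<in> rcosets\<^bsub>G\<^esub> \<Gamma>. C \<subseteq> double_coset G \<Gamma> g}"

definition hecke_modular :: "('a, 'm) monoid_scheme \<Rightarrow> 'a set \<Rightarrow> 'a \<Rightarrow> real" where
  "hecke_modular G \<Gamma> g = real (hecke_L G \<Gamma> g) / real (hecke_R G \<Gamma> g)"

text \<open>An arbitrary representative of a left coset or double coset.\<close>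

definition coset_rep :: "'a set \<Rightarrow> 'a" where
  "coset_rep C = (SOME g. g \<in> C)"

text \<open>
  The Hecke algebra, with the norm of \<open>L\<^sup>1(G,\<Gamma>)\<close>.  Functions on \<open>\<Gamma>\G/\<Gamma>\<close> are extended by \<open>0\<close> to
  sets that are not double cosets; the values do not depend on the chosen representatives.
\<close>

definition hecke_alg :: "('a, 'm) monoid_scheme \<Rightarrow> 'a set \<Rightarrow> ('a set \<Rightarrow> complex) star_alg" where
  "hecke_alg G \<Gamma> =
    \<lparr>carrier = {f. finite {D. f D \<noteq> 0} \<and> {D. f D \<noteq> 0} \<subseteq> double_cosets G \<Gamma>},
     vadd = \<lambda>f h D. f D + h D,
     scal = \<lambda>c f D. c * f D,
     vmul = \<lambda>f h D. if D \<in> double_cosets G \<Gamma>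
        then (\<Sum>\<^sub>\<infinity>C\<in>lcosets\<^bsub>G\<^esub> \<Gamma>. f (double_coset G \<Gamma> (coset_rep C)) *
               h (double_coset G \<Gamma> (inv\<^bsub>G\<^esub> (coset_rep C) \<otimes>\<^bsub>G\<^esub> coset_rep D)))
        else 0,
     star = \<lambda>f D. if D \<in> double_cosets G \<Gamma>
        then of_real (hecke_modular G \<Gamma> (inv\<^bsub>G\<^esub> (coset_rep D))) *
               cnj (f (double_coset G \<Gamma> (inv\<^bsub>G\<^esub> (coset_rep D))))
        else 0,
     nrm = \<lambda>f. \<Sum>D | f D \<noteq> 0. cmod (f D) * real (hecke_L G \<Gamma> (coset_rep D))\<rparr>"

definition L1_hecke ::
  "('a, 'm) monoid_scheme \<Rightarrow> 'a set \<Rightarrow> (nat \<Rightarrow> 'a set \<Rightarrow> complex) set star_alg" where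
  "L1_hecke G \<Gamma> = completion (hecke_alg G \<Gamma>)"

definition cstar_L1_hecke ::
  "('a, 'm) monoid_scheme \<Rightarrow> 'a set \<Rightarrow> (nat \<Rightarrow> (nat \<Rightarrow> 'a set \<Rightarrow> complex) set) set star_alg" where
  "cstar_L1_hecke G \<Gamma> = enveloping_cstar (L1_hecke G \<Gamma>)"

definition hecke_to_cstar_L1 ::
  "('a, 'm) monoid_scheme \<Rightarrow> 'a set \<Rightarrow> ('a set \<Rightarrow> complex) \<Rightarrow>
     (nat \<Rightarrow> (nat \<Rightarrow> 'a set \<Rightarrow> complex) set) set" where
  "hecke_to_cstar_L1 G \<Gamma> f =
     enveloping_map (L1_hecke G \<Gamma>) (completion_map (hecke_alg G \<Gamma>) f)"

section \<open>Reduction and Schlichting completion\<close>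

definition reduction_kernel :: "('a, 'm) monoid_scheme \<Rightarrow> 'a set \<Rightarrow> 'a set" where
  "reduction_kernel G \<Gamma> =
     (\<Inter>g\<in>carrier G. (\<lambda>x. g \<otimes>\<^bsub>G\<^esub> x \<otimes>\<^bsub>G\<^esub> inv\<^bsub>G\<^esub> g) ` \<Gamma>)"

definition reduction_group :: "('a, 'm) monoid_scheme \<Rightarrow> 'a set \<Rightarrow> 'a set monoid" where
  "reduction_group G \<Gamma> = G Mod reduction_kernel G \<Gamma>"

definition perm_topology :: "'c set \<Rightarrow> ('c \<Rightarrow> 'c) topology" where
  "perm_topology S = subtopology (product_topology (\<lambda>_. discrete_topology S) S) (Bij S)"

definition coset_action :: "('a, 'm) monoid_scheme \<Rightarrow> 'a set \<Rightarrow> 'a \<Rightarrow> 'a set \<Rightarrow> 'a set" where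
  "coset_action G \<Gamma> g = (\<lambda>C\<in>lcosets\<^bsub>G\<^esub> \<Gamma>. g <#\<^bsub>G\<^esub> C)"

definition schlichting_group ::
  "('a, 'm) monoid_scheme \<Rightarrow> 'a set \<Rightarrow> ('a set \<Rightarrow> 'a set) monoid" where
  "schlichting_group G \<Gamma> = (BijGroup (lcosets\<^bsub>G\<^esub> \<Gamma>))
     \<lparr>carrier := perm_topology (lcosets\<^bsub>G\<^esub> \<Gamma>) closure_of (coset_action G \<Gamma> ` carrier G)\<rparr>"

definition schlichting_subgroup :: "('a, 'm) monoid_scheme \<Rightarrow> 'a set \<Rightarrow> ('a set \<Rightarrow> 'a set) set" where
  "schlichting_subgroup G \<Gamma> = perm_topology (lcosets\<^bsub>G\<^esub> \<Gamma>) closure_of (coset_action G \<Gamma> ` \<Gamma>)"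

definition schlichting_topology ::
  "('a, 'm) monoid_scheme \<Rightarrow> 'a set \<Rightarrow> ('a set \<Rightarrow> 'a set) topology" where
  "schlichting_topology G \<Gamma> =
     subtopology (perm_topology (lcosets\<^bsub>G\<^esub> \<Gamma>)) (carrier (schlichting_group G \<Gamma>))"

definition schlichting_proj ::
  "('a, 'm) monoid_scheme \<Rightarrow> 'a set \<Rightarrow> ('a set \<Rightarrow> 'a set) \<Rightarrow> complex" where
  "schlichting_proj G \<Gamma> = indicator (schlichting_subgroup G \<Gamma>)"

text \<open>
  The isomorphism of the Hecke algebra with \<open>p C\<^sub>c p\<close>, \<open>p = schlichting_proj G \<Gamma>\<close>, coming from the
  bijection of \<open>\<Gamma>\G/\<Gamma>\<close> with the double cosets of the Schlichting completion: \<open>x\<close> in the double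
  coset of the image of \<open>g\<close> is sent to \<open>f(\<Gamma>g\<Gamma>)\<close>.
\<close>

definition hecke_to_Cc ::
  "('a, 'm) monoid_scheme \<Rightarrow> 'a set \<Rightarrow> ('a set \<Rightarrow> complex) \<Rightarrow> ('a set \<Rightarrow> 'a set) \<Rightarrow> complex" where
  "hecke_to_Cc G \<Gamma> f =
     (\<lambda>x. if x \<in> carrier (schlichting_group G \<Gamma>)
       then f (double_coset G \<Gamma> (SOME g. g \<in> carrier G \<and>
              x \<in> double_coset (schlichting_group G \<Gamma>) (schlichting_subgroup G \<Gamma>)
                    (coset_action G \<Gamma> g)))
       else 0)"

text \<open>In the following, \<open>\<mu>\<close> is the Haar measure of the Schlichting completion.\<close>

definition cstar_corner ::
  "('a, 'm) monoid_scheme \<Rightarrow> 'a set \<Rightarrow> ('a set \<Rightarrow> 'a set) measure \<Rightarrow>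
     (nat \<Rightarrow> (nat \<Rightarrow> ('a set \<Rightarrow> 'a set) \<Rightarrow> complex) set) set star_alg" where
  "cstar_corner G \<Gamma> \<mu> =
     corner (Cc_to_cstar (schlichting_group G \<Gamma>) (schlichting_topology G \<Gamma>) \<mu>
              (schlichting_proj G \<Gamma>))
       (cstar_group (schlichting_group G \<Gamma>) (schlichting_topology G \<Gamma>) \<mu>)"

definition hecke_to_corner ::
  "('a, 'm) monoid_scheme \<Rightarrow> 'a set \<Rightarrow> ('a set \<Rightarrow> 'a set) measure \<Rightarrow> ('a set \<Rightarrow> complex) \<Rightarrow>
     (nat \<Rightarrow> (nat \<Rightarrow> ('a set \<Rightarrow> 'a set) \<Rightarrow> complex) set) set" where
  "hecke_to_corner G \<Gamma> \<mu> f =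
     Cc_to_cstar (schlichting_group G \<Gamma>) (schlichting_topology G \<Gamma>) \<mu> (hecke_to_Cc G \<Gamma> f)"

definition reduced_hecke_alg ::
  "('a, 'm) monoid_scheme \<Rightarrow> 'a set \<Rightarrow> ('a set \<Rightarrow> 'a set) measure \<Rightarrow> ('a set \<Rightarrow> complex) star_alg" where
  "reduced_hecke_alg G \<Gamma> \<mu> = (hecke_alg G \<Gamma>)
     \<lparr>nrm := \<lambda>f. regular_rep_norm (schlichting_group G \<Gamma>) \<mu> (hecke_to_Cc G \<Gamma> f)\<rparr>"

definition cstar_reduced_hecke ::
  "('a, 'm) monoid_scheme \<Rightarrow> 'a set \<Rightarrow> ('a set \<Rightarrow> 'a set) measure \<Rightarrow>
     (nat \<Rightarrow> 'a set \<Rightarrow> complex) set star_alg" where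
  "cstar_reduced_hecke G \<Gamma> \<mu> = completion (reduced_hecke_alg G \<Gamma> \<mu>)"

definition hecke_to_reduced ::
  "('a, 'm) monoid_scheme \<Rightarrow> 'a set \<Rightarrow> ('a set \<Rightarrow> 'a set) measure \<Rightarrow> ('a set \<Rightarrow> complex) \<Rightarrow>
     (nat \<Rightarrow> 'a set \<Rightarrow> complex) set" where
  "hecke_to_reduced G \<Gamma> \<mu> = completion_map (reduced_hecke_alg G \<Gamma> \<mu>)"

end

theory Submission
  imports Defs
begin

text \<open>
  All three C*-algebras are completions of the Hecke algebra, in norms \<open>N\<^sub>1\<close> (the largest
  C*-seminorm), \<open>N\<^sub>2\<close> (the largest C*-seminorm of \<open>C\<^sub>c\<close>, restricted to \<open>p C\<^sub>c p\<close>) and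
  \<open>N\<^sub>3\<close> (the regular representation), so it suffices that these norms agree.  Let \<open>M(f)\<close> be the
  norm of \<open>f\<close> acting on \<open>\<ell>\<^sup>2(G/\<Gamma>)\<close> through the permutation representation.  Then
  \<open>M \<le> N\<^sub>2 \<le> N\<^sub>1\<close> and \<open>M \<le> N\<^sub>3 \<le> N\<^sub>1\<close> always hold, and growth gives \<open>N\<^sub>1 \<le> M\<close>: for
  \<open>f\<^sub>0 = f\<close>, \<open>f\<^sub>k\<^sub>+\<^sub>1 = f\<^sub>k* f\<^sub>k\<close> the C*-identity gives
  \<open>N\<^sub>1(f)^(2^k) = N\<^sub>1(f\<^sub>k) \<le> \<parallel>f\<^sub>k\<parallel>\<^sub>1\<close>, Cauchy-Schwarz bounds \<open>\<parallel>f\<^sub>k\<parallel>\<^sub>1\<close> by the square root of the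
  number of cosets in the support times \<open>\<parallel>f\<^sub>k\<parallel>\<^sub>2\<close>, and \<open>\<parallel>f\<^sub>k\<parallel>\<^sub>2\<close> is at most
  \<open>M(f)^(2^k - 1) \<parallel>f\<parallel>\<^sub>2\<close>.  The support of \<open>f\<^sub>k\<close> lies in \<open>V^(2^k)\<close>, so the coset count is
  subexponential in \<open>2^k\<close> and disappears when \<open>2^k\<close>-th roots are taken.
\<close>

section \<open>Normed *-algebras and their completions\<close>

text \<open>No Hilbert space is constructed: a representation is an infinite matrix tested on
  finitely supported vectors, and its operator norm is a C*-seminorm. Two matrices occur for
  bi-invariant functions. \<open>mat\<close> is the permutation representation; it is the regular
  representation restricted to functions constant on left cosets, whence M \<le>
  \<open>N\<^sub>3\<close>. The bound \<open>N\<^sub>3\<close> \<le> \<open>N\<^sub>1\<close> needs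
  the regular norm to be dominated by a C*-seminorm of the Hecke algebra. That seminorm is the norm
  of \<open>ker\<close>, the action on functions constant on right cosets. A right coset has measure
  \<open>w s\<close> rather than 1, which is where the square roots of \<open>w\<close> come from.
  The Haar measure need not be sigma-finite, so Fubini is not at hand. Double integrals are
  exchanged through Riemann sums over cosets of small open subgroups, and total masses are computed
  as row and column sums of \<open>mat\<close>. A canonical surjection is contractive and prescribed
  on a dense set, so equality of the norms on that set already forces it to be isometric.\<close>

text \<open>The zero of \<open>A\<close> is \<open>scal A 0 a\<close>, for any \<open>a\<close>: \<open>star_alg\<close> has no constant for it.\<close>

locale star_nalg =
  fixes A :: "'x star_alg"
  assumes carrier_ne: "carrier A \<noteq> {}"
    and add_in [simp]: "\<And>a b. a \<in> carrier A \<Longrightarrow> b \<in> carrier A \<Longrightarrow> vadd A a b \<in> carrier A"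
    and scal_in [simp]: "\<And>c a. a \<in> carrier A \<Longrightarrow> scal A c a \<in> carrier A"
    and mul_in [simp]: "\<And>a b. a \<in> carrier A \<Longrightarrow> b \<in> carrier A \<Longrightarrow> vmul A a b \<in> carrier A"
    and star_in [simp]: "\<And>a. a \<in> carrier A \<Longrightarrow> star A a \<in> carrier A"
    and add_assoc: "\<And>a b c. a \<in> carrier A \<Longrightarrow> b \<in> carrier A \<Longrightarrow> c \<in> carrier A \<Longrightarrow>
        vadd A (vadd A a b) c = vadd A a (vadd A b c)"
    and add_comm: "\<And>a b. a \<in> carrier A \<Longrightarrow> b \<in> carrier A \<Longrightarrow> vadd A a b = vadd A b a"
    and add_zero: "\<And>a b. a \<in> carrier A \<Longrightarrow> b \<in> carrier A \<Longrightarrow> vadd A a (scal A 0 b) = a"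
    and scal_add: "\<And>c a b. a \<in> carrier A \<Longrightarrow> b \<in> carrier A \<Longrightarrow>
        scal A c (vadd A a b) = vadd A (scal A c a) (scal A c b)"
    and add_scal: "\<And>c d a. a \<in> carrier A \<Longrightarrow> scal A (c + d) a = vadd A (scal A c a) (scal A d a)"
    and scal_scal: "\<And>c d a. a \<in> carrier A \<Longrightarrow> scal A c (scal A d a) = scal A (c * d) a"
    and scal_one: "\<And>a. a \<in> carrier A \<Longrightarrow> scal A 1 a = a"
    and mul_add_left: "\<And>a b c. a \<in> carrier A \<Longrightarrow> b \<in> carrier A \<Longrightarrow> c \<in> carrier A \<Longrightarrow>
        vmul A (vadd A a b) c = vadd A (vmul A a c) (vmul A b c)"
    and mul_add_right: "\<And>a b c. a \<in> carrier A \<Longrightarrow> b \<in> carrier A \<Longrightarrow> c \<in> carrier A \<Longrightarrow>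
        vmul A c (vadd A a b) = vadd A (vmul A c a) (vmul A c b)"
    and mul_scal_left: "\<And>k a b. a \<in> carrier A \<Longrightarrow> b \<in> carrier A \<Longrightarrow>
        vmul A (scal A k a) b = scal A k (vmul A a b)"
    and mul_scal_right: "\<And>k a b. a \<in> carrier A \<Longrightarrow> b \<in> carrier A \<Longrightarrow>
        vmul A a (scal A k b) = scal A k (vmul A a b)"
    and star_add: "\<And>a b. a \<in> carrier A \<Longrightarrow> b \<in> carrier A \<Longrightarrow>
        star A (vadd A a b) = vadd A (star A a) (star A b)"
    and star_scal: "\<And>c a. a \<in> carrier A \<Longrightarrow> star A (scal A c a) = scal A (cnj c) (star A a)"
    and star_star: "\<And>a. a \<in> carrier A \<Longrightarrow> star A (star A a) = a"
    and nrm_nonneg [simp]: "\<And>a. a \<in> carrier A \<Longrightarrow> 0 \<le> nrm A a"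
    and nrm_add: "\<And>a b. a \<in> carrier A \<Longrightarrow> b \<in> carrier A \<Longrightarrow> nrm A (vadd A a b) \<le> nrm A a + nrm A b"
    and nrm_scal: "\<And>c a. a \<in> carrier A \<Longrightarrow> nrm A (scal A c a) = cmod c * nrm A a"
    and nrm_mul: "\<And>a b. a \<in> carrier A \<Longrightarrow> b \<in> carrier A \<Longrightarrow> nrm A (vmul A a b) \<le> nrm A a * nrm A b"
    and nrm_star: "\<And>a. a \<in> carrier A \<Longrightarrow> nrm A (star A a) = nrm A a"
begin

lemma vdiff_in [simp]: "a \<in> carrier A \<Longrightarrow> b \<in> carrier A \<Longrightarrow> vdiff A a b \<in> carrier A"
  by (simp add: vdiff_def)

lemma add_left_comm: "a \<in> carrier A \<Longrightarrow> b \<in> carrier A \<Longrightarrow> c \<in> carrier A \<Longrightarrow>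
    vadd A a (vadd A b c) = vadd A b (vadd A a c)"
  by (metis add_assoc add_comm)

lemmas add_ac = add_assoc add_comm add_left_comm

lemma add_neg: "a \<in> carrier A \<Longrightarrow> vadd A a (scal A (-1) a) = scal A 0 a"
  using add_scal[of a 1 "-1"] by (simp add: scal_one)

lemma neg_add_cancel: "a \<in> carrier A \<Longrightarrow> b \<in> carrier A \<Longrightarrow> vadd A a (vadd A (scal A (-1) a) b) = b"
  by (metis add_assoc add_comm add_neg add_zero scal_in)

lemma vdiff_trans: "a \<in> carrier A \<Longrightarrow> b \<in> carrier A \<Longrightarrow> c \<in> carrier A \<Longrightarrow>
    vadd A (vdiff A a b) (vdiff A b c) = vdiff A a c"
  unfolding vdiff_def
  by (smt (verit) add_assoc add_comm neg_add_cancel scal_in add_in)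

lemma vdiff_add: "a \<in> carrier A \<Longrightarrow> b \<in> carrier A \<Longrightarrow> c \<in> carrier A \<Longrightarrow> d \<in> carrier A \<Longrightarrow>
    vdiff A (vadd A a b) (vadd A c d) = vadd A (vdiff A a c) (vdiff A b d)"
  unfolding vdiff_def by (simp add: scal_add add_ac)

lemma vdiff_scal: "a \<in> carrier A \<Longrightarrow> b \<in> carrier A \<Longrightarrow>
    vdiff A (scal A c a) (scal A c b) = scal A c (vdiff A a b)"
  unfolding vdiff_def by (simp add: scal_add scal_scal)

lemma vdiff_star: "a \<in> carrier A \<Longrightarrow> b \<in> carrier A \<Longrightarrow>
    vdiff A (star A a) (star A b) = star A (vdiff A a b)"
  unfolding vdiff_def by (simp add: star_add star_scal)

lemma vdiff_mul: "a \<in> carrier A \<Longrightarrow> b \<in> carrier A \<Longrightarrow> c \<in> carrier A \<Longrightarrow> d \<in> carrier A \<Longrightarrow>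
    vdiff A (vmul A a b) (vmul A c d) = vadd A (vmul A (vdiff A a c) b) (vmul A c (vdiff A b d))"
proof -
  assume h: "a \<in> carrier A" "b \<in> carrier A" "c \<in> carrier A" "d \<in> carrier A"
  have "vmul A (vdiff A a c) b = vdiff A (vmul A a b) (vmul A c b)"
    "vmul A c (vdiff A b d) = vdiff A (vmul A c b) (vmul A c d)"
    using h by (simp_all add: vdiff_def mul_add_left mul_add_right mul_scal_left mul_scal_right)
  then show ?thesis using h by (simp add: vdiff_trans)
qed

lemma nrm_zero: "a \<in> carrier A \<Longrightarrow> nrm A (scal A 0 a) = 0"
  by (simp add: nrm_scal)

lemma dist_self: "a \<in> carrier A \<Longrightarrow> nrm A (vdiff A a a) = 0"
  by (simp add: vdiff_def add_neg nrm_zero)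

lemma dist_sym: "a \<in> carrier A \<Longrightarrow> b \<in> carrier A \<Longrightarrow> nrm A (vdiff A a b) = nrm A (vdiff A b a)"
proof -
  assume h: "a \<in> carrier A" "b \<in> carrier A"
  have "vdiff A b a = scal A (-1) (vdiff A a b)"
    using h by (simp add: vdiff_def scal_add scal_scal scal_one add_comm)
  then show ?thesis using h by (simp add: nrm_scal)
qed

lemma dist_tri: "a \<in> carrier A \<Longrightarrow> b \<in> carrier A \<Longrightarrow> c \<in> carrier A \<Longrightarrow>
    nrm A (vdiff A a c) \<le> nrm A (vdiff A a b) + nrm A (vdiff A b c)"
  by (metis nrm_add vdiff_in vdiff_trans)

lemma add_vdiff: "a \<in> carrier A \<Longrightarrow> b \<in> carrier A \<Longrightarrow> vadd A (vdiff A a b) b = a"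
  unfolding vdiff_def by (metis add_assoc add_comm neg_add_cancel scal_in add_in)

lemma nrm_diff: "a \<in> carrier A \<Longrightarrow> b \<in> carrier A \<Longrightarrow> \<bar>nrm A a - nrm A b\<bar> \<le> nrm A (vdiff A a b)"
  using nrm_add[of "vdiff A a b" b] nrm_add[of "vdiff A b a" a] dist_sym[of a b]
  by (simp add: add_vdiff)

lemma dist_add: "a \<in> carrier A \<Longrightarrow> b \<in> carrier A \<Longrightarrow> c \<in> carrier A \<Longrightarrow> d \<in> carrier A \<Longrightarrow>
    nrm A (vdiff A (vadd A a b) (vadd A c d)) \<le> nrm A (vdiff A a c) + nrm A (vdiff A b d)"
  by (simp add: vdiff_add nrm_add)

lemma dist_scal: "a \<in> carrier A \<Longrightarrow> b \<in> carrier A \<Longrightarrow>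
    nrm A (vdiff A (scal A k a) (scal A k b)) = cmod k * nrm A (vdiff A a b)"
  by (simp add: vdiff_scal nrm_scal)

lemma dist_star: "a \<in> carrier A \<Longrightarrow> b \<in> carrier A \<Longrightarrow>
    nrm A (vdiff A (star A a) (star A b)) = nrm A (vdiff A a b)"
  by (simp add: vdiff_star nrm_star)

lemma dist_mul: "a \<in> carrier A \<Longrightarrow> b \<in> carrier A \<Longrightarrow> c \<in> carrier A \<Longrightarrow> d \<in> carrier A \<Longrightarrow>
    nrm A (vdiff A (vmul A a b) (vmul A c d)) \<le> nrm A (vdiff A a c) * nrm A b + nrm A c * nrm A (vdiff A b d)"
  using nrm_add[of "vmul A (vdiff A a c) b" "vmul A c (vdiff A b d)"]
    nrm_mul[of "vdiff A a c" b] nrm_mul[of c "vdiff A b d"]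
  by (simp add: vdiff_mul)

section \<open>Cauchy sequences, their equivalence and the operations on classes\<close>

lemma cauchy_in_carrier: "cauchy_in A s \<Longrightarrow> s n \<in> carrier A"
  unfolding cauchy_in_def by auto

lemma cauchy_const: "a \<in> carrier A \<Longrightarrow> cauchy_in A (\<lambda>_. a)"
  unfolding cauchy_in_def by (auto simp: dist_self)

text \<open>The equivalence relation whose classes \<open>cauchy_class\<close> collects. It is kept
  as a relation between sequences so that any sequence can be traded for the member picked by
  \<open>class_rep\<close>.\<close>

definition null_dist :: "(nat \<Rightarrow> 'x) \<Rightarrow> (nat \<Rightarrow> 'x) \<Rightarrow> bool" where
  "null_dist s t \<longleftrightarrow> (\<lambda>n. nrm A (vdiff A (s n) (t n))) \<longlonglongrightarrow> 0"

lemma nrm_cauchy: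
  assumes "cauchy_in A s" shows "Cauchy (\<lambda>n. nrm A (s n))"
proof (rule metric_CauchyI)
  fix e :: real assume "e > 0"
  then obtain N where N: "\<forall>m\<ge>N. \<forall>n\<ge>N. nrm A (vdiff A (s m) (s n)) < e"
    using assms unfolding cauchy_in_def by blast
  have "dist (nrm A (s m)) (nrm A (s n)) < e" if "m \<ge> N" "n \<ge> N" for m n
    using N that nrm_diff[of "s m" "s n"] cauchy_in_carrier[OF assms] by (fastforce simp: dist_real_def)
  then show "\<exists>M. \<forall>m\<ge>M. \<forall>n\<ge>M. dist (nrm A (s m)) (nrm A (s n)) < e" by blast
qed

lemma nrm_lim:
  assumes "cauchy_in A s" shows "(\<lambda>n. nrm A (s n)) \<longlonglongrightarrow> lim (\<lambda>n. nrm A (s n))"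
  using nrm_cauchy[OF assms] by (simp add: Cauchy_convergent_iff convergent_LIMSEQ_iff)

lemma nrm_bounded:
  assumes "cauchy_in A s" obtains B where "B > 0" "\<And>n. nrm A (s n) \<le> B"
proof -
  have "Bseq (\<lambda>n. nrm A (s n))" using nrm_cauchy[OF assms] by (rule Cauchy_Bseq)
  then obtain B where "B > 0" "\<And>n. norm (nrm A (s n)) \<le> B" by (auto simp: Bseq_def)
  then show ?thesis using that[of B] by (metis abs_ge_self order_trans real_norm_def)
qed

lemma cauchy_add:
  assumes s: "cauchy_in A s" and t: "cauchy_in A t" shows "cauchy_in A (\<lambda>n. vadd A (s n) (t n))"
  unfolding cauchy_in_def
proof (intro conjI allI impI)
  show "range (\<lambda>n. vadd A (s n) (t n)) \<subseteq> carrier A"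
    using cauchy_in_carrier[OF s] cauchy_in_carrier[OF t] by auto
  fix e :: real assume "e > 0"
  then have e2: "e/2 > 0" by simp
  obtain N where N: "\<forall>m\<ge>N. \<forall>n\<ge>N. nrm A (vdiff A (s m) (s n)) < e/2"
    using s e2 unfolding cauchy_in_def by blast
  obtain M where M: "\<forall>m\<ge>M. \<forall>n\<ge>M. nrm A (vdiff A (t m) (t n)) < e/2"
    using t e2 unfolding cauchy_in_def by blast
  have "nrm A (vdiff A (vadd A (s m) (t m)) (vadd A (s n) (t n))) < e" if "m \<ge> max N M" "n \<ge> max N M" for m n
    using dist_add[of "s m" "t m" "s n" "t n"] cauchy_in_carrier[OF s] cauchy_in_carrier[OF t]
      N[rule_format, of m n] M[rule_format, of m n] that by simp
  then show "\<exists>N. \<forall>m\<ge>N. \<forall>n\<ge>N. nrm A (vdiff A (vadd A (s m) (t m)) (vadd A (s n) (t n))) < e" by blast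
qed

lemma cauchy_scal:
  assumes s: "cauchy_in A s" shows "cauchy_in A (\<lambda>n. scal A k (s n))"
  unfolding cauchy_in_def
proof (intro conjI allI impI)
  show "range (\<lambda>n. scal A k (s n)) \<subseteq> carrier A" using cauchy_in_carrier[OF s] by auto
  fix e :: real assume "e > 0"
  then have "e / (cmod k + 1) > 0" by (simp add: add_nonneg_pos)
  then obtain N where N: "\<forall>m\<ge>N. \<forall>n\<ge>N. nrm A (vdiff A (s m) (s n)) < e / (cmod k + 1)"
    using s unfolding cauchy_in_def by blast
  have "nrm A (vdiff A (scal A k (s m)) (scal A k (s n))) < e" if "m \<ge> N" "n \<ge> N" for m n
  proof -
    have k: "cmod k + 1 > 0" by (simp add: add_nonneg_pos)
    have "nrm A (vdiff A (s m) (s n)) * (cmod k + 1) < e"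
      using N that k by (simp add: pos_less_divide_eq)
    moreover have "cmod k * nrm A (vdiff A (s m) (s n)) \<le> nrm A (vdiff A (s m) (s n)) * (cmod k + 1)"
      using cauchy_in_carrier[OF s] by (simp add: algebra_simps)
    ultimately show ?thesis using cauchy_in_carrier[OF s] by (simp add: dist_scal)
  qed
  then show "\<exists>N. \<forall>m\<ge>N. \<forall>n\<ge>N. nrm A (vdiff A (scal A k (s m)) (scal A k (s n))) < e" by blast
qed

lemma cauchy_star:
  assumes s: "cauchy_in A s" shows "cauchy_in A (\<lambda>n. star A (s n))"
  using s cauchy_in_carrier[OF s] unfolding cauchy_in_def by (auto simp: dist_star)

lemma cauchy_mul:
  assumes s: "cauchy_in A s" and t: "cauchy_in A t" shows "cauchy_in A (\<lambda>n. vmul A (s n) (t n))"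
  unfolding cauchy_in_def
proof (intro conjI allI impI)
  note cs = cauchy_in_carrier[OF s] and ct = cauchy_in_carrier[OF t]
  show "range (\<lambda>n. vmul A (s n) (t n)) \<subseteq> carrier A" using cs ct by auto
  \<comment> \<open>Multiplication is uniformly continuous only on bounded sets, so bounds for both
    sequences are fixed before e is split.\<close>
  obtain B where B: "B > 0" "\<And>n. nrm A (s n) \<le> B" using nrm_bounded[OF s] by blast
  obtain C where C: "C > 0" "\<And>n. nrm A (t n) \<le> C" using nrm_bounded[OF t] by blast
  fix e :: real assume "e > 0"
  then have e2: "e/(2*C) > 0" "e/(2*B) > 0" using B C by simp_all
  obtain N where N: "\<forall>m\<ge>N. \<forall>n\<ge>N. nrm A (vdiff A (s m) (s n)) < e/(2*C)"
    using s e2 unfolding cauchy_in_def by blast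
  obtain M where M: "\<forall>m\<ge>M. \<forall>n\<ge>M. nrm A (vdiff A (t m) (t n)) < e/(2*B)"
    using t e2 unfolding cauchy_in_def by blast
  have "nrm A (vdiff A (vmul A (s m) (t m)) (vmul A (s n) (t n))) < e" if "m \<ge> max N M" "n \<ge> max N M" for m n
  proof -
    have "nrm A (vdiff A (vmul A (s m) (t m)) (vmul A (s n) (t n))) \<le>
        nrm A (vdiff A (s m) (s n)) * nrm A (t m) + nrm A (s n) * nrm A (vdiff A (t m) (t n))"
      by (rule dist_mul) (simp_all add: cs ct)
    also have "\<dots> \<le> nrm A (vdiff A (s m) (s n)) * C + B * nrm A (vdiff A (t m) (t n))"
      using B C cs ct by (intro add_mono mult_mono) (auto intro: less_imp_le)
    also have "\<dots> < e/(2*C) * C + B * (e/(2*B))"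
      using N M that B C by (intro add_strict_mono mult_strict_right_mono mult_strict_left_mono) auto
    also have "\<dots> = e" using B C by simp
    finally show ?thesis .
  qed
  then show "\<exists>N. \<forall>m\<ge>N. \<forall>n\<ge>N. nrm A (vdiff A (vmul A (s m) (t m)) (vmul A (s n) (t n))) < e" by blast
qed

lemma cauchy_vdiff:
  assumes s: "cauchy_in A s" and t: "cauchy_in A t" shows "cauchy_in A (\<lambda>n. vdiff A (s n) (t n))"
  unfolding vdiff_def by (intro cauchy_add cauchy_scal s t)

lemma null_dist_refl: "cauchy_in A s \<Longrightarrow> null_dist s s"
  by (simp add: null_dist_def dist_self cauchy_in_carrier)

lemma null_dist_sym: "cauchy_in A s \<Longrightarrow> cauchy_in A t \<Longrightarrow> null_dist s t \<Longrightarrow> null_dist t s"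
  unfolding null_dist_def by (subst dist_sym) (simp_all add: cauchy_in_carrier)

lemma null_dist_le:
  assumes "\<And>n. 0 \<le> f n" "\<And>n. f n \<le> g n" "g \<longlonglongrightarrow> (0::real)" shows "f \<longlonglongrightarrow> 0"
  by (rule tendsto_sandwich[OF _ _ tendsto_const assms(3)]) (use assms in auto)

lemma null_dist_trans: "cauchy_in A s \<Longrightarrow> cauchy_in A t \<Longrightarrow> cauchy_in A u \<Longrightarrow> null_dist s t \<Longrightarrow> null_dist t u \<Longrightarrow> null_dist s u"
  unfolding null_dist_def
  apply (rule null_dist_le[where g = "\<lambda>n. nrm A (vdiff A (s n) (t n)) + nrm A (vdiff A (t n) (u n))"])
  by (auto simp: cauchy_in_carrier dist_tri intro: tendsto_add_zero)

lemma class_eq_iff: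
  assumes s: "cauchy_in A s" and t: "cauchy_in A t"
  shows "cauchy_class A s = cauchy_class A t \<longleftrightarrow> null_dist s t"
proof
  assume "cauchy_class A s = cauchy_class A t"
  moreover have "t \<in> cauchy_class A t" using t null_dist_refl[OF t] by (simp add: cauchy_class_def null_dist_def)
  ultimately show "null_dist s t" by (auto simp: cauchy_class_def null_dist_def)
next
  assume "null_dist s t"
  then show "cauchy_class A s = cauchy_class A t"
    unfolding cauchy_class_def null_dist_def[symmetric]
    using null_dist_trans null_dist_sym s t by blast
qed

text \<open>\<open>class_rep\<close> returns an unspecified member of a class. What survives of the
  choice is that it is Cauchy and equivalent to every sequence representing the class.\<close>

lemma rep:
  assumes s: "cauchy_in A s"
  shows "cauchy_in A (class_rep (cauchy_class A s))" "null_dist s (class_rep (cauchy_class A s))"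
proof -
  have "s \<in> cauchy_class A s" using s null_dist_refl[OF s] by (simp add: cauchy_class_def null_dist_def)
  then have "class_rep (cauchy_class A s) \<in> cauchy_class A s"
    unfolding class_rep_def by (metis someI)
  then show "cauchy_in A (class_rep (cauchy_class A s))" "null_dist s (class_rep (cauchy_class A s))"
    by (auto simp: cauchy_class_def null_dist_def)
qed

lemma null_dist_add:
  assumes "cauchy_in A s" "cauchy_in A s'" "cauchy_in A t" "cauchy_in A t'" "null_dist s s'" "null_dist t t'"
  shows "null_dist (\<lambda>n. vadd A (s n) (t n)) (\<lambda>n. vadd A (s' n) (t' n))"
  unfolding null_dist_def
  apply (rule null_dist_le[where g = "\<lambda>n. nrm A (vdiff A (s n) (s' n)) + nrm A (vdiff A (t n) (t' n))"])
  using assms by (auto simp: cauchy_in_carrier dist_add null_dist_def intro: tendsto_add_zero)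

lemma null_dist_scal:
  assumes "cauchy_in A s" "cauchy_in A s'" "null_dist s s'"
  shows "null_dist (\<lambda>n. scal A k (s n)) (\<lambda>n. scal A k (s' n))"
  using assms unfolding null_dist_def by (simp add: dist_scal cauchy_in_carrier tendsto_mult_right_zero)

lemma null_dist_star:
  assumes "cauchy_in A s" "cauchy_in A s'" "null_dist s s'"
  shows "null_dist (\<lambda>n. star A (s n)) (\<lambda>n. star A (s' n))"
  using assms unfolding null_dist_def by (simp add: dist_star cauchy_in_carrier)

lemma null_dist_mul:
  assumes h: "cauchy_in A s" "cauchy_in A s'" "cauchy_in A t" "cauchy_in A t'" "null_dist s s'" "null_dist t t'"
  shows "null_dist (\<lambda>n. vmul A (s n) (t n)) (\<lambda>n. vmul A (s' n) (t' n))"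
proof -
  obtain B where B: "B > 0" "\<And>n. nrm A (s' n) \<le> B" using nrm_bounded[OF h(2)] by blast
  obtain C where C: "C > 0" "\<And>n. nrm A (t n) \<le> C" using nrm_bounded[OF h(3)] by blast
  show ?thesis
    unfolding null_dist_def
  proof (rule null_dist_le[where g = "\<lambda>n. nrm A (vdiff A (s n) (s' n)) * C + B * nrm A (vdiff A (t n) (t' n))"])
    fix n
    show "0 \<le> nrm A (vdiff A (vmul A (s n) (t n)) (vmul A (s' n) (t' n)))"
      using h by (simp add: cauchy_in_carrier)
    have "nrm A (vdiff A (vmul A (s n) (t n)) (vmul A (s' n) (t' n)))
      \<le> nrm A (vdiff A (s n) (s' n)) * nrm A (t n) + nrm A (s' n) * nrm A (vdiff A (t n) (t' n))"
      using h by (intro dist_mul) (simp_all add: cauchy_in_carrier)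
    also have "\<dots> \<le> nrm A (vdiff A (s n) (s' n)) * C + B * nrm A (vdiff A (t n) (t' n))"
      using B C h by (intro add_mono mult_mono) (auto simp: cauchy_in_carrier intro: less_imp_le)
    finally show "nrm A (vdiff A (vmul A (s n) (t n)) (vmul A (s' n) (t' n)))
      \<le> nrm A (vdiff A (s n) (s' n)) * C + B * nrm A (vdiff A (t n) (t' n))" .
    show "(\<lambda>n. nrm A (vdiff A (s n) (s' n)) * C + B * nrm A (vdiff A (t n) (t' n))) \<longlonglongrightarrow> 0"
      using h(5,6) unfolding null_dist_def
      by (intro tendsto_add_zero tendsto_mult_left_zero tendsto_mult_right_zero)
  qed
qed

lemma null_dist_nrm:
  assumes "cauchy_in A s" "cauchy_in A t" "null_dist s t"
  shows "lim (\<lambda>n. nrm A (s n)) = lim (\<lambda>n. nrm A (t n))"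
proof -
  have "(\<lambda>n. nrm A (s n) - nrm A (t n)) \<longlonglongrightarrow> 0"
    apply (rule tendsto_rabs_zero_cancel)
    apply (rule null_dist_le[where g = "\<lambda>n. nrm A (vdiff A (s n) (t n))"])
    using assms nrm_diff by (auto simp: cauchy_in_carrier null_dist_def)
  moreover have "(\<lambda>n. nrm A (s n) - nrm A (t n)) \<longlonglongrightarrow> lim (\<lambda>n. nrm A (s n)) - lim (\<lambda>n. nrm A (t n))"
    using assms by (intro tendsto_diff nrm_lim)
  ultimately show ?thesis using LIMSEQ_unique by fastforce
qed

lemma completion_carrier: "carrier (completion A) = cauchy_class A ` {s. cauchy_in A s}"
  by (simp add: completion_def)

text \<open>\<open>completion\<close> defines its operations on chosen representatives. Each
  operation respects \<open>null_dist\<close>, so any representing sequence may be used in their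
  place.\<close>

lemma completion_ops:
  assumes s: "cauchy_in A s" and t: "cauchy_in A t"
  shows "vadd (completion A) (cauchy_class A s) (cauchy_class A t) = cauchy_class A (\<lambda>n. vadd A (s n) (t n))"
    and "scal (completion A) k (cauchy_class A s) = cauchy_class A (\<lambda>n. scal A k (s n))"
    and "vmul (completion A) (cauchy_class A s) (cauchy_class A t) = cauchy_class A (\<lambda>n. vmul A (s n) (t n))"
    and "star (completion A) (cauchy_class A s) = cauchy_class A (\<lambda>n. star A (s n))"
    and "nrm (completion A) (cauchy_class A s) = lim (\<lambda>n. nrm A (s n))"
    and "vdiff (completion A) (cauchy_class A s) (cauchy_class A t) = cauchy_class A (\<lambda>n. vdiff A (s n) (t n))"
proof -
  note rs = rep[OF s] and rt = rep[OF t]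
  have a: "vadd (completion A) (cauchy_class A s) (cauchy_class A t) = cauchy_class A (\<lambda>n. vadd A (s n) (t n))"
    if "cauchy_in A s" "cauchy_in A t" for s t
    using class_eq_iff cauchy_add null_dist_add rep null_dist_sym that by (simp add: completion_def)
  have b: "scal (completion A) k (cauchy_class A s) = cauchy_class A (\<lambda>n. scal A k (s n))"
    if "cauchy_in A s" for s k
    using class_eq_iff cauchy_scal null_dist_scal rep null_dist_sym that by (simp add: completion_def)
  show "vadd (completion A) (cauchy_class A s) (cauchy_class A t) = cauchy_class A (\<lambda>n. vadd A (s n) (t n))"
    by (rule a[OF s t])
  show "scal (completion A) k (cauchy_class A s) = cauchy_class A (\<lambda>n. scal A k (s n))"
    by (rule b[OF s])
  show "vmul (completion A) (cauchy_class A s) (cauchy_class A t) = cauchy_class A (\<lambda>n. vmul A (s n) (t n))"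
    using class_eq_iff cauchy_mul null_dist_mul rep null_dist_sym s t by (simp add: completion_def)
  show "star (completion A) (cauchy_class A s) = cauchy_class A (\<lambda>n. star A (s n))"
    using class_eq_iff cauchy_star null_dist_star rep null_dist_sym s t by (simp add: completion_def)
  show "nrm (completion A) (cauchy_class A s) = lim (\<lambda>n. nrm A (s n))"
    using null_dist_nrm[OF s rs] by (simp add: completion_def)
  show "vdiff (completion A) (cauchy_class A s) (cauchy_class A t) = cauchy_class A (\<lambda>n. vdiff A (s n) (t n))"
    using s t by (simp add: vdiff_def a b cauchy_scal)
qed

lemma class_in: "cauchy_in A s \<Longrightarrow> cauchy_class A s \<in> carrier (completion A)"
  by (simp add: completion_carrier)

lemma completion_cases:
  assumes "X \<in> carrier (completion A)" obtains s where "cauchy_in A s" "X = cauchy_class A s"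
  using assms by (auto simp: completion_carrier)

text \<open>Identities are inherited term by term from representing sequences, and inequalities
  between norms by passing to the limit.\<close>

lemma star_nalg_completion: "star_nalg (completion A)"
proof -
  note C = cauchy_add cauchy_scal cauchy_mul cauchy_star class_in completion_ops(1-5)
  obtain a0 where a0: "a0 \<in> carrier A" using carrier_ne by blast
  have lim0: "0 \<le> lim (\<lambda>n. nrm A (s n))" if "cauchy_in A s" for s
    using nrm_lim[OF that] by (rule LIMSEQ_le_const) (use that cauchy_in_carrier in auto)
  show ?thesis
  proof (unfold_locales, goal_cases)
    case 1
    show ?case using class_in[OF cauchy_const[OF a0]] by blast
  next
    case (2 a b) then show ?case by (elim completion_cases) (simp add: C)
  next
    case (3 c a) then show ?case by (elim completion_cases) (simp add: C)
  next
    case (4 a b) then show ?case by (elim completion_cases) (simp add: C)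
  next
    case (5 a) then show ?case by (elim completion_cases) (simp add: C)
  next
    case (6 a b c) then show ?case
      by (elim completion_cases) (simp add: C add_assoc cauchy_in_carrier)
  next
    case (7 a b) then show ?case
      by (elim completion_cases) (simp add: C add_comm cauchy_in_carrier)
  next
    case (8 a b) then show ?case
      by (elim completion_cases) (simp add: C add_zero cauchy_in_carrier)
  next
    case (9 c a b) then show ?case
      by (elim completion_cases) (simp add: C scal_add cauchy_in_carrier)
  next
    case (10 c d a) then show ?case
      by (elim completion_cases) (simp add: C add_scal cauchy_in_carrier)
  next
    case (11 c d a) then show ?case
      by (elim completion_cases) (simp add: C scal_scal cauchy_in_carrier)
  next
    case (12 a) then show ?case
      by (elim completion_cases) (simp add: C scal_one cauchy_in_carrier)
  next
    case (13 a b c) then show ?case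
      by (elim completion_cases) (simp add: C mul_add_left cauchy_in_carrier)
  next
    case (14 a b c) then show ?case
      by (elim completion_cases) (simp add: C mul_add_right cauchy_in_carrier)
  next
    case (15 k a b) then show ?case
      by (elim completion_cases) (simp add: C mul_scal_left cauchy_in_carrier)
  next
    case (16 k a b) then show ?case
      by (elim completion_cases) (simp add: C mul_scal_right cauchy_in_carrier)
  next
    case (17 a b) then show ?case
      by (elim completion_cases) (simp add: C star_add cauchy_in_carrier)
  next
    case (18 c a) then show ?case
      by (elim completion_cases) (simp add: C star_scal cauchy_in_carrier)
  next
    case (19 a) then show ?case
      by (elim completion_cases) (simp add: C star_star cauchy_in_carrier)
  next
    case (20 a) then show ?case by (elim completion_cases) (simp add: C lim0)
  next
    case (21 a b)
    then obtain s t where st: "cauchy_in A s" "cauchy_in A t" "a = cauchy_class A s" "b = cauchy_class A t"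
      by (elim completion_cases)
    have "lim (\<lambda>n. nrm A (vadd A (s n) (t n))) \<le> lim (\<lambda>n. nrm A (s n)) + lim (\<lambda>n. nrm A (t n))"
      by (rule LIMSEQ_le[OF nrm_lim[OF cauchy_add[OF st(1,2)]] tendsto_add[OF nrm_lim[OF st(1)] nrm_lim[OF st(2)]]])
        (use st nrm_add cauchy_in_carrier in auto)
    then show ?case using st by (simp add: C)
  next
    case (22 c a)
    then obtain s where s: "cauchy_in A s" "a = cauchy_class A s" by (elim completion_cases)
    have "(\<lambda>n. cmod c * nrm A (s n)) \<longlonglongrightarrow> cmod c * lim (\<lambda>n. nrm A (s n))"
      by (intro tendsto_mult_left nrm_lim s)
    then show ?case using s by (simp add: C nrm_scal cauchy_in_carrier limI)
  next
    case (23 a b)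
    then obtain s t where st: "cauchy_in A s" "cauchy_in A t" "a = cauchy_class A s" "b = cauchy_class A t"
      by (elim completion_cases)
    have "lim (\<lambda>n. nrm A (vmul A (s n) (t n))) \<le> lim (\<lambda>n. nrm A (s n)) * lim (\<lambda>n. nrm A (t n))"
      by (rule LIMSEQ_le[OF nrm_lim[OF cauchy_mul[OF st(1,2)]] tendsto_mult[OF nrm_lim[OF st(1)] nrm_lim[OF st(2)]]])
        (use st nrm_mul cauchy_in_carrier in auto)
    then show ?case using st by (simp add: C)
  next
    case (24 a) then show ?case
      by (elim completion_cases) (simp add: C nrm_star cauchy_in_carrier)
  qed
qed

lemma completion_map_ops:
  assumes a: "a \<in> carrier A" and b: "b \<in> carrier A"
  shows "completion_map A a \<in> carrier (completion A)"
    "completion_map A (vadd A a b) = vadd (completion A) (completion_map A a) (completion_map A b)"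
    "completion_map A (scal A k a) = scal (completion A) k (completion_map A a)"
    "completion_map A (vmul A a b) = vmul (completion A) (completion_map A a) (completion_map A b)"
    "completion_map A (star A a) = star (completion A) (completion_map A a)"
    "nrm (completion A) (completion_map A a) = nrm A a"
    "nrm (completion A) (vdiff (completion A) (completion_map A a) (completion_map A b)) = nrm A (vdiff A a b)"
  using cauchy_const[OF a] cauchy_const[OF b] cauchy_vdiff[OF cauchy_const[OF a] cauchy_const[OF b]]
  by (simp_all add: completion_map_def completion_ops class_in)

lemma star_hom_completion_map: "star_hom A (completion A) (completion_map A)"
  unfolding star_hom_def using completion_map_ops by blast

text \<open>The distance from the constant sequence \<open>s m\<close> to the class of
  \<open>s\<close> is the limit over n of the distances from \<open>s m\<close> to
  \<open>s n\<close>, which is small as soon as m is past a Cauchy index.\<close>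

lemma completion_approx:
  assumes s: "cauchy_in A s"
  shows "(\<lambda>n. nrm (completion A) (vdiff (completion A) (completion_map A (s n)) (cauchy_class A s))) \<longlonglongrightarrow> 0"
proof (rule LIMSEQ_I)
  fix e :: real assume "e > 0"
  then have "e/2 > 0" by simp
  then obtain N where N: "\<forall>m\<ge>N. \<forall>n\<ge>N. nrm A (vdiff A (s m) (s n)) < e/2"
    using s unfolding cauchy_in_def by blast
  have "norm (nrm (completion A) (vdiff (completion A) (completion_map A (s m)) (cauchy_class A s)) - 0) < e"
    if "m \<ge> N" for m
  proof -
    have c: "cauchy_in A (\<lambda>_. s m)" using s by (intro cauchy_const cauchy_in_carrier)
    have eq: "nrm (completion A) (vdiff (completion A) (completion_map A (s m)) (cauchy_class A s))
      = lim (\<lambda>n. nrm A (vdiff A (s m) (s n)))"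
      using c s by (simp add: completion_map_def completion_ops cauchy_vdiff)
    have l: "(\<lambda>n. nrm A (vdiff A (s m) (s n))) \<longlonglongrightarrow> lim (\<lambda>n. nrm A (vdiff A (s m) (s n)))"
      by (rule nrm_lim[OF cauchy_vdiff[OF c s]])
    \<comment> \<open>Strict inequalities become weak ones in the limit; halving e restores
      strictness.\<close>
    have "lim (\<lambda>n. nrm A (vdiff A (s m) (s n))) \<le> e/2"
      by (rule LIMSEQ_le_const2[OF l]) (use N that in \<open>force intro: less_imp_le\<close>)
    moreover have "lim (\<lambda>n. nrm A (vdiff A (s m) (s n))) \<ge> 0"
      by (rule LIMSEQ_le_const[OF l]) (use s cauchy_in_carrier in auto)
    ultimately show ?thesis using eq \<open>e > 0\<close> by simp
  qed
  then show "\<exists>N. \<forall>n\<ge>N. norm (nrm (completion A) (vdiff (completion A) (completion_map A (s n)) (cauchy_class A s)) - 0) < e"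
    by blast
qed

end

definition converges :: "'x star_alg \<Rightarrow> (nat \<Rightarrow> 'x) \<Rightarrow> 'x \<Rightarrow> bool" where
  "converges A s a \<longleftrightarrow> (\<lambda>n. nrm A (vdiff A (s n) a)) \<longlonglongrightarrow> 0"

locale banach_star = star_nalg A for A :: "'x star_alg" +
  assumes hausdorff: "\<And>a b. a \<in> carrier A \<Longrightarrow> b \<in> carrier A \<Longrightarrow> nrm A (vdiff A a b) = 0 \<Longrightarrow> a = b"
    and complete: "\<And>s. cauchy_in A s \<Longrightarrow> \<exists>a\<in>carrier A. converges A s a"

context star_nalg
begin

text \<open>Completeness by approximation: choose in \<open>A\<close> a point within 1/(n+1) of the
  n-th term of a Cauchy sequence of classes. The chosen points form a Cauchy sequence of
  \<open>A\<close>, and its class is the limit.\<close>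

lemma banach_star_completion: "banach_star (completion A)"
proof -
  interpret C: star_nalg "completion A" by (rule star_nalg_completion)
  show ?thesis
  proof
    fix a b assume "a \<in> carrier (completion A)" "b \<in> carrier (completion A)"
      and z: "nrm (completion A) (vdiff (completion A) a b) = 0"
    then obtain s t where st: "cauchy_in A s" "cauchy_in A t" "a = cauchy_class A s" "b = cauchy_class A t"
      by (elim completion_cases)
    then have "lim (\<lambda>n. nrm A (vdiff A (s n) (t n))) = 0"
      using z by (simp add: completion_ops cauchy_vdiff)
    then have "null_dist s t" using nrm_lim[OF cauchy_vdiff[OF st(1,2)]] by (simp add: null_dist_def)
    then show "a = b" using st class_eq_iff by simp
  next
    fix X assume X: "cauchy_in (completion A) X"
    let ?C = "completion A"
    have "\<exists>a. a \<in> carrier A \<and> nrm ?C (vdiff ?C (completion_map A a) (X n)) < inverse (real (Suc n))" for n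
    proof -
      obtain s where s: "cauchy_in A s" "X n = cauchy_class A s"
        using C.cauchy_in_carrier[OF X, of n] by (elim completion_cases)
      obtain m where "norm (nrm ?C (vdiff ?C (completion_map A (s m)) (X n)) - 0) < inverse (real (Suc n))"
        using LIMSEQ_D[OF completion_approx[OF s(1)], of "inverse (real (Suc n))"] s(2) by auto
      then have "nrm ?C (vdiff ?C (completion_map A (s m)) (X n)) < inverse (real (Suc n))" by auto
      then show ?thesis using cauchy_in_carrier[OF s(1), of m] by blast
    qed
    then obtain a where a: "\<And>n. a n \<in> carrier A"
      "\<And>n. nrm ?C (vdiff ?C (completion_map A (a n)) (X n)) < inverse (real (Suc n))" by metis
    have Xc: "X n \<in> carrier ?C" and ac: "completion_map A (a n) \<in> carrier ?C" for n
      using C.cauchy_in_carrier[OF X] completion_map_ops(1)[OF a(1) a(1)] by auto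
    have "cauchy_in A a"
      unfolding cauchy_in_def
    proof (intro conjI allI impI)
      show "range a \<subseteq> carrier A" using a by auto
      fix e :: real assume e: "e > 0"
      then have "e/3 > 0" by simp
      then obtain N where N: "\<forall>m\<ge>N. \<forall>n\<ge>N. nrm ?C (vdiff ?C (X m) (X n)) < e/3"
        using X unfolding cauchy_in_def by blast
      obtain M where M: "inverse (real (Suc M)) < e/3" using reals_Archimedean \<open>e/3 > 0\<close> by blast
      have "nrm A (vdiff A (a m) (a n)) < e" if "m \<ge> max N M" "n \<ge> max N M" for m n
      proof -
        have i: "inverse (real (Suc m)) \<le> inverse (real (Suc M))" "inverse (real (Suc n)) \<le> inverse (real (Suc M))"
          using that by auto
        have "nrm A (vdiff A (a m) (a n)) = nrm ?C (vdiff ?C (completion_map A (a m)) (completion_map A (a n)))"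
          using a completion_map_ops by simp
        also have "\<dots> \<le> nrm ?C (vdiff ?C (completion_map A (a m)) (X m)) +
           (nrm ?C (vdiff ?C (X m) (X n)) + nrm ?C (vdiff ?C (X n) (completion_map A (a n))))"
          using C.dist_tri[of "completion_map A (a m)" "X m" "completion_map A (a n)"]
            C.dist_tri[of "X m" "X n" "completion_map A (a n)"] Xc ac by force
        also have "nrm ?C (vdiff ?C (X n) (completion_map A (a n))) = nrm ?C (vdiff ?C (completion_map A (a n)) (X n))"
          using Xc ac by (rule C.dist_sym)
        finally show ?thesis using a(2)[of m] a(2)[of n] i M N[rule_format, of m n] that by linarith
      qed
      then show "\<exists>N. \<forall>m\<ge>N. \<forall>n\<ge>N. nrm A (vdiff A (a m) (a n)) < e" by blast
    qed
    note ca = this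
    have "(\<lambda>n. nrm ?C (vdiff ?C (X n) (cauchy_class A a))) \<longlonglongrightarrow> 0"
    proof (rule null_dist_le)
      fix n
      show "0 \<le> nrm ?C (vdiff ?C (X n) (cauchy_class A a))" using Xc class_in[OF ca] by simp
      show "nrm ?C (vdiff ?C (X n) (cauchy_class A a)) \<le>
         inverse (real (Suc n)) + nrm ?C (vdiff ?C (completion_map A (a n)) (cauchy_class A a))"
        using C.dist_tri[OF Xc ac class_in[OF ca], of n n] C.dist_sym[OF Xc ac, of n n] a(2)[of n] by simp
      show "(\<lambda>n. inverse (real (Suc n)) + nrm ?C (vdiff ?C (completion_map A (a n)) (cauchy_class A a))) \<longlonglongrightarrow> 0"
        by (rule tendsto_add_zero[OF LIMSEQ_inverse_real_of_nat completion_approx[OF ca]])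
    qed
    then show "\<exists>a\<in>carrier ?C. converges ?C X a" unfolding converges_def using class_in[OF ca] by blast
  qed
qed

end

text \<open>Changes the norm while keeping the algebra. It is applied to the largest C*-seminorm and
  to the regular norm.\<close>

lemma (in star_nalg) star_nalg_nrm:
  assumes N: "\<And>a. a \<in> carrier A \<Longrightarrow> 0 \<le> N a"
    "\<And>a b. a \<in> carrier A \<Longrightarrow> b \<in> carrier A \<Longrightarrow> N (vadd A a b) \<le> N a + N b"
    "\<And>c a. a \<in> carrier A \<Longrightarrow> N (scal A c a) = cmod c * N a"
    "\<And>a b. a \<in> carrier A \<Longrightarrow> b \<in> carrier A \<Longrightarrow> N (vmul A a b) \<le> N a * N b"
    "\<And>a. a \<in> carrier A \<Longrightarrow> N (star A a) = N a"
  shows "star_nalg (A\<lparr>nrm := N\<rparr>)"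
  by (unfold_locales;
      ((simp add: carrier_ne N add_assoc add_zero scal_add add_scal scal_scal scal_one mul_add_left
        mul_add_right mul_scal_left mul_scal_right star_add star_scal star_star; fail) |
       (simp add: add_comm; fail)))

section \<open>C*-seminorms and the enveloping C*-algebra\<close>

context star_nalg
begin

text \<open>Keeps the set under the supremum in \<open>max_seminorm\<close> nonempty; the bound by
  \<open>nrm A\<close> inside \<open>cstar_seminorm\<close> keeps it bounded above.\<close>

lemma cstar_zero: "cstar_seminorm A (\<lambda>_. 0)"
  by (simp add: cstar_seminorm_def)

definition max_seminorm :: "'x \<Rightarrow> real" where
  "max_seminorm a = Sup {N a | N. cstar_seminorm A N}"

lemma max_seminorm_upper: "cstar_seminorm A N \<Longrightarrow> a \<in> carrier A \<Longrightarrow> N a \<le> max_seminorm a"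
  unfolding max_seminorm_def by (rule cSup_upper) (auto simp: bdd_above_def cstar_seminorm_def intro!: exI[of _ "nrm A a"])

lemma max_seminorm_least: "(\<And>N. cstar_seminorm A N \<Longrightarrow> N a \<le> c) \<Longrightarrow> max_seminorm a \<le> c"
  unfolding max_seminorm_def using cstar_zero by (intro cSup_least) auto

lemma max_seminorm_nrm: "a \<in> carrier A \<Longrightarrow> max_seminorm a \<le> nrm A a"
  by (rule max_seminorm_least) (simp add: cstar_seminorm_def)

lemma max_seminorm_nonneg: "a \<in> carrier A \<Longrightarrow> 0 \<le> max_seminorm a"
  using max_seminorm_upper[OF cstar_zero] by simp

text \<open>Invariance under the involution is a consequence of the C*-identity: the square of N b
  is N of (star b) b, hence at most N (star b) times N b. Cancel N b and apply the result to star b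
  as well.\<close>

lemma cstar_seminorm_star:
  assumes N: "cstar_seminorm A N" and a: "a \<in> carrier A" shows "N (star A a) = N a"
proof -
  have le: "N b \<le> N (star A b)" if b: "b \<in> carrier A" for b
  proof -
    have "(N b)\<^sup>2 \<le> N (star A b) * N b" "0 \<le> N b" "0 \<le> N (star A b)"
      using N b unfolding cstar_seminorm_def by (metis star_in)+
    then show ?thesis by (cases "N b = 0") (auto simp: power2_eq_square)
  qed
  show ?thesis using le[OF a] le[OF star_in[OF a]] a by (simp add: star_star)
qed

text \<open>A supremum of seminorms inherits their upper estimates at once. Only homogeneity needs a
  lower bound, obtained by dividing by \<open>cmod c\<close>.\<close>

lemma star_nalg_max: "star_nalg (with_max_cstar_norm A)"
proof -
  have "star_nalg (A\<lparr>nrm := max_seminorm\<rparr>)"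
  proof (rule star_nalg_nrm)
    fix a assume a: "a \<in> carrier A"
    show "0 \<le> max_seminorm a" using max_seminorm_nonneg[OF a] .
    have m: "max_seminorm b \<le> max_seminorm (star A b)" if b: "b \<in> carrier A" for b
      using max_seminorm_upper cstar_seminorm_star b by (intro max_seminorm_least) (metis star_in)
    show "max_seminorm (star A a) = max_seminorm a" using m[OF a] m[OF star_in[OF a]] a by (simp add: star_star)
    fix c
    show "max_seminorm (scal A c a) = cmod c * max_seminorm a"
    proof (rule antisym)
      show "max_seminorm (scal A c a) \<le> cmod c * max_seminorm a"
      proof (rule max_seminorm_least)
        fix N assume N: "cstar_seminorm A N"
        then have "N (scal A c a) = cmod c * N a" using a by (simp add: cstar_seminorm_def)
        then show "N (scal A c a) \<le> cmod c * max_seminorm a" using max_seminorm_upper[OF N a] by (simp add: mult_left_mono)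
      qed
      show "cmod c * max_seminorm a \<le> max_seminorm (scal A c a)"
      proof (cases "c = 0")
        case True then show ?thesis using max_seminorm_nonneg a by simp
      next
        case False
        have "max_seminorm a \<le> max_seminorm (scal A c a) / cmod c"
        proof (rule max_seminorm_least)
          fix N assume N: "cstar_seminorm A N"
          then have "N (scal A c a) = cmod c * N a" using a by (simp add: cstar_seminorm_def)
          then show "N a \<le> max_seminorm (scal A c a) / cmod c"
            using max_seminorm_upper[OF N scal_in[OF a, of c]] False by (simp add: field_simps)
        qed
        then show ?thesis using False by (simp add: field_simps)
      qed
    qed
  next
    fix a b assume a: "a \<in> carrier A" and b: "b \<in> carrier A"
    show "max_seminorm (vadd A a b) \<le> max_seminorm a + max_seminorm b"
    proof (rule max_seminorm_least)
      fix N assume N: "cstar_seminorm A N"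
      then have "N (vadd A a b) \<le> N a + N b" using a b by (simp add: cstar_seminorm_def)
      then show "N (vadd A a b) \<le> max_seminorm a + max_seminorm b" using max_seminorm_upper[OF N a] max_seminorm_upper[OF N b] by linarith
    qed
    show "max_seminorm (vmul A a b) \<le> max_seminorm a * max_seminorm b"
    proof (rule max_seminorm_least)
      fix N assume N: "cstar_seminorm A N"
      then have "N (vmul A a b) \<le> N a * N b" "0 \<le> N b" using a b by (simp_all add: cstar_seminorm_def)
      then show "N (vmul A a b) \<le> max_seminorm a * max_seminorm b"
        using mult_mono[OF max_seminorm_upper[OF N a] max_seminorm_upper[OF N b] max_seminorm_nonneg[OF a]] by linarith
    qed
  qed
  moreover have "with_max_cstar_norm A = A\<lparr>nrm := max_seminorm\<rparr>"
    by (simp add: with_max_cstar_norm_def max_seminorm_def[abs_def])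
  ultimately show ?thesis by simp
qed

lemma max_simps [simp]:
  "carrier (with_max_cstar_norm A) = carrier A" "vadd (with_max_cstar_norm A) = vadd A"
  "scal (with_max_cstar_norm A) = scal A" "vmul (with_max_cstar_norm A) = vmul A"
  "star (with_max_cstar_norm A) = star A" "nrm (with_max_cstar_norm A) = max_seminorm"
  "vdiff (with_max_cstar_norm A) = vdiff A"
  by (simp_all add: with_max_cstar_norm_def max_seminorm_def[abs_def] vdiff_def[abs_def])

end

lemma star_hom_comp: "star_hom A B \<phi> \<Longrightarrow> star_hom B C \<psi> \<Longrightarrow> star_hom A C (\<lambda>x. \<psi> (\<phi> x))"
  unfolding star_hom_def by auto

text \<open>Pullback along a *-homomorphism. Contractivity supplies the bound by
  \<open>nrm A\<close> that \<open>cstar_seminorm\<close> includes.\<close>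

lemma cstar_seminorm_comp:
  assumes "star_hom A B \<phi>" "\<And>a. a \<in> carrier A \<Longrightarrow> nrm B (\<phi> a) \<le> nrm A a" "cstar_seminorm B N"
    and "\<And>a. a \<in> carrier A \<Longrightarrow> star A a \<in> carrier A"
  shows "cstar_seminorm A (\<lambda>a. N (\<phi> a))"
proof -
  have "N (\<phi> a) \<le> nrm A a" if "a \<in> carrier A" for a
    using assms(1-3) that unfolding star_hom_def cstar_seminorm_def by (meson order_trans)
  then show ?thesis using assms unfolding star_hom_def cstar_seminorm_def by auto
qed

context star_nalg
begin

text \<open>Being dominated by the norm makes N Lipschitz with constant 1, so N extends to the
  completion.\<close>

lemma cstar_lipschitz:
  assumes N: "cstar_seminorm A N" and a: "a \<in> carrier A" and b: "b \<in> carrier A"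
  shows "\<bar>N a - N b\<bar> \<le> nrm A (vdiff A a b)"
proof -
  have t: "N (vadd A x y) \<le> N x + N y" if "x \<in> carrier A" "y \<in> carrier A" for x y
    using N that by (simp add: cstar_seminorm_def)
  have u: "N x \<le> nrm A x" if "x \<in> carrier A" for x using N that by (simp add: cstar_seminorm_def)
  show ?thesis
    using t[of "vdiff A a b" b] t[of "vdiff A b a" a] u[of "vdiff A a b"] u[of "vdiff A b a"] dist_sym[of a b] a b
    by (simp add: add_vdiff)
qed

text \<open>Extension by continuity to the completion; \<open>ext_lim\<close> shows that every
  representing sequence computes it.\<close>

definition ext :: "('x \<Rightarrow> real) \<Rightarrow> (nat \<Rightarrow> 'x) set \<Rightarrow> real" where
  "ext N X = lim (\<lambda>n. N (class_rep X n))"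

lemma ext_lim:
  assumes N: "cstar_seminorm A N" and s: "cauchy_in A s"
  shows "(\<lambda>n. N (s n)) \<longlonglongrightarrow> ext N (cauchy_class A s)"
proof -
  let ?r = "class_rep (cauchy_class A s)"
  have c: "Cauchy (\<lambda>n. N (t n))" if t: "cauchy_in A t" for t
  proof (rule metric_CauchyI)
    fix e :: real assume "e > 0"
    then obtain M where M: "\<forall>m\<ge>M. \<forall>n\<ge>M. nrm A (vdiff A (t m) (t n)) < e"
      using t unfolding cauchy_in_def by blast
    have "dist (N (t m)) (N (t n)) < e" if "m \<ge> M" "n \<ge> M" for m n
      using M that cstar_lipschitz[OF N, of "t m" "t n"] cauchy_in_carrier[OF t] by (fastforce simp: dist_real_def)
    then show "\<exists>M. \<forall>m\<ge>M. \<forall>n\<ge>M. dist (N (t m)) (N (t n)) < e" by blast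
  qed
  have r: "(\<lambda>n. N (?r n)) \<longlonglongrightarrow> ext N (cauchy_class A s)"
    unfolding ext_def using c[OF rep(1)[OF s]] by (simp add: Cauchy_convergent_iff convergent_LIMSEQ_iff)
  have "(\<lambda>n. N (s n) - N (?r n)) \<longlonglongrightarrow> 0"
    apply (rule tendsto_rabs_zero_cancel)
    apply (rule null_dist_le[where g = "\<lambda>n. nrm A (vdiff A (s n) (?r n))"])
    using rep[OF s] cstar_lipschitz[OF N] cauchy_in_carrier[OF s] by (auto simp: cauchy_in_carrier null_dist_def)
  from tendsto_add[OF this r] show ?thesis by simp
qed

lemma ext_map:
  assumes "cstar_seminorm A N" "a \<in> carrier A" shows "ext N (completion_map A a) = N a"
  using ext_lim[OF assms(1) cauchy_const[OF assms(2)]]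
  by (simp add: completion_map_def LIMSEQ_const_iff)

lemma ext_cstar:
  assumes N: "cstar_seminorm A N" shows "cstar_seminorm (completion A) (ext N)"
proof -
  have N': "\<And>a. a \<in> carrier A \<Longrightarrow> 0 \<le> N a" "\<And>a. a \<in> carrier A \<Longrightarrow> N a \<le> nrm A a"
    "\<And>a b. a \<in> carrier A \<Longrightarrow> b \<in> carrier A \<Longrightarrow> N (vadd A a b) \<le> N a + N b"
    "\<And>c a. a \<in> carrier A \<Longrightarrow> N (scal A c a) = cmod c * N a"
    "\<And>a b. a \<in> carrier A \<Longrightarrow> b \<in> carrier A \<Longrightarrow> N (vmul A a b) \<le> N a * N b"
    "\<And>a. a \<in> carrier A \<Longrightarrow> N (vmul A (star A a) a) = (N a)\<^sup>2"
    using N unfolding cstar_seminorm_def by auto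
  note L = ext_lim[OF N]
  show ?thesis
    unfolding cstar_seminorm_def
  proof (intro conjI ballI allI)
    fix X assume "X \<in> carrier (completion A)"
    then obtain s where s: "cauchy_in A s" "X = cauchy_class A s" by (elim completion_cases)
    note sc = cauchy_in_carrier[OF s(1)]
    show "0 \<le> ext N X" unfolding s(2)
      by (rule LIMSEQ_le_const[OF L[OF s(1)]]) (use sc N' in auto)
    show "ext N X \<le> nrm (completion A) X" unfolding s(2) completion_ops(5)[OF s(1) s(1)]
      by (rule LIMSEQ_le[OF L[OF s(1)] nrm_lim[OF s(1)]]) (use sc N' in auto)
    show "ext N (vmul (completion A) (star (completion A) X) X) = (ext N X)\<^sup>2"
    proof (rule LIMSEQ_unique)
      show "(\<lambda>n. N (vmul A (star A (s n)) (s n))) \<longlonglongrightarrow> ext N (vmul (completion A) (star (completion A) X) X)"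
        using L[OF cauchy_mul[OF cauchy_star[OF s(1)] s(1)]] s(1)
        by (simp add: s(2) completion_ops cauchy_star)
      show "(\<lambda>n. N (vmul A (star A (s n)) (s n))) \<longlonglongrightarrow> (ext N X)\<^sup>2"
        using tendsto_power[OF L[OF s(1)], of 2] sc by (simp add: N' s(2))
    qed
    { fix c
      show "ext N (scal (completion A) c X) = cmod c * ext N X"
      proof (rule LIMSEQ_unique)
        show "(\<lambda>n. N (scal A c (s n))) \<longlonglongrightarrow> ext N (scal (completion A) c X)"
          using L[OF cauchy_scal[OF s(1)]] s(1) by (simp add: s(2) completion_ops)
        show "(\<lambda>n. N (scal A c (s n))) \<longlonglongrightarrow> cmod c * ext N X"
          using tendsto_mult_left[OF L[OF s(1)], of "cmod c"] sc by (simp add: N' s(2))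
      qed }
    fix Y assume "Y \<in> carrier (completion A)"
    then obtain t where t: "cauchy_in A t" "Y = cauchy_class A t" by (elim completion_cases)
    note tc = cauchy_in_carrier[OF t(1)]
    show "ext N (vadd (completion A) X Y) \<le> ext N X + ext N Y"
      unfolding s(2) t(2) completion_ops(1)[OF s(1) t(1)]
      by (rule LIMSEQ_le[OF L[OF cauchy_add[OF s(1) t(1)]] tendsto_add[OF L[OF s(1)] L[OF t(1)]]])
        (use sc tc N' in auto)
    show "ext N (vmul (completion A) X Y) \<le> ext N X * ext N Y"
      unfolding s(2) t(2) completion_ops(3)[OF s(1) t(1)]
      by (rule LIMSEQ_le[OF L[OF cauchy_mul[OF s(1) t(1)]] tendsto_mult[OF L[OF s(1)] L[OF t(1)]]])
        (use sc tc N' in auto)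
  qed
qed

text \<open>Restriction along \<open>completion_map\<close> and extension by \<open>ext\<close>
  match the C*-seminorms of \<open>A\<close> with those of its completion, so the two suprema agree
  on \<open>A\<close>. The enveloping norm of an L^1-algebra can thus be computed on its dense
  subalgebra.\<close>

lemma max_seminorm_completion:
  assumes a: "a \<in> carrier A"
  shows "star_nalg.max_seminorm (completion A) (completion_map A a) = max_seminorm a"
proof -
  interpret C: star_nalg "completion A" by (rule star_nalg_completion)
  have "C.max_seminorm (completion_map A a) \<le> max_seminorm a"
  proof (rule C.max_seminorm_least)
    fix N assume "cstar_seminorm (completion A) N"
    then have "cstar_seminorm A (\<lambda>a. N (completion_map A a))"
      by (intro cstar_seminorm_comp[OF star_hom_completion_map]) (simp_all add: completion_map_ops)
    then show "N (completion_map A a) \<le> max_seminorm a" using a by (rule max_seminorm_upper)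
  qed
  moreover have "max_seminorm a \<le> C.max_seminorm (completion_map A a)"
  proof (rule max_seminorm_least)
    fix N assume N: "cstar_seminorm A N"
    show "N a \<le> C.max_seminorm (completion_map A a)"
      using C.max_seminorm_upper[OF ext_cstar[OF N], of "completion_map A a"] a
      by (simp add: ext_map[OF N] completion_map_ops)
  qed
  ultimately show ?thesis by simp
qed

lemma banach_star_enveloping: "banach_star (enveloping_cstar A)"
  unfolding enveloping_cstar_def by (rule star_nalg.banach_star_completion[OF star_nalg_max])

lemma star_hom_enveloping_map: "star_hom A (enveloping_cstar A) (enveloping_map A)"
  using star_nalg.star_hom_completion_map[OF star_nalg_max]
  unfolding enveloping_cstar_def enveloping_map_def star_hom_def by simp

lemma nrm_enveloping_map: "a \<in> carrier A \<Longrightarrow> nrm (enveloping_cstar A) (enveloping_map A a) = max_seminorm a"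
  using star_nalg.completion_map_ops(6)[OF star_nalg_max, of a]
  unfolding enveloping_cstar_def enveloping_map_def by simp

end

context star_nalg
begin

abbreviation "E \<equiv> enveloping_cstar (completion A)"

text \<open>For \<open>A\<close> the Hecke algebra or \<open>C_c\<close> this is the composite
  through the L^1-completion into its enveloping C*-algebra.\<close>

definition emb :: "'x \<Rightarrow> (nat \<Rightarrow> (nat \<Rightarrow> 'x) set) set" where
  "emb a = enveloping_map (completion A) (completion_map A a)"

lemma banach_E: "banach_star E"
  by (rule star_nalg.banach_star_enveloping[OF star_nalg_completion])

lemma star_hom_emb: "star_hom A E emb"
  unfolding emb_def
  by (rule star_hom_comp[OF star_hom_completion_map star_nalg.star_hom_enveloping_map[OF star_nalg_completion]])

lemma nrm_emb: "a \<in> carrier A \<Longrightarrow> nrm E (emb a) = max_seminorm a"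
  by (simp add: emb_def star_nalg.nrm_enveloping_map[OF star_nalg_completion] completion_map_ops max_seminorm_completion)

text \<open>Two approximations are composed, one for each completion. The first is made in the norm
  of \<open>completion A\<close>, which dominates the largest C*-seminorm and so stays small in
  \<open>E\<close>.\<close>

lemma emb_dense:
  assumes X: "X \<in> carrier E" and e: "e > 0"
  shows "\<exists>a\<in>carrier A. nrm E (vdiff E (emb a) X) < e"
proof -
  interpret C: star_nalg "completion A" by (rule star_nalg_completion)
  interpret M: star_nalg "with_max_cstar_norm (completion A)" by (rule C.star_nalg_max)
  interpret E: banach_star E by (rule banach_E)
  have X': "X \<in> carrier (completion (with_max_cstar_norm (completion A)))"
    using X by (simp add: enveloping_cstar_def)
  obtain s where s: "cauchy_in (with_max_cstar_norm (completion A)) s"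
    "X = cauchy_class (with_max_cstar_norm (completion A)) s"
    by (rule M.completion_cases[OF X'])
  have e2: "e/2 > 0" using e by simp
  obtain m where m: "norm (nrm E (vdiff E (enveloping_map (completion A) (s m)) X) - 0) < e/2"
    using LIMSEQ_D[OF M.completion_approx[OF s(1)] e2] s(2)
    unfolding enveloping_cstar_def enveloping_map_def by blast
  have sm: "s m \<in> carrier (completion A)" using M.cauchy_in_carrier[OF s(1)] by simp
  then obtain t where t: "cauchy_in A t" "s m = cauchy_class A t" by (elim completion_cases)
  obtain k where k: "norm (nrm (completion A) (vdiff (completion A) (completion_map A (t k)) (s m)) - 0) < e/2"
    using LIMSEQ_D[OF completion_approx[OF t(1)] e2] t(2) by auto
  have tk: "t k \<in> carrier A" "completion_map A (t k) \<in> carrier (completion A)"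
    using cauchy_in_carrier[OF t(1)] completion_map_ops(1)[of "t k" "t k"] by auto
  let ?em = "enveloping_map (completion A)"
  have emc: "?em x \<in> carrier E" if "x \<in> carrier (completion A)" for x
    using C.star_hom_enveloping_map that by (simp add: star_hom_def)
  have "nrm E (vdiff E (emb (t k)) (?em (s m))) = C.max_seminorm (vdiff (completion A) (completion_map A (t k)) (s m))"
    using M.completion_map_ops(7)[of "completion_map A (t k)" "s m"] sm tk
    unfolding emb_def enveloping_cstar_def enveloping_map_def by simp
  also have "\<dots> \<le> nrm (completion A) (vdiff (completion A) (completion_map A (t k)) (s m))"
    using sm tk by (intro C.max_seminorm_nrm) simp
  also have "\<dots> < e/2" using k by simp
  finally have 1: "nrm E (vdiff E (emb (t k)) (?em (s m))) < e/2" .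
  have "nrm E (vdiff E (emb (t k)) X) \<le> nrm E (vdiff E (emb (t k)) (?em (s m))) + nrm E (vdiff E (?em (s m)) X)"
    by (rule E.dist_tri) (use emc sm tk X in \<open>auto simp: emb_def\<close>)
  then show ?thesis using 1 m tk by force
qed

end

section \<open>Completions in equal norms are isomorphic\<close>

text \<open>Two complete algebras containing dense images of \<open>Z\<close>. Since
  \<open>nrm Z\<close> is only a seminorm, \<open>i\<close> and \<open>j\<close> may fail to be
  injective; \<open>nrm_eq\<close> still makes the passage from \<open>i z\<close> to
  \<open>j z\<close> well defined and isometric.\<close>

locale dense_pair =
  A: banach_star A + B: banach_star B + Z: star_nalg Z
  for A :: "'x star_alg" and B :: "'y star_alg" and Z :: "'z star_alg" +
  fixes i :: "'z \<Rightarrow> 'x" and j :: "'z \<Rightarrow> 'y"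
  assumes i: "star_hom Z A i" and j: "star_hom Z B j"
    and i_dense: "\<And>a e. a \<in> carrier A \<Longrightarrow> e > 0 \<Longrightarrow> \<exists>z\<in>carrier Z. nrm A (vdiff A (i z) a) < e"
    and j_dense: "\<And>b e. b \<in> carrier B \<Longrightarrow> e > 0 \<Longrightarrow> \<exists>z\<in>carrier Z. nrm B (vdiff B (j z) b) < e"
    and nrm_eq: "\<And>z. z \<in> carrier Z \<Longrightarrow> nrm A (i z) = nrm B (j z)"
begin

lemma ij_in: "z \<in> carrier Z \<Longrightarrow> i z \<in> carrier A" "z \<in> carrier Z \<Longrightarrow> j z \<in> carrier B"
  using i j by (auto simp: star_hom_def)

lemma ij_vdiff: "z \<in> carrier Z \<Longrightarrow> w \<in> carrier Z \<Longrightarrow> i (vdiff Z z w) = vdiff A (i z) (i w)"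
  "z \<in> carrier Z \<Longrightarrow> w \<in> carrier Z \<Longrightarrow> j (vdiff Z z w) = vdiff B (j z) (j w)"
  using i j by (simp_all add: star_hom_def vdiff_def)

lemma dist_eq: "z \<in> carrier Z \<Longrightarrow> w \<in> carrier Z \<Longrightarrow>
    nrm A (vdiff A (i z) (i w)) = nrm B (vdiff B (j z) (j w))"
  by (metis Z.vdiff_in ij_vdiff nrm_eq)

text \<open>The closure of the graph of \<open>i z \<mapsto> j z\<close>.\<close>

definition rel :: "'x \<Rightarrow> 'y \<Rightarrow> bool" where
  "rel a b \<longleftrightarrow> a \<in> carrier A \<and> b \<in> carrier B \<and>
     (\<forall>e>0. \<exists>z\<in>carrier Z. nrm A (vdiff A (i z) a) < e \<and> nrm B (vdiff B (j z) b) < e)"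

lemma relD: "rel a b \<Longrightarrow> a \<in> carrier A" "rel a b \<Longrightarrow> b \<in> carrier B"
  by (auto simp: rel_def)

text \<open>On the images of \<open>Z\<close> the two distances coincide. Replacing both end points
  by approximations within e/4 changes either distance by at most e/2. Together with the Hausdorff
  property this makes \<open>rel\<close> single valued and injective.\<close>

lemma rel_dist:
  assumes "rel a b" "rel a' b'" shows "nrm A (vdiff A a a') = nrm B (vdiff B b b')"
proof -
  have "\<bar>nrm A (vdiff A a a') - nrm B (vdiff B b b')\<bar> \<le> e" if e: "e > 0" for e
  proof -
    have "e/4 > 0" using e by simp
    then obtain z w where z: "z \<in> carrier Z" "nrm A (vdiff A (i z) a) < e/4" "nrm B (vdiff B (j z) b) < e/4"
      and w: "w \<in> carrier Z" "nrm A (vdiff A (i w) a') < e/4" "nrm B (vdiff B (j w) b') < e/4"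
      using assms unfolding rel_def by meson
    note c = relD(1)[OF assms(1)] relD(2)[OF assms(1)] relD(1)[OF assms(2)] relD(2)[OF assms(2)]
      ij_in(1)[OF z(1)] ij_in(2)[OF z(1)] ij_in(1)[OF w(1)] ij_in(2)[OF w(1)]
    have 1: "\<bar>nrm A (vdiff A (i z) (i w)) - nrm A (vdiff A a a')\<bar> \<le> e/2"
      using A.dist_tri[OF c(5,1,7)] A.dist_tri[OF c(1,3,7)] A.dist_tri[OF c(1,5,3)]
        A.dist_tri[OF c(5,7,3)] A.dist_sym[OF c(1,5)] A.dist_sym[OF c(7,3)] z(2,3) w(2,3)
      unfolding abs_le_iff by (intro conjI) linarith+
    have 2: "\<bar>nrm B (vdiff B (j z) (j w)) - nrm B (vdiff B b b')\<bar> \<le> e/2"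
      using B.dist_tri[OF c(6,2,8)] B.dist_tri[OF c(2,4,8)] B.dist_tri[OF c(2,6,4)]
        B.dist_tri[OF c(6,8,4)] B.dist_sym[OF c(2,6)] B.dist_sym[OF c(8,4)] z(2,3) w(2,3)
      unfolding abs_le_iff by (intro conjI) linarith+
    show ?thesis using 1 2 dist_eq[OF z(1) w(1)] by linarith
  qed
  then have "\<bar>nrm A (vdiff A a a') - nrm B (vdiff B b b')\<bar> \<le> 0" by (rule field_le_epsilon) simp
  then show ?thesis by simp
qed

lemma rel_ij: "z \<in> carrier Z \<Longrightarrow> rel (i z) (j z)"
  unfolding rel_def by (auto simp: ij_in A.dist_self B.dist_self intro!: bexI[of _ z])

end

text \<open>If the points \<open>i z\<close> approach c, equality of the norms makes the points
  \<open>j z\<close> a Cauchy sequence, and completeness of the target supplies the partner of c. It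
  serves in both directions: for totality and for surjectivity of \<open>rel\<close>.\<close>

lemma (in banach_star) limit_of_dense:
  assumes i: "star_hom Z C i" "\<And>z. z \<in> carrier Z \<Longrightarrow> nrm C (i z) = nrm A (j z)"
    and j: "star_hom Z A j" and Z: "star_nalg Z" and C: "star_nalg C"
    and c: "c \<in> carrier C" and d: "\<And>e. e > 0 \<Longrightarrow> \<exists>z\<in>carrier Z. nrm C (vdiff C (i z) c) < e"
  shows "\<exists>a\<in>carrier A. \<forall>e>0. \<exists>z\<in>carrier Z. nrm C (vdiff C (i z) c) < e \<and> nrm A (vdiff A (j z) a) < e"
proof -
  interpret Z: star_nalg Z by (rule Z)
  interpret C: star_nalg C by (rule C)
  have "\<forall>n. \<exists>z. z \<in> carrier Z \<and> nrm C (vdiff C (i z) c) < inverse (real (Suc n))"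
    using d by (metis inverse_positive_iff_positive of_nat_0_less_iff zero_less_Suc)
  then obtain z where z: "\<And>n. z n \<in> carrier Z" "\<And>n. nrm C (vdiff C (i (z n)) c) < inverse (real (Suc n))"
    by metis
  have ic: "i (z n) \<in> carrier C" and jc: "j (z n) \<in> carrier A" for n
    using i(1) j z(1) by (auto simp: star_hom_def)
  have eq: "nrm A (vdiff A (j (z m)) (j (z n))) = nrm C (vdiff C (i (z m)) (i (z n)))" for m n
  proof -
    have "i (vdiff Z (z m) (z n)) = vdiff C (i (z m)) (i (z n))" "j (vdiff Z (z m) (z n)) = vdiff A (j (z m)) (j (z n))"
      using i(1) j z(1) by (simp_all add: star_hom_def vdiff_def)
    then show ?thesis using i(2)[of "vdiff Z (z m) (z n)"] z(1) by simp
  qed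
  have "cauchy_in A (\<lambda>n. j (z n))"
    unfolding cauchy_in_def
  proof (intro conjI allI impI)
    show "range (\<lambda>n. j (z n)) \<subseteq> carrier A" using jc by auto
    fix e :: real assume "e > 0"
    then obtain M where M: "inverse (real (Suc M)) < e/2" using reals_Archimedean half_gt_zero by blast
    have "nrm A (vdiff A (j (z m)) (j (z n))) < e" if "m \<ge> M" "n \<ge> M" for m n
    proof -
      have "inverse (real (Suc m)) \<le> inverse (real (Suc M))" "inverse (real (Suc n)) \<le> inverse (real (Suc M))"
        using that by auto
      then show ?thesis
        using C.dist_tri[OF ic c ic, of m n] C.dist_sym[OF c ic, of n] z(2)[of m] z(2)[of n] M
        unfolding eq by linarith
    qed
    then show "\<exists>N. \<forall>m\<ge>N. \<forall>n\<ge>N. nrm A (vdiff A (j (z m)) (j (z n))) < e" by blast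
  qed
  then obtain a where a: "a \<in> carrier A" "(\<lambda>n. nrm A (vdiff A (j (z n)) a)) \<longlonglongrightarrow> 0"
    using complete unfolding converges_def by blast
  have "\<exists>z\<in>carrier Z. nrm C (vdiff C (i z) c) < e \<and> nrm A (vdiff A (j z) a) < e" if e: "e > 0" for e
  proof -
    obtain N where N: "\<forall>n\<ge>N. norm (nrm A (vdiff A (j (z n)) a) - 0) < e" using LIMSEQ_D[OF a(2) e] by blast
    obtain M where M: "inverse (real (Suc M)) < e" using reals_Archimedean e by blast
    have "inverse (real (Suc (max N M))) \<le> inverse (real (Suc M))" by auto
    then have "nrm C (vdiff C (i (z (max N M))) c) < e" using z(2)[of "max N M"] M by linarith
    moreover have "nrm A (vdiff A (j (z (max N M))) a) < e" using N[rule_format, of "max N M"] by simp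
    ultimately show ?thesis using z(1) by blast
  qed
  then show ?thesis using a(1) by blast
qed

context dense_pair
begin

lemma rel_total: "a \<in> carrier A \<Longrightarrow> \<exists>b. rel a b"
  using B.limit_of_dense[OF i nrm_eq j Z.star_nalg_axioms A.star_nalg_axioms _ i_dense] unfolding rel_def by blast

lemma rel_surj: "b \<in> carrier B \<Longrightarrow> \<exists>a. rel a b"
  using A.limit_of_dense[OF j nrm_eq[symmetric] i Z.star_nalg_axioms B.star_nalg_axioms _ j_dense] unfolding rel_def by meson

lemma rel_unique: "rel a b \<Longrightarrow> rel a b' \<Longrightarrow> b = b'"
  using rel_dist[of a b a b'] A.dist_self relD B.hausdorff by metis

lemma rel_inj: "rel a b \<Longrightarrow> rel a' b \<Longrightarrow> a = a'"
  using rel_dist[of a b a' b] B.dist_self relD A.hausdorff by metis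

lemma rel_closed:
  assumes "a \<in> carrier A" "b \<in> carrier B" "\<And>e. e > 0 \<Longrightarrow> \<exists>z\<in>carrier Z. nrm A (vdiff A (i z) a) < e \<and> nrm B (vdiff B (j z) b) < e"
  shows "rel a b"
  using assms by (auto simp: rel_def)

lemma rel_add: assumes "rel a b" "rel a' b'" shows "rel (vadd A a a') (vadd B b b')"
proof (rule rel_closed)
  note c = relD[OF assms(1)] relD[OF assms(2)]
  show "vadd A a a' \<in> carrier A" "vadd B b b' \<in> carrier B" using c by auto
  fix e :: real assume "e > 0" then have "e/2 > 0" by simp
  then obtain z w where z: "z \<in> carrier Z" "nrm A (vdiff A (i z) a) < e/2" "nrm B (vdiff B (j z) b) < e/2"
    and w: "w \<in> carrier Z" "nrm A (vdiff A (i w) a') < e/2" "nrm B (vdiff B (j w) b') < e/2"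
    using assms unfolding rel_def by meson
  have "i (vadd Z z w) = vadd A (i z) (i w)" "j (vadd Z z w) = vadd B (j z) (j w)"
    using i j z w by (simp_all add: star_hom_def)
  then show "\<exists>z\<in>carrier Z. nrm A (vdiff A (i z) (vadd A a a')) < e \<and> nrm B (vdiff B (j z) (vadd B b b')) < e"
    using A.dist_add[OF ij_in(1)[OF z(1)] ij_in(1)[OF w(1)] c(1,3)]
      B.dist_add[OF ij_in(2)[OF z(1)] ij_in(2)[OF w(1)] c(2,4)] z w
    by (intro bexI[of _ "vadd Z z w"]) auto
qed

lemma rel_scal: assumes "rel a b" shows "rel (scal A k a) (scal B k b)"
proof (rule rel_closed)
  note c = relD[OF assms(1)]
  show "scal A k a \<in> carrier A" "scal B k b \<in> carrier B" using c by auto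
  fix e :: real assume e: "e > 0"
  have k: "cmod k + 1 > 0" by (simp add: add_nonneg_pos)
  then have "e / (cmod k + 1) > 0" using e by simp
  then obtain z where z: "z \<in> carrier Z" "nrm A (vdiff A (i z) a) < e / (cmod k + 1)" "nrm B (vdiff B (j z) b) < e / (cmod k + 1)"
    using assms unfolding rel_def by meson
  have eq: "i (scal Z k z) = scal A k (i z)" "j (scal Z k z) = scal B k (j z)"
    using i j z by (simp_all add: star_hom_def)
  have le: "cmod k * x < e" if "0 \<le> x" "x < e / (cmod k + 1)" for x
  proof -
    have "x * (cmod k + 1) < e" using that k by (simp add: pos_less_divide_eq)
    then show ?thesis using that by (simp add: algebra_simps)
  qed
  show "\<exists>z\<in>carrier Z. nrm A (vdiff A (i z) (scal A k a)) < e \<and> nrm B (vdiff B (j z) (scal B k b)) < e"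
    using z c by (intro bexI[of _ "scal Z k z"])
      (auto simp: eq A.dist_scal B.dist_scal ij_in intro!: le)
qed

lemma rel_star: assumes "rel a b" shows "rel (star A a) (star B b)"
proof (rule rel_closed)
  note c = relD[OF assms(1)]
  show "star A a \<in> carrier A" "star B b \<in> carrier B" using c by auto
  fix e :: real assume e: "e > 0"
  then obtain z where z: "z \<in> carrier Z" "nrm A (vdiff A (i z) a) < e" "nrm B (vdiff B (j z) b) < e"
    using assms unfolding rel_def by meson
  have eq: "i (star Z z) = star A (i z)" "j (star Z z) = star B (j z)"
    using i j z by (simp_all add: star_hom_def)
  show "\<exists>z\<in>carrier Z. nrm A (vdiff A (i z) (star A a)) < e \<and> nrm B (vdiff B (j z) (star B b)) < e"
    using z c by (intro bexI[of _ "star Z z"]) (auto simp: eq A.dist_star B.dist_star ij_in)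
qed

lemma rel_mul: assumes "rel a b" "rel a' b'" shows "rel (vmul A a a') (vmul B b b')"
proof (rule rel_closed)
  note c = relD[OF assms(1)] relD[OF assms(2)]
  show "vmul A a a' \<in> carrier A" "vmul B b b' \<in> carrier B" using c by auto
  fix e :: real assume e: "e > 0"
  \<comment> \<open>\<open>dist_mul\<close> leaves one original factor and one approximating factor.
    The summand 1 in K covers the approximating one, which is within d \<le> 1 of its limit. Then d
    \<le> e/(2K) makes each of the two error terms less than e/2.\<close>
  define K where "K = nrm A a + nrm A a' + nrm B b + nrm B b' + 1"
  have K: "K > 0" "nrm A a \<le> K" "nrm A a' + 1 \<le> K" "nrm B b \<le> K" "nrm B b' + 1 \<le> K"
    using c A.nrm_nonneg B.nrm_nonneg unfolding K_def by (smt (verit))+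
  define d where "d = min 1 (e / (2 * K))"
  have d: "d > 0" "d \<le> 1" "d \<le> e / (2*K)" using K e by (auto simp: d_def)
  have dK: "d * K \<le> e/2" using d(3) K by (simp add: field_simps)
  obtain z w where z: "z \<in> carrier Z" "nrm A (vdiff A (i z) a) < d" "nrm B (vdiff B (j z) b) < d"
    and w: "w \<in> carrier Z" "nrm A (vdiff A (i w) a') < d" "nrm B (vdiff B (j w) b') < d"
    using assms d(1) unfolding rel_def by meson
  have eq: "i (vmul Z z w) = vmul A (i z) (i w)" "j (vmul Z z w) = vmul B (j z) (j w)"
    using i j z w by (simp_all add: star_hom_def)
  have key: "x * p + q * y < e" if "0 \<le> x" "x < d" "0 \<le> y" "y < d" "p \<le> K" "0 \<le> q" "q \<le> K" for x y p q :: real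
  proof -
    have "x * p \<le> x * K" "q * y \<le> K * y" using that by (simp_all add: mult_left_mono mult_right_mono)
    moreover have "x * K < d * K" "K * y < K * d" using that K by simp_all
    ultimately show ?thesis using dK by (simp add: mult.commute)
  qed
  have "nrm A (i w) \<le> K" using A.nrm_diff[of "i w" a'] w ij_in c K d by simp
  then have 1: "nrm A (vdiff A (vmul A (i z) (i w)) (vmul A a a')) < e"
    using A.dist_mul[of "i z" "i w" a a'] ij_in z w c K
      key[of "nrm A (vdiff A (i z) a)" "nrm A (vdiff A (i w) a')" "nrm A (i w)" "nrm A a"] by fastforce
  have "nrm B (j w) \<le> K" using B.nrm_diff[of "j w" b'] w ij_in c K d by simp
  then have 2: "nrm B (vdiff B (vmul B (j z) (j w)) (vmul B b b')) < e"
    using B.dist_mul[of "j z" "j w" b b'] ij_in z w c K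
      key[of "nrm B (vdiff B (j z) b)" "nrm B (vdiff B (j w) b')" "nrm B (j w)" "nrm B b"] by fastforce
  show "\<exists>z\<in>carrier Z. nrm A (vdiff A (i z) (vmul A a a')) < e \<and> nrm B (vdiff B (j z) (vmul B b b')) < e"
    using 1 2 z w by (intro bexI[of _ "vmul Z z w"]) (auto simp: eq)
qed

text \<open>A norm is the distance to zero, and zero, written \<open>scal A 0 a\<close>, is related
  to zero by \<open>rel_scal\<close>; so this is a case of \<open>rel_dist\<close>.\<close>

lemma rel_nrm: assumes "rel a b" shows "nrm A a = nrm B b"
proof -
  have c: "a \<in> carrier A" "b \<in> carrier B" using relD[OF assms] by auto
  have "nrm A (vdiff A a (scal A 0 a)) = nrm B (vdiff B b (scal B 0 b))"
    by (rule rel_dist[OF assms rel_scal[OF assms]])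
  moreover have "vdiff A a (scal A 0 a) = a" "vdiff B b (scal B 0 b) = b"
    using c by (simp_all add: vdiff_def A.scal_scal A.add_zero B.scal_scal B.add_zero)
  ultimately show ?thesis by simp
qed

theorem canonical_surjection_exists:
  "\<exists>\<Phi>. canonical_surjection (carrier Z) i A j B \<Phi>"
proof -
  obtain \<Phi> where P: "\<And>a. a \<in> carrier A \<Longrightarrow> rel a (\<Phi> a)" using rel_total by metis
  have eq: "rel a b \<Longrightarrow> \<Phi> a = b" for a b using P rel_unique relD by blast
  have "star_hom A B \<Phi>"
    unfolding star_hom_def
  proof (intro conjI ballI allI)
    fix a assume a: "a \<in> carrier A"
    show "\<Phi> a \<in> carrier B" by (rule relD(2)[OF P[OF a]])
    show "\<Phi> (star A a) = star B (\<Phi> a)" by (rule eq[OF rel_star[OF P[OF a]]])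
    show "\<Phi> (scal A c a) = scal B c (\<Phi> a)" for c by (rule eq[OF rel_scal[OF P[OF a]]])
    fix b assume b: "b \<in> carrier A"
    show "\<Phi> (vadd A a b) = vadd B (\<Phi> a) (\<Phi> b)" by (rule eq[OF rel_add[OF P[OF a] P[OF b]]])
    show "\<Phi> (vmul A a b) = vmul B (\<Phi> a) (\<Phi> b)" by (rule eq[OF rel_mul[OF P[OF a] P[OF b]]])
  qed
  moreover have "\<Phi> ` carrier A = carrier B"
  proof
    show "\<Phi> ` carrier A \<subseteq> carrier B" using P relD(2) by blast
    show "carrier B \<subseteq> \<Phi> ` carrier A"
    proof
      fix b assume "b \<in> carrier B"
      then obtain a where a: "rel a b" using rel_surj by blast
      then show "b \<in> \<Phi> ` carrier A" using eq[OF a] relD(1)[OF a] by blast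
    qed
  qed
  ultimately show ?thesis
    unfolding canonical_surjection_def using rel_nrm[OF P] eq[OF rel_ij] by (intro exI[of _ \<Phi>]) auto
qed

text \<open>A canonical surjection is contractive and sends \<open>i z\<close> to
  \<open>j z\<close>, so approximating a by \<open>i z\<close> places the pair of a and its image in
  \<open>rel\<close>. Relations of that kind preserve norms and determine a from its image.\<close>

theorem canonical_surjection_iso:
  assumes \<Phi>: "canonical_surjection (carrier Z) i A j B \<Phi>"
  shows "star_iso A B \<Phi>"
proof -
  have hom: "star_hom A B \<Phi>" and surj: "\<Phi> ` carrier A = carrier B"
    and le: "\<And>a. a \<in> carrier A \<Longrightarrow> nrm B (\<Phi> a) \<le> nrm A a" and ij: "\<And>z. z \<in> carrier Z \<Longrightarrow> \<Phi> (i z) = j z"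
    using \<Phi> by (auto simp: canonical_surjection_def)
  have vd: "\<Phi> (vdiff A a b) = vdiff B (\<Phi> a) (\<Phi> b)" if "a \<in> carrier A" "b \<in> carrier A" for a b
    using hom that by (simp add: star_hom_def vdiff_def)
  have rel: "rel a (\<Phi> a)" if a: "a \<in> carrier A" for a
  proof (rule rel_closed)
    show "a \<in> carrier A" "\<Phi> a \<in> carrier B" using a hom by (auto simp: star_hom_def)
    fix e :: real assume "e > 0"
    then obtain z where z: "z \<in> carrier Z" "nrm A (vdiff A (i z) a) < e" using i_dense a by blast
    moreover have "nrm B (vdiff B (j z) (\<Phi> a)) \<le> nrm A (vdiff A (i z) a)"
      using le[of "vdiff A (i z) a"] vd[of "i z" a] ij z a ij_in by simp
    ultimately show "\<exists>z\<in>carrier Z. nrm A (vdiff A (i z) a) < e \<and> nrm B (vdiff B (j z) (\<Phi> a)) < e"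
      by (intro bexI[of _ z]) auto
  qed
  have "inj_on \<Phi> (carrier A)" using rel rel_inj by (metis inj_onI)
  then show ?thesis
    unfolding star_iso_def bij_betw_def using hom surj rel_nrm[OF rel] by auto
qed

end

text \<open>The closure of the image of \<open>Z\<close> in a complete algebra. The corner cut out
  by p will be recognised as such a closure, which makes it complete and gives it a dense copy of
  the Hecke algebra.\<close>

locale closed_image = B: banach_star B + Z: star_nalg Z
  for B :: "'y star_alg" and Z :: "'z star_alg" +
  fixes j :: "'z \<Rightarrow> 'y"
  assumes j: "star_hom Z B j"
begin

definition cl :: "'y set" where
  "cl = {b \<in> carrier B. \<forall>e>0. \<exists>z\<in>carrier Z. nrm B (vdiff B (j z) b) < e}"

lemma j_in: "z \<in> carrier Z \<Longrightarrow> j z \<in> carrier B"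
  using j by (auto simp: star_hom_def)

text \<open>Points of \<open>cl\<close> are limits of sequences from the image of \<open>j\<close>,
  the operations are continuous along such sequences, and a closed subset inherits
  completeness.\<close>

lemma banach_star_cl: "banach_star (B\<lparr>carrier := cl\<rparr>)"
proof -
  let ?C = "B\<lparr>carrier := cl\<rparr>"
  have sub: "b \<in> carrier B" if "b \<in> cl" for b using that by (simp add: cl_def)
  have clI: "b \<in> cl" if b1: "b \<in> carrier B" and b2: "\<And>e. e > 0 \<Longrightarrow> \<exists>c\<in>cl. nrm B (vdiff B c b) < e" for b
    unfolding cl_def
  proof (intro CollectI conjI allI impI b1)
    fix e :: real assume "e > 0"
    then have e2: "e/2 > 0" by simp
    then obtain c where c: "c \<in> cl" "nrm B (vdiff B c b) < e/2" using b2 by blast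
    then obtain z where z: "z \<in> carrier Z" "nrm B (vdiff B (j z) c) < e/2" using e2 unfolding cl_def by blast
    then show "\<exists>z\<in>carrier Z. nrm B (vdiff B (j z) b) < e"
      using B.dist_tri[OF j_in[OF z(1)] sub[OF c(1)] b1] c by (intro bexI[of _ z]) auto
  qed
  have jz: "j z \<in> cl" if "z \<in> carrier Z" for z
    unfolding cl_def using that by (auto simp: j_in B.dist_self intro!: bexI[of _ z])
  have seq: "\<exists>f. cauchy_in B f \<and> (\<forall>n. f n \<in> j ` carrier Z) \<and> converges B f b" if "b \<in> cl" for b
  proof -
    have "\<forall>n. \<exists>z. z \<in> carrier Z \<and> nrm B (vdiff B (j z) b) < inverse (real (Suc n))"
      using that unfolding cl_def by (simp add: Bex_def)
    then obtain z where z: "\<And>n. z n \<in> carrier Z" "\<And>n. nrm B (vdiff B (j (z n)) b) < inverse (real (Suc n))"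
      by metis
    have jc: "j (z n) \<in> carrier B" for n using z j_in by auto
    have t: "converges B (\<lambda>n. j (z n)) b"
      unfolding converges_def
      by (rule B.null_dist_le[OF _ _ LIMSEQ_inverse_real_of_nat]) (use z jc sub that in \<open>auto intro: less_imp_le\<close>)
    have "cauchy_in B (\<lambda>n. j (z n))"
      unfolding cauchy_in_def
    proof (intro conjI allI impI)
      show "range (\<lambda>n. j (z n)) \<subseteq> carrier B" using jc by auto
      fix e :: real assume "e > 0" then have "e/2 > 0" by simp
      then obtain N where N: "\<forall>n\<ge>N. norm (nrm B (vdiff B (j (z n)) b) - 0) < e/2"
        using LIMSEQ_D[OF t[unfolded converges_def]] by blast
      have "nrm B (vdiff B (j (z m)) (j (z n))) < e" if "m \<ge> N" "n \<ge> N" for m n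
        using N[rule_format, OF that(1)] N[rule_format, OF that(2)]
          B.dist_tri[OF jc sub[OF \<open>b \<in> cl\<close>] jc, of m n] B.dist_sym[OF sub[OF \<open>b \<in> cl\<close>] jc, of n] by simp
      then show "\<exists>N. \<forall>m\<ge>N. \<forall>n\<ge>N. nrm B (vdiff B (j (z m)) (j (z n))) < e" by blast
    qed
    then show ?thesis using t z by auto
  qed
  have lim_in: "b \<in> cl" if b1: "b \<in> carrier B" and b2: "\<And>n. f n \<in> cl" and b3: "(\<lambda>n. nrm B (vdiff B (f n) b)) \<longlonglongrightarrow> 0" for f b
  proof (rule clI[OF b1])
    fix e :: real assume "e > 0"
    then obtain N where "\<forall>n\<ge>N. norm (nrm B (vdiff B (f n) b) - 0) < e" using LIMSEQ_D[OF b3] by blast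
    then have "nrm B (vdiff B (f N) b) < e" by auto
    then show "\<exists>c\<in>cl. nrm B (vdiff B c b) < e" using b2 by blast
  qed
  have nulc: "B.null_dist f (\<lambda>_. b) \<longleftrightarrow> converges B f b" for f b by (simp add: B.null_dist_def converges_def)
  have cadd: "vadd B a b \<in> cl" if ab: "a \<in> cl" "b \<in> cl" for a b
  proof -
    obtain f g where f: "cauchy_in B f" "\<And>n. f n \<in> j ` carrier Z" "converges B f a"
      and g: "cauchy_in B g" "\<And>n. g n \<in> j ` carrier Z" "converges B g b" using seq ab by meson
    have n: "B.null_dist (\<lambda>n. vadd B (f n) (g n)) (\<lambda>_. vadd B a b)"
      using B.null_dist_add[OF f(1) B.cauchy_const g(1) B.cauchy_const] f g sub ab nulc by blast
    have m: "vadd B (f n) (g n) \<in> cl" for n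
      using f(2)[of n] g(2)[of n] jz j by (auto simp: star_hom_def) (metis Z.add_in)
    have "vadd B a b \<in> carrier B" using sub ab by simp
    then show ?thesis by (rule lim_in[OF _ m n[unfolded B.null_dist_def]])
  qed
  have cmul: "vmul B a b \<in> cl" if ab: "a \<in> cl" "b \<in> cl" for a b
  proof -
    obtain f g where f: "cauchy_in B f" "\<And>n. f n \<in> j ` carrier Z" "converges B f a"
      and g: "cauchy_in B g" "\<And>n. g n \<in> j ` carrier Z" "converges B g b" using seq ab by meson
    have n: "B.null_dist (\<lambda>n. vmul B (f n) (g n)) (\<lambda>_. vmul B a b)"
      using B.null_dist_mul[OF f(1) B.cauchy_const g(1) B.cauchy_const] f g sub ab nulc by blast
    have m: "vmul B (f n) (g n) \<in> cl" for n
      using f(2)[of n] g(2)[of n] jz j by (auto simp: star_hom_def) (metis Z.mul_in)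
    have "vmul B a b \<in> carrier B" using sub ab by simp
    then show ?thesis by (rule lim_in[OF _ m n[unfolded B.null_dist_def]])
  qed
  have cscal: "scal B k a \<in> cl" if ab: "a \<in> cl" for a k
  proof -
    obtain f where f: "cauchy_in B f" "\<And>n. f n \<in> j ` carrier Z" "converges B f a" using seq ab by meson
    have n: "B.null_dist (\<lambda>n. scal B k (f n)) (\<lambda>_. scal B k a)"
      using B.null_dist_scal[OF f(1) B.cauchy_const] f sub ab nulc by blast
    have m: "scal B k (f n) \<in> cl" for n
      using f(2)[of n] jz j by (auto simp: star_hom_def) (metis Z.scal_in)
    have "scal B k a \<in> carrier B" using sub ab by simp
    then show ?thesis by (rule lim_in[OF _ m n[unfolded B.null_dist_def]])
  qed
  have cstar: "star B a \<in> cl" if ab: "a \<in> cl" for a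
  proof -
    obtain f where f: "cauchy_in B f" "\<And>n. f n \<in> j ` carrier Z" "converges B f a" using seq ab by meson
    have n: "B.null_dist (\<lambda>n. star B (f n)) (\<lambda>_. star B a)"
      using B.null_dist_star[OF f(1) B.cauchy_const] f sub ab nulc by blast
    have m: "star B (f n) \<in> cl" for n
      using f(2)[of n] jz j by (auto simp: star_hom_def) (metis Z.star_in)
    have "star B a \<in> carrier B" using sub ab by simp
    then show ?thesis by (rule lim_in[OF _ m n[unfolded B.null_dist_def]])
  qed
  have ne: "cl \<noteq> {}" using jz Z.carrier_ne by blast
  interpret C: star_nalg ?C
    by (unfold_locales;
      ((simp add: ne cadd cmul cscal cstar sub B.add_assoc B.add_zero B.scal_add B.add_scal B.scal_scal
        B.scal_one B.mul_add_left B.mul_add_right B.mul_scal_left B.mul_scal_right B.star_add B.star_scal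
        B.star_star B.nrm_add B.nrm_scal B.nrm_mul B.nrm_star; fail) |
       (simp add: sub B.add_comm; fail)))
  have vd: "vdiff ?C = vdiff B" by (simp add: vdiff_def[abs_def])
  show ?thesis
  proof
    fix a b assume "a \<in> carrier ?C" "b \<in> carrier ?C" "nrm ?C (vdiff ?C a b) = 0"
    then show "a = b" using B.hausdorff sub by (simp add: vd)
  next
    fix s assume s: "cauchy_in ?C s"
    have sc: "s n \<in> cl" for n using C.cauchy_in_carrier[OF s] by simp
    have "cauchy_in B s" using s sc sub by (auto simp: cauchy_in_def vd)
    then obtain a where a: "a \<in> carrier B" "converges B s a" using B.complete by blast
    then have "a \<in> cl" using lim_in[OF a(1) sc] by (simp add: converges_def)
    then show "\<exists>a\<in>carrier ?C. converges ?C s a" using a by (auto simp: converges_def vd)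
  qed
qed

end

section \<open>Infinite matrices as operators\<close>

text \<open>\<open>mbound k C\<close>: the infinite matrix \<open>k\<close> has operator norm at most \<open>C\<close> on \<open>\<ell>\<^sup>2\<close>.\<close>

definition mbound :: "('s \<Rightarrow> 's \<Rightarrow> complex) \<Rightarrow> real \<Rightarrow> bool" where
  "mbound k C \<longleftrightarrow> 0 \<le> C \<and> (\<forall>F F' \<xi>. finite F \<longrightarrow> finite F' \<longrightarrow>
     L2_set (\<lambda>s. cmod (\<Sum>t\<in>F'. k s t * \<xi> t)) F \<le> C * L2_set (\<lambda>t. cmod (\<xi> t)) F')"

definition mnorm :: "('s \<Rightarrow> 's \<Rightarrow> complex) \<Rightarrow> real" where
  "mnorm k = Inf {C. mbound k C}"

lemma mboundD: "mbound k C \<Longrightarrow> finite F \<Longrightarrow> finite F' \<Longrightarrow>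
    L2_set (\<lambda>s. cmod (\<Sum>t\<in>F'. k s t * \<xi> t)) F \<le> C * L2_set (\<lambda>t. cmod (\<xi> t)) F'"
  by (simp add: mbound_def)

lemma mnorm_le: "mbound k C \<Longrightarrow> mnorm k \<le> C"
  unfolding mnorm_def by (rule cInf_lower) (auto simp: mbound_def intro: bdd_belowI[of _ 0])

lemma mnorm_nonneg: "mbound k C \<Longrightarrow> 0 \<le> mnorm k"
  unfolding mnorm_def by (rule cInf_greatest) (auto simp: mbound_def)

text \<open>The infimum is attained: after division by the norm of \<xi>, each defining inequality
  says that a fixed number is a lower bound of the admissible constants.\<close>

lemma mbound_mnorm:
  assumes "mbound k C" shows "mbound k (mnorm k)"
  unfolding mbound_def
proof (intro conjI allI impI)
  show "0 \<le> mnorm k" by (rule mnorm_nonneg[OF assms])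
  fix F F' :: "'a set" and \<xi> :: "'a \<Rightarrow> complex" assume F: "finite F" "finite F'"
  let ?L = "L2_set (\<lambda>s. cmod (\<Sum>t\<in>F'. k s t * \<xi> t)) F" and ?x = "L2_set (\<lambda>t. cmod (\<xi> t)) F'"
  show "?L \<le> mnorm k * ?x"
  proof (cases "?x = 0")
    case True then show ?thesis using mboundD[OF assms F, of \<xi>] by simp
  next
    case False
    then have x: "?x > 0" by (simp add: less_le)
    have "?L / ?x \<le> mnorm k"
      unfolding mnorm_def
    proof (rule cInf_greatest)
      show "{C. mbound k C} \<noteq> {}" using assms by auto
      fix D assume "D \<in> {C. mbound k C}"
      then show "?L / ?x \<le> D" using mboundD[OF _ F, of k D \<xi>] x by (simp add: pos_divide_le_eq)
    qed
    then show ?thesis using x by (simp add: pos_divide_le_eq)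
  qed
qed

lemma mbound_add:
  assumes k: "mbound k C" and h: "mbound h D" shows "mbound (\<lambda>s t. k s t + h s t) (C + D)"
  unfolding mbound_def
proof (intro conjI allI impI)
  show "0 \<le> C + D" using k h by (simp add: mbound_def)
  fix F F' :: "'a set" and \<xi> :: "'a \<Rightarrow> complex" assume F: "finite F" "finite F'"
  have "L2_set (\<lambda>s. cmod (\<Sum>t\<in>F'. (k s t + h s t) * \<xi> t)) F
     \<le> L2_set (\<lambda>s. cmod (\<Sum>t\<in>F'. k s t * \<xi> t) + cmod (\<Sum>t\<in>F'. h s t * \<xi> t)) F"
    by (rule L2_set_mono) (auto simp: distrib_right sum.distrib norm_triangle_ineq)
  also have "\<dots> \<le> L2_set (\<lambda>s. cmod (\<Sum>t\<in>F'. k s t * \<xi> t)) F + L2_set (\<lambda>s. cmod (\<Sum>t\<in>F'. h s t * \<xi> t)) F"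
    by (rule L2_set_triangle_ineq)
  also have "\<dots> \<le> (C + D) * L2_set (\<lambda>t. cmod (\<xi> t)) F'"
    using mboundD[OF k F, of \<xi>] mboundD[OF h F, of \<xi>] by (simp add: distrib_right)
  finally show "L2_set (\<lambda>s. cmod (\<Sum>t\<in>F'. (k s t + h s t) * \<xi> t)) F \<le> (C + D) * L2_set (\<lambda>t. cmod (\<xi> t)) F'" .
qed

lemma mbound_scal:
  assumes k: "mbound k C" shows "mbound (\<lambda>s t. c * k s t) (cmod c * C)"
  unfolding mbound_def
proof (intro conjI allI impI)
  show "0 \<le> cmod c * C" using k by (simp add: mbound_def)
  fix F F' :: "'a set" and \<xi> :: "'a \<Rightarrow> complex" assume F: "finite F" "finite F'"
  have "L2_set (\<lambda>s. cmod (\<Sum>t\<in>F'. c * k s t * \<xi> t)) F = L2_set (\<lambda>s. cmod c * cmod (\<Sum>t\<in>F'. k s t * \<xi> t)) F"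
    by (simp add: mult.assoc norm_mult flip: sum_distrib_left)
  also have "\<dots> = cmod c * L2_set (\<lambda>s. cmod (\<Sum>t\<in>F'. k s t * \<xi> t)) F" by (simp add: L2_set_right_distrib)
  also have "\<dots> \<le> cmod c * C * L2_set (\<lambda>t. cmod (\<xi> t)) F'"
    using mboundD[OF k F, of \<xi>] by (simp add: mult.assoc mult_left_mono)
  finally show "L2_set (\<lambda>s. cmod (\<Sum>t\<in>F'. c * k s t * \<xi> t)) F \<le> cmod c * C * L2_set (\<lambda>t. cmod (\<xi> t)) F'" .
qed

lemma mnorm_scal:
  assumes k: "mbound k C" shows "mnorm (\<lambda>s t. c * k s t) = cmod c * mnorm k"
proof (rule antisym)
  show le: "mnorm (\<lambda>s t. c * k s t) \<le> cmod c * mnorm k"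
    by (intro mnorm_le mbound_scal mbound_mnorm[OF k])
  show "cmod c * mnorm k \<le> mnorm (\<lambda>s t. c * k s t)"
  proof (cases "c = 0")
    case True then show ?thesis using mnorm_nonneg[OF mbound_scal[OF k, of c]] by simp
  next
    case False
    have "mbound (\<lambda>s t. inverse c * (c * k s t)) (cmod (inverse c) * mnorm (\<lambda>s t. c * k s t))"
      by (intro mbound_scal mbound_mnorm[OF mbound_scal[OF k]])
    moreover have "(\<lambda>s t. inverse c * (c * k s t)) = k" using False by (intro ext) (simp add: mult.assoc[symmetric])
    ultimately have "mnorm k \<le> cmod (inverse c) * mnorm (\<lambda>s t. c * k s t)" by (simp add: mnorm_le)
    then show ?thesis using False by (simp add: norm_divide field_simps)
  qed
qed

text \<open>Matrix product, summed over the column support of \<open>h\<close>; for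
  \<open>colfin\<close> matrices all sums are finite and no convergence question arises.\<close>

definition mprod :: "('s \<Rightarrow> 's \<Rightarrow> complex) \<Rightarrow> ('s \<Rightarrow> 's \<Rightarrow> complex) \<Rightarrow> 's \<Rightarrow> 's \<Rightarrow> complex" where
  "mprod k h s u = (\<Sum>t | h t u \<noteq> 0. k s t * h t u)"

definition colfin :: "('s \<Rightarrow> 's \<Rightarrow> complex) \<Rightarrow> bool" where
  "colfin h \<longleftrightarrow> (\<forall>u. finite {t. h t u \<noteq> 0})"

lemma mprod_sum:
  assumes "colfin h" "finite T" "\<And>t. h t u \<noteq> 0 \<Longrightarrow> t \<in> T"
  shows "mprod k h s u = (\<Sum>t\<in>T. k s t * h t u)"
  unfolding mprod_def using assms by (intro sum.mono_neutral_left) auto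

text \<open>\<open>h\<close> sends a vector supported in F to one supported in the finite set T, so
  applying the product is a finite exchange of sums.\<close>

lemma mprod_apply:
  assumes h: "colfin h" and F: "finite F" "T = (\<Union>u\<in>F. {t. h t u \<noteq> 0})"
  shows "(\<Sum>u\<in>F. mprod k h s u * \<xi> u) = (\<Sum>t\<in>T. k s t * (\<Sum>u\<in>F. h t u * \<xi> u))" "finite T"
proof -
  show T: "finite T" using h F by (simp add: colfin_def)
  have "(\<Sum>u\<in>F. mprod k h s u * \<xi> u) = (\<Sum>u\<in>F. \<Sum>t\<in>T. k s t * h t u * \<xi> u)"
  proof (intro sum.cong refl)
    fix u assume "u \<in> F"
    then have "mprod k h s u = (\<Sum>t\<in>T. k s t * h t u)" using F by (intro mprod_sum[OF h T]) auto
    then show "mprod k h s u * \<xi> u = (\<Sum>t\<in>T. k s t * h t u * \<xi> u)" by (simp add: sum_distrib_right)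
  qed
  also have "\<dots> = (\<Sum>t\<in>T. k s t * (\<Sum>u\<in>F. h t u * \<xi> u))"
    by (subst sum.swap) (simp add: sum_distrib_left mult.assoc)
  finally show "(\<Sum>u\<in>F. mprod k h s u * \<xi> u) = (\<Sum>t\<in>T. k s t * (\<Sum>u\<in>F. h t u * \<xi> u))" .
qed

lemma mbound_mprod:
  assumes k: "mbound k C" and h: "mbound h D" and c: "colfin h" shows "mbound (mprod k h) (C * D)"
  unfolding mbound_def
proof (intro conjI allI impI)
  show "0 \<le> C * D" using k h by (simp add: mbound_def)
  fix F F' :: "'a set" and \<xi> :: "'a \<Rightarrow> complex" assume F: "finite F" "finite F'"
  define T where "T = (\<Union>u\<in>F'. {t. h t u \<noteq> 0})"
  note A = mprod_apply[OF c F(2) T_def]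
  have "L2_set (\<lambda>s. cmod (\<Sum>u\<in>F'. mprod k h s u * \<xi> u)) F
    \<le> C * L2_set (\<lambda>t. cmod (\<Sum>u\<in>F'. h t u * \<xi> u)) T"
    unfolding A(1) by (rule mboundD[OF k F(1) A(2)])
  also have "\<dots> \<le> C * (D * L2_set (\<lambda>t. cmod (\<xi> t)) F')"
    using k by (intro mult_left_mono mboundD[OF h A(2) F(2)]) (simp add: mbound_def)
  finally show "L2_set (\<lambda>s. cmod (\<Sum>u\<in>F'. mprod k h s u * \<xi> u)) F \<le> C * D * L2_set (\<lambda>t. cmod (\<xi> t)) F'"
    by (simp add: mult.assoc)
qed

lemma cauchy_schwarz_sum:
  fixes f g :: "'s \<Rightarrow> complex"
  shows "cmod (\<Sum>s\<in>F. f s * g s) \<le> L2_set (\<lambda>s. cmod (f s)) F * L2_set (\<lambda>s. cmod (g s)) F"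
proof -
  have "cmod (\<Sum>s\<in>F. f s * g s) \<le> (\<Sum>s\<in>F. \<bar>cmod (f s)\<bar> * \<bar>cmod (g s)\<bar>)"
    by (rule order_trans[OF norm_sum]) (simp add: norm_mult)
  also have "\<dots> \<le> L2_set (\<lambda>s. cmod (f s)) F * L2_set (\<lambda>s. cmod (g s)) F" by (rule L2_set_mult_ineq)
  finally show ?thesis .
qed

lemma L2_set_sq: "(L2_set f F)\<^sup>2 = (\<Sum>s\<in>F. (f s)\<^sup>2)"
  by (simp add: L2_set_def sum_nonneg)

lemma cmod_sq_sum: "complex_of_real ((L2_set (\<lambda>s. cmod (y s)) F)\<^sup>2) = (\<Sum>s\<in>F. cnj (y s) * y s)"
  by (simp add: L2_set_sq complex_norm_square mult.commute del: of_real_power)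

text \<open>With y the adjoint applied to \<xi> and cut to F, the squared norm of y is the pairing
  of \<xi> with k y, hence at most C times both norms. One factor of the norm of y cancels.\<close>

lemma mbound_adj:
  assumes k: "mbound k C" shows "mbound (\<lambda>s t. cnj (k t s)) C"
  unfolding mbound_def
proof (intro conjI allI impI)
  show C: "0 \<le> C" using k by (simp add: mbound_def)
  fix F F' :: "'a set" and \<xi> :: "'a \<Rightarrow> complex" assume F: "finite F" "finite F'"
  define y where "y s = (\<Sum>t\<in>F'. cnj (k t s) * \<xi> t)" for s
  let ?Y = "L2_set (\<lambda>s. cmod (y s)) F" and ?X = "L2_set (\<lambda>t. cmod (\<xi> t)) F'"
  have "complex_of_real (?Y\<^sup>2) = (\<Sum>s\<in>F. cnj (y s) * (\<Sum>t\<in>F'. cnj (k t s) * \<xi> t))"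
    by (simp add: cmod_sq_sum y_def[symmetric] del: of_real_power)
  also have "\<dots> = (\<Sum>t\<in>F'. \<xi> t * cnj (\<Sum>s\<in>F. k t s * y s))"
    unfolding sum_distrib_left cnj_sum by (subst sum.swap) (simp add: ac_simps)
  finally have "?Y\<^sup>2 = cmod (\<Sum>t\<in>F'. \<xi> t * cnj (\<Sum>s\<in>F. k t s * y s))"
    by (metis norm_of_real abs_power2)
  also have "\<dots> \<le> ?X * L2_set (\<lambda>t. cmod (\<Sum>s\<in>F. k t s * y s)) F'"
    using cauchy_schwarz_sum[of \<xi> "\<lambda>t. cnj (\<Sum>s\<in>F. k t s * y s)" F'] by (simp only: complex_mod_cnj)
  also have "\<dots> \<le> ?X * (C * ?Y)" by (intro mult_left_mono mboundD[OF k F(2,1)]) simp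
  finally have "?Y * ?Y \<le> (C * ?X) * ?Y" by (simp add: power2_eq_square ac_simps)
  then have "?Y \<le> C * ?X" using C by (cases "?Y = 0") (auto simp: less_le)
  then show "L2_set (\<lambda>s. cmod (\<Sum>t\<in>F'. cnj (k t s) * \<xi> t)) F \<le> C * L2_set (\<lambda>t. cmod (\<xi> t)) F'"
    by (simp add: y_def)
qed

text \<open>The hard half of the C*-identity: the squared norm of k \<xi> is the pairing of \<xi>
  with the matrix \<open>mprod (\<lambda>s t. cnj (k t s)) k\<close> applied to \<xi>. Finite
  columns place all of k \<xi> in the finite set T, so this pairing is exact rather than
  truncated.\<close>

lemma mbound_cstar:
  assumes k: "colfin k" and D: "mbound (mprod (\<lambda>s t. cnj (k t s)) k) D" shows "mbound k (sqrt D)"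
  unfolding mbound_def
proof (intro conjI allI impI)
  have D0: "0 \<le> D" using D by (simp add: mbound_def)
  show "0 \<le> sqrt D" using D0 by simp
  fix F F' :: "'a set" and \<xi> :: "'a \<Rightarrow> complex" assume F: "finite F" "finite F'"
  define T where "T = (\<Union>u\<in>F'. {t. k t u \<noteq> 0})"
  note A = mprod_apply[OF k F(2) T_def]
  define y where "y s = (\<Sum>t\<in>F'. k s t * \<xi> t)" for s
  let ?Y = "L2_set (\<lambda>s. cmod (y s)) T" and ?X = "L2_set (\<lambda>t. cmod (\<xi> t)) F'"
  have y0: "y s = 0" if "s \<notin> T" for s using that by (auto simp: y_def T_def intro!: sum.neutral)
  have "complex_of_real (?Y\<^sup>2) = (\<Sum>s\<in>T. cnj (\<Sum>t\<in>F'. k s t * \<xi> t) * y s)"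
    by (simp add: cmod_sq_sum y_def[symmetric] del: of_real_power)
  also have "\<dots> = (\<Sum>t\<in>F'. cnj (\<xi> t) * (\<Sum>s\<in>T. cnj (k s t) * y s))"
    unfolding sum_distrib_left sum_distrib_right cnj_sum by (subst sum.swap) (simp add: ac_simps)
  also have "\<dots> = (\<Sum>t\<in>F'. cnj (\<xi> t) * (\<Sum>u\<in>F'. mprod (\<lambda>s t. cnj (k t s)) k t u * \<xi> u))"
    by (simp add: A(1) y_def)
  finally have "?Y\<^sup>2 = cmod (\<Sum>t\<in>F'. cnj (\<xi> t) * (\<Sum>u\<in>F'. mprod (\<lambda>s t. cnj (k t s)) k t u * \<xi> u))"
    by (metis norm_of_real abs_power2)
  also have "\<dots> \<le> ?X * L2_set (\<lambda>t. cmod (\<Sum>u\<in>F'. mprod (\<lambda>s t. cnj (k t s)) k t u * \<xi> u)) F'"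
    using cauchy_schwarz_sum[of "\<lambda>t. cnj (\<xi> t)" _ F'] by (simp only: complex_mod_cnj)
  also have "\<dots> \<le> ?X * (D * ?X)" by (intro mult_left_mono mboundD[OF D F(2,2)]) simp
  also have "\<dots> = (sqrt D * ?X)\<^sup>2" using D0 by (simp add: power2_eq_square ac_simps)
  finally have Y: "?Y \<le> sqrt D * ?X" by (rule power2_le_imp_le) (simp add: D0)
  \<comment> \<open>F is arbitrary, but y vanishes off T, so its norm over F is at most its norm
    over T.\<close>
  have "L2_set (\<lambda>s. cmod (y s)) F \<le> ?Y"
  proof (rule power2_le_imp_le)
    have "(\<Sum>s\<in>F. (cmod (y s))\<^sup>2) = (\<Sum>s\<in>F \<inter> T. (cmod (y s))\<^sup>2)"
      using F y0 by (intro sum.mono_neutral_right) auto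
    also have "\<dots> \<le> (\<Sum>s\<in>T. (cmod (y s))\<^sup>2)" using A(2) by (intro sum_mono2) auto
    finally show "(L2_set (\<lambda>s. cmod (y s)) F)\<^sup>2 \<le> ?Y\<^sup>2" by (simp add: L2_set_sq)
  qed simp
  then show "L2_set (\<lambda>s. cmod (\<Sum>t\<in>F'. k s t * \<xi> t)) F \<le> sqrt D * ?X" using Y by (simp add: y_def)
qed

text \<open>Cauchy-Schwarz on the rows with a positive weight q, followed by the column bound after
  exchanging the sums. The weight is constant for \<open>mat\<close>; for \<open>ker\<close> it is
  the square root of \<open>w\<close>, which compensates the different sizes of right
  cosets.\<close>

lemma schur_test:
  fixes k :: "'s \<Rightarrow> 's \<Rightarrow> complex"
  assumes C: "0 \<le> C" and q: "\<And>s. 0 < q s"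
    and row: "\<And>s F. finite F \<Longrightarrow> (\<Sum>t\<in>F. cmod (k s t) * q t) \<le> C * q s"
    and col: "\<And>t F. finite F \<Longrightarrow> (\<Sum>s\<in>F. q s * cmod (k s t)) \<le> C * q t"
  shows "mbound k C"
  unfolding mbound_def
proof (intro conjI allI impI C)
  fix F F' :: "'s set" and \<xi> :: "'s \<Rightarrow> complex" assume F: "finite F" "finite F'"
  have "(L2_set (\<lambda>s. cmod (\<Sum>t\<in>F'. k s t * \<xi> t)) F)\<^sup>2 = (\<Sum>s\<in>F. (cmod (\<Sum>t\<in>F'. k s t * \<xi> t))\<^sup>2)"
    by (rule L2_set_sq)
  also have "\<dots> \<le> (\<Sum>s\<in>F. C * q s * (\<Sum>t\<in>F'. cmod (k s t) * (cmod (\<xi> t))\<^sup>2 / q t))"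
  proof (rule sum_mono)
    fix s
    \<comment> \<open>Each entry is split into two square roots with q in one and 1/q in the other,
      so that the squares of \<open>?a\<close> sum to the row hypothesis.\<close>
    let ?a = "\<lambda>t. sqrt (cmod (k s t) * q t)" and ?b = "\<lambda>t. sqrt (cmod (k s t) / q t) * cmod (\<xi> t)"
    have ab: "?a t * ?b t = cmod (k s t * \<xi> t)" for t
    proof -
      have "sqrt (cmod (k s t) * q t) * sqrt (cmod (k s t) / q t) = cmod (k s t)"
        using q[of t] by (simp flip: real_sqrt_mult)
      then show ?thesis by (simp add: norm_mult mult.assoc[symmetric])
    qed
    have a2: "(?a t)\<^sup>2 = cmod (k s t) * q t" and b2: "(?b t)\<^sup>2 = cmod (k s t) * (cmod (\<xi> t))\<^sup>2 / q t" for t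
      using q[of t] by (simp_all add: power_mult_distrib)
    have a0: "0 \<le> ?a t" "0 \<le> ?b t" for t using q[of t] by simp_all
    have "cmod (\<Sum>t\<in>F'. k s t * \<xi> t) \<le> (\<Sum>t\<in>F'. \<bar>?a t\<bar> * \<bar>?b t\<bar>)"
      using a0 ab by (intro order_trans[OF norm_sum]) (simp add: abs_of_nonneg)
    also have "\<dots> \<le> L2_set ?a F' * L2_set ?b F'" by (rule L2_set_mult_ineq)
    finally have "(cmod (\<Sum>t\<in>F'. k s t * \<xi> t))\<^sup>2 \<le> (L2_set ?a F' * L2_set ?b F')\<^sup>2" by (simp add: power_mono)
    also have "\<dots> = (\<Sum>t\<in>F'. cmod (k s t) * q t) * (\<Sum>t\<in>F'. cmod (k s t) * (cmod (\<xi> t))\<^sup>2 / q t)"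
      by (simp only: power_mult_distrib L2_set_sq a2 b2[unfolded power_mult_distrib])
    also have "\<dots> \<le> C * q s * (\<Sum>t\<in>F'. cmod (k s t) * (cmod (\<xi> t))\<^sup>2 / q t)"
      using F q by (intro mult_right_mono row sum_nonneg) (auto intro!: divide_nonneg_pos)
    finally show "(cmod (\<Sum>t\<in>F'. k s t * \<xi> t))\<^sup>2 \<le> C * q s * (\<Sum>t\<in>F'. cmod (k s t) * (cmod (\<xi> t))\<^sup>2 / q t)" .
  qed
  also have "\<dots> = C * (\<Sum>t\<in>F'. (\<Sum>s\<in>F. q s * cmod (k s t)) * ((cmod (\<xi> t))\<^sup>2 / q t))"
    unfolding sum_distrib_left sum_distrib_right by (subst sum.swap) (simp add: ac_simps)
  also have "\<dots> \<le> C * (\<Sum>t\<in>F'. (C * q t) * ((cmod (\<xi> t))\<^sup>2 / q t))"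
    using F q C by (intro mult_left_mono sum_mono mult_right_mono col) (auto intro!: divide_nonneg_pos)
  also have "\<dots> = C\<^sup>2 * (\<Sum>t\<in>F'. (cmod (\<xi> t))\<^sup>2)"
    using q by (simp add: sum_distrib_left power2_eq_square less_imp_neq[THEN not_sym] mult.assoc)
  also have "\<dots> = (C * L2_set (\<lambda>t. cmod (\<xi> t)) F')\<^sup>2" by (simp add: power_mult_distrib L2_set_sq)
  finally show "L2_set (\<lambda>s. cmod (\<Sum>t\<in>F'. k s t * \<xi> t)) F \<le> C * L2_set (\<lambda>t. cmod (\<xi> t)) F'"
    by (rule power2_le_imp_le) (simp add: C)
qed

text \<open>The operator norm of a *-representation by column-finite matrices. It produces
  C*-seminorms from \<open>mat\<close> on \<open>Cc\<close> and from \<open>ker\<close> on the Hecke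
  algebra.\<close>

lemma cstar_seminorm_mnorm:
  assumes A: "star_nalg A"
    and bnd: "\<And>a. a \<in> carrier A \<Longrightarrow> mbound (k a) (nrm A a)"
    and cf: "\<And>a. a \<in> carrier A \<Longrightarrow> colfin (k a)"
    and add: "\<And>a b. a \<in> carrier A \<Longrightarrow> b \<in> carrier A \<Longrightarrow> k (vadd A a b) = (\<lambda>s t. k a s t + k b s t)"
    and scal: "\<And>c a. a \<in> carrier A \<Longrightarrow> k (scal A c a) = (\<lambda>s t. c * k a s t)"
    and mul: "\<And>a b. a \<in> carrier A \<Longrightarrow> b \<in> carrier A \<Longrightarrow> k (vmul A a b) = mprod (k a) (k b)"
    and star: "\<And>a. a \<in> carrier A \<Longrightarrow> k (star A a) = (\<lambda>s t. cnj (k a t s))"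
  shows "cstar_seminorm A (\<lambda>a. mnorm (k a))"
proof -
  interpret star_nalg A by (rule A)
  note B = mbound_mnorm[OF bnd]
  show ?thesis
    unfolding cstar_seminorm_def
  proof (intro conjI ballI allI)
    fix a assume a: "a \<in> carrier A"
    show "0 \<le> mnorm (k a)" by (rule mnorm_nonneg[OF bnd[OF a]])
    show "mnorm (k a) \<le> nrm A a" by (rule mnorm_le[OF bnd[OF a]])
    show "mnorm (k (scal A c a)) = cmod c * mnorm (k a)" for c
      by (simp add: scal[OF a] mnorm_scal[OF bnd[OF a]])
    show "mnorm (k (vmul A (star A a) a)) = (mnorm (k a))\<^sup>2"
    proof (rule antisym)
      have eq: "k (vmul A (star A a) a) = mprod (\<lambda>s t. cnj (k a t s)) (k a)" using a by (simp add: mul star)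
      show "mnorm (k (vmul A (star A a) a)) \<le> (mnorm (k a))\<^sup>2"
        unfolding eq power2_eq_square by (intro mnorm_le mbound_mprod mbound_adj B a cf)
      have c: "star A a \<in> carrier A" "vmul A (star A a) a \<in> carrier A" using a by auto
      have "mnorm (k a) \<le> sqrt (mnorm (k (vmul A (star A a) a)))"
        by (rule mnorm_le[OF mbound_cstar[OF cf[OF a]]]) (use B[OF c(2)] in \<open>simp only: eq\<close>)
      then have "(mnorm (k a))\<^sup>2 \<le> (sqrt (mnorm (k (vmul A (star A a) a))))\<^sup>2"
        using mnorm_nonneg[OF bnd[OF a]] by (intro power_mono) auto
      then show "(mnorm (k a))\<^sup>2 \<le> mnorm (k (vmul A (star A a) a))"
        using mnorm_nonneg[OF bnd[OF c(2)]] by simp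
    qed
    fix b assume b: "b \<in> carrier A"
    show "mnorm (k (vadd A a b)) \<le> mnorm (k a) + mnorm (k b)"
      unfolding add[OF a b] by (intro mnorm_le mbound_add B a b)
    show "mnorm (k (vmul A a b)) \<le> mnorm (k a) * mnorm (k b)"
      unfolding mul[OF a b] by (intro mnorm_le mbound_mprod B a b cf)
  qed
qed

section \<open>Transitive permutation groups with compact open stabilisers\<close>

text \<open>\<open>open_iff\<close> says that \<open>T\<close> is the topology of pointwise convergence of the action.\<close>

locale perm_haar = group H for H :: "('g, 'm) monoid_scheme" (structure) +
  fixes T :: "'g topology" and \<mu> :: "'g measure" and act :: "'g \<Rightarrow> 's \<Rightarrow> 's" and S :: "'s set" and b :: 's
  assumes act_in [simp]: "x \<in> carrier H \<Longrightarrow> s \<in> S \<Longrightarrow> act x s \<in> S"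
    and act_one [simp]: "s \<in> S \<Longrightarrow> act \<one> s = s"
    and act_mult: "x \<in> carrier H \<Longrightarrow> y \<in> carrier H \<Longrightarrow> s \<in> S \<Longrightarrow> act (x \<otimes> y) s = act x (act y s)"
    and b_in [simp]: "b \<in> S"
    and trans: "s \<in> S \<Longrightarrow> \<exists>x\<in>carrier H. act x b = s"
    and open_iff: "openin T U \<longleftrightarrow> U \<subseteq> carrier H \<and>
          (\<forall>x\<in>U. \<exists>F\<subseteq>S. finite F \<and> (\<forall>y\<in>carrier H. (\<forall>s\<in>F. act y s = act x s) \<longrightarrow> y \<in> U))"
    and stab_compact: "compactin T {x \<in> carrier H. act x b = b}"
    and haar: "left_haar_measure H T \<mu>"
    and stab_norm: "emeasure \<mu> {x \<in> carrier H. act x b = b} = 1"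
begin

text \<open>\<open>tr b b\<close> is the compact open stabiliser, the sets \<open>tr b t\<close> are
  its left cosets and the sets \<open>tr s b\<close> its right cosets.\<close>

definition tr :: "'s \<Rightarrow> 's \<Rightarrow> 'g set" where "tr s t = {x \<in> carrier H. act x s = t}"
text \<open>The left coset of x for the pointwise stabiliser of F. With F finite these cosets form a
  basis of the topology.\<close>

definition cyl :: "'s set \<Rightarrow> 'g \<Rightarrow> 'g set" where "cyl F x = {y \<in> carrier H. \<forall>s\<in>F. act y s = act x s}"
definition CO :: "'g set \<Rightarrow> bool" where "CO A \<longleftrightarrow> compactin T A \<and> openin T A"

section \<open>The topology of the action and its compact open sets\<close>

lemma trI [intro]: "x \<in> carrier H \<Longrightarrow> act x s = t \<Longrightarrow> x \<in> tr s t"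
  and trD: "x \<in> tr s t \<Longrightarrow> x \<in> carrier H" "x \<in> tr s t \<Longrightarrow> act x s = t"
  by (auto simp: tr_def)

lemma topspace_eq [simp]: "topspace T = carrier H"
proof
  show "topspace T \<subseteq> carrier H" using open_iff by (simp add: topspace_def Union_subsetI) blast
  have "openin T (carrier H)" unfolding open_iff by auto
  then show "carrier H \<subseteq> topspace T" by (rule openin_subset)
qed

lemma act_inv [simp]: "x \<in> carrier H \<Longrightarrow> s \<in> S \<Longrightarrow> act (inv x) (act x s) = s"
  and act_inv2 [simp]: "x \<in> carrier H \<Longrightarrow> s \<in> S \<Longrightarrow> act x (act (inv x) s) = s"
  by (simp_all flip: act_mult)

lemma act_inj: "x \<in> carrier H \<Longrightarrow> s \<in> S \<Longrightarrow> t \<in> S \<Longrightarrow> act x s = act x t \<longleftrightarrow> s = t"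
  by (metis act_inv)

lemma act_inv_eq: "x \<in> carrier H \<Longrightarrow> s \<in> S \<Longrightarrow> t \<in> S \<Longrightarrow> act (inv x) s = t \<longleftrightarrow> act x t = s"
  by (metis act_inv act_inv2)

lemma cyl_self: "x \<in> carrier H \<Longrightarrow> x \<in> cyl F x"
  by (simp add: cyl_def)

lemma cyl_sub: "cyl F x \<subseteq> carrier H"
  by (auto simp: cyl_def)

lemma open_cyl: "finite F \<Longrightarrow> F \<subseteq> S \<Longrightarrow> openin T (cyl F x)"
  unfolding open_iff by (auto simp: cyl_def)

lemma open_tr: "s \<in> S \<Longrightarrow> openin T (tr s t)"
  unfolding open_iff tr_def by (auto intro!: exI[of _ "{s}"])

lemma openE_cyl: "openin T U \<Longrightarrow> x \<in> U \<Longrightarrow> \<exists>F\<subseteq>S. finite F \<and> cyl F x \<subseteq> U"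
proof -
  assume "openin T U" "x \<in> U"
  then obtain F where "F \<subseteq> S" "finite F" "\<forall>y\<in>carrier H. (\<forall>s\<in>F. act y s = act x s) \<longrightarrow> y \<in> U"
    unfolding open_iff by meson
  then show ?thesis by (intro exI[of _ F]) (auto simp: cyl_def)
qed

lemma closed_cyl:
  assumes "finite F" "F \<subseteq> S" shows "closedin T (cyl F x)"
proof -
  have "openin T (carrier H - cyl F x)"
    unfolding open_iff
  proof (intro conjI ballI)
    fix y assume y: "y \<in> carrier H - cyl F x"
    then show "\<exists>F'\<subseteq>S. finite F' \<and> (\<forall>z\<in>carrier H. (\<forall>s\<in>F'. act z s = act y s) \<longrightarrow> z \<in> carrier H - cyl F x)"
      using assms by (intro exI[of _ F]) (auto simp: cyl_def)
  qed auto
  then show ?thesis by (simp add: closedin_def cyl_sub)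
qed

lemma continuous_mapI:
  assumes "\<And>x. x \<in> carrier H \<Longrightarrow> \<theta> x \<in> carrier H"
    and "\<And>x F. x \<in> carrier H \<Longrightarrow> finite F \<Longrightarrow> F \<subseteq> S \<Longrightarrow> \<exists>F'\<subseteq>S. finite F' \<and>
      (\<forall>y\<in>carrier H. (\<forall>s\<in>F'. act y s = act x s) \<longrightarrow> (\<forall>s\<in>F. act (\<theta> y) s = act (\<theta> x) s))"
  shows "continuous_map T T \<theta>"
  unfolding continuous_map_def
proof (intro conjI allI impI)
  show "\<theta> \<in> topspace T \<rightarrow> topspace T" using assms(1) by auto
  fix U assume U: "openin T U"
  show "openin T {x \<in> topspace T. \<theta> x \<in> U}"
    unfolding open_iff
  proof (intro conjI ballI)
    fix x assume x: "x \<in> {x \<in> topspace T. \<theta> x \<in> U}"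
    then obtain F where F: "F \<subseteq> S" "finite F" "cyl F (\<theta> x) \<subseteq> U" using openE_cyl[OF U] by blast
    obtain F' where F': "F' \<subseteq> S" "finite F'"
      "\<forall>y\<in>carrier H. (\<forall>s\<in>F'. act y s = act x s) \<longrightarrow> (\<forall>s\<in>F. act (\<theta> y) s = act (\<theta> x) s)"
      using assms(2)[OF _ F(2,1), of x] x by auto
    have "y \<in> {x \<in> topspace T. \<theta> x \<in> U}" if "y \<in> carrier H" "\<forall>s\<in>F'. act y s = act x s" for y
      using F(3) F'(3) that assms(1) by (auto simp: cyl_def)
    then show "\<exists>F\<subseteq>S. finite F \<and> (\<forall>y\<in>carrier H. (\<forall>s\<in>F. act y s = act x s) \<longrightarrow> y \<in> {x \<in> topspace T. \<theta> x \<in> U})"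
      using F' by blast
  qed auto
qed

lemma cont_left: "z \<in> carrier H \<Longrightarrow> continuous_map T T (\<lambda>y. z \<otimes> y)"
  by (rule continuous_mapI) (auto simp: act_mult subset_iff)

lemma cont_right:
  assumes z: "z \<in> carrier H" shows "continuous_map T T (\<lambda>y. y \<otimes> z)"
proof (rule continuous_mapI)
  fix x F assume x: "x \<in> carrier H" and F: "finite F" "F \<subseteq> S"
  then show "\<exists>F'\<subseteq>S. finite F' \<and>
      (\<forall>y\<in>carrier H. (\<forall>s\<in>F'. act y s = act x s) \<longrightarrow> (\<forall>s\<in>F. act (y \<otimes> z) s = act (x \<otimes> z) s))"
    using z by (intro exI[of _ "act z ` F"]) (auto simp: act_mult subset_iff)
qed (simp add: z)

lemma cont_inv: "continuous_map T T (\<lambda>y. inv y)"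
proof (rule continuous_mapI)
  fix x F assume x: "x \<in> carrier H" and F: "finite F" "F \<subseteq> S"
  have "act (inv y) s = act (inv x) s"
    if "y \<in> carrier H" "\<forall>s\<in>act (inv x) ` F. act y s = act x s" "s \<in> F" for y s
    using that x F by (auto simp: act_inv_eq)
  then show "\<exists>F'\<subseteq>S. finite F' \<and>
      (\<forall>y\<in>carrier H. (\<forall>s\<in>F'. act y s = act x s) \<longrightarrow> (\<forall>s\<in>F. act (inv y) s = act (inv x) s))"
    using x F by (intro exI[of _ "act (inv x) ` F"] conjI) (blast intro: act_in inv_closed)+
qed simp

lemma open_image:
  assumes "continuous_map T T \<theta>'" "U \<subseteq> carrier H" "\<And>x. x \<in> carrier H \<Longrightarrow> \<theta> x \<in> carrier H"
    "\<And>x. x \<in> carrier H \<Longrightarrow> \<theta>' (\<theta> x) = x" "\<And>x. x \<in> carrier H \<Longrightarrow> \<theta> (\<theta>' x) = x" "openin T U"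
  shows "openin T (\<theta> ` U)"
proof -
  have "\<theta> ` U = {x \<in> topspace T. \<theta>' x \<in> U}" using assms(2-5) by (auto simp: image_iff) (metis subsetD)
  then show ?thesis using assms(1,6) by (simp add: continuous_map_def)
qed

lemma CO_image:
  assumes "continuous_map T T \<theta>" "continuous_map T T \<theta>'" "\<And>x. x \<in> carrier H \<Longrightarrow> \<theta> x \<in> carrier H"
    "\<And>x. x \<in> carrier H \<Longrightarrow> \<theta>' (\<theta> x) = x" "\<And>x. x \<in> carrier H \<Longrightarrow> \<theta> (\<theta>' x) = x" "CO A"
  shows "CO (\<theta> ` A)"
  using assms openin_subset[of T A] unfolding CO_def by (auto intro: image_compactin open_image[where \<theta>' = \<theta>'])

lemma CO_sub: "CO A \<Longrightarrow> A \<subseteq> carrier H"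
  unfolding CO_def using openin_subset by fastforce

lemma CO_left: "z \<in> carrier H \<Longrightarrow> CO A \<Longrightarrow> CO ((\<lambda>y. z \<otimes> y) ` A)"
  by (rule CO_image[OF cont_left cont_left[of "inv z"]]) (auto simp: inv_solve_left m_assoc[symmetric])

lemma CO_right: "z \<in> carrier H \<Longrightarrow> CO A \<Longrightarrow> CO ((\<lambda>y. y \<otimes> z) ` A)"
  by (rule CO_image[OF cont_right cont_right[of "inv z"]]) (auto simp: m_assoc)

lemma CO_inv: "CO A \<Longrightarrow> CO ((\<lambda>y. inv y) ` A)"
  by (rule CO_image[OF cont_inv cont_inv]) auto

lemma CO_stab: "CO (tr b b)"
  unfolding CO_def using open_tr stab_compact by (simp add: tr_def)

lemma tr_left: "z \<in> carrier H \<Longrightarrow> s \<in> S \<Longrightarrow> t \<in> S \<Longrightarrow> (\<lambda>y. z \<otimes> y) ` tr s t = tr s (act z t)"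
proof safe
  fix y assume "z \<in> carrier H" "s \<in> S" "t \<in> S" "y \<in> tr s t"
  then show "z \<otimes> y \<in> tr s (act z t)" by (auto simp: tr_def act_mult)
next
  fix y assume h: "z \<in> carrier H" "s \<in> S" "t \<in> S" "y \<in> tr s (act z t)"
  then have "inv z \<otimes> y \<in> tr s t" "y = z \<otimes> (inv z \<otimes> y)" by (auto simp: tr_def act_mult m_assoc[symmetric])
  then show "y \<in> (\<lambda>y. z \<otimes> y) ` tr s t" by blast
qed

lemma tr_right: "z \<in> carrier H \<Longrightarrow> s \<in> S \<Longrightarrow> t \<in> S \<Longrightarrow> (\<lambda>y. y \<otimes> z) ` tr s t = tr (act (inv z) s) t"
proof safe
  fix y assume "z \<in> carrier H" "s \<in> S" "t \<in> S" "y \<in> tr s t"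
  then show "y \<otimes> z \<in> tr (act (inv z) s) t" by (auto simp: tr_def act_mult)
next
  fix y assume h: "z \<in> carrier H" "s \<in> S" "t \<in> S" "y \<in> tr (act (inv z) s) t"
  then have "y \<otimes> inv z \<in> tr s t" "y = (y \<otimes> inv z) \<otimes> z" by (auto simp: tr_def act_mult m_assoc)
  then show "y \<in> (\<lambda>y. y \<otimes> z) ` tr s t" by blast
qed

lemma tr_inv: "s \<in> S \<Longrightarrow> t \<in> S \<Longrightarrow> (\<lambda>y. inv y) ` tr s t = tr t s"
proof safe
  fix y assume "s \<in> S" "t \<in> S" "y \<in> tr s t" then show "inv y \<in> tr t s" by (auto simp: tr_def)
next
  fix y assume h: "s \<in> S" "t \<in> S" "y \<in> tr t s"
  then have "inv y \<in> tr s t" "y = inv (inv y)" by (auto simp: tr_def)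
  then show "y \<in> (\<lambda>y. inv y) ` tr s t" by blast
qed

lemma CO_tr: assumes "s \<in> S" "t \<in> S" shows "CO (tr s t)"
proof -
  obtain z w where z: "z \<in> carrier H" "act z b = t" and w: "w \<in> carrier H" "act w b = s"
    using trans assms by metis
  have "CO ((\<lambda>y. y \<otimes> inv w) ` ((\<lambda>y. z \<otimes> y) ` tr b b))"
    using z w CO_stab by (intro CO_right CO_left) auto
  then show ?thesis using z w assms by (simp add: tr_left tr_right)
qed

text \<open>A cylinder that fixes the image of \<open>b\<close> is a closed subset of the compact
  coset \<open>tr b (act x b)\<close>. This is why \<open>b\<close> is put into the index sets of
  cylinders below.\<close>

lemma CO_cyl:
  assumes "finite F" "F \<subseteq> S" "b \<in> F" "x \<in> carrier H" shows "CO (cyl F x)"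
proof -
  have "CO (tr b (act x b))" using assms by (intro CO_tr) auto
  moreover have "cyl F x \<subseteq> tr b (act x b)" using assms by (auto simp: cyl_def tr_def)
  ultimately show ?thesis
    using closed_compactin closed_cyl open_cyl assms unfolding CO_def by metis
qed

lemma CO_Un: "CO A \<Longrightarrow> CO B \<Longrightarrow> CO (A \<union> B)"
  unfolding CO_def by (auto intro: compactin_Un)

lemma CO_empty: "CO {}"
  by (simp add: CO_def)

lemma CO_UN: "finite I \<Longrightarrow> (\<And>i. i \<in> I \<Longrightarrow> CO (A i)) \<Longrightarrow> CO (\<Union>i\<in>I. A i)"
  by (induction I rule: finite_induct) (auto simp: CO_empty intro: CO_Un)

lemma compact_cover:
  assumes K: "compactin T K" and U: "\<And>x. x \<in> K \<Longrightarrow> openin T (U x) \<and> x \<in> U x"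
  shows "\<exists>X\<subseteq>K. finite X \<and> K \<subseteq> (\<Union>x\<in>X. U x)"
proof -
  have "(\<forall>V\<in>U ` K. openin T V) \<and> K \<subseteq> \<Union>(U ` K)" using U by blast
  then obtain \<F> where \<F>: "finite \<F>" "\<F> \<subseteq> U ` K" "K \<subseteq> \<Union>\<F>" using K unfolding compactin_def by meson
  obtain X where "X \<subseteq> K" "finite X" "\<F> = U ` X" using finite_subset_image[OF \<F>(1,2)] by blast
  then show ?thesis using \<F> by blast
qed

text \<open>Lets inner regularity be tested on compact open sets, where measures are found by
  counting cosets.\<close>

lemma CO_between:
  assumes "compactin T K" "openin T U" "K \<subseteq> U" shows "\<exists>D. CO D \<and> K \<subseteq> D \<and> D \<subseteq> U"
proof -
  have "\<forall>x\<in>K. \<exists>F\<subseteq>S. finite F \<and> cyl F x \<subseteq> U" using openE_cyl assms by blast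
  then obtain F where F: "\<And>x. x \<in> K \<Longrightarrow> F x \<subseteq> S \<and> finite (F x) \<and> cyl (F x) x \<subseteq> U" by metis
  have Kc: "x \<in> carrier H" if "x \<in> K" for x using compactin_subset_topspace[OF assms(1)] that by auto
  have "\<exists>X\<subseteq>K. finite X \<and> K \<subseteq> (\<Union>x\<in>X. cyl (insert b (F x)) x)"
    by (rule compact_cover[OF assms(1)]) (use F Kc in \<open>simp add: open_cyl cyl_self\<close>)
  then obtain X where X: "X \<subseteq> K" "finite X" "K \<subseteq> (\<Union>x\<in>X. cyl (insert b (F x)) x)" by blast
  have FX: "F x \<subseteq> S" "finite (F x)" "x \<in> carrier H" if "x \<in> X" for x using that X(1) F Kc by blast+
  have "CO (\<Union>x\<in>X. cyl (insert b (F x)) x)" using X(2) FX by (intro CO_UN CO_cyl) auto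
  moreover have "(\<Union>x\<in>X. cyl (insert b (F x)) x) \<subseteq> U"
  proof -
    have "cyl (insert b (F x)) x \<subseteq> cyl (F x) x" for x by (auto simp: cyl_def)
    then show ?thesis using F X(1) by blast
  qed
  ultimately show ?thesis using X by blast
qed

lemma cyl_cong: "y \<in> cyl F x \<Longrightarrow> cyl F y = cyl F x"
  by (auto simp: cyl_def)

text \<open>A finite partition of A into left cosets of the pointwise stabiliser of F, with X a set
  of representatives.\<close>

definition parts :: "'s set \<Rightarrow> 'g set \<Rightarrow> 'g set \<Rightarrow> bool" where
  "parts F A X \<longleftrightarrow> X \<subseteq> A \<and> finite X \<and> disjoint_family_on (cyl F) X \<and> A = (\<Union>x\<in>X. cyl F x)"

text \<open>The partition exists for every F above F0, so it can be made common to two sets or fine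
  enough for a given continuous function.\<close>

lemma CO_partition:
  assumes "CO A"
  shows "\<exists>F0\<subseteq>S. finite F0 \<and> (\<forall>F. finite F \<longrightarrow> F \<subseteq> S \<longrightarrow> F0 \<subseteq> F \<longrightarrow> (\<exists>X. parts F A X))"
proof -
  have A: "compactin T A" "openin T A" using assms by (auto simp: CO_def)
  note Ac = CO_sub[OF assms]
  have "\<forall>x\<in>A. \<exists>F\<subseteq>S. finite F \<and> cyl F x \<subseteq> A" using openE_cyl A by blast
  then obtain f where F: "\<And>x. x \<in> A \<Longrightarrow> f x \<subseteq> S \<and> finite (f x) \<and> cyl (f x) x \<subseteq> A" by metis
  have "\<exists>X\<subseteq>A. finite X \<and> A \<subseteq> (\<Union>x\<in>X. cyl (f x) x)"
    by (rule compact_cover[OF A(1)]) (use F Ac in \<open>auto simp: open_cyl cyl_self subset_iff\<close>)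
  then obtain X where X: "X \<subseteq> A" "finite X" "A \<subseteq> (\<Union>x\<in>X. cyl (f x) x)" by blast
  define F0 where "F0 = (\<Union>x\<in>X. f x)"
  have "\<exists>X. parts F A X"
    if F': "finite F" "F \<subseteq> S" "F0 \<subseteq> F" for F
  proof -
    have sat: "cyl F y \<subseteq> A" if "y \<in> A" for y
    proof -
      have "y \<in> (\<Union>x\<in>X. cyl (f x) x)" using X(3) that by (rule subsetD)
      then obtain x where x: "x \<in> X" "y \<in> cyl (f x) x" by (rule UN_E)
      have "cyl F y \<subseteq> cyl (f x) y" using F'(3) x(1) by (auto simp: cyl_def F0_def)
      also have "\<dots> \<subseteq> A" using cyl_cong[OF x(2)] F X x by blast
      finally show ?thesis .
    qed
    have "\<exists>Y\<subseteq>A. finite Y \<and> A \<subseteq> (\<Union>x\<in>Y. cyl F x)"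
      by (rule compact_cover[OF A(1)]) (use F' Ac in \<open>auto simp: open_cyl cyl_self subset_iff\<close>)
    then obtain Y where Y: "Y \<subseteq> A" "finite Y" "A \<subseteq> (\<Union>x\<in>Y. cyl F x)" by blast
    \<comment> \<open>Cylinders with the same F are equal or disjoint, so keeping one centre for
      each distinct cylinder gives a disjoint family.\<close>
    obtain Z where Z: "Z \<subseteq> Y" "inj_on (cyl F) Z" "cyl F ` Y = cyl F ` Z"
      using subset_image_inj[of "cyl F ` Y" "cyl F" Y] by auto
    have "disjoint_family_on (cyl F) Z"
      unfolding disjoint_family_on_def using Z(2) by (metis cyl_cong disjoint_iff inj_onD)
    moreover have "A = (\<Union>x\<in>Z. cyl F x)"
    proof
      have "(\<Union>x\<in>Y. cyl F x) = (\<Union>x\<in>Z. cyl F x)" using Z(3) by simp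
      then show "A \<subseteq> (\<Union>x\<in>Z. cyl F x)" using Y(3) by simp
      show "(\<Union>x\<in>Z. cyl F x) \<subseteq> A" using sat Z(1) Y(1) by (intro UN_least) auto
    qed
    ultimately show ?thesis using Z Y unfolding parts_def by (intro exI[of _ Z]) (auto intro: finite_subset)
  qed
  moreover have "F0 \<subseteq> S" "finite F0" using X(1,2) F unfolding F0_def by blast+
  ultimately show ?thesis by blast
qed

section \<open>Haar measure under translation and inversion\<close>

lemma space_mu [simp]: "space \<mu> = carrier H"
  and sets_mu: "sets \<mu> = sigma_sets (carrier H) {U. openin T U}"
  using haar by (simp_all add: left_haar_measure_def)

lemma outer_regular: "E \<in> sets \<mu> \<Longrightarrow> emeasure \<mu> E = Inf {emeasure \<mu> U |U. openin T U \<and> E \<subseteq> U}"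
  using haar unfolding left_haar_measure_def by (elim conjE) (rule bspec)

lemma inner_regular: "openin T U \<Longrightarrow> emeasure \<mu> U = Sup {emeasure \<mu> K |K. compactin T K \<and> K \<subseteq> U}"
  using haar unfolding left_haar_measure_def by (elim conjE) (rule mp, erule spec)

lemma open_sets: "openin T U \<Longrightarrow> U \<in> sets \<mu>"
  by (auto simp: sets_mu intro: sigma_sets.Basic)

lemma CO_sets: "CO A \<Longrightarrow> A \<in> sets \<mu>"
  by (auto simp: CO_def intro: open_sets)

lemma tr_sets [simp]: "s \<in> S \<Longrightarrow> tr s t \<in> sets \<mu>"
  by (intro open_sets open_tr)

lemma compact_finite: "compactin T K \<Longrightarrow> emeasure \<mu> K < \<infinity>"
  using haar by (simp add: left_haar_measure_def)

lemma CO_finite: "CO A \<Longrightarrow> emeasure \<mu> A < \<infinity>"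
  using compact_finite by (auto simp: CO_def)

lemma left_inv: "x \<in> carrier H \<Longrightarrow> E \<in> sets \<mu> \<Longrightarrow> emeasure \<mu> ((\<lambda>y. x \<otimes> y) ` E) = emeasure \<mu> E"
proof -
  have "(\<lambda>y. x \<otimes> y) ` E = x <# E" by (auto simp: l_coset_def)
  then show "x \<in> carrier H \<Longrightarrow> E \<in> sets \<mu> \<Longrightarrow> emeasure \<mu> ((\<lambda>y. x \<otimes> y) ` E) = emeasure \<mu> E"
    using haar by (simp add: left_haar_measure_def)
qed

lemma cyl_left:
  assumes "x \<in> carrier H" "F \<subseteq> S" shows "cyl F x = (\<lambda>y. x \<otimes> y) ` cyl F \<one>"
proof safe
  fix y assume y: "y \<in> cyl F x"
  then have "inv x \<otimes> y \<in> cyl F \<one>" "y = x \<otimes> (inv x \<otimes> y)"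
    using assms by (auto simp: cyl_def act_mult m_assoc[symmetric] subset_iff)
  then show "y \<in> (\<lambda>y. x \<otimes> y) ` cyl F \<one>" by blast
next
  fix y assume "y \<in> cyl F \<one>"
  then show "x \<otimes> y \<in> cyl F x" using assms by (auto simp: cyl_def act_mult subset_iff)
qed

lemma cyl_inv_one: assumes "F \<subseteq> S" shows "(\<lambda>y. inv y) ` cyl F \<one> = cyl F \<one>"
proof -
  have inv: "inv y \<in> cyl F \<one>" if "y \<in> cyl F \<one>" for y using that assms by (auto simp: cyl_def act_inv_eq subset_iff)
  then have "(\<lambda>y. inv y) ` cyl F \<one> \<subseteq> cyl F \<one>" by auto
  moreover have "y \<in> (\<lambda>y. inv y) ` cyl F \<one>" if "y \<in> cyl F \<one>" for y
  proof (rule image_eqI)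
    show "y = inv (inv y)" using that by (simp add: cyl_def)
    show "inv y \<in> cyl F \<one>" by (rule inv[OF that])
  qed
  ultimately show ?thesis by blast
qed

lemma emeasure_cyl: "x \<in> carrier H \<Longrightarrow> finite F \<Longrightarrow> F \<subseteq> S \<Longrightarrow> emeasure \<mu> (cyl F x) = emeasure \<mu> (cyl F \<one>)"
  by (subst cyl_left) (auto intro: left_inv open_sets open_cyl)

lemma emeasure_tr_b: assumes "t \<in> S" shows "emeasure \<mu> (tr b t) = 1"
proof -
  obtain z where z: "z \<in> carrier H" "act z b = t" using trans assms by metis
  have "emeasure \<mu> ((\<lambda>y. z \<otimes> y) ` tr b b) = 1"
    using z stab_norm by (subst left_inv) (auto simp: tr_def[symmetric])
  then show ?thesis using z by (simp add: tr_left)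
qed

text \<open>Right translation multiplies the Haar measure by a constant, found on compact open sets first and
  extended to measurable sets by regularity.\<close>

definition right_factor :: "'g \<Rightarrow> ennreal" where "right_factor z = emeasure \<mu> ((\<lambda>y. y \<otimes> z) ` tr b b)"

lemma emeasure_UN_cyl:
  assumes X: "finite X" "X \<subseteq> carrier H" and F: "finite F" "F \<subseteq> S" and d: "disjoint_family_on (cyl F) X"
  shows "emeasure \<mu> (\<Union>x\<in>X. cyl F x) = of_nat (card X) * emeasure \<mu> (cyl F \<one>)"
proof -
  have "emeasure \<mu> (\<Union>x\<in>X. cyl F x) = (\<Sum>x\<in>X. emeasure \<mu> (cyl F x))"
    using X F d by (intro sum_emeasure[symmetric]) (auto intro: open_sets open_cyl)
  also have "\<dots> = (\<Sum>x\<in>X. emeasure \<mu> (cyl F \<one>))" using X F by (intro sum.cong refl emeasure_cyl) auto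
  finally show ?thesis by simp
qed

text \<open>A and the stabiliser are cut into left cosets of one small open subgroup. Right
  translates of these cosets are left translates of a single set and have equal measure, so
  translation scales A by the same factor as the stabiliser.\<close>

lemma emeasure_right_CO:
  assumes z: "z \<in> carrier H" and A: "CO A"
  shows "emeasure \<mu> ((\<lambda>y. y \<otimes> z) ` A) = right_factor z * emeasure \<mu> A"
proof -
  let ?r = "\<lambda>A. (\<lambda>y. y \<otimes> z) ` A"
  obtain F1 where F1: "F1 \<subseteq> S" "finite F1" "\<And>F. finite F \<Longrightarrow> F \<subseteq> S \<Longrightarrow> F1 \<subseteq> F \<Longrightarrow> \<exists>X. parts F (A) X"
    using CO_partition[OF A] by blast
  obtain F2 where F2: "F2 \<subseteq> S" "finite F2" "\<And>F. finite F \<Longrightarrow> F \<subseteq> S \<Longrightarrow> F2 \<subseteq> F \<Longrightarrow> \<exists>X. parts F (tr b b) X"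
    using CO_partition[OF CO_stab] by blast
  define F where "F = insert b (F1 \<union> F2)"
  have F: "finite F" "F \<subseteq> S" "F1 \<subseteq> F" "F2 \<subseteq> F" "b \<in> F" using F1 F2 by (auto simp: F_def)
  obtain X where X: "X \<subseteq> A" "finite X" "disjoint_family_on (cyl F) X" "A = (\<Union>x\<in>X. cyl F x)"
    using F1(3)[OF F(1,2,3)] unfolding parts_def by blast
  obtain Y where Y: "Y \<subseteq> tr b b" "finite Y" "disjoint_family_on (cyl F) Y" "tr b b = (\<Union>x\<in>Y. cyl F x)"
    using F2(3)[OF F(1,2,4)] unfolding parts_def by blast
  have Xc: "X \<subseteq> carrier H" "Y \<subseteq> carrier H" using X(1) Y(1) CO_sub[OF A] CO_sub[OF CO_stab] by (blast+)
  define q where "q = emeasure \<mu> (?r (cyl F \<one>))"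
  have q: "emeasure \<mu> (?r (\<Union>x\<in>Z. cyl F x)) = of_nat (card Z) * q"
    if Z: "finite Z" "Z \<subseteq> carrier H" "disjoint_family_on (cyl F) Z" for Z
  proof -
    have inj: "inj_on (\<lambda>y. y \<otimes> z) (carrier H)" using z by (auto intro!: inj_onI)
    have COr: "CO (?r (cyl F x))" if "x \<in> carrier H" for x using F that z by (intro CO_right CO_cyl)
    have "disjoint_family_on (\<lambda>x. ?r (cyl F x)) Z"
      using Z(3) cyl_sub inj unfolding disjoint_family_on_def
      by (metis image_empty inj_on_image_Int)
    then have "emeasure \<mu> (?r (\<Union>x\<in>Z. cyl F x)) = (\<Sum>x\<in>Z. emeasure \<mu> (?r (cyl F x)))"
      unfolding image_UN using Z COr by (intro sum_emeasure[symmetric]) (auto intro: CO_sets)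
    also have "\<dots> = (\<Sum>x\<in>Z. q)"
    proof (rule sum.cong[OF refl])
      fix x assume "x \<in> Z"
      then have x: "x \<in> carrier H" using Z by auto
      have "?r (cyl F x) = (\<lambda>y. x \<otimes> y) ` ?r (cyl F \<one>)"
        unfolding cyl_left[OF x F(2)] image_image using x z by (auto simp: m_assoc cyl_def intro!: image_cong)
      then show "emeasure \<mu> (?r (cyl F x)) = q"
        unfolding q_def using x COr[of "\<one>"] by (simp add: left_inv CO_sets)
    qed
    finally show ?thesis by simp
  qed
  define k where "k = emeasure \<mu> (cyl F \<one>)"
  have "right_factor z = of_nat (card Y) * q" unfolding right_factor_def using q[OF Y(2) Xc(2) Y(3)] Y(4) by simp
  \<comment> \<open>The normalisation of the stabiliser relates the two counts:
    \<open>card X * q\<close> equals \<open>card X * (card Y * k) * q\<close>, that is, the factor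
    \<open>card Y * q\<close> times the measure \<open>card X * k\<close> of A.\<close>
  moreover have "1 = of_nat (card Y) * k"
    using emeasure_UN_cyl[OF Y(2) Xc(2) F(1,2) Y(3)] Y(4) emeasure_tr_b[OF b_in] by (simp add: k_def)
  moreover have "emeasure \<mu> A = of_nat (card X) * k"
    using emeasure_UN_cyl[OF X(2) Xc(1) F(1,2) X(3)] X(4) by (simp add: k_def)
  moreover have "emeasure \<mu> (?r A) = of_nat (card X) * q" using q[OF X(2) Xc(1) X(3)] X(4) by simp
  ultimately show ?thesis by (metis mult.left_commute mult.commute mult.right_neutral)
qed

lemma right_factor_mult: "x \<in> carrier H \<Longrightarrow> z \<in> carrier H \<Longrightarrow> right_factor (x \<otimes> z) = right_factor x * right_factor z"
proof -
  assume h: "x \<in> carrier H" "z \<in> carrier H"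
  have "(\<lambda>y. y \<otimes> (x \<otimes> z)) ` tr b b = (\<lambda>y. y \<otimes> z) ` (\<lambda>y. y \<otimes> x) ` tr b b"
    unfolding image_image using h by (auto simp: m_assoc tr_def intro!: image_cong)
  then show ?thesis using emeasure_right_CO[OF h(2) CO_right[OF h(1) CO_stab]] h
    by (simp add: right_factor_def mult.commute)
qed

lemma right_factor_one: "right_factor \<one> = 1"
proof -
  have "(\<lambda>y. y \<otimes> \<one>) ` tr b b = tr b b" by (force simp: tr_def)
  then show ?thesis using emeasure_tr_b[OF b_in] by (simp add: right_factor_def)
qed

definition w :: "'s \<Rightarrow> real" where "w s = measure \<mu> (tr s b)"
text \<open>The stabiliser translated on the right by z is the right coset
  \<open>tr (act (inv z) b) b\<close>, so this is the modular function, read off from the stabiliser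
  of measure 1.\<close>

definition modulus :: "'g \<Rightarrow> real" where "modulus z = w (act (inv z) b)"

lemma right_factor_modulus: "z \<in> carrier H \<Longrightarrow> right_factor z = ennreal (modulus z)"
  unfolding right_factor_def modulus_def w_def using CO_finite[OF CO_tr[of "act (inv z) b" b]]
  by (simp add: tr_right emeasure_eq_ennreal_measure)

lemma modulus_nonneg [simp]: "0 \<le> modulus z"
  by (simp add: modulus_def w_def)

lemma modulus_mult: "x \<in> carrier H \<Longrightarrow> z \<in> carrier H \<Longrightarrow> modulus (x \<otimes> z) = modulus x * modulus z"
  using right_factor_mult[of x z] by (simp add: right_factor_modulus flip: ennreal_mult)

lemma modulus_one: "modulus \<one> = 1"
  using right_factor_one by (simp add: right_factor_modulus)

lemma modulus_inv_mult: "z \<in> carrier H \<Longrightarrow> modulus z * modulus (inv z) = 1"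
  using modulus_mult[of z "inv z"] modulus_one by simp

lemma modulus_pos: "z \<in> carrier H \<Longrightarrow> 0 < modulus z"
  using modulus_inv_mult[of z] modulus_nonneg[of z] by (cases "modulus z = 0") (auto simp: less_le)

lemma modulus_inv: "z \<in> carrier H \<Longrightarrow> modulus (inv z) = 1 / modulus z"
  using modulus_inv_mult[of z] modulus_pos[of z] by (simp add: field_simps)

lemma w_pos: "s \<in> S \<Longrightarrow> 0 < w s"
  using trans[of s] modulus_pos[of "inv x" for x] by (force simp: modulus_def)

lemma w_act: "z \<in> carrier H \<Longrightarrow> w (act z b) = modulus (inv z)"
  by (simp add: modulus_def)

lemma w_b: "w b = 1"
  using w_act[of "\<one>"] by (simp add: modulus_one)

lemma modulus_tr_b: "k \<in> tr b b \<Longrightarrow> modulus k = 1"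
  unfolding modulus_def using w_b act_inv[of k b] by (auto simp: tr_def)

text \<open>Two elements of \<open>tr s t\<close> differ by an element fixing s. Conjugating it to
  the base point gives an element of the stabiliser, where the modulus is 1, and conjugation does
  not change a multiplicative real function. So the modulus is locally constant.\<close>

lemma modulus_tr:
  assumes "s \<in> S" "x \<in> tr s t" "y \<in> tr s t" shows "modulus x = modulus y"
proof -
  obtain z where z: "z \<in> carrier H" "act z b = s" using trans assms by metis
  have c: "x \<in> carrier H" "y \<in> carrier H" using assms by (auto simp: tr_def)
  define k where "k = inv z \<otimes> (inv y \<otimes> x) \<otimes> z"
  have "act (inv y) t = s" using trD(2)[OF assms(3)] c assms(1) by auto
  moreover have "act k b = act (inv z) (act (inv y) (act x (act z b)))"
    using c z(1) by (simp add: k_def act_mult)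
  ultimately have "k \<in> tr b b" using trD(2)[OF assms(2)] c z act_inv[OF z(1) b_in]
    by (simp add: k_def tr_def)
  then have "modulus k = 1" by (rule modulus_tr_b)
  moreover have "modulus k = modulus (inv z) * (modulus (inv y) * modulus x) * modulus z" using c z by (simp add: k_def modulus_mult)
  moreover have "modulus (inv z) * (modulus (inv y) * modulus x) * modulus z = (modulus z * modulus (inv z)) * (modulus (inv y) * modulus x)"
    by (simp only: ac_simps)
  ultimately have "modulus (inv y) * modulus x = 1" using modulus_inv_mult[OF z(1)] by simp
  then show ?thesis using modulus_inv_mult[OF c(2)] modulus_pos[OF c(2)] by (simp add: modulus_inv c field_simps)
qed

text \<open>Inner regularity carries the estimate from compact open sets to open ones, and outer
  regularity from there to measurable ones. The ambient open set A is the whole group for right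
  translations and one \<open>tr s t\<close> for inversion, whose factor is constant only on such
  sets.\<close>

lemma le_by_compact_open:
  assumes cont: "continuous_map T T \<theta>" "continuous_map T T \<theta>'"
    and \<theta>: "\<And>x. x \<in> carrier H \<Longrightarrow> \<theta> x \<in> carrier H" "\<And>x. x \<in> carrier H \<Longrightarrow> \<theta>' x \<in> carrier H"
      "\<And>x. x \<in> carrier H \<Longrightarrow> \<theta>' (\<theta> x) = x" "\<And>x. x \<in> carrier H \<Longrightarrow> \<theta> (\<theta>' x) = x"
    and A: "openin T A" and c: "c > 0"
    and le: "\<And>D. CO D \<Longrightarrow> D \<subseteq> A \<Longrightarrow> emeasure \<mu> (\<theta> ` D) \<le> ennreal c * emeasure \<mu> D"
    and E: "E \<in> sets \<mu>" "E \<subseteq> A"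
  shows "emeasure \<mu> (\<theta> ` E) \<le> ennreal c * emeasure \<mu> E"
proof -
  have op: "openin T (\<theta> ` U)" if "openin T U" for U
    using that openin_subset[OF that] \<theta> by (intro open_image[OF cont(2)]) auto
  have U: "emeasure \<mu> (\<theta> ` U) \<le> ennreal c * emeasure \<mu> U" if U: "openin T U" "U \<subseteq> A" for U
  proof -
    have "emeasure \<mu> (\<theta> ` U) = Sup {emeasure \<mu> K |K. compactin T K \<and> K \<subseteq> \<theta> ` U}"
      by (rule inner_regular[OF op[OF U(1)]])
    also have "\<dots> \<le> ennreal c * emeasure \<mu> U"
    proof (rule Sup_least, clarify)
      fix K assume K: "compactin T K" "K \<subseteq> \<theta> ` U"
      have "\<theta>' ` K \<subseteq> U" using K(2) \<theta> openin_subset[OF U(1)] by force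
      then obtain D where D: "CO D" "\<theta>' ` K \<subseteq> D" "D \<subseteq> U"
        using CO_between[OF image_compactin[OF K(1) cont(2)] U(1)] by blast
      have "K \<subseteq> \<theta> ` D"
      proof
        fix x assume x: "x \<in> K"
        then have "\<theta>' x \<in> D" "x = \<theta> (\<theta>' x)" using D \<theta> compactin_subset_topspace[OF K(1)] by auto
        then show "x \<in> \<theta> ` D" by blast
      qed
      then have "emeasure \<mu> K \<le> emeasure \<mu> (\<theta> ` D)" using op D by (intro emeasure_mono open_sets) (auto simp: CO_def)
      also have "\<dots> \<le> ennreal c * emeasure \<mu> D" using le D U by auto
      also have "\<dots> \<le> ennreal c * emeasure \<mu> U" using D U by (intro mult_left_mono emeasure_mono open_sets) auto
      finally show "emeasure \<mu> K \<le> ennreal c * emeasure \<mu> U" .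
    qed
    finally show ?thesis .
  qed
  have c1: "ennreal (1/c) * ennreal c = 1" using c by (simp flip: ennreal_mult)
  \<comment> \<open>The constant is moved to the left as 1/c so that the right-hand side is exactly
    the infimum of outer regularity.\<close>
  have "ennreal (1/c) * emeasure \<mu> (\<theta> ` E) \<le> Inf {emeasure \<mu> U |U. openin T U \<and> E \<subseteq> U}"
  proof (rule Inf_greatest, clarify)
    fix V assume V: "openin T V" "E \<subseteq> V"
    have VA: "openin T (V \<inter> A)" using V A by auto
    have "emeasure \<mu> (\<theta> ` E) \<le> emeasure \<mu> (\<theta> ` (V \<inter> A))"
      using V E op[OF VA] by (intro emeasure_mono open_sets) auto
    also have "\<dots> \<le> ennreal c * emeasure \<mu> (V \<inter> A)" by (rule U[OF VA]) auto
    also have "\<dots> \<le> ennreal c * emeasure \<mu> V" using V by (intro mult_left_mono emeasure_mono open_sets) auto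
    finally have "ennreal (1/c) * emeasure \<mu> (\<theta> ` E) \<le> ennreal (1/c) * (ennreal c * emeasure \<mu> V)"
      by (rule mult_left_mono) simp
    then show "ennreal (1/c) * emeasure \<mu> (\<theta> ` E) \<le> emeasure \<mu> V" by (simp add: mult.assoc[symmetric] c1)
  qed
  also have "\<dots> = emeasure \<mu> E" by (rule outer_regular[OF E(1), symmetric])
  finally have "ennreal c * (ennreal (1/c) * emeasure \<mu> (\<theta> ` E)) \<le> ennreal c * emeasure \<mu> E"
    by (rule mult_left_mono) simp
  then show ?thesis by (simp add: mult.assoc[symmetric] mult.commute[of "ennreal c"] c1)
qed

lemma measurable_cont:
  assumes "continuous_map T T \<theta>" shows "\<theta> \<in> measurable \<mu> \<mu>"
proof (rule measurable_sigma_sets[OF sets_mu])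
  show "{U. openin T U} \<subseteq> Pow (carrier H)" using openin_subset by fastforce
  show "\<theta> \<in> space \<mu> \<rightarrow> carrier H" using assms by (auto simp: continuous_map_def)
  fix U assume "U \<in> {U. openin T U}"
  then have "openin T {x \<in> topspace T. \<theta> x \<in> U}" using assms by (auto simp: continuous_map_def)
  moreover have "{x \<in> topspace T. \<theta> x \<in> U} = \<theta> -` U \<inter> space \<mu>" by auto
  ultimately show "\<theta> -` U \<inter> space \<mu> \<in> sets \<mu>" using open_sets by metis
qed

lemma image_sets:
  assumes "continuous_map T T \<theta>'" "\<And>x. x \<in> carrier H \<Longrightarrow> \<theta> x \<in> carrier H"
    "\<And>x. x \<in> carrier H \<Longrightarrow> \<theta>' (\<theta> x) = x" "\<And>x. x \<in> carrier H \<Longrightarrow> \<theta> (\<theta>' x) = x" "E \<in> sets \<mu>"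
  shows "\<theta> ` E \<in> sets \<mu>" "\<theta> ` E = \<theta>' -` E \<inter> space \<mu>"
proof -
  have "E \<subseteq> carrier H" using sets.sets_into_space[OF assms(5)] by simp
  then show "\<theta> ` E = \<theta>' -` E \<inter> space \<mu>" using assms(2-4) by (auto simp: image_iff) (metis subsetD)
  then show "\<theta> ` E \<in> sets \<mu>" using measurable_sets[OF measurable_cont[OF assms(1)] assms(5)] by simp
qed

text \<open>The upper estimate for z and the one for its inverse combine to an equality, since the
  two moduli are reciprocal.\<close>

lemma emeasure_right:
  assumes z: "z \<in> carrier H" and E: "E \<in> sets \<mu>"
  shows "emeasure \<mu> ((\<lambda>y. y \<otimes> z) ` E) = ennreal (modulus z) * emeasure \<mu> E"
proof (rule antisym)
  have le: "emeasure \<mu> ((\<lambda>y. y \<otimes> z) ` E) \<le> ennreal (modulus z) * emeasure \<mu> E"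
    if z: "z \<in> carrier H" and E: "E \<in> sets \<mu>" for z E
  proof (rule le_by_compact_open[OF cont_right cont_right[of "inv z"]])
    show "openin T (carrier H)" using openin_topspace[of T] by simp
    show "E \<subseteq> carrier H" using sets.sets_into_space[OF E] by simp
  qed (use z E in \<open>auto simp: m_assoc modulus_pos emeasure_right_CO right_factor_modulus\<close>)
  show "emeasure \<mu> ((\<lambda>y. y \<otimes> z) ` E) \<le> ennreal (modulus z) * emeasure \<mu> E" by (rule le[OF z E])
  have Ec: "E \<subseteq> carrier H" using sets.sets_into_space[OF E] by simp
  have s: "(\<lambda>y. y \<otimes> z) ` E \<in> sets \<mu>"
    by (rule image_sets[OF cont_right[of "inv z"]]) (use z E in \<open>auto simp: m_assoc\<close>)
  have "(\<lambda>y. y \<otimes> inv z) ` (\<lambda>y. y \<otimes> z) ` E = E"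
    unfolding image_image using z Ec by (force simp: m_assoc)
  then have "emeasure \<mu> E \<le> ennreal (modulus (inv z)) * emeasure \<mu> ((\<lambda>y. y \<otimes> z) ` E)"
    using le[OF inv_closed[OF z] s] by simp
  then have "ennreal (modulus z) * emeasure \<mu> E \<le> ennreal (modulus z) * (ennreal (modulus (inv z)) * emeasure \<mu> ((\<lambda>y. y \<otimes> z) ` E))"
    by (rule mult_left_mono) simp
  then show "ennreal (modulus z) * emeasure \<mu> E \<le> emeasure \<mu> ((\<lambda>y. y \<otimes> z) ` E)"
    using modulus_inv_mult[OF z] by (simp add: mult.assoc[symmetric] flip: ennreal_mult)
qed

lemma modular_fun_eq: assumes z: "z \<in> carrier H" shows "modular_fun H \<mu> z = modulus z"
  unfolding modular_fun_def
proof (rule the_equality)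
  have eq: "E #> z = (\<lambda>y. y \<otimes> z) ` E" for E by (auto simp: r_coset_def)
  show "0 < modulus z \<and> (\<forall>E\<in>sets \<mu>. emeasure \<mu> (E #> z) = ennreal (modulus z) * emeasure \<mu> E)"
    using z by (simp add: eq emeasure_right modulus_pos)
  fix c assume c: "0 < c \<and> (\<forall>E\<in>sets \<mu>. emeasure \<mu> (E #> z) = ennreal c * emeasure \<mu> E)"
  then have "ennreal (modulus z) * emeasure \<mu> (tr b b) = ennreal c * emeasure \<mu> (tr b b)"
    using emeasure_right[OF z, of "tr b b"] by (simp add: eq)
  then show "c = modulus z" using c by (simp add: emeasure_tr_b)
qed

text \<open>The inverse of a left coset x N of a small open subgroup N is N translated on the right
  by the inverse of x, so its measure changes by \<open>modulus (inv x)\<close>, which is constant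
  on \<open>tr s t\<close>. The reverse inequality is the same estimate for the inverted
  set.\<close>

lemma emeasure_inv:
  assumes s: "s \<in> S" "t \<in> S" and y: "y \<in> tr s t" and E: "E \<in> sets \<mu>" "E \<subseteq> tr s t"
  shows "emeasure \<mu> ((\<lambda>y. inv y) ` E) = ennreal (modulus (inv y)) * emeasure \<mu> E"
proof (rule antisym)
  have CO: "emeasure \<mu> ((\<lambda>y. inv y) ` D) = ennreal (modulus (inv y)) * emeasure \<mu> D"
    if s: "s \<in> S" "t \<in> S" and y: "y \<in> tr s t" and D: "CO D" "D \<subseteq> tr s t" for s t y D
  proof -
    obtain F1 where F1: "F1 \<subseteq> S" "finite F1" "\<And>F. finite F \<Longrightarrow> F \<subseteq> S \<Longrightarrow> F1 \<subseteq> F \<Longrightarrow> \<exists>X. parts F (D) X"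
      using CO_partition[OF D(1)] by blast
    define F where "F = insert b F1"
    have F: "finite F" "F \<subseteq> S" "F1 \<subseteq> F" "b \<in> F" using F1 by (auto simp: F_def)
    obtain X where X: "X \<subseteq> D" "finite X" "disjoint_family_on (cyl F) X" "D = (\<Union>x\<in>X. cyl F x)"
      using F1(3)[OF F(1,2,3)] unfolding parts_def by blast
    have Xc: "X \<subseteq> carrier H" using X CO_sub[OF D(1)] by auto
    have inj: "inj_on (\<lambda>y. inv y) (carrier H)" by (rule inj_on_inverseI[of _ "\<lambda>y. inv y"]) simp
    have "disjoint_family_on (\<lambda>x. (\<lambda>y. inv y) ` cyl F x) X"
      using X(3) cyl_sub inj unfolding disjoint_family_on_def by (metis image_empty inj_on_image_Int)
    then have "emeasure \<mu> ((\<lambda>y. inv y) ` D) = (\<Sum>x\<in>X. emeasure \<mu> ((\<lambda>y. inv y) ` cyl F x))"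
      using X Xc F by (subst X(4), unfold image_UN, intro sum_emeasure[symmetric]) (auto intro!: CO_sets CO_inv CO_cyl)
    also have "\<dots> = (\<Sum>x\<in>X. ennreal (modulus (inv y)) * emeasure \<mu> (cyl F \<one>))"
    proof (rule sum.cong[OF refl])
      fix x assume x: "x \<in> X"
      then have xc: "x \<in> carrier H" "x \<in> tr s t" using Xc X D by auto
      have "(\<lambda>y. inv y) ` cyl F x = (\<lambda>y. y \<otimes> inv x) ` ((\<lambda>y. inv y) ` cyl F \<one>)"
        unfolding cyl_left[OF xc(1) F(2)] image_image using xc(1)
        by (auto simp: inv_mult_group cyl_def intro!: image_cong)
      also have "\<dots> = (\<lambda>y. y \<otimes> inv x) ` cyl F \<one>" using F by (simp add: cyl_inv_one)
      finally have "emeasure \<mu> ((\<lambda>y. inv y) ` cyl F x) = ennreal (modulus (inv x)) * emeasure \<mu> (cyl F \<one>)"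
        using xc F by (simp add: emeasure_right open_sets open_cyl)
      moreover have "modulus (inv x) = modulus (inv y)" using modulus_tr[OF s(1) xc(2) y] trD[OF y] xc by (simp add: modulus_inv)
      ultimately show "emeasure \<mu> ((\<lambda>y. inv y) ` cyl F x) = ennreal (modulus (inv y)) * emeasure \<mu> (cyl F \<one>)" by simp
    qed
    also have "\<dots> = ennreal (modulus (inv y)) * emeasure \<mu> D"
      using emeasure_UN_cyl[OF X(2) Xc F(1,2) X(3)] X(4) by (simp add: ac_simps)
    finally show ?thesis .
  qed
  have le: "emeasure \<mu> ((\<lambda>y. inv y) ` E) \<le> ennreal (modulus (inv y)) * emeasure \<mu> E"
    if s: "s \<in> S" "t \<in> S" and y: "y \<in> tr s t" and E: "E \<in> sets \<mu>" "E \<subseteq> tr s t" for s t y E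
  proof (rule le_by_compact_open[OF cont_inv cont_inv])
    show "openin T (tr s t)" using s by (intro open_tr)
    show "modulus (inv y) > 0" using trD[OF y] by (intro modulus_pos) auto
  qed (use E CO[OF s y] in auto)
  show "emeasure \<mu> ((\<lambda>y. inv y) ` E) \<le> ennreal (modulus (inv y)) * emeasure \<mu> E" by (rule le[OF s y E])
  have yc: "y \<in> carrier H" "inv y \<in> tr t s" using y s by (auto simp: tr_def)
  have sE: "(\<lambda>y. inv y) ` E \<in> sets \<mu>" by (rule image_sets[OF cont_inv]) (use E in auto)
  have "(\<lambda>y. inv y) ` E \<subseteq> tr t s" using image_mono[OF E(2), of "\<lambda>y. inv y"] tr_inv[OF s] by auto
  moreover have "(\<lambda>y. inv y) ` (\<lambda>y. inv y) ` E = E"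
    unfolding image_image using E(2) by (force simp: tr_def)
  ultimately have "emeasure \<mu> E \<le> ennreal (modulus y) * emeasure \<mu> ((\<lambda>y. inv y) ` E)"
    using le[OF s(2,1) yc(2) sE] yc by simp
  have e1: "ennreal (modulus (inv y)) * ennreal (modulus y) = 1"
    using modulus_inv_mult[OF yc(1)] by (simp add: mult.commute flip: ennreal_mult)
  from \<open>emeasure \<mu> E \<le> _\<close>
  have "ennreal (modulus (inv y)) * emeasure \<mu> E \<le> ennreal (modulus (inv y)) * (ennreal (modulus y) * emeasure \<mu> ((\<lambda>y. inv y) ` E))"
    by (rule mult_left_mono) simp
  then show "ennreal (modulus (inv y)) * emeasure \<mu> E \<le> emeasure \<mu> ((\<lambda>y. inv y) ` E)"
    using e1 by (simp add: mult.assoc[symmetric])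
qed

section \<open>Change of variables in integrals\<close>

lemma distr_left:
  assumes x: "x \<in> carrier H" shows "distr \<mu> \<mu> (\<lambda>y. x \<otimes> y) = \<mu>"
proof (rule measure_eqI)
  fix E assume "E \<in> sets (distr \<mu> \<mu> (\<lambda>y. x \<otimes> y))"
  then have E: "E \<in> sets \<mu>" by simp
  have "(\<lambda>y. inv x \<otimes> y) ` E = (\<lambda>y. x \<otimes> y) -` E \<inter> space \<mu>"
    by (rule image_sets(2)[OF cont_left[OF x]]) (use x E in \<open>auto simp: m_assoc[symmetric]\<close>)
  then show "emeasure (distr \<mu> \<mu> (\<lambda>y. x \<otimes> y)) E = emeasure \<mu> E"
    using x E left_inv[of "inv x" E] by (simp add: emeasure_distr measurable_cont cont_left)
qed simp

lemma distr_inv: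
  assumes s: "s \<in> S" "t \<in> S" and y: "y \<in> tr s t"
  shows "distr (density \<mu> (indicator (tr t s))) \<mu> (\<lambda>y. inv y)
     = density \<mu> (\<lambda>x. ennreal (modulus (inv y)) * indicator (tr s t) x)"
proof (rule measure_eqI)
  fix E assume "E \<in> sets (distr (density \<mu> (indicator (tr t s))) \<mu> (\<lambda>y. inv y))"
  then have E: "E \<in> sets \<mu>" by simp
  have m: "(\<lambda>y. inv y) \<in> measurable \<mu> \<mu>" by (rule measurable_cont[OF cont_inv])
  have pre: "(\<lambda>y. inv y) -` E \<inter> space \<mu> \<in> sets \<mu>" by (rule measurable_sets[OF m E])
  have Es: "E \<inter> tr s t \<in> sets \<mu>" using E s by auto
  have "emeasure (distr (density \<mu> (indicator (tr t s))) \<mu> (\<lambda>y. inv y)) E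
      = emeasure (density \<mu> (indicator (tr t s))) ((\<lambda>y. inv y) -` E \<inter> space \<mu>)"
    using E m by (subst emeasure_distr) auto
  also have "\<dots> = emeasure \<mu> (tr t s \<inter> ((\<lambda>y. inv y) -` E \<inter> space \<mu>))"
  proof (subst emeasure_density)
    show "indicator (tr t s) \<in> borel_measurable \<mu>" by (rule borel_measurable_indicator[OF tr_sets[OF s(2)]])
    have i: "tr t s \<inter> ((\<lambda>y. inv y) -` E \<inter> space \<mu>) \<in> sets \<mu>" using pre s by auto
    show "(\<integral>\<^sup>+ x. indicator (tr t s) x * indicator ((\<lambda>y. inv y) -` E \<inter> space \<mu>) x \<partial>\<mu>) =
        emeasure \<mu> (tr t s \<inter> ((\<lambda>y. inv y) -` E \<inter> space \<mu>))"
      unfolding indicator_inter_arith[symmetric] by (rule nn_integral_indicator[OF i])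
  qed (rule pre)
  also have "tr t s \<inter> ((\<lambda>y. inv y) -` E \<inter> space \<mu>) = (\<lambda>y. inv y) ` (E \<inter> tr s t)"
  proof safe
    fix x assume "x \<in> tr t s" "x \<in> space \<mu>" "inv x \<in> E"
    then have "inv x \<in> E \<inter> tr s t" "x = inv (inv x)" using s by (auto simp: tr_def)
    then show "x \<in> (\<lambda>y. inv y) ` (E \<inter> tr s t)" by blast
  qed (use s in \<open>auto simp: tr_def\<close>)
  also have "emeasure \<mu> ((\<lambda>y. inv y) ` (E \<inter> tr s t)) = ennreal (modulus (inv y)) * emeasure \<mu> (E \<inter> tr s t)"
    by (rule emeasure_inv[OF s y Es]) auto
  also have "\<dots> = emeasure (density \<mu> (\<lambda>x. ennreal (modulus (inv y)) * indicator (tr s t) x)) E"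
  proof (subst emeasure_density)
    show "(\<lambda>x. ennreal (modulus (inv y)) * indicator (tr s t) x) \<in> borel_measurable \<mu>"
      using s by (intro borel_measurable_times_ennreal borel_measurable_const borel_measurable_indicator tr_sets)
    show "ennreal (modulus (inv y)) * emeasure \<mu> (E \<inter> tr s t) =
       (\<integral>\<^sup>+ x. ennreal (modulus (inv y)) * indicator (tr s t) x * indicator E x \<partial>\<mu>)"
      unfolding mult.assoc indicator_inter_arith[symmetric] using Es
      by (simp only: nn_integral_cmult_indicator Int_commute)
  qed (rule E)
  finally show "emeasure (distr (density \<mu> (indicator (tr t s))) \<mu> (\<lambda>y. inv y)) E
     = emeasure (density \<mu> (\<lambda>x. ennreal (modulus (inv y)) * indicator (tr s t) x)) E" .
qed simp

lemma integral_left: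
  fixes \<phi> :: "'g \<Rightarrow> complex"
  assumes "x \<in> carrier H" "\<phi> \<in> borel_measurable \<mu>"
  shows "(\<integral>y. \<phi> (x \<otimes> y) \<partial>\<mu>) = (\<integral>y. \<phi> y \<partial>\<mu>)"
  using integral_distr[OF measurable_cont[OF cont_left[OF assms(1)]] assms(2)] distr_left[OF assms(1)] by simp

lemma integral_inv:
  fixes \<phi> :: "'g \<Rightarrow> complex"
  assumes s: "s \<in> S" "t \<in> S" "y \<in> tr s t" and \<phi>: "\<phi> \<in> borel_measurable \<mu>"
  shows "(\<integral>x. indicator (tr t s) x *\<^sub>R \<phi> (inv x) \<partial>\<mu>) = modulus (inv y) *\<^sub>R (\<integral>x. indicator (tr s t) x *\<^sub>R \<phi> x \<partial>\<mu>)"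
proof -
  have m: "(\<lambda>y. inv y) \<in> measurable \<mu> \<mu>" by (rule measurable_cont[OF cont_inv])
  have "(\<integral>x. indicator (tr t s) x *\<^sub>R \<phi> (inv x) \<partial>\<mu>) = integral\<^sup>L (density \<mu> (\<lambda>x. ennreal (indicator (tr t s) x))) (\<lambda>x. \<phi> (inv x))"
    using s \<phi> measurable_compose[OF m \<phi>] by (subst integral_density) (auto intro: borel_measurable_indicator)
  also have "\<dots> = integral\<^sup>L (distr (density \<mu> (indicator (tr t s))) \<mu> (\<lambda>y. inv y)) \<phi>"
    using m \<phi> by (subst integral_distr) (auto simp: ennreal_indicator)
  also have "\<dots> = integral\<^sup>L (density \<mu> (\<lambda>x. ennreal (modulus (inv y) * indicator (tr s t) x))) \<phi>"
    by (simp add: distr_inv[OF s] ennreal_mult ennreal_indicator)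
  also have "\<dots> = (\<integral>x. (modulus (inv y) * indicator (tr s t) x) *\<^sub>R \<phi> x \<partial>\<mu>)"
    using s \<phi> by (subst integral_density) (auto intro!: borel_measurable_times borel_measurable_indicator)
  finally show ?thesis by (simp flip: scaleR_scaleR)
qed

lemma norm_integral_le:
  fixes f :: "'g \<Rightarrow> complex"
  assumes "integrable \<mu> f" "integrable \<mu> h" "\<And>x. x \<in> space \<mu> \<Longrightarrow> norm (f x) \<le> h x"
  shows "norm (\<integral>x. f x \<partial>\<mu>) \<le> (\<integral>x. h x \<partial>\<mu>)"
proof -
  have "norm (\<integral>x. f x \<partial>\<mu>) \<le> (\<integral>x. norm (f x) \<partial>\<mu>)" by (rule integral_norm_bound)
  also have "\<dots> \<le> (\<integral>x. h x \<partial>\<mu>)" using assms by (intro integral_mono) auto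
  finally show ?thesis .
qed

lemma compact_orbit:
  assumes K: "compactin T K" and s: "s \<in> S"
  shows "finite ((\<lambda>x. act x s) ` K)" "finite ((\<lambda>x. act (inv x) s) ` K)"
proof -
  have *: "finite ((\<lambda>x. act x s) ` K)" if K: "compactin T K" for K
  proof -
    have Kc: "K \<subseteq> carrier H" using compactin_subset_topspace[OF K] by simp
    have "\<exists>X\<subseteq>K. finite X \<and> K \<subseteq> (\<Union>x\<in>X. tr s (act x s))"
      by (rule compact_cover[OF K]) (use s Kc in \<open>auto simp: open_tr\<close>)
    then obtain X where X: "finite X" "K \<subseteq> (\<Union>x\<in>X. tr s (act x s))" by blast
    have "(\<lambda>x. act x s) ` K \<subseteq> (\<lambda>x. act x s) ` X" using X(2) by (force simp: tr_def)
    then show ?thesis using X(1) finite_subset by blast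
  qed
  show "finite ((\<lambda>x. act x s) ` K)" by (rule *[OF K])
  show "finite ((\<lambda>x. act (inv x) s) ` K)"
    using *[OF image_compactin[OF K cont_inv]] by (simp add: image_image)
qed

section \<open>Compactly supported continuous functions\<close>

abbreviation "Cc \<equiv> Cc_alg H T \<mu>"

lemma CcD0: "f \<in> carrier Cc \<Longrightarrow> x \<notin> carrier H \<Longrightarrow> f x = 0"
  unfolding Cc_alg_def using compactin_subset_topspace[of T] by auto

lemma Cc_K:
  assumes "f \<in> carrier Cc" obtains K where "compactin T K" "\<And>x. f x \<noteq> 0 \<Longrightarrow> x \<in> K"
  using assms unfolding Cc_alg_def by auto

lemma Cc_supp:
  assumes "f \<in> carrier Cc" "t \<in> S"
  shows "finite {act x t | x. f x \<noteq> 0}" "finite {act (inv x) t | x. f x \<noteq> 0}"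
proof -
  obtain K where K: "compactin T K" "\<And>x. f x \<noteq> 0 \<Longrightarrow> x \<in> K" by (rule Cc_K[OF assms(1)]) blast
  have "{act x t | x. f x \<noteq> 0} \<subseteq> (\<lambda>x. act x t) ` K" "{act (inv x) t | x. f x \<noteq> 0} \<subseteq> (\<lambda>x. act (inv x) t) ` K"
    using K(2) by auto
  then show "finite {act x t | x. f x \<noteq> 0}" "finite {act (inv x) t | x. f x \<noteq> 0}"
    using compact_orbit[OF K(1) assms(2)] finite_subset by blast+
qed

lemma Cc_cont: "f \<in> carrier Cc \<Longrightarrow> continuous_map T euclidean f"
  by (simp add: Cc_alg_def)

lemma Cc_local:
  assumes f: "f \<in> carrier Cc" and x: "x \<in> carrier H" and e: "e > 0"
  shows "\<exists>F\<subseteq>S. finite F \<and> (\<forall>y\<in>cyl F x. cmod (f y - f x) < e)"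
proof -
  have "openin T {y \<in> topspace T. f y \<in> ball (f x) e}"
    using Cc_cont[OF f] by (rule openin_continuous_map_preimage) simp
  moreover have "x \<in> {y \<in> topspace T. f y \<in> ball (f x) e}" using x e by simp
  ultimately obtain F where F: "F \<subseteq> S" "finite F" "cyl F x \<subseteq> {y \<in> topspace T. f y \<in> ball (f x) e}"
    using openE_cyl by meson
  have "\<forall>y\<in>cyl F x. cmod (f y - f x) < e"
    using F(3) by (auto simp: dist_norm norm_minus_commute)
  then show ?thesis using F by blast
qed

lemma CcI:
  assumes z: "\<And>x. x \<notin> carrier H \<Longrightarrow> f x = 0" and E: "finite E" "E \<subseteq> S" "\<And>x. f x \<noteq> 0 \<Longrightarrow> act x b \<in> E"
    and loc: "\<And>x e. x \<in> carrier H \<Longrightarrow> e > 0 \<Longrightarrow> \<exists>F\<subseteq>S. finite F \<and> (\<forall>y\<in>cyl F x. cmod (f y - f x) < e)"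
  shows "f \<in> carrier Cc"
proof -
  have "continuous_map T euclidean f"
    unfolding continuous_map_def
  proof (intro conjI allI impI)
    fix U :: "complex set" assume "openin euclidean U"
    then have U: "open U" by simp
    show "openin T {x \<in> topspace T. f x \<in> U}"
      unfolding open_iff
    proof (intro conjI ballI)
      fix x assume x: "x \<in> {x \<in> topspace T. f x \<in> U}"
      then obtain e where e: "e > 0" "ball (f x) e \<subseteq> U" using U by (auto simp: open_contains_ball)
      obtain F where F: "F \<subseteq> S" "finite F" "\<forall>y\<in>cyl F x. cmod (f y - f x) < e" using loc[OF _ e(1), of x] x by auto
      have "y \<in> {x \<in> topspace T. f x \<in> U}" if "y \<in> carrier H" "\<forall>s\<in>F. act y s = act x s" for y
      proof -
        have "cmod (f y - f x) < e" using F that by (auto simp: cyl_def)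
        then have "f y \<in> ball (f x) e" by (simp add: dist_norm norm_minus_commute)
        then show ?thesis using e that by auto
      qed
      then show "\<exists>F\<subseteq>S. finite F \<and> (\<forall>y\<in>carrier H. (\<forall>s\<in>F. act y s = act x s) \<longrightarrow> y \<in> {x \<in> topspace T. f x \<in> U})"
        using F by blast
    qed auto
  qed auto
  moreover have "compactin T (\<Union>t\<in>E. tr b t)"
    using CO_UN[OF E(1), of "\<lambda>t. tr b t"] CO_tr[OF b_in] E(2) by (auto simp: CO_def)
  moreover have "f x = 0" if "x \<notin> (\<Union>t\<in>E. tr b t)" for x
    using that z E(3) by (auto simp: tr_def)
  ultimately show ?thesis unfolding Cc_alg_def by auto
qed

text \<open>Uniform continuity along left cosets. On the support set K it is compactness; off K the
  point \<open>b\<close> in F keeps the cylinder in one left coset of the stabiliser, so the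
  cylinder stays off K and f vanishes on it.\<close>

lemma Cc_unif:
  assumes f: "f \<in> carrier Cc" and e: "e > 0"
  shows "\<exists>F\<subseteq>S. finite F \<and> b \<in> F \<and> (\<forall>x\<in>carrier H. \<forall>y\<in>cyl F x. cmod (f y - f x) \<le> e)"
proof -
  define E where "E = {act x b | x. f x \<noteq> 0}"
  have fin: "finite E" using Cc_supp[OF f b_in] by (simp add: E_def)
  have ES: "E \<subseteq> S" using CcD0[OF f] by (auto simp: E_def) (metis act_in b_in)
  define K where "K = (\<Union>t\<in>E. tr b t)"
  have "CO K" unfolding K_def using fin ES by (intro CO_UN CO_tr) auto
  then have K: "compactin T K" "K \<subseteq> carrier H" using CO_sub by (auto simp: CO_def)
  have K0: "f x = 0" if "x \<in> carrier H" "x \<notin> K" for x using that by (auto simp: K_def E_def)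
  have e2: "e/2 > 0" using e by simp
  have "\<forall>x\<in>K. \<exists>F\<subseteq>S. finite F \<and> (\<forall>y\<in>cyl F x. cmod (f y - f x) < e/2)"
    using Cc_local[OF f _ e2] K(2) by blast
  then obtain g where g: "\<And>x. x \<in> K \<Longrightarrow> g x \<subseteq> S \<and> finite (g x) \<and> (\<forall>y\<in>cyl (g x) x. cmod (f y - f x) < e/2)" by metis
  have "\<exists>X\<subseteq>K. finite X \<and> K \<subseteq> (\<Union>x\<in>X. cyl (g x) x)"
    by (rule compact_cover[OF K(1)]) (use g K(2) in \<open>auto simp: open_cyl cyl_self subset_iff\<close>)
  then obtain X where X: "X \<subseteq> K" "finite X" "K \<subseteq> (\<Union>x\<in>X. cyl (g x) x)" by blast
  define F where "F = insert b (\<Union>x\<in>X. g x)"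
  have gX: "g x \<subseteq> S" "finite (g x)" if "x \<in> X" for x using g X(1) that by blast+
  then have FS: "F \<subseteq> S" "finite F" "b \<in> F" using X(2) unfolding F_def by auto
  have "cmod (f y - f x) \<le> e" if x: "x \<in> carrier H" and y: "y \<in> cyl F x" for x y
  proof (cases "x \<in> K")
    case True
    then have "x \<in> (\<Union>x\<in>X. cyl (g x) x)" using X(3) by (rule rev_subsetD)
    then obtain z where z: "z \<in> X" "x \<in> cyl (g z) z" by (rule UN_E)
    then have "y \<in> cyl (g z) z" using y by (auto simp: cyl_def F_def)
    then have "cmod (f y - f z) < e/2" "cmod (f x - f z) < e/2" using g z X(1) by blast+
    then show ?thesis using norm_triangle_ineq4[of "f y - f z" "f x - f z"] by simp
  next
    case False
    have "act y b = act x b" using y by (auto simp: cyl_def F_def)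
    then have "y \<notin> K" using False x by (auto simp: K_def tr_def)
    then show ?thesis using K0 False x y e by (auto simp: cyl_def)
  qed
  then show ?thesis using FS by blast
qed

lemma Cc_measurable: assumes "f \<in> carrier Cc" shows "f \<in> borel_measurable \<mu>"
proof (rule borel_measurableI)
  fix U :: "complex set" assume "open U"
  then have "openin T {x \<in> topspace T. f x \<in> U}"
    using Cc_cont[OF assms] by (intro openin_continuous_map_preimage) auto
  moreover have "{x \<in> topspace T. f x \<in> U} = f -` U \<inter> space \<mu>" by auto
  ultimately show "f -` U \<inter> space \<mu> \<in> sets \<mu>" using open_sets by metis
qed

lemma Cc_bounded: assumes f: "f \<in> carrier Cc" shows "\<exists>B>0. \<forall>x. cmod (f x) \<le> B"
proof -
  obtain K where K: "compactin T K" "\<And>x. f x \<noteq> 0 \<Longrightarrow> x \<in> K" by (rule Cc_K[OF f]) blast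
  have "compactin euclidean (f ` K)" by (rule image_compactin[OF K(1) Cc_cont[OF f]])
  then have "bounded (f ` K)" by (simp add: compact_imp_bounded)
  then obtain B where "B > 0" "\<forall>x\<in>K. cmod (f x) \<le> B" by (auto simp: bounded_pos)
  then have "\<forall>x. cmod (f x) \<le> B" using K(2) by (metis less_imp_le norm_zero)
  then show ?thesis using \<open>B > 0\<close> by blast
qed

lemma bounded_integrable:
  fixes f :: "'g \<Rightarrow> complex"
  assumes "f \<in> borel_measurable \<mu>" "\<And>x. cmod (f x) \<le> B" "finite E" "E \<subseteq> S"
    "\<And>x. x \<in> carrier H \<Longrightarrow> f x \<noteq> 0 \<Longrightarrow> act x b \<in> E"
  shows "integrable \<mu> f"
proof (rule integrableI_bounded_set[where A = "\<Union>t\<in>E. tr b t" and B = B])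
  have CO: "CO (\<Union>t\<in>E. tr b t)" using assms by (intro CO_UN CO_tr) auto
  show "(\<Union>t\<in>E. tr b t) \<in> sets \<mu>" "emeasure \<mu> (\<Union>t\<in>E. tr b t) < \<infinity>" using CO_sets[OF CO] CO_finite[OF CO] by auto
  show "AE x in \<mu>. x \<notin> (\<Union>t\<in>E. tr b t) \<longrightarrow> f x = 0"
    using assms(5) by (intro AE_I2) (auto simp: tr_def)
qed (use assms in auto)

lemma Cc_integrable: assumes f: "f \<in> carrier Cc" shows "integrable \<mu> f"
proof -
  obtain B where "\<forall>x. cmod (f x) \<le> B" using Cc_bounded[OF f] by blast
  moreover have "{act x b | x. f x \<noteq> 0} \<subseteq> S" using CcD0[OF f] by auto (metis act_in b_in)
  ultimately show ?thesis
    using Cc_measurable[OF f] Cc_supp(1)[OF f b_in]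
    by (intro bounded_integrable[where B = B and E = "{act x b | x. f x \<noteq> 0}"]) auto
qed

lemma Cc_norm: assumes f: "f \<in> carrier Cc" shows "(\<lambda>x. complex_of_real (cmod (f x))) \<in> carrier Cc"
proof (rule CcI)
  show "finite {act x b | x. f x \<noteq> 0}" by (rule Cc_supp(1)[OF f b_in])
  show "{act x b | x. f x \<noteq> 0} \<subseteq> S" using CcD0[OF f] by auto (metis act_in b_in)
  fix x and e :: real assume x: "x \<in> carrier H" "e > 0"
  then obtain F where F: "F \<subseteq> S" "finite F" "\<forall>y\<in>cyl F x. cmod (f y - f x) < e" using Cc_local[OF f] by blast
  have "cmod (complex_of_real (cmod (f y)) - complex_of_real (cmod (f x))) < e" if "y \<in> cyl F x" for y
    using F(3) that norm_triangle_ineq3[of "f y" "f x"] by (simp flip: of_real_diff) (metis order_le_less_trans)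
  then show "\<exists>F\<subseteq>S. finite F \<and> (\<forall>y\<in>cyl F x. cmod (complex_of_real (cmod (f y)) - complex_of_real (cmod (f x))) < e)"
    using F by blast
qed (auto simp: CcD0[OF f])

text \<open>The matrix of \<open>f\<close> in the permutation representation on \<open>\<ell>\<^sup>2(S)\<close>.\<close>

definition mat :: "('g \<Rightarrow> complex) \<Rightarrow> 's \<Rightarrow> 's \<Rightarrow> complex" where
  "mat f s t = (if s \<in> S \<and> t \<in> S then (\<integral>x. indicator (tr t s) x *\<^sub>R f x \<partial>\<mu>) else 0)"

section \<open>Matrices of compactly supported functions\<close>

lemma mat_nonzero:
  assumes "mat f s t \<noteq> 0" shows "s \<in> S \<and> t \<in> S \<and> (\<exists>x. f x \<noteq> 0 \<and> x \<in> tr t s)"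
proof -
  have st: "s \<in> S" "t \<in> S" using assms by (auto simp: mat_def split: if_splits)
  have "\<exists>x. indicator (tr t s) x *\<^sub>R f x \<noteq> 0"
  proof (rule ccontr)
    assume "\<not> (\<exists>x. indicator (tr t s) x *\<^sub>R f x \<noteq> 0)"
    then have "(\<lambda>x. indicator (tr t s) x *\<^sub>R f x) = (\<lambda>x. 0)" by blast
    then show False using assms st by (simp add: mat_def)
  qed
  then show ?thesis using st by (auto simp: indicator_def split: if_splits)
qed

lemma mat_col:
  assumes "f \<in> carrier Cc" shows "finite {s. mat f s t \<noteq> 0}"
proof (cases "t \<in> S")
  case True
  have "{s. mat f s t \<noteq> 0} \<subseteq> {act x t | x. f x \<noteq> 0}" using mat_nonzero by (fastforce simp: tr_def)
  then show ?thesis using Cc_supp(1)[OF assms True] finite_subset by blast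
qed (simp add: mat_def)

lemma colfin_mat: "f \<in> carrier Cc \<Longrightarrow> colfin (mat f)"
  by (simp add: colfin_def mat_col)

lemma integrable_tr: "integrable \<mu> (f :: 'g \<Rightarrow> complex) \<Longrightarrow> t \<in> S \<Longrightarrow> integrable \<mu> (\<lambda>x. indicator (tr t s) x *\<^sub>R f x)"
  by (rule integrable_mult_indicator) auto

text \<open>Every group element sends t to exactly one point, so the sets \<open>tr t s\<close>
  partition the group and each column sums to the whole integral. \<open>integral_rows\<close> is
  the same for preimages of s. These identities give both the Schur bounds and the total masses
  below.\<close>

lemma integral_cols:
  assumes f: "integrable \<mu> f" and t: "t \<in> S" and F: "finite F" "F \<subseteq> S"
    and supp: "\<And>x. x \<in> carrier H \<Longrightarrow> f x \<noteq> 0 \<Longrightarrow> act x t \<in> F"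
  shows "(\<integral>x. f x \<partial>\<mu>) = (\<Sum>s\<in>F. mat f s t)"
proof -
  have eq: "f x = (\<Sum>s\<in>F. indicator (tr t s) x *\<^sub>R f x)" if x: "x \<in> carrier H" for x
  proof (cases "f x = 0")
    case False
    have "(\<Sum>s\<in>F. indicator (tr t s) x *\<^sub>R f x) = (\<Sum>s\<in>F. if s = act x t then f x else 0)"
      using x by (intro sum.cong refl) (auto simp: tr_def indicator_def)
    then show ?thesis using supp[OF x False] F by simp
  qed simp
  have "(\<integral>x. f x \<partial>\<mu>) = (\<integral>x. (\<Sum>s\<in>F. indicator (tr t s) x *\<^sub>R f x) \<partial>\<mu>)"
    using eq by (intro Bochner_Integration.integral_cong) auto
  also have "\<dots> = (\<Sum>s\<in>F. \<integral>x. indicator (tr t s) x *\<^sub>R f x \<partial>\<mu>)"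
    using f t by (intro Bochner_Integration.integral_sum integrable_tr)
  also have "\<dots> = (\<Sum>s\<in>F. mat f s t)" using F t by (intro sum.cong) (auto simp: mat_def)
  finally show ?thesis .
qed

lemma integral_rows:
  assumes f: "integrable \<mu> f" and s: "s \<in> S" and F: "finite F" "F \<subseteq> S"
    and supp: "\<And>x. x \<in> carrier H \<Longrightarrow> f x \<noteq> 0 \<Longrightarrow> act (inv x) s \<in> F"
  shows "(\<integral>x. f x \<partial>\<mu>) = (\<Sum>t\<in>F. mat f s t)"
proof -
  have eq: "f x = (\<Sum>t\<in>F. indicator (tr t s) x *\<^sub>R f x)" if x: "x \<in> carrier H" for x
  proof (cases "f x = 0")
    case False
    have "(\<Sum>t\<in>F. indicator (tr t s) x *\<^sub>R f x) = (\<Sum>t\<in>F. if t = act (inv x) s then f x else 0)"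
      using x s F by (intro sum.cong refl) (auto simp: tr_def indicator_def)
    then show ?thesis using supp[OF x False] F by simp
  qed simp
  have "(\<integral>x. f x \<partial>\<mu>) = (\<integral>x. (\<Sum>t\<in>F. indicator (tr t s) x *\<^sub>R f x) \<partial>\<mu>)"
    using eq by (intro Bochner_Integration.integral_cong) auto
  also have "\<dots> = (\<Sum>t\<in>F. \<integral>x. indicator (tr t s) x *\<^sub>R f x \<partial>\<mu>)"
    using f F by (intro Bochner_Integration.integral_sum integrable_tr) auto
  also have "\<dots> = (\<Sum>t\<in>F. mat f s t)" using F s by (intro sum.cong) (auto simp: mat_def)
  finally show ?thesis .
qed

lemma translate_measurable:
  assumes "(h :: 'g \<Rightarrow> complex) \<in> borel_measurable \<mu>" "x \<in> carrier H"
  shows "(\<lambda>y. h (inv y \<otimes> x)) \<in> borel_measurable \<mu>"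
  by (rule measurable_compose[OF measurable_compose[OF measurable_cont[OF cont_inv] measurable_cont[OF cont_right[OF assms(2)]]] assms(1)])

lemma conv_integrable:
  assumes f: "f \<in> carrier Cc" and h: "h \<in> carrier Cc" and x: "x \<in> carrier H"
  shows "integrable \<mu> (\<lambda>y. f y * h (inv y \<otimes> x))"
proof -
  obtain B where B: "\<forall>x. cmod (h x) \<le> B" using Cc_bounded[OF h] by blast
  show ?thesis
  proof (rule Bochner_Integration.integrable_bound)
    show "integrable \<mu> (\<lambda>y. B * cmod (f y))" using Cc_integrable[OF f] by auto
    show "(\<lambda>y. f y * h (inv y \<otimes> x)) \<in> borel_measurable \<mu>"
      using Cc_measurable[OF f] translate_measurable[OF Cc_measurable[OF h] x] by (rule borel_measurable_times)
    show "AE y in \<mu>. norm (f y * h (inv y \<otimes> x)) \<le> norm (B * cmod (f y))"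
    proof (rule AE_I2)
      fix y
      have "cmod (h (inv y \<otimes> x)) \<le> \<bar>B\<bar>" using B by (meson abs_ge_self order_trans)
      then show "norm (f y * h (inv y \<otimes> x)) \<le> norm (B * cmod (f y))"
        by (simp add: norm_mult abs_mult mult.commute[of "\<bar>B\<bar>"] mult_left_mono)
    qed
  qed
qed

abbreviation "conv \<equiv> convolution H \<mu>"

lemma conv_in: "x \<in> carrier H \<Longrightarrow> conv f h x = (\<integral>y. f y * h (inv y \<otimes> x) \<partial>\<mu>)"
  by (simp add: convolution_def)

text \<open>Left translation permutes cylinders with the same F, so a convolution inherits the
  uniform continuity of its second factor, scaled by the L^1-norm of the first.\<close>

lemma conv_unif:
  assumes f: "f \<in> carrier Cc" and h: "h \<in> carrier Cc" and x: "x \<in> carrier H" and y: "y \<in> cyl F x" and F: "F \<subseteq> S"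
    and u: "\<forall>x\<in>carrier H. \<forall>y\<in>cyl F x. cmod (h y - h x) \<le> e"
  shows "cmod (conv f h y - conv f h x) \<le> e * (\<integral>z. cmod (f z) \<partial>\<mu>)"
proof -
  have yc: "y \<in> carrier H" using y by (auto simp: cyl_def)
  note i = conv_integrable[OF f h x] conv_integrable[OF f h yc]
  have "conv f h y - conv f h x = (\<integral>z. f z * (h (inv z \<otimes> y) - h (inv z \<otimes> x)) \<partial>\<mu>)"
    using x yc i by (simp add: conv_in right_diff_distrib)
  also have "cmod \<dots> \<le> (\<integral>z. e * cmod (f z) \<partial>\<mu>)"
  proof (rule norm_integral_le)
    show "integrable \<mu> (\<lambda>z. f z * (h (inv z \<otimes> y) - h (inv z \<otimes> x)))" using i by (simp add: right_diff_distrib)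
    show "integrable \<mu> (\<lambda>z. e * cmod (f z))" using Cc_integrable[OF f] by auto
    fix z assume "z \<in> space \<mu>"
    then have z: "z \<in> carrier H" by simp
    have "inv z \<otimes> y \<in> cyl F (inv z \<otimes> x)" using z x y F by (auto simp: cyl_def act_mult subset_iff)
    then have "cmod (h (inv z \<otimes> y) - h (inv z \<otimes> x)) \<le> e" using u z x by simp
    then show "norm (f z * (h (inv z \<otimes> y) - h (inv z \<otimes> x))) \<le> e * cmod (f z)"
      by (simp add: norm_mult mult.commute[of e] mult_left_mono)
  qed
  finally show ?thesis by simp
qed

lemma conv_Cc:
  assumes f: "f \<in> carrier Cc" and h: "h \<in> carrier Cc" shows "conv f h \<in> carrier Cc"
proof (rule CcI)
  let ?Eh = "{act x b | x. h x \<noteq> 0}"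
  let ?E = "\<Union>t\<in>?Eh. {act y t | y. f y \<noteq> 0}"
  have EhS: "?Eh \<subseteq> S" using CcD0[OF h] by auto (metis act_in b_in)
  show "finite ?E" using Cc_supp(1)[OF h b_in] EhS Cc_supp(1)[OF f] by blast
  show "?E \<subseteq> S" using EhS CcD0[OF f] by (force intro: act_in)
  show "conv f h x = 0" if "x \<notin> carrier H" for x using that by (simp add: convolution_def)
  show "act x b \<in> ?E" if x: "conv f h x \<noteq> 0" for x
  proof -
    have xc: "x \<in> carrier H" using x by (auto simp: convolution_def split: if_splits)
    have "\<exists>y. f y * h (inv y \<otimes> x) \<noteq> 0"
    proof (rule ccontr)
      assume "\<not> (\<exists>y. f y * h (inv y \<otimes> x) \<noteq> 0)"
      then have "(\<lambda>y. f y * h (inv y \<otimes> x)) = (\<lambda>y. 0)" by blast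
      then show False using x xc by (simp add: conv_in)
    qed
    then obtain y where y: "f y \<noteq> 0" "h (inv y \<otimes> x) \<noteq> 0" by auto
    then have yc: "y \<in> carrier H" using CcD0[OF f] by blast
    have "act x b = act y (act (inv y \<otimes> x) b)" using yc xc by (simp add: act_mult)
    then show ?thesis using y by blast
  qed
  fix x and e :: real assume x: "x \<in> carrier H" and e: "e > 0"
  let ?N = "\<integral>z. cmod (f z) \<partial>\<mu>"
  have N: "?N + 1 > 0" by (simp add: add_nonneg_pos)
  then have d: "e / (?N + 1) > 0" using e by simp
  obtain F where F: "F \<subseteq> S" "finite F" "\<forall>x\<in>carrier H. \<forall>y\<in>cyl F x. cmod (h y - h x) \<le> e / (?N + 1)"
    using Cc_unif[OF h d] by blast
  have "e / (?N + 1) * ?N < e" using N e by (simp add: field_simps)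
  then have "\<forall>y\<in>cyl F x. cmod (conv f h y - conv f h x) < e"
    using conv_unif[OF f h x _ F(1,3)] by (meson order_le_less_trans)
  then show "\<exists>F\<subseteq>S. finite F \<and> (\<forall>y\<in>cyl F x. cmod (conv f h y - conv f h x) < e)" using F by blast
qed

text \<open>All cosets of the partition have the measure of \<open>cyl F \<one>\<close>, so the
  integral is close to that measure times the sum of sampled values. A finite sum commutes with a
  second integral, which takes the place of Fubini.\<close>

lemma riemann_sum:
  fixes g :: "'g \<Rightarrow> complex"
  assumes A: "parts F A X" "CO A" and F: "finite F" "F \<subseteq> S" "b \<in> F" and g: "integrable \<mu> g"
    and u: "\<And>x y. x \<in> carrier H \<Longrightarrow> y \<in> cyl F x \<Longrightarrow> cmod (g y - g x) \<le> d"
  shows "cmod ((\<integral>x. indicator A x *\<^sub>R g x \<partial>\<mu>) - measure \<mu> (cyl F \<one>) *\<^sub>R (\<Sum>x\<in>X. g x)) \<le> d * measure \<mu> A"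
proof -
  have X: "X \<subseteq> A" "finite X" "disjoint_family_on (cyl F) X" "A = (\<Union>x\<in>X. cyl F x)" using A by (auto simp: parts_def)
  have Xc: "X \<subseteq> carrier H" using X(1) CO_sub[OF A(2)] by blast
  have COc: "CO (cyl F x)" if "x \<in> carrier H" for x using F that by (intro CO_cyl)
  have mc: "measure \<mu> (cyl F x) = measure \<mu> (cyl F \<one>)" if "x \<in> carrier H" for x
    using emeasure_cyl[OF that F(1,2)] by (simp add: measure_def)
  have ind: "indicator A x *\<^sub>R g x = (\<Sum>z\<in>X. indicator (cyl F z) x *\<^sub>R g x)" for x
  proof -
    have "indicator A x = (\<Sum>z\<in>X. indicator (cyl F z) x :: real)"
      unfolding X(4) using X by (intro indicator_UN_disjoint) auto
    then show ?thesis by (simp add: scaleR_sum_left)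
  qed
  have int: "integrable \<mu> (\<lambda>x. indicator (cyl F z) x *\<^sub>R g x)" if "z \<in> X" for z
    using that Xc by (intro integrable_mult_indicator g CO_sets COc) auto
  have intc: "integrable \<mu> (\<lambda>x. indicator (cyl F z) x :: real)" if "z \<in> X" for z
    using that Xc CO_finite[OF COc[of z]] CO_sets[OF COc[of z]] by (intro integrable_real_indicator) auto
  have "(\<integral>x. indicator A x *\<^sub>R g x \<partial>\<mu>) = (\<Sum>z\<in>X. \<integral>x. indicator (cyl F z) x *\<^sub>R g x \<partial>\<mu>)"
    unfolding ind by (rule Bochner_Integration.integral_sum) (rule int)
  moreover have "measure \<mu> (cyl F \<one>) *\<^sub>R (\<Sum>x\<in>X. g x) = (\<Sum>z\<in>X. \<integral>x. indicator (cyl F z) x *\<^sub>R g z \<partial>\<mu>)"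
  proof -
    have "(\<integral>x. indicator (cyl F z) x *\<^sub>R g z \<partial>\<mu>) = measure \<mu> (cyl F \<one>) *\<^sub>R g z" if z: "z \<in> X" for z
      using z Xc intc[OF z] mc[of z] CO_sets[OF COc[of z]] sets.sets_into_space[of "cyl F z" \<mu>]
      by (subst integral_scaleR_left) (auto simp: Int_absorb2)
    then show ?thesis by (simp add: scaleR_sum_right)
  qed
  ultimately have "cmod ((\<integral>x. indicator A x *\<^sub>R g x \<partial>\<mu>) - measure \<mu> (cyl F \<one>) *\<^sub>R (\<Sum>x\<in>X. g x))
     = cmod (\<Sum>z\<in>X. (\<integral>x. indicator (cyl F z) x *\<^sub>R g x \<partial>\<mu>) - (\<integral>x. indicator (cyl F z) x *\<^sub>R g z \<partial>\<mu>))"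
    by (simp add: sum_subtractf)
  also have "\<dots> \<le> (\<Sum>z\<in>X. d * measure \<mu> (cyl F z))"
  proof (rule sum_norm_le)
    fix z assume z: "z \<in> X"
    have i2: "integrable \<mu> (\<lambda>x. indicator (cyl F z) x *\<^sub>R g z)" using intc[OF z] by (rule integrable_scaleR_left)
    have "cmod ((\<integral>x. indicator (cyl F z) x *\<^sub>R g x \<partial>\<mu>) - (\<integral>x. indicator (cyl F z) x *\<^sub>R g z \<partial>\<mu>))
       = cmod (\<integral>x. indicator (cyl F z) x *\<^sub>R (g x - g z) \<partial>\<mu>)"
      using int[OF z] i2 by (simp add: scaleR_diff_right)
    also have "\<dots> \<le> (\<integral>x. d * indicator (cyl F z) x \<partial>\<mu>)"
    proof (rule norm_integral_le)
      show "integrable \<mu> (\<lambda>x. indicator (cyl F z) x *\<^sub>R (g x - g z))" using int[OF z] i2 by (simp add: scaleR_diff_right)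
      show "integrable \<mu> (\<lambda>x. d * indicator (cyl F z) x)" using intc[OF z] by simp
      fix x show "norm (indicator (cyl F z) x *\<^sub>R (g x - g z)) \<le> d * indicator (cyl F z) x"
        using u[of z x] z Xc by (auto simp: indicator_def)
    qed
    also have "\<dots> = d * measure \<mu> (cyl F z)"
      using cyl_sub[of F z] by (simp add: Int_absorb2)
    finally show "norm ((\<integral>x. indicator (cyl F z) x *\<^sub>R g x \<partial>\<mu>) - (\<integral>x. indicator (cyl F z) x *\<^sub>R g z \<partial>\<mu>)) \<le> d * measure \<mu> (cyl F z)" .
  qed
  also have "\<dots> = d * (\<Sum>z\<in>X. measure \<mu> (cyl F z))" by (simp add: sum_distrib_left)
  also have "(\<Sum>z\<in>X. measure \<mu> (cyl F z)) = measure \<mu> A"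
  proof -
    have "measure \<mu> (\<Union>z\<in>X. cyl F z) = (\<Sum>z\<in>X. measure \<mu> (cyl F z))"
    proof (rule measure_finite_Union[OF X(2) _ X(3)])
      show "cyl F ` X \<subseteq> sets \<mu>" using COc Xc CO_sets by blast
      fix z assume "z \<in> X"
      then have "emeasure \<mu> (cyl F z) < \<infinity>" using Xc by (intro CO_finite COc) auto
      then show "emeasure \<mu> (cyl F z) \<noteq> \<infinity>" by simp
    qed
    then show ?thesis using X(4) by simp
  qed
  finally show ?thesis .
qed

lemma integrable_inv_left:
  assumes h: "h \<in> carrier Cc" and y: "y \<in> carrier H"
  shows "integrable \<mu> (\<lambda>x. h (inv y \<otimes> x))"
proof -
  have "integrable (distr \<mu> \<mu> (\<lambda>x. inv y \<otimes> x)) h" using Cc_integrable[OF h] distr_left[of "inv y"] y by simp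
  then show ?thesis using measurable_cont[OF cont_left[of "inv y"]] y by (subst (asm) integrable_distr_eq) (auto intro: Cc_measurable[OF h])
qed

text \<open>Both sides are iterated integrals of f y times h at the product of inv y and x, over all
  y and over x in \<open>tr u s\<close>, taken in the two orders. The x-integral is replaced by one
  Riemann sum that works for all y at once, because h varies little on cylinders and these are
  permuted by left translation.\<close>

lemma mat_conv:
  assumes f: "f \<in> carrier Cc" and h: "h \<in> carrier Cc"
  shows "mat (conv f h) = mprod (mat f) (mat h)"
proof (intro ext)
  fix s u
  show "mat (conv f h) s u = mprod (mat f) (mat h) s u"
  proof (cases "s \<in> S \<and> u \<in> S")
    case False
    then show ?thesis by (auto simp: mat_def mprod_def)
  next
    case True
    then have s: "s \<in> S" and u: "u \<in> S" by auto
    let ?A = "tr u s" and ?N = "\<integral>z. cmod (f z) \<partial>\<mu>"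
    define Tf where "Tf = {t. mat h t u \<noteq> 0}"
    have Tf: "finite Tf" "Tf \<subseteq> S" using mat_col[OF h] mat_nonzero[of h] by (auto simp: Tf_def)
    \<comment> \<open>For given y exactly one t satisfies \<open>act y t = s\<close>, so the matrix
      product collapses to a single integral over y.\<close>
    have pt: "f y * mat h (act (inv y) s) u = (\<Sum>t\<in>Tf. (indicator (tr t s) y *\<^sub>R f y) * mat h t u)"
      if y: "y \<in> carrier H" for y
    proof -
      have "(\<Sum>t\<in>Tf. (indicator (tr t s) y *\<^sub>R f y) * mat h t u) =
        (\<Sum>t\<in>Tf. if t = act (inv y) s then f y * mat h (act (inv y) s) u else 0)"
        using Tf(2) y s by (intro sum.cong refl) (auto simp: indicator_def tr_def)
      then show ?thesis using Tf(1) by (auto simp: Tf_def)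
    qed
    have it: "integrable \<mu> (\<lambda>y. (indicator (tr t s) y *\<^sub>R f y) * mat h t u)" if "t \<in> Tf" for t
      using that Tf by (intro integrable_mult_left integrable_tr Cc_integrable f) auto
    have ic: "integrable \<mu> (\<lambda>y. f y * mat h (act (inv y) s) u)"
    proof -
      have "integrable \<mu> (\<lambda>y. \<Sum>t\<in>Tf. (indicator (tr t s) y *\<^sub>R f y) * mat h t u)"
        using it by (rule Bochner_Integration.integrable_sum)
      then show ?thesis using pt by (subst Bochner_Integration.integrable_cong[OF refl]) auto
    qed
    have "mprod (mat f) (mat h) s u = (\<Sum>t\<in>Tf. \<integral>y. (indicator (tr t s) y *\<^sub>R f y) * mat h t u \<partial>\<mu>)"
      unfolding mprod_def Tf_def[symmetric]
    proof (intro sum.cong refl)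
      fix t assume "t \<in> Tf"
      then have "mat f s t = (\<integral>y. indicator (tr t s) y *\<^sub>R f y \<partial>\<mu>)" using Tf s by (auto simp: mat_def)
      then show "mat f s t * mat h t u = (\<integral>y. (indicator (tr t s) y *\<^sub>R f y) * mat h t u \<partial>\<mu>)"
        by (simp only: integral_mult_left_zero)
    qed
    also have "\<dots> = (\<integral>y. f y * mat h (act (inv y) s) u \<partial>\<mu>)"
    proof -
      have "(\<integral>y. (\<Sum>t\<in>Tf. (indicator (tr t s) y *\<^sub>R f y) * mat h t u) \<partial>\<mu>)
          = (\<Sum>t\<in>Tf. \<integral>y. (indicator (tr t s) y *\<^sub>R f y) * mat h t u \<partial>\<mu>)"
        by (rule Bochner_Integration.integral_sum) (rule it)
      moreover have "(\<integral>y. (\<Sum>t\<in>Tf. (indicator (tr t s) y *\<^sub>R f y) * mat h t u) \<partial>\<mu>)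
          = (\<integral>y. f y * mat h (act (inv y) s) u \<partial>\<mu>)"
        by (rule Bochner_Integration.integral_cong[OF refl]) (simp only: pt space_mu)
      ultimately show ?thesis by simp
    qed
    finally have R: "mprod (mat f) (mat h) s u = (\<integral>y. f y * mat h (act (inv y) s) u \<partial>\<mu>)" .
    have tl: "mat h (act (inv y) s) u = (\<integral>x. indicator ?A x *\<^sub>R h (inv y \<otimes> x) \<partial>\<mu>)" if y: "y \<in> carrier H" for y
    proof -
      let ?\<phi> = "\<lambda>x. indicator (tr u (act (inv y) s)) x *\<^sub>R h x"
      have "mat h (act (inv y) s) u = (\<integral>x. ?\<phi> x \<partial>\<mu>)" using y s u by (simp add: mat_def)
      also have "\<dots> = (\<integral>x. ?\<phi> (inv y \<otimes> x) \<partial>\<mu>)"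
        using y u Cc_measurable[OF h]
        by (intro integral_left[symmetric] borel_measurable_scaleR borel_measurable_indicator tr_sets inv_closed)
      also have "\<dots> = (\<integral>x. indicator ?A x *\<^sub>R h (inv y \<otimes> x) \<partial>\<mu>)"
        using y s u by (intro Bochner_Integration.integral_cong) (auto simp: indicator_def tr_def act_mult act_inj)
      finally show ?thesis .
    qed
    have "cmod (mat (conv f h) s u - mprod (mat f) (mat h) s u) \<le> e" if e: "e > 0" for e
    proof -
      \<comment> \<open>Each of the two Riemann errors is d times the L^1-norm of f times the
        measure of \<open>tr u s\<close>. The summand 1 keeps the denominator positive when that
        product is 0.\<close>
      define d where "d = e / (2 * (?N * measure \<mu> ?A) + 1)"
      have p: "2 * (?N * measure \<mu> ?A) + 1 > 0" by (simp add: add_nonneg_pos)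
      have d: "d > 0" using e p by (simp add: d_def)
      have modulus: "2 * (d * (?N * measure \<mu> ?A)) \<le> e"
        using p e by (simp add: d_def field_simps)
      obtain F1 where F1: "F1 \<subseteq> S" "finite F1" "b \<in> F1" "\<forall>x\<in>carrier H. \<forall>y\<in>cyl F1 x. cmod (h y - h x) \<le> d"
        using Cc_unif[OF h d] by blast
      have COA: "CO ?A" using s u by (intro CO_tr)
      obtain F0 where F0: "F0 \<subseteq> S" "finite F0" "\<And>F. finite F \<Longrightarrow> F \<subseteq> S \<Longrightarrow> F0 \<subseteq> F \<Longrightarrow> \<exists>X. parts F ?A X"
        using CO_partition[OF COA] by blast
      define F where "F = F0 \<union> F1"
      have F: "finite F" "F \<subseteq> S" "b \<in> F" "F0 \<subseteq> F" using F0 F1 by (auto simp: F_def)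
      obtain X where X: "parts F ?A X" using F0(3)[OF F(1,2,4)] by blast
      have Xc: "X \<subseteq> carrier H" using X CO_sub[OF COA] unfolding parts_def by (elim conjE) (rule order_trans)
      have unif: "\<forall>x\<in>carrier H. \<forall>y\<in>cyl F x. cmod (h y - h x) \<le> d"
        using F1(4) by (auto simp: F_def cyl_def)
      define k where "k = measure \<mu> (cyl F \<one>)"
      have 1: "cmod (mat (conv f h) s u - k *\<^sub>R (\<Sum>x\<in>X. conv f h x)) \<le> (d * ?N) * measure \<mu> ?A"
      proof -
        have "mat (conv f h) s u = (\<integral>x. indicator ?A x *\<^sub>R conv f h x \<partial>\<mu>)" using s u by (simp add: mat_def)
        then show ?thesis unfolding k_def
          using riemann_sum[OF X COA F(1,2,3) Cc_integrable[OF conv_Cc[OF f h]] conv_unif[OF f h _ _ F(2) unif]] by simp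
      qed
      have sumeq: "k *\<^sub>R (\<Sum>x\<in>X. conv f h x) = (\<integral>y. f y * (k *\<^sub>R (\<Sum>x\<in>X. h (inv y \<otimes> x))) \<partial>\<mu>)"
      proof -
        have "(\<Sum>x\<in>X. conv f h x) = (\<Sum>x\<in>X. \<integral>y. f y * h (inv y \<otimes> x) \<partial>\<mu>)" using Xc by (intro sum.cong) (auto simp: conv_in)
        also have "\<dots> = (\<integral>y. f y * (\<Sum>x\<in>X. h (inv y \<otimes> x)) \<partial>\<mu>)"
          using conv_integrable[OF f h] Xc by (subst Bochner_Integration.integral_sum[symmetric]) (auto simp: sum_distrib_left)
        finally show ?thesis by simp
      qed
      have i3: "integrable \<mu> (\<lambda>y. f y * (k *\<^sub>R (\<Sum>x\<in>X. h (inv y \<otimes> x))))"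
      proof -
        have "integrable \<mu> (\<lambda>y. k *\<^sub>R (\<Sum>x\<in>X. f y * h (inv y \<otimes> x)))"
          using conv_integrable[OF f h] Xc by (intro integrable_scaleR_right Bochner_Integration.integrable_sum) auto
        then show ?thesis by (simp add: sum_distrib_left)
      qed
      have 2: "cmod ((\<integral>y. f y * mat h (act (inv y) s) u \<partial>\<mu>) - k *\<^sub>R (\<Sum>x\<in>X. conv f h x)) \<le> (d * measure \<mu> ?A) * ?N"
      proof -
        have "(\<integral>y. f y * mat h (act (inv y) s) u \<partial>\<mu>) - k *\<^sub>R (\<Sum>x\<in>X. conv f h x) =
            (\<integral>y. f y * (mat h (act (inv y) s) u - k *\<^sub>R (\<Sum>x\<in>X. h (inv y \<otimes> x))) \<partial>\<mu>)"
          unfolding sumeq using ic i3 by (simp add: right_diff_distrib)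
        also have "cmod \<dots> \<le> (\<integral>y. (d * measure \<mu> ?A) * cmod (f y) \<partial>\<mu>)"
        proof (rule norm_integral_le)
          show "integrable \<mu> (\<lambda>y. f y * (mat h (act (inv y) s) u - k *\<^sub>R (\<Sum>x\<in>X. h (inv y \<otimes> x))))"
            using ic i3 by (simp add: right_diff_distrib)
          show "integrable \<mu> (\<lambda>y. (d * measure \<mu> ?A) * cmod (f y))" using Cc_integrable[OF f] by auto
          fix y assume "y \<in> space \<mu>"
          then have y: "y \<in> carrier H" by simp
          have "cmod (mat h (act (inv y) s) u - k *\<^sub>R (\<Sum>x\<in>X. h (inv y \<otimes> x))) \<le> d * measure \<mu> ?A"
            unfolding tl[OF y] k_def
          proof (rule riemann_sum[OF X COA F(1,2,3) integrable_inv_left[OF h y]])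
            fix x z assume "x \<in> carrier H" "z \<in> cyl F x"
            then show "cmod (h (inv y \<otimes> z) - h (inv y \<otimes> x)) \<le> d"
              using unif y F(2) by (auto simp: cyl_def act_mult subset_iff)
          qed
          then show "norm (f y * (mat h (act (inv y) s) u - k *\<^sub>R (\<Sum>x\<in>X. h (inv y \<otimes> x)))) \<le> (d * measure \<mu> ?A) * cmod (f y)"
            by (simp add: norm_mult mult.commute[of _ "cmod (f y)"] mult_left_mono)
        qed
        finally show ?thesis by simp
      qed
      have tri: "cmod (p - q) \<le> cmod (p - r) + cmod (q - r)" for p q r :: complex
        using norm_triangle_ineq4[of "p - r" "q - r"] by simp
      have "cmod (mat (conv f h) s u - mprod (mat f) (mat h) s u) \<le> (d * ?N) * measure \<mu> ?A + (d * measure \<mu> ?A) * ?N"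
        unfolding R by (rule order_trans[OF tri add_mono[OF 1 2]])
      also have "\<dots> = 2 * (d * (?N * measure \<mu> ?A))" by (simp add: algebra_simps)
      also note modulus
      finally show ?thesis .
    qed
    then have "cmod (mat (conv f h) s u - mprod (mat f) (mat h) s u) \<le> 0" by (rule field_le_epsilon) simp
    then show ?thesis by simp
  qed
qed

section \<open>Compactly supported functions as a normed *-algebra\<close>

lemma Cc_ops:
  "vadd Cc = (\<lambda>f h x. f x + h x)" "scal Cc = (\<lambda>c f x. c * f x)" "vmul Cc = conv"
  "nrm Cc = (\<lambda>f. \<integral>x. cmod (f x) \<partial>\<mu>)"
  by (simp_all add: Cc_alg_def)

lemma Cc_star: "star Cc f x = (if x \<in> carrier H then of_real (w (act x b)) * cnj (f (inv x)) else 0)"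
  by (simp add: Cc_alg_def modular_fun_eq modulus_def)

lemma Cc_supp_sub: "f \<in> carrier Cc \<Longrightarrow> t \<in> S \<Longrightarrow> {act x t |x. f x \<noteq> 0} \<subseteq> S"
  using CcD0 act_in by blast

lemma Cc_zero: "(\<lambda>x. 0) \<in> carrier Cc"
  by (rule CcI[where E = "{}"]) auto

lemma Cc_add:
  assumes f: "f \<in> carrier Cc" and h: "h \<in> carrier Cc" shows "(\<lambda>x. f x + h x) \<in> carrier Cc"
proof (rule CcI)
  let ?E = "{act x b |x. f x \<noteq> 0} \<union> {act x b |x. h x \<noteq> 0}"
  show "finite ?E" using Cc_supp(1) f h by simp
  show "?E \<subseteq> S" using Cc_supp_sub f h by simp
  show "act x b \<in> ?E" if "f x + h x \<noteq> 0" for x using that by (cases "f x = 0") auto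
  fix x and e :: real assume x: "x \<in> carrier H" and e: "e > 0"
  then have e2: "e/2 > 0" by simp
  obtain F1 where F1: "F1 \<subseteq> S" "finite F1" "\<forall>y\<in>cyl F1 x. cmod (f y - f x) < e/2" using Cc_local[OF f x e2] by blast
  obtain F2 where F2: "F2 \<subseteq> S" "finite F2" "\<forall>y\<in>cyl F2 x. cmod (h y - h x) < e/2" using Cc_local[OF h x e2] by blast
  have "cmod ((f y + h y) - (f x + h x)) < e" if "y \<in> cyl (F1 \<union> F2) x" for y
  proof -
    have "y \<in> cyl F1 x" "y \<in> cyl F2 x" using that by (auto simp: cyl_def)
    then have "cmod (f y - f x) < e/2" "cmod (h y - h x) < e/2" using F1 F2 by auto
    then show ?thesis using norm_triangle_ineq[of "f y - f x" "h y - h x"] by (simp add: algebra_simps)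
  qed
  then show "\<exists>F\<subseteq>S. finite F \<and> (\<forall>y\<in>cyl F x. cmod ((f y + h y) - (f x + h x)) < e)"
    using F1 F2 by (intro exI[of _ "F1 \<union> F2"]) auto
qed (simp add: CcD0[OF f] CcD0[OF h])

lemma Cc_scal:
  assumes f: "f \<in> carrier Cc" shows "(\<lambda>x. c * f x) \<in> carrier Cc"
proof (rule CcI)
  let ?E = "{act x b |x. f x \<noteq> 0}"
  show "finite ?E" using Cc_supp(1) f by simp
  show "?E \<subseteq> S" using Cc_supp_sub f by simp
  fix x and e :: real assume x: "x \<in> carrier H" and e: "e > 0"
  have c: "cmod c + 1 > 0" by (simp add: add_nonneg_pos)
  then have e2: "e / (cmod c + 1) > 0" using e by simp
  obtain F1 where F1: "F1 \<subseteq> S" "finite F1" "\<forall>y\<in>cyl F1 x. cmod (f y - f x) < e / (cmod c + 1)" using Cc_local[OF f x e2] by blast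
  have "cmod (c * f y - c * f x) < e" if "y \<in> cyl F1 x" for y
  proof -
    have "cmod (f y - f x) * (cmod c + 1) < e" using F1(3) that c by (simp add: pos_less_divide_eq)
    moreover have "cmod (c * f y - c * f x) = cmod c * cmod (f y - f x)" by (simp flip: norm_mult right_diff_distrib)
    moreover have "cmod c * cmod (f y - f x) \<le> cmod (f y - f x) * (cmod c + 1)" by (simp add: algebra_simps)
    ultimately show ?thesis by linarith
  qed
  then show "\<exists>F\<subseteq>S. finite F \<and> (\<forall>y\<in>cyl F x. cmod (c * f y - c * f x) < e)" using F1 by blast
qed (use CcD0 f in auto)

lemma Cc_star_in:
  assumes f: "f \<in> carrier Cc" shows "star Cc f \<in> carrier Cc"
proof (rule CcI)
  let ?E = "{act (inv x) b |x. f x \<noteq> 0}"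
  show "finite ?E" using Cc_supp(2) f by simp
  show "?E \<subseteq> S" using CcD0[OF f] act_in[OF inv_closed b_in] by blast
  show "star Cc f x = 0" if "x \<notin> carrier H" for x using that by (simp add: Cc_star)
  show "act x b \<in> ?E" if "star Cc f x \<noteq> 0" for x
  proof -
    have "x \<in> carrier H" "f (inv x) \<noteq> 0" using that by (auto simp: Cc_star split: if_splits)
    then show ?thesis by (intro CollectI exI[of _ "inv x"]) auto
  qed
  fix x and e :: real assume x: "x \<in> carrier H" and e: "e > 0"
  define W where "W = w (act x b)"
  have W: "W > 0" using x by (simp add: W_def w_pos)
  then have "e / W > 0" using e by simp
  then obtain F where F: "F \<subseteq> S" "finite F" "\<forall>y\<in>cyl F (inv x). cmod (f y - f (inv x)) < e / W"
    using Cc_local[OF f inv_closed[OF x]] by blast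
  \<comment> \<open>Fixing the image of \<open>b\<close> freezes the modular factor at W; fixing the
    images of the points of F under inv x makes inv y agree with inv x on F.\<close>
  have "cmod (star Cc f y - star Cc f x) < e" if y: "y \<in> cyl (insert b (act (inv x) ` F)) x" for y
  proof -
    have yc: "y \<in> carrier H" and yb: "act y b = act x b" using y by (auto simp: cyl_def)
    have "act (inv y) s = act (inv x) s" if "s \<in> F" for s
      using y that x yc F(1) by (auto simp: cyl_def act_inv_eq)
    then have "inv y \<in> cyl F (inv x)" using yc by (simp add: cyl_def)
    then have "cmod (f (inv y) - f (inv x)) < e / W" using F(3) by blast
    then have "W * cmod (f (inv y) - f (inv x)) < e" using W by (simp add: field_simps)
    moreover have "star Cc f y - star Cc f x = of_real W * cnj (f (inv y) - f (inv x))"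
      using x yc yb by (simp add: Cc_star W_def right_diff_distrib)
    ultimately show ?thesis using W by (simp only: norm_mult complex_mod_cnj) simp
  qed
  then show "\<exists>F\<subseteq>S. finite F \<and> (\<forall>y\<in>cyl F x. cmod (star Cc f y - star Cc f x) < e)"
    using F x by (intro exI[of _ "insert b (act (inv x) ` F)"]) auto
qed

text \<open>On \<open>tr t s\<close> the modular factor of the involution is a constant, and it
  cancels against the factor produced by the change of variables x to inv x.\<close>

lemma mat_star:
  assumes f: "f \<in> carrier Cc" shows "mat (star Cc f) s t = cnj (mat f t s)"
proof (cases "s \<in> S \<and> t \<in> S \<and> tr s t \<noteq> {}")
  case False
  have "tr t s = {}" if "s \<in> S" "t \<in> S" "tr s t = {}" using tr_inv[OF that(1,2)] that(3) by simp
  then show ?thesis using False by (auto simp: mat_def)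
next
  case True
  then have s: "s \<in> S" and t: "t \<in> S" by auto
  obtain y where y: "y \<in> tr s t" using True by blast
  have yc: "y \<in> carrier H" using y by (auto simp: tr_def)
  have iy: "inv y \<in> tr t s" using y s by (auto simp: tr_def)
  have eq: "indicator (tr t s) x *\<^sub>R star Cc f x = modulus y *\<^sub>R (indicator (tr t s) x *\<^sub>R cnj (f (inv x)))"
    if x: "x \<in> carrier H" for x
  proof (cases "x \<in> tr t s")
    case True
    then have "inv x \<in> tr s t" using t by (auto simp: tr_def)
    then have "modulus (inv x) = modulus y" using modulus_tr[OF s _ y] by simp
    then show ?thesis using x True by (simp add: Cc_star w_act scaleR_conv_of_real)
  qed simp
  have "mat (star Cc f) s t = (\<integral>x. modulus y *\<^sub>R (indicator (tr t s) x *\<^sub>R cnj (f (inv x))) \<partial>\<mu>)"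
    using s t eq by (auto simp: mat_def intro!: Bochner_Integration.integral_cong)
  also have "\<dots> = modulus y *\<^sub>R (\<integral>x. indicator (tr t s) x *\<^sub>R cnj (f (inv x)) \<partial>\<mu>)"
    by (rule integral_scaleR_right)
  also have "\<dots> = modulus y *\<^sub>R (modulus (inv y) *\<^sub>R (\<integral>x. indicator (tr s t) x *\<^sub>R cnj (f x) \<partial>\<mu>))"
  proof -
    have "cnj \<in> borel_measurable borel" by (intro borel_measurable_continuous_onI continuous_intros)
    then have "(\<lambda>x. cnj (f x)) \<in> borel_measurable \<mu>" by (rule measurable_compose[OF Cc_measurable[OF f]])
    from integral_inv[OF s t y this] show ?thesis by (rule arg_cong)
  qed
  also have "\<dots> = (\<integral>x. indicator (tr s t) x *\<^sub>R cnj (f x) \<partial>\<mu>)"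
    using modulus_inv_mult[OF yc] by simp
  also have "\<dots> = (\<integral>x. cnj (indicator (tr s t) x *\<^sub>R f x) \<partial>\<mu>)" by (simp add: scaleR_conv_of_real)
  also have "\<dots> = cnj (\<integral>x. indicator (tr s t) x *\<^sub>R f x \<partial>\<mu>)" by (rule Bochner_Integration.integral_cnj)
  also have "\<dots> = cnj (mat f t s)" using s t by (simp only: mat_def simp_thms if_True)
  finally show ?thesis .
qed

text \<open>The absolute value kept complex valued, so that it lies in \<open>Cc\<close> and has a
  matrix.\<close>

definition cabs :: "('g \<Rightarrow> complex) \<Rightarrow> 'g \<Rightarrow> complex" where "cabs f x = complex_of_real (cmod (f x))"

lemma cabs_Cc: "f \<in> carrier Cc \<Longrightarrow> cabs f \<in> carrier Cc"
  using Cc_norm[of f] by (simp add: cabs_def[abs_def])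

lemma nrm_cabs: "complex_of_real (\<integral>x. cmod (f x) \<partial>\<mu>) = (\<integral>x. cabs f x \<partial>\<mu>)"
  by (simp add: cabs_def)

lemma integral_cols_Cc:
  assumes f: "f \<in> carrier Cc" and t: "t \<in> S"
  shows "(\<integral>x. f x \<partial>\<mu>) = (\<Sum>s | mat f s t \<noteq> 0. mat f s t)"
proof -
  have "(\<integral>x. f x \<partial>\<mu>) = (\<Sum>s\<in>{act x t |x. f x \<noteq> 0}. mat f s t)"
    using Cc_supp(1)[OF f t] Cc_supp_sub[OF f t] by (intro integral_cols Cc_integrable f t) auto
  also have "\<dots> = (\<Sum>s | mat f s t \<noteq> 0. mat f s t)"
  proof (rule sum.mono_neutral_right)
    show "finite {act x t |x. f x \<noteq> 0}" by (rule Cc_supp(1)[OF f t])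
    show "{s. mat f s t \<noteq> 0} \<subseteq> {act x t |x. f x \<noteq> 0}" using mat_nonzero[of f] by (fastforce simp: tr_def)
  qed auto
  finally show ?thesis .
qed

lemma mat_row:
  assumes f: "f \<in> carrier Cc" and s: "s \<in> S"
  shows "finite {act (inv x) s |x. f x \<noteq> 0}" "{act (inv x) s |x. f x \<noteq> 0} \<subseteq> S"
    "{t. mat f s t \<noteq> 0} \<subseteq> {act (inv x) s |x. f x \<noteq> 0}"
proof -
  show "finite {act (inv x) s |x. f x \<noteq> 0}" by (rule Cc_supp(2)[OF f s])
  show "{act (inv x) s |x. f x \<noteq> 0} \<subseteq> S" using CcD0[OF f] act_in[OF inv_closed s] by blast
  show "{t. mat f s t \<noteq> 0} \<subseteq> {act (inv x) s |x. f x \<noteq> 0}"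
  proof
    fix t assume "t \<in> {t. mat f s t \<noteq> 0}"
    then obtain x where "f x \<noteq> 0" "x \<in> tr t s" "t \<in> S" using mat_nonzero[of f s t] by blast
    then show "t \<in> {act (inv x) s |x. f x \<noteq> 0}"
      by (intro CollectI exI[of _ x]) (auto simp: tr_def)
  qed
qed

lemma integral_rows_Cc:
  assumes f: "f \<in> carrier Cc" and s: "s \<in> S"
  shows "(\<integral>x. f x \<partial>\<mu>) = (\<Sum>t | mat f s t \<noteq> 0. mat f s t)"
proof -
  note r = mat_row[OF f s]
  have "(\<integral>x. f x \<partial>\<mu>) = (\<Sum>t\<in>{act (inv x) s |x. f x \<noteq> 0}. mat f s t)"
    using r by (intro integral_rows Cc_integrable f s) auto
  also have "\<dots> = (\<Sum>t | mat f s t \<noteq> 0. mat f s t)"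
    by (rule sum.mono_neutral_right) (use r in auto)
  finally show ?thesis .
qed

text \<open>Pointwise the absolute value of f * h is at most |f| * |h|. The integral of the latter
  is the product of the integrals: integrals are column sums, matrices multiply, and all columns of
  \<open>mat (cabs f)\<close> at points of S have the same sum.\<close>

lemma nrm_conv:
  assumes f: "f \<in> carrier Cc" and h: "h \<in> carrier Cc"
  shows "(\<integral>x. cmod (conv f h x) \<partial>\<mu>) \<le> (\<integral>x. cmod (f x) \<partial>\<mu>) * (\<integral>x. cmod (h x) \<partial>\<mu>)"
proof -
  note F = cabs_Cc[OF f] and G = cabs_Cc[OF h]
  have le: "cmod (conv f h x) \<le> Re (conv (cabs f) (cabs h) x)" if x: "x \<in> carrier H" for x
  proof -
    have "cmod (conv f h x) \<le> (\<integral>y. cmod (f y * h (inv y \<otimes> x)) \<partial>\<mu>)" using x by (simp add: conv_in integral_norm_bound)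
    moreover have "conv (cabs f) (cabs h) x = complex_of_real (\<integral>y. cmod (f y * h (inv y \<otimes> x)) \<partial>\<mu>)"
      using x by (simp add: conv_in cabs_def norm_mult flip: integral_complex_of_real)
    ultimately show ?thesis by simp
  qed
  have "(\<integral>x. cmod (conv f h x) \<partial>\<mu>) \<le> (\<integral>x. Re (conv (cabs f) (cabs h) x) \<partial>\<mu>)"
    using Cc_integrable[OF conv_Cc[OF f h]] Cc_integrable[OF conv_Cc[OF F G]] le by (intro integral_mono) auto
  also have "\<dots> = Re (\<integral>x. conv (cabs f) (cabs h) x \<partial>\<mu>)"
    using Cc_integrable[OF conv_Cc[OF F G]] by simp
  also have "(\<integral>x. conv (cabs f) (cabs h) x \<partial>\<mu>) = (\<integral>x. cabs f x \<partial>\<mu>) * (\<integral>x. cabs h x \<partial>\<mu>)"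
  proof -
    define U where "U = {t. mat (cabs h) t b \<noteq> 0}"
    define V where "V = {s. mat (conv (cabs f) (cabs h)) s b \<noteq> 0} \<union> (\<Union>t\<in>U. {s. mat (cabs f) s t \<noteq> 0})"
    have U: "finite U" "U \<subseteq> S" using mat_col[OF G] mat_nonzero[of "cabs h"] by (auto simp: U_def)
    have V: "finite V" using mat_col[OF F] mat_col[OF conv_Cc[OF F G]] U by (auto simp: V_def)
    have "(\<integral>x. conv (cabs f) (cabs h) x \<partial>\<mu>) = (\<Sum>s\<in>V. mat (conv (cabs f) (cabs h)) s b)"
      unfolding integral_cols_Cc[OF conv_Cc[OF F G] b_in] using V by (intro sum.mono_neutral_left) (auto simp: V_def)
    also have "\<dots> = (\<Sum>s\<in>V. \<Sum>t\<in>U. mat (cabs f) s t * mat (cabs h) t b)"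
      by (simp add: mat_conv[OF F G] mprod_def U_def)
    also have "\<dots> = (\<Sum>t\<in>U. (\<Sum>s\<in>V. mat (cabs f) s t) * mat (cabs h) t b)"
      by (subst sum.swap) (simp add: sum_distrib_right)
    also have "\<dots> = (\<Sum>t\<in>U. (\<integral>x. cabs f x \<partial>\<mu>) * mat (cabs h) t b)"
    proof (rule sum.cong[OF refl])
      fix t assume t: "t \<in> U"
      have "(\<Sum>s\<in>V. mat (cabs f) s t) = (\<integral>x. cabs f x \<partial>\<mu>)"
        using t U V by (subst integral_cols_Cc[OF F, of t]) (auto intro!: sum.mono_neutral_right simp: V_def)
      then show "(\<Sum>s\<in>V. mat (cabs f) s t) * mat (cabs h) t b = (\<integral>x. cabs f x \<partial>\<mu>) * mat (cabs h) t b" by simp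
    qed
    also have "\<dots> = (\<integral>x. cabs f x \<partial>\<mu>) * (\<integral>x. cabs h x \<partial>\<mu>)"
      unfolding integral_cols_Cc[OF G b_in] by (simp add: U_def sum_distrib_left)
    finally show ?thesis .
  qed
  also have "Re \<dots> = (\<integral>x. cmod (f x) \<partial>\<mu>) * (\<integral>x. cmod (h x) \<partial>\<mu>)" by (simp flip: nrm_cabs)
  finally show ?thesis .
qed

text \<open>The matrix of the adjoint turns a column sum into a row sum, and both compute the
  integral.\<close>

lemma nrm_star_Cc:
  assumes f: "f \<in> carrier Cc"
  shows "(\<integral>x. cmod (star Cc f x) \<partial>\<mu>) = (\<integral>x. cmod (f x) \<partial>\<mu>)"
proof -
  note F = cabs_Cc[OF f]
  have eq: "cabs (star Cc f) = star Cc (cabs f)"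
    using w_pos by (auto simp: cabs_def Cc_star norm_mult less_imp_le)
  have "complex_of_real (\<integral>x. cmod (star Cc f x) \<partial>\<mu>) = (\<integral>x. star Cc (cabs f) x \<partial>\<mu>)" by (simp only: nrm_cabs eq)
  also have "\<dots> = (\<Sum>s | mat (star Cc (cabs f)) s b \<noteq> 0. mat (star Cc (cabs f)) s b)"
    by (rule integral_cols_Cc[OF Cc_star_in[OF F] b_in])
  also have "\<dots> = cnj (\<Sum>s | mat (cabs f) b s \<noteq> 0. mat (cabs f) b s)" by (simp add: mat_star[OF F])
  also have "\<dots> = cnj (\<integral>x. cabs f x \<partial>\<mu>)" by (simp only: integral_rows_Cc[OF F b_in])
  also have "\<dots> = complex_of_real (\<integral>x. cmod (f x) \<partial>\<mu>)" by (simp flip: nrm_cabs)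
  finally show ?thesis by (simp only: of_real_eq_iff)
qed

lemma conv_add:
  assumes "f \<in> carrier Cc" "h \<in> carrier Cc" "k \<in> carrier Cc"
  shows "conv (\<lambda>x. f x + h x) k = (\<lambda>x. conv f k x + conv h k x)"
    "conv k (\<lambda>x. f x + h x) = (\<lambda>x. conv k f x + conv k h x)"
proof -
  show "conv (\<lambda>x. f x + h x) k = (\<lambda>x. conv f k x + conv h k x)"
  proof
    fix x show "conv (\<lambda>x. f x + h x) k x = conv f k x + conv h k x"
    proof (cases "x \<in> carrier H")
      case True
      then show ?thesis
        using conv_integrable[OF assms(1,3) True] conv_integrable[OF assms(2,3) True] by (simp add: conv_in distrib_right)
    qed (simp add: convolution_def)
  qed
  show "conv k (\<lambda>x. f x + h x) = (\<lambda>x. conv k f x + conv k h x)"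
  proof
    fix x show "conv k (\<lambda>x. f x + h x) x = conv k f x + conv k h x"
    proof (cases "x \<in> carrier H")
      case True
      then show ?thesis
        using conv_integrable[OF assms(3,1) True] conv_integrable[OF assms(3,2) True] by (simp add: conv_in distrib_left)
    qed (simp add: convolution_def)
  qed
qed

lemma conv_scal: "conv (\<lambda>x. c * f x) k = (\<lambda>x. c * conv f k x)" "conv k (\<lambda>x. c * f x) = (\<lambda>x. c * conv k f x)"
  by (auto simp: convolution_def mult.assoc mult.left_commute[of _ c])

lemma star_nalg_Cc: "star_nalg Cc"
proof
  fix f assume f: "f \<in> carrier Cc"
  show "star Cc (star Cc f) = f"
  proof
    fix x show "star Cc (star Cc f) x = f x"
    proof (cases "x \<in> carrier H")
      case True
      have "complex_of_real (modulus (inv x)) * of_real (modulus x) = 1"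
        using modulus_inv_mult[OF True] by (simp add: mult.commute flip: of_real_mult)
      then show ?thesis using True by (simp add: Cc_star w_act)
    qed (simp add: Cc_star CcD0[OF f])
  qed
  show "nrm Cc (star Cc f) = nrm Cc f" by (simp add: Cc_ops nrm_star_Cc[OF f])
  fix h assume h: "h \<in> carrier Cc"
  have "(\<integral>x. cmod (f x + h x) \<partial>\<mu>) \<le> (\<integral>x. cmod (f x) + cmod (h x) \<partial>\<mu>)"
    using Cc_integrable[OF f] Cc_integrable[OF h] by (intro integral_mono) (auto simp: norm_triangle_ineq)
  then show "nrm Cc (vadd Cc f h) \<le> nrm Cc f + nrm Cc h"
    using Cc_integrable[OF f] Cc_integrable[OF h] by (simp add: Cc_ops)
qed (auto simp: Cc_ops Cc_add Cc_scal conv_Cc Cc_star_in add.assoc add.commute distrib_left distrib_right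
    conv_add conv_scal Cc_star nrm_conv nrm_star_Cc norm_mult intro!: exI[of _ "\<lambda>x. 0"] Cc_zero
    Bochner_Integration.integral_nonneg)

text \<open>Schur test with constant weight: entries are dominated by those of |f|, whose row and
  column sums are the L^1-norm.\<close>

lemma mbound_mat:
  assumes f: "f \<in> carrier Cc" shows "mbound (mat f) (\<integral>x. cmod (f x) \<partial>\<mu>)"
proof (rule schur_test[where q = "\<lambda>_. 1"])
  note F = cabs_Cc[OF f]
  show "0 \<le> (\<integral>x. cmod (f x) \<partial>\<mu>)" by simp
  have le: "cmod (mat f s t) \<le> cmod (mat (cabs f) s t)" and re: "cmod (mat (cabs f) s t) = Re (mat (cabs f) s t)" for s t
  proof -
    have eq: "mat (cabs f) s t = complex_of_real (if s \<in> S \<and> t \<in> S then \<integral>x. cmod (indicator (tr t s) x *\<^sub>R f x) \<partial>\<mu> else 0)"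
    proof -
      have "indicator (tr t s) x *\<^sub>R cabs f x = complex_of_real (cmod (indicator (tr t s) x *\<^sub>R f x))" for x
        by (simp add: cabs_def scaleR_conv_of_real norm_mult indicator_def)
      then show ?thesis by (simp add: mat_def del: norm_scaleR)
    qed
    show "cmod (mat (cabs f) s t) = Re (mat (cabs f) s t)" unfolding eq by simp
    show "cmod (mat f s t) \<le> cmod (mat (cabs f) s t)" unfolding eq by (simp add: mat_def del: norm_scaleR)
  qed
  have tot: "(\<Sum>t\<in>U. cmod (mat (cabs f) s t)) \<le> (\<integral>x. cmod (f x) \<partial>\<mu>)" if "finite U" for s U
  proof (cases "s \<in> S")
    case True
    have fin: "finite {t. mat (cabs f) s t \<noteq> 0}" using mat_row[OF F True] finite_subset by blast
    have "(\<Sum>t\<in>U. cmod (mat (cabs f) s t)) = (\<Sum>t\<in>U \<inter> {t. mat (cabs f) s t \<noteq> 0}. cmod (mat (cabs f) s t))"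
      using that by (intro sum.mono_neutral_right) auto
    also have "\<dots> \<le> (\<Sum>t | mat (cabs f) s t \<noteq> 0. cmod (mat (cabs f) s t))" using fin by (intro sum_mono2) auto
    also have "\<dots> = Re (\<integral>x. cabs f x \<partial>\<mu>)" unfolding integral_rows_Cc[OF F True] by (simp add: re)
    also have "\<dots> = (\<integral>x. cmod (f x) \<partial>\<mu>)" by (simp flip: nrm_cabs)
    finally show ?thesis .
  qed (simp add: mat_def)
  show "(\<Sum>t\<in>U. cmod (mat f s t) * 1) \<le> (\<integral>x. cmod (f x) \<partial>\<mu>) * 1" if "finite U" for s U
    using order_trans[OF sum_mono[OF le] tot[OF that]] by simp
  have totc: "(\<Sum>s\<in>U. cmod (mat (cabs f) s t)) \<le> (\<integral>x. cmod (f x) \<partial>\<mu>)" if "finite U" for t U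
  proof (cases "t \<in> S")
    case True
    have fin: "finite {s. mat (cabs f) s t \<noteq> 0}" by (rule mat_col[OF F])
    have "(\<Sum>s\<in>U. cmod (mat (cabs f) s t)) = (\<Sum>s\<in>U \<inter> {s. mat (cabs f) s t \<noteq> 0}. cmod (mat (cabs f) s t))"
      using that by (intro sum.mono_neutral_right) auto
    also have "\<dots> \<le> (\<Sum>s | mat (cabs f) s t \<noteq> 0. cmod (mat (cabs f) s t))" using fin by (intro sum_mono2) auto
    also have "\<dots> = Re (\<integral>x. cabs f x \<partial>\<mu>)" unfolding integral_cols_Cc[OF F True] by (simp add: re)
    also have "\<dots> = (\<integral>x. cmod (f x) \<partial>\<mu>)" by (simp flip: nrm_cabs)
    finally show ?thesis .
  qed (simp add: mat_def)
  show "(\<Sum>s\<in>U. 1 * cmod (mat f s t)) \<le> (\<integral>x. cmod (f x) \<partial>\<mu>) * 1" if "finite U" for t U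
    using order_trans[OF sum_mono[OF le] totc[OF that]] by simp
qed simp

lemma cstar_seminorm_mat: "cstar_seminorm Cc (\<lambda>f. mnorm (mat f))"
proof (rule cstar_seminorm_mnorm[OF star_nalg_Cc])
  fix f assume f: "f \<in> carrier Cc"
  show "mbound (mat f) (nrm Cc f)" using mbound_mat[OF f] by (simp add: Cc_ops)
  show "colfin (mat f)" by (rule colfin_mat[OF f])
  show "mat (star Cc f) = (\<lambda>s t. cnj (mat f t s))" using mat_star[OF f] by blast
  show "mat (scal Cc c f) = (\<lambda>s t. c * mat f s t)" for c
    by (intro ext) (simp add: mat_def Cc_ops flip: mult_scaleR_right)
  fix h assume h: "h \<in> carrier Cc"
  show "mat (vmul Cc f h) = mprod (mat f) (mat h)" using mat_conv[OF f h] by (simp add: Cc_ops)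
  show "mat (vadd Cc f h) = (\<lambda>s t. mat f s t + mat h s t)"
    using integrable_tr[OF Cc_integrable[OF f]] integrable_tr[OF Cc_integrable[OF h]]
    by (intro ext) (simp add: mat_def Cc_ops scaleR_add_right)
qed

section \<open>Bi-invariant functions\<close>

lemma inv_cancel [simp]: "x \<in> carrier H \<Longrightarrow> y \<in> carrier H \<Longrightarrow> inv x \<otimes> (x \<otimes> y) = y"
  "x \<in> carrier H \<Longrightarrow> y \<in> carrier H \<Longrightarrow> x \<otimes> (inv x \<otimes> y) = y"
  by (simp_all flip: m_assoc)

lemma tr_iff: "y \<in> carrier H \<Longrightarrow> t \<in> S \<Longrightarrow> s \<in> S \<Longrightarrow> y \<in> tr t s \<longleftrightarrow> t = act (inv y) s"
  using act_inv_eq[of y s t] by (auto simp: tr_def)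

text \<open>\<open>binv\<close> is \<open>p C\<^sub>c p\<close>.\<close>

definition binv :: "('g \<Rightarrow> complex) set" where
  "binv = {f \<in> carrier Cc. \<forall>x\<in>carrier H. \<forall>k\<in>tr b b. f (x \<otimes> k) = f x \<and> f (k \<otimes> x) = f x}"

lemma binvD: "f \<in> binv \<Longrightarrow> f \<in> carrier Cc"
  "f \<in> binv \<Longrightarrow> x \<in> carrier H \<Longrightarrow> k \<in> tr b b \<Longrightarrow> f (x \<otimes> k) = f x"
  "f \<in> binv \<Longrightarrow> x \<in> carrier H \<Longrightarrow> k \<in> tr b b \<Longrightarrow> f (k \<otimes> x) = f x"
  by (auto simp: binv_def)

lemma stabD: "k \<in> tr b b \<Longrightarrow> k \<in> carrier H" "k \<in> tr b b \<Longrightarrow> act k b = b" "k \<in> tr b b \<Longrightarrow> inv k \<in> tr b b"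
  using tr_inv[OF b_in b_in] by (auto simp: tr_def)

lemma tr_b_eq: assumes "x \<in> carrier H" "y \<in> carrier H" "act x b = act y b" shows "inv y \<otimes> x \<in> tr b b" "x = y \<otimes> (inv y \<otimes> x)"
  using assms by (auto simp: tr_def act_mult m_assoc[symmetric])

lemma binv_eq: assumes "f \<in> binv" "x \<in> carrier H" "y \<in> carrier H" "act x b = act y b" shows "f x = f y"
  using tr_b_eq[OF assms(2-4)] binvD(2)[OF assms(1,3)] by metis

lemma conv_left: assumes "k \<in> carrier H" "x \<in> carrier H" "f \<in> carrier Cc" "h \<in> borel_measurable \<mu>"
  and "\<And>y. y \<in> carrier H \<Longrightarrow> f (k \<otimes> y) = f y"
  shows "conv f h (k \<otimes> x) = conv f h x"
proof -
  have "conv f h (k \<otimes> x) = (\<integral>y. f y * h (inv y \<otimes> (k \<otimes> x)) \<partial>\<mu>)" using assms by (simp add: conv_in)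
  also have "\<dots> = (\<integral>y. f (k \<otimes> y) * h (inv (k \<otimes> y) \<otimes> (k \<otimes> x)) \<partial>\<mu>)"
    using integral_left[OF assms(1) borel_measurable_times[OF Cc_measurable[OF assms(3)]
      translate_measurable[OF assms(4) m_closed[OF assms(1,2)]]]] by simp
  also have "\<dots> = (\<integral>y. f y * h (inv y \<otimes> x) \<partial>\<mu>)"
    using assms by (intro Bochner_Integration.integral_cong) (auto simp: inv_mult_group m_assoc)
  finally show ?thesis using assms by (simp add: conv_in)
qed

lemma conv_right: assumes "k \<in> carrier H" "x \<in> carrier H" "f \<in> carrier Cc"
  and "\<And>y. y \<in> carrier H \<Longrightarrow> h (y \<otimes> k) = h y"
  shows "conv f h (x \<otimes> k) = conv f h x"
  using assms by (auto simp: conv_in m_assoc[symmetric] intro!: Bochner_Integration.integral_cong)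

lemma conv_binv: "f \<in> binv \<Longrightarrow> h \<in> binv \<Longrightarrow> conv f h \<in> binv"
  unfolding binv_def by (auto intro!: conv_Cc conv_left conv_right Cc_measurable dest: stabD)

lemma star_binv: assumes f: "f \<in> binv" shows "star Cc f \<in> binv"
  unfolding binv_def
proof (intro CollectI conjI ballI)
  show "star Cc f \<in> carrier Cc" by (rule Cc_star_in[OF binvD(1)[OF f]])
  fix x k assume x: "x \<in> carrier H" and k: "k \<in> tr b b"
  note k' = stabD[OF k]
  show "star Cc f (x \<otimes> k) = star Cc f x"
    using x k' binvD(3)[OF f inv_closed[OF x] k'(3)] by (simp add: Cc_star act_mult inv_mult_group)
  have "w (act (k \<otimes> x) b) = w (act x b)"
    using x k' modulus_tr_b[OF k'(3)] by (simp add: w_act inv_mult_group modulus_mult)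
  then show "star Cc f (k \<otimes> x) = star Cc f x"
    using x k' binvD(2)[OF f inv_closed[OF x] k'(3)] by (simp add: Cc_star inv_mult_group)
qed

text \<open>The projection p.\<close>

definition unit_proj :: "'g \<Rightarrow> complex" where "unit_proj = indicator (tr b b)"

lemma unit_proj_Cc: "unit_proj \<in> carrier Cc"
proof (rule CcI[where E = "{b}"])
  fix x and e :: real assume "x \<in> carrier H" "e > 0"
  then show "\<exists>F\<subseteq>S. finite F \<and> (\<forall>y\<in>cyl F x. cmod (unit_proj y - unit_proj x) < e)"
    by (intro exI[of _ "{b}"]) (auto simp: unit_proj_def cyl_def tr_def indicator_def)
qed (auto simp: unit_proj_def tr_def indicator_def split: if_splits)

lemma unit_proj_binv: "unit_proj \<in> binv"
  unfolding binv_def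
proof (intro CollectI conjI ballI unit_proj_Cc)
  fix x k assume x: "x \<in> carrier H" and k: "k \<in> tr b b"
  note k' = stabD[OF k]
  show "unit_proj (x \<otimes> k) = unit_proj x" using x k' by (simp add: unit_proj_def indicator_def tr_def act_mult)
  have "act k (act x b) = b \<longleftrightarrow> act x b = b" using x k' act_inj[of k "act x b" b] by simp
  then show "unit_proj (k \<otimes> x) = unit_proj x" using x k' by (simp add: unit_proj_def indicator_def tr_def act_mult)
qed

lemma conv_unit_proj_left: assumes f: "f \<in> binv" shows "conv unit_proj f = f"
proof
  fix x show "conv unit_proj f x = f x"
  proof (cases "x \<in> carrier H")
    case True
    have "conv unit_proj f x = (\<integral>y. indicator (tr b b) y *\<^sub>R f x \<partial>\<mu>)"
      using True binvD(3)[OF f True] stabD by (auto simp: conv_in unit_proj_def indicator_def intro!: Bochner_Integration.integral_cong)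
    also have "\<dots> = f x"
      using CO_finite[OF CO_stab] emeasure_tr_b[OF b_in]
      by (subst integral_scaleR_left) (auto simp: measure_def Int_absorb2 CO_sub[OF CO_stab])
    finally show ?thesis .
  qed (simp add: convolution_def CcD0[OF binvD(1)[OF f]])
qed

text \<open>A right invariant function is constant on \<open>tr b (act x b)\<close>, a left coset of
  measure 1, so the \<open>b\<close>-column of its matrix lists its values.\<close>

lemma mat_right_inv:
  fixes g :: "'g \<Rightarrow> complex"
  assumes "\<And>y k. y \<in> carrier H \<Longrightarrow> k \<in> tr b b \<Longrightarrow> g (y \<otimes> k) = g y" and x: "x \<in> carrier H"
  shows "mat g (act x b) b = g x"
proof -
  have t: "tr b (act x b) \<subseteq> carrier H" by (auto simp: tr_def)
  have "g y = g x" if "y \<in> tr b (act x b)" for y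
    using tr_b_eq[of y x] that x assms(1)[OF x] by (metis trD)
  then have "mat g (act x b) b = (\<integral>y. indicator (tr b (act x b)) y *\<^sub>R g x \<partial>\<mu>)"
    using x by (auto simp: mat_def indicator_def intro!: Bochner_Integration.integral_cong)
  also have "\<dots> = g x"
    using CO_finite[OF CO_tr[OF b_in]] emeasure_tr_b[of "act x b"] x t
    by (subst integral_scaleR_left) (auto simp: measure_def Int_absorb2)
  finally show ?thesis .
qed

text \<open>Identifies functions on S with right invariant functions on the group. Left cosets have
  measure 1, so square norms are preserved.\<close>

definition lift :: "('s \<Rightarrow> complex) \<Rightarrow> 'g \<Rightarrow> complex" where
  "lift \<phi> x = (if x \<in> carrier H then \<phi> (act x b) else 0)"

lemma lift_Cc:
  assumes "finite E" "E \<subseteq> S" "\<And>s. \<phi> s \<noteq> 0 \<Longrightarrow> s \<in> E" shows "lift \<phi> \<in> carrier Cc"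
proof (rule CcI[OF _ assms(1,2)])
  fix x and e :: real assume "x \<in> carrier H" "e > 0"
  then show "\<exists>F\<subseteq>S. finite F \<and> (\<forall>y\<in>cyl F x. cmod (lift \<phi> y - lift \<phi> x) < e)"
    by (intro exI[of _ "{b}"]) (auto simp: lift_def cyl_def)
qed (use assms in \<open>auto simp: lift_def split: if_splits\<close>)

text \<open>Under this identification left convolution by f is the matrix \<open>mat f\<close>, so
  the permutation representation sits inside the regular one.\<close>

lemma conv_lift:
  assumes f: "f \<in> carrier Cc" and E: "finite E" "E \<subseteq> S" "\<And>s. \<phi> s \<noteq> 0 \<Longrightarrow> s \<in> E" and x: "x \<in> carrier H"
  shows "conv f (lift \<phi>) x = (\<Sum>t\<in>E. mat f (act x b) t * \<phi> t)"
proof -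
  let ?s = "act x b"
  have pt: "f y * lift \<phi> (inv y \<otimes> x) = (\<Sum>t\<in>E. (indicator (tr t ?s) y *\<^sub>R f y) * \<phi> t)" if y: "y \<in> carrier H" for y
  proof -
    have "(\<Sum>t\<in>E. (indicator (tr t ?s) y *\<^sub>R f y) * \<phi> t) = (\<Sum>t\<in>E. if t = act (inv y) ?s then f y * \<phi> (act (inv y) ?s) else 0)"
    proof (rule sum.cong[OF refl])
      fix t assume "t \<in> E"
      then have "y \<in> tr t ?s \<longleftrightarrow> t = act (inv y) ?s" using E(2) x by (intro tr_iff y) auto
      then show "(indicator (tr t ?s) y *\<^sub>R f y) * \<phi> t = (if t = act (inv y) ?s then f y * \<phi> (act (inv y) ?s) else 0)"
        by auto
    qed
    then show ?thesis using E y x by (auto simp: lift_def act_mult)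
  qed
  have "conv f (lift \<phi>) x = (\<integral>y. (\<Sum>t\<in>E. (indicator (tr t ?s) y *\<^sub>R f y) * \<phi> t) \<partial>\<mu>)"
    unfolding conv_in[OF x] by (rule Bochner_Integration.integral_cong[OF refl]) (simp only: pt space_mu)
  also have "\<dots> = (\<Sum>t\<in>E. \<integral>y. (indicator (tr t ?s) y *\<^sub>R f y) * \<phi> t \<partial>\<mu>)"
    using E by (intro Bochner_Integration.integral_sum integrable_mult_left integrable_tr Cc_integrable f) auto
  also have "\<dots> = (\<Sum>t\<in>E. mat f ?s t * \<phi> t)"
  proof (rule sum.cong[OF refl])
    fix t assume "t \<in> E"
    then have "mat f ?s t = (\<integral>y. indicator (tr t ?s) y *\<^sub>R f y \<partial>\<mu>)" using E x by (auto simp: mat_def)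
    then show "(\<integral>y. (indicator (tr t ?s) y *\<^sub>R f y) * \<phi> t \<partial>\<mu>) = mat f ?s t * \<phi> t" by (simp only: integral_mult_left_zero)
  qed
  finally show ?thesis .
qed

lemma conv_unit_proj_right: assumes f: "f \<in> binv" shows "conv f unit_proj = f"
proof
  have p: "unit_proj = lift (\<lambda>s. if s = b then 1 else 0)" by (auto simp: unit_proj_def lift_def indicator_def tr_def)
  fix x show "conv f unit_proj x = f x"
  proof (cases "x \<in> carrier H")
    case True
    have "conv f unit_proj x = mat f (act x b) b"
      unfolding p by (subst conv_lift[OF binvD(1)[OF f], of "{b}"]) (auto simp: True split: if_splits)
    also have "\<dots> = f x" by (rule mat_right_inv[OF binvD(2)[OF f] True])
    finally show ?thesis .
  qed (simp add: convolution_def CcD0[OF binvD(1)[OF f]])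
qed

lemma unit_proj_conv_unit_proj: assumes f: "f \<in> carrier Cc" shows "conv (conv unit_proj f) unit_proj \<in> binv"
proof -
  note pf = conv_Cc[OF unit_proj_Cc f]
  have l: "conv unit_proj f (k \<otimes> x) = conv unit_proj f x" if "x \<in> carrier H" "k \<in> tr b b" for x k
    using that stabD binvD(3)[OF unit_proj_binv] by (intro conv_left unit_proj_Cc Cc_measurable f) auto
  show ?thesis
    unfolding binv_def
  proof (intro CollectI conjI ballI)
    show "conv (conv unit_proj f) unit_proj \<in> carrier Cc" by (rule conv_Cc[OF pf unit_proj_Cc])
    fix x k assume x: "x \<in> carrier H" and k: "k \<in> tr b b"
    show "conv (conv unit_proj f) unit_proj (x \<otimes> k) = conv (conv unit_proj f) unit_proj x"
      by (rule conv_right[OF stabD(1)[OF k] x pf]) (rule binvD(2)[OF unit_proj_binv _ k])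
    show "conv (conv unit_proj f) unit_proj (k \<otimes> x) = conv (conv unit_proj f) unit_proj x"
      by (rule conv_left[OF stabD(1)[OF k] x pf Cc_measurable[OF unit_proj_Cc]]) (rule l[OF _ k])
  qed
qed

definition sect :: "'s \<Rightarrow> 'g" where "sect s = (SOME x. x \<in> carrier H \<and> act x b = s)"

lemma sect: assumes "s \<in> S" shows "sect s \<in> carrier H" "act (sect s) b = s"
  using someI_ex[of "\<lambda>x. x \<in> carrier H \<and> act x b = s"] trans[OF assms] unfolding sect_def by blast+

lemma binv_lift:
  assumes f: "f \<in> binv"
  defines "\<phi> \<equiv> (\<lambda>s. if s \<in> S then f (sect s) else 0)" and "E \<equiv> {act x b |x. f x \<noteq> 0}"
  shows "f = lift \<phi>" "finite E" "E \<subseteq> S" "\<And>s. \<phi> s \<noteq> 0 \<longleftrightarrow> s \<in> E" "\<And>x. x \<in> carrier H \<Longrightarrow> \<phi> (act x b) = f x"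
proof -
  show e: "\<phi> (act x b) = f x" if x: "x \<in> carrier H" for x
    using binv_eq[OF f _ x, of "sect (act x b)"] sect[of "act x b"] x by (simp add: \<phi>_def)
  then show "f = lift \<phi>" using CcD0[OF binvD(1)[OF f]] by (auto simp: lift_def)
  show "finite E" "E \<subseteq> S" unfolding E_def using Cc_supp(1)[OF binvD(1)[OF f] b_in] Cc_supp_sub[OF binvD(1)[OF f] b_in] by auto
  show "\<phi> s \<noteq> 0 \<longleftrightarrow> s \<in> E" for s
  proof
    assume "\<phi> s \<noteq> 0"
    then have "s \<in> S" "f (sect s) \<noteq> 0" by (auto simp: \<phi>_def split: if_splits)
    then show "s \<in> E" using sect[of s] unfolding E_def by (intro CollectI exI[of _ "sect s"]) auto
  next
    assume "s \<in> E"
    then obtain x where "s = act x b" "f x \<noteq> 0" "x \<in> carrier H" using CcD0[OF binvD(1)[OF f]] unfolding E_def by blast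
    then show "\<phi> s \<noteq> 0" using e by simp
  qed
qed

text \<open>A right invariant integrand is summed over the left cosets that it meets, each of
  measure 1.\<close>

lemma integral_right_inv:
  fixes g :: "'g \<Rightarrow> complex"
  assumes g: "integrable \<mu> g" and F: "finite F" "F \<subseteq> S" "\<And>x. x \<in> carrier H \<Longrightarrow> g x \<noteq> 0 \<Longrightarrow> act x b \<in> F"
    and inv: "\<And>y k. y \<in> carrier H \<Longrightarrow> k \<in> tr b b \<Longrightarrow> g (y \<otimes> k) = g y"
  shows "(\<integral>x. g x \<partial>\<mu>) = (\<Sum>s\<in>F. g (sect s))"
proof -
  have "(\<integral>x. g x \<partial>\<mu>) = (\<Sum>s\<in>F. mat g s b)" by (rule integral_cols[OF g b_in F])
  also have "\<dots> = (\<Sum>s\<in>F. g (sect s))"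
  proof (rule sum.cong[OF refl])
    fix s assume "s \<in> F"
    then show "mat g s b = g (sect s)" using mat_right_inv[OF inv, of "sect s"] sect[of s] F by auto
  qed
  finally show ?thesis .
qed

text \<open>The kernel of the representation of \<open>p C\<^sub>c p\<close> on \<open>L\<^sup>2\<close> of the left-invariant functions,
  the variable being inverted; \<open>w s\<close> is the measure of the right coset indexed by \<open>s\<close>.\<close>

definition ker :: "('g \<Rightarrow> complex) \<Rightarrow> 's \<Rightarrow> 's \<Rightarrow> complex" where
  "ker f s t = (if s \<in> S \<and> t \<in> S then f (inv (sect s) \<otimes> sect t) * of_real (sqrt (w s / w t)) else 0)"

section \<open>The weighted kernel of the regular representation\<close>

lemma ker_supp:
  assumes f: "f \<in> carrier Cc" shows "finite {s. ker f s t \<noteq> 0}" "finite {t. ker f s t \<noteq> 0}"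
proof -
  have "{s. ker f s t \<noteq> 0} \<subseteq> act (sect t) ` {act (inv x) b |x. f x \<noteq> 0}"
  proof
    fix s assume "s \<in> {s. ker f s t \<noteq> 0}"
    then have st: "s \<in> S" "t \<in> S" "f (inv (sect s) \<otimes> sect t) \<noteq> 0" by (auto simp: ker_def split: if_splits)
    moreover have "s = act (sect t) (act (inv (inv (sect s) \<otimes> sect t)) b)"
      using st sect by (simp add: inv_mult_group act_mult)
    ultimately show "s \<in> act (sect t) ` {act (inv x) b |x. f x \<noteq> 0}" by blast
  qed
  then show "finite {s. ker f s t \<noteq> 0}" using Cc_supp(2)[OF f b_in] finite_surj by blast
  have "{t. ker f s t \<noteq> 0} \<subseteq> act (sect s) ` {act x b |x. f x \<noteq> 0}"
  proof
    fix t assume "t \<in> {t. ker f s t \<noteq> 0}"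
    then have st: "s \<in> S" "t \<in> S" "f (inv (sect s) \<otimes> sect t) \<noteq> 0" by (auto simp: ker_def split: if_splits)
    moreover have "t = act (sect s) (act (inv (sect s) \<otimes> sect t) b)"
      using st sect by (simp add: act_mult)
    ultimately show "t \<in> act (sect s) ` {act x b |x. f x \<noteq> 0}" by blast
  qed
  then show "finite {t. ker f s t \<noteq> 0}" using Cc_supp(1)[OF f b_in] finite_surj by blast
qed

lemma sqrt_w: "s \<in> S \<Longrightarrow> t \<in> S \<Longrightarrow> u \<in> S \<Longrightarrow> sqrt (w s / w t) * sqrt (w t / w u) = sqrt (w s / w u)"
  using w_pos[of t] by (simp flip: real_sqrt_mult)

text \<open>Translating the convolution integral by \<open>sect s\<close> gives an integrand
  constant on left cosets, hence a sum over intermediate points t. The weights telescope through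
  \<open>sqrt_w\<close>.\<close>

lemma ker_conv:
  assumes f: "f \<in> binv" and h: "h \<in> binv" shows "ker (conv f h) = mprod (ker f) (ker h)"
proof (intro ext)
  fix s u
  show "ker (conv f h) s u = mprod (ker f) (ker h) s u"
  proof (cases "s \<in> S \<and> u \<in> S")
    case False then show ?thesis by (auto simp: ker_def mprod_def)
  next
    case True
    then have s: "s \<in> S" and u: "u \<in> S" by auto
    note fC = binvD(1)[OF f] and hC = binvD(1)[OF h]
    have c: "sect s \<in> carrier H" "sect u \<in> carrier H" using s u sect by auto
    define g where "g y = f (inv (sect s) \<otimes> y) * h (inv y \<otimes> sect u)" for y
    have fm: "(\<lambda>y. f (inv (sect s) \<otimes> y)) \<in> borel_measurable \<mu>"
      using measurable_compose[OF measurable_cont[OF cont_left] Cc_measurable[OF fC]] c by simp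
    have gm: "g \<in> borel_measurable \<mu>"
      unfolding g_def[abs_def] using fm translate_measurable[OF Cc_measurable[OF hC] c(2)] by (rule borel_measurable_times)
    have cvg: "conv f h (inv (sect s) \<otimes> sect u) = (\<integral>y. g y \<partial>\<mu>)"
    proof -
      have "(\<integral>y. g y \<partial>\<mu>) = (\<integral>y. g (sect s \<otimes> y) \<partial>\<mu>)" using gm c by (simp add: integral_left)
      also have "\<dots> = (\<integral>y. f y * h (inv y \<otimes> (inv (sect s) \<otimes> sect u)) \<partial>\<mu>)"
        using c by (intro Bochner_Integration.integral_cong) (auto simp: g_def inv_mult_group m_assoc)
      finally show ?thesis using c by (simp add: conv_in)
    qed
    define V where "V = {t. ker h t u \<noteq> 0}"
    have V: "finite V" "V \<subseteq> S" using ker_supp(1)[OF hC] by (auto simp: V_def ker_def split: if_splits)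
    have kh: "ker h t u \<noteq> 0 \<longleftrightarrow> h (inv (sect t) \<otimes> sect u) \<noteq> 0" if "t \<in> S" for t
      using that u w_pos by (auto simp: ker_def less_imp_neq[THEN not_sym])
    have ginv: "g (y \<otimes> k) = g y" if "y \<in> carrier H" "k \<in> tr b b" for y k
      using that c binvD(2)[OF f, of "inv (sect s) \<otimes> y" k] binvD(3)[OF h, of "inv y \<otimes> sect u" "inv k"] stabD[OF that(2)]
      by (simp add: g_def m_assoc inv_mult_group)
    have gsupp: "act y b \<in> V" if y: "y \<in> carrier H" "g y \<noteq> 0" for y
    proof -
      let ?t = "act y b"
      have t: "?t \<in> S" using y by simp
      have "g (sect ?t) = g y"
        using tr_b_eq[of "sect ?t" y] sect[OF t] y ginv by metis
      then show ?thesis using y kh[OF t] by (auto simp: V_def g_def)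
    qed
    have gi: "integrable \<mu> g"
    proof -
      obtain B where B: "\<forall>x. cmod (f x) \<le> B" "B > 0" using Cc_bounded[OF fC] by blast
      obtain C where C: "\<forall>x. cmod (h x) \<le> C" "C > 0" using Cc_bounded[OF hC] by blast
      show ?thesis
      proof (rule bounded_integrable[OF gm _ V, of "B * C"])
        show "cmod (g x) \<le> B * C" for x
          unfolding g_def norm_mult using B C by (intro mult_mono) (auto intro: less_imp_le)
      qed (rule gsupp)
    qed
    have "ker (conv f h) s u = (\<Sum>t\<in>V. g (sect t)) * of_real (sqrt (w s / w u))"
      using s u integral_right_inv[OF gi V gsupp ginv] by (simp add: ker_def cvg)
    also have "\<dots> = (\<Sum>t\<in>V. ker f s t * ker h t u)"
      unfolding sum_distrib_right
    proof (rule sum.cong[OF refl])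
      fix t assume "t \<in> V"
      then have t: "t \<in> S" using V by auto
      show "g (sect t) * of_real (sqrt (w s / w u)) = ker f s t * ker h t u"
        unfolding sqrt_w[OF s t u, symmetric] using s t u by (simp add: ker_def g_def)
    qed
    finally show ?thesis by (simp add: mprod_def V_def)
  qed
qed

lemma w_quot: "s \<in> S \<Longrightarrow> t \<in> S \<Longrightarrow> w (act (inv (sect s) \<otimes> sect t) b) = w t / w s"
proof -
  assume st: "s \<in> S" "t \<in> S"
  have "w (act (inv (sect s) \<otimes> sect t) b) = modulus (inv (sect t)) * modulus (sect s)"
    using sect[OF st(1)] sect[OF st(2)] by (simp add: w_act inv_mult_group modulus_mult)
  moreover have "modulus (inv (sect t)) = w t" "modulus (inv (sect s)) = w s"
    using sect[OF st(1)] sect[OF st(2)] w_act by (metis)+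
  ultimately show ?thesis using modulus_inv[of "inv (sect s)"] sect[OF st(1)] by simp
qed

text \<open>The reason for the square roots: the modular factor of the involution is here
  \<open>w t / w s\<close>, and it turns the weight for s, t into the weight for t, s. The kernel of
  the adjoint is therefore exactly the conjugate transpose.\<close>

lemma ker_star: assumes f: "f \<in> carrier Cc" shows "ker (star Cc f) s t = cnj (ker f t s)"
proof (cases "s \<in> S \<and> t \<in> S")
  case True
  then have s: "s \<in> S" and t: "t \<in> S" by auto
  have "w t / w s * sqrt (w s / w t) = sqrt (w t / w s)"
    using w_pos[OF s] w_pos[OF t] by (simp add: real_sqrt_divide field_simps)
  then have e: "complex_of_real (w t / w s) * of_real (sqrt (w s / w t)) = of_real (sqrt (w t / w s))"
    by (metis of_real_mult)
  have "ker (star Cc f) s t = (complex_of_real (w t / w s) * of_real (sqrt (w s / w t))) * cnj (f (inv (sect t) \<otimes> sect s))"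
    using s t sect[OF s] sect[OF t] w_quot[OF s t] by (simp add: ker_def Cc_star inv_mult_group)
  then show ?thesis unfolding e using s t by (simp add: ker_def)
qed (auto simp: ker_def)

lemma row_sum:
  assumes f: "f \<in> binv" and x: "x \<in> carrier H" and U: "finite U" "U \<subseteq> S"
  shows "(\<Sum>t\<in>U. cmod (f (inv x \<otimes> sect t))) \<le> (\<integral>y. cmod (f y) \<partial>\<mu>)"
proof -
  note fC = binvD(1)[OF f] and F = cabs_Cc[OF binvD(1)[OF f]]
  define g where "g y = cabs f (inv x \<otimes> y)" for y
  have gi: "integrable \<mu> g" unfolding g_def[abs_def] by (rule integrable_inv_left[OF F x])
  define V where "V = U \<union> act x ` {act y b |y. f y \<noteq> 0}"
  have V: "finite V" "V \<subseteq> S" using U Cc_supp(1)[OF fC b_in] Cc_supp_sub[OF fC b_in] x by (auto simp: V_def)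
  have gsupp: "act y b \<in> V" if y: "y \<in> carrier H" "g y \<noteq> 0" for y
  proof -
    have "f (inv x \<otimes> y) \<noteq> 0" using y by (simp add: g_def cabs_def)
    moreover have "act y b = act x (act (inv x \<otimes> y) b)" using x y by (simp add: act_mult)
    ultimately show ?thesis unfolding V_def by blast
  qed
  have ginv: "g (y \<otimes> k) = g y" if "y \<in> carrier H" "k \<in> tr b b" for y k
    using that x binvD(2)[OF f, of "inv x \<otimes> y" k] stabD[OF that(2)] by (simp add: g_def cabs_def m_assoc)
  have "complex_of_real (\<integral>y. cmod (f y) \<partial>\<mu>) = (\<integral>y. g y \<partial>\<mu>)"
    unfolding nrm_cabs g_def using integral_left[OF inv_closed[OF x] Cc_measurable[OF F]] by (rule sym)
  also have "\<dots> = complex_of_real (\<Sum>t\<in>V. cmod (f (inv x \<otimes> sect t)))"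
  proof -
    have "(\<integral>y. g y \<partial>\<mu>) = (\<Sum>t\<in>V. g (sect t))" by (rule integral_right_inv[OF gi V gsupp ginv])
    also have "\<dots> = complex_of_real (\<Sum>t\<in>V. cmod (f (inv x \<otimes> sect t)))" by (simp add: g_def cabs_def)
    finally show ?thesis .
  qed
  finally have "(\<integral>y. cmod (f y) \<partial>\<mu>) = (\<Sum>t\<in>V. cmod (f (inv x \<otimes> sect t)))" by (simp only: of_real_eq_iff)
  then show ?thesis using V by (auto simp: V_def intro!: sum_mono2)
qed

text \<open>Schur test with weight \<open>sqrt (w s)\<close>, which reduces every row to a sum of
  values of |f| over left cosets; columns are rows of the adjoint. Outside S the value 1 keeps the
  weight positive.\<close>

lemma mbound_ker:
  assumes f: "f \<in> binv" shows "mbound (ker f) (\<integral>x. cmod (f x) \<partial>\<mu>)"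
proof (rule schur_test[where q = "\<lambda>s. if s \<in> S then sqrt (w s) else 1"])
  let ?q = "\<lambda>s. if s \<in> S then sqrt (w s) else 1" and ?N = "\<integral>x. cmod (f x) \<partial>\<mu>"
  show "0 \<le> ?N" by simp
  show "0 < ?q s" for s using w_pos by auto
  note fC = binvD(1)[OF f]
  show "(\<Sum>t\<in>U. cmod (ker f s t) * ?q t) \<le> ?N * ?q s" if U: "finite U" for s U
  proof (cases "s \<in> S")
    case True
    have "(\<Sum>t\<in>U. cmod (ker f s t) * ?q t) = (\<Sum>t\<in>U \<inter> S. cmod (ker f s t) * ?q t)"
      using U by (intro sum.mono_neutral_right) (auto simp: ker_def)
    also have "\<dots> = (\<Sum>t\<in>U \<inter> S. cmod (f (inv (sect s) \<otimes> sect t)) * sqrt (w s))"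
    proof (rule sum.cong[OF refl])
      fix t assume t: "t \<in> U \<inter> S"
      then have "sqrt (w s / w t) * sqrt (w t) = sqrt (w s)" using w_pos[of t] by (simp flip: real_sqrt_mult)
      moreover have "0 \<le> sqrt (w s / w t)" using w_pos[of t] w_pos[OF True] t by simp
      ultimately show "cmod (ker f s t) * ?q t = cmod (f (inv (sect s) \<otimes> sect t)) * sqrt (w s)"
        using t True by (simp add: ker_def norm_mult)
    qed
    also have "\<dots> \<le> ?N * sqrt (w s)"
      unfolding sum_distrib_right[symmetric]
      using U True sect[OF True] w_pos[OF True] by (intro mult_right_mono row_sum[OF f]) auto
    finally show ?thesis using True by simp
  qed (simp add: ker_def)
  show "(\<Sum>s\<in>U. ?q s * cmod (ker f s t)) \<le> ?N * ?q t" if U: "finite U" for t U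
  proof (cases "t \<in> S")
    case True
    note t = sect[OF True]
    have "(\<Sum>s\<in>U. ?q s * cmod (ker f s t)) = (\<Sum>s\<in>U \<inter> S. ?q s * cmod (ker f s t))"
      using U by (intro sum.mono_neutral_right) (auto simp: ker_def)
    also have "\<dots> = (\<Sum>s\<in>U \<inter> S. cmod (star Cc f (inv (sect t) \<otimes> sect s)) * sqrt (w t))"
    proof (rule sum.cong[OF refl])
      fix s assume s: "s \<in> U \<inter> S"
      have "cmod (ker f s t) = cmod (ker (star Cc f) t s)" by (simp add: ker_star[OF fC])
      also have "\<dots> = cmod (star Cc f (inv (sect t) \<otimes> sect s)) * sqrt (w t / w s)"
        using s True w_pos[of s] w_pos[OF True] by (simp add: ker_def norm_mult)
      finally have "sqrt (w s) * cmod (ker f s t) = cmod (star Cc f (inv (sect t) \<otimes> sect s)) * (sqrt (w t / w s) * sqrt (w s))" by simp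
      also have "sqrt (w t / w s) * sqrt (w s) = sqrt (w t)" using w_pos[of s] s by (simp flip: real_sqrt_mult)
      finally show "?q s * cmod (ker f s t) = cmod (star Cc f (inv (sect t) \<otimes> sect s)) * sqrt (w t)"
        using s by simp
    qed
    also have "\<dots> \<le> (\<integral>x. cmod (star Cc f x) \<partial>\<mu>) * sqrt (w t)"
      unfolding sum_distrib_right[symmetric]
      using U t w_pos[OF True] by (intro mult_right_mono row_sum[OF star_binv[OF f]]) auto
    finally show ?thesis using True by (simp add: nrm_star_Cc[OF fC])
  qed (simp add: ker_def)
qed

end

text \<open>Taking roots of order 2^k without limits: if N/m exceeded 1, its powers would outgrow
  the fixed constant c.\<close>

lemma lim_root_le:
  fixes N m c K :: real
  assumes "0 \<le> N" "0 < m" "0 < c" "\<And>k. N ^ (2 ^ k) \<le> c * m ^ (2 ^ k)" shows "N \<le> m"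
proof (rule ccontr)
  assume "\<not> N \<le> m"
  then have r: "N / m > 1" using assms by simp
  obtain n where n: "c < (N / m) ^ n" using real_arch_pow[OF r] by blast
  have "(N / m) ^ n \<le> (N / m) ^ (2 ^ n)" using r by (intro power_increasing) (auto simp: less_imp_le)
  then have "c < N ^ (2 ^ n) / m ^ (2 ^ n)" using n by (simp add: power_divide)
  then have "c * m ^ (2 ^ n) < N ^ (2 ^ n)" using assms(2) by (simp add: pos_less_divide_eq)
  then show False using assms(4)[of n] by simp
qed

lemma sum_le_sqrt_card:
  fixes f :: "'s \<Rightarrow> real"
  assumes "finite A" "\<And>s. 0 \<le> f s" shows "(\<Sum>s\<in>A. f s) \<le> sqrt (card A) * L2_set f A"
proof -
  have "(\<Sum>s\<in>A. f s) = (\<Sum>s\<in>A. \<bar>1\<bar> * \<bar>f s\<bar>)" using assms by simp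
  also have "\<dots> \<le> L2_set (\<lambda>s. 1) A * L2_set f A" by (rule L2_set_mult_ineq)
  also have "L2_set (\<lambda>s. 1) A = sqrt (card A)" by (simp add: L2_set_def)
  finally show ?thesis .
qed

context group
begin

lemma set_power_in: "V \<subseteq> carrier G \<Longrightarrow> set_power G V n \<subseteq> carrier G"
  by (induction n) (auto simp: set_mult_def)

lemma set_power_add: "V \<subseteq> carrier G \<Longrightarrow> set_power G V (m + n) = set_power G V m <#> set_power G V n"
proof (induction n)
  case 0
  have "set_power G V m <#> {\<one>} = set_power G V m" using set_power_in[OF 0, of m] by (force simp: set_mult_def)
  then show ?case by simp
next
  case (Suc n)
  then show ?case using set_mult_assoc[OF set_power_in[OF Suc.prems] set_power_in[OF Suc.prems] Suc.prems] by simp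
qed

text \<open>Inversion moves the last letter of a word to the front, hence the split 1 + n in place
  of n + 1.\<close>

lemma set_power_inv:
  assumes V: "V \<subseteq> carrier G" "\<And>x. x \<in> V \<Longrightarrow> inv x \<in> V"
  shows "x \<in> set_power G V n \<Longrightarrow> inv x \<in> set_power G V n"
proof (induction n arbitrary: x)
  case 0 then show ?case by simp
next
  case (Suc n)
  then obtain y v where yv: "y \<in> set_power G V n" "v \<in> V" "x = y \<otimes> v" by (auto simp: set_mult_def)
  have c: "y \<in> carrier G" "v \<in> carrier G" using yv set_power_in[OF V(1)] V by auto
  have one: "set_power G V 1 = V" using V(1) by (force simp: set_mult_def)
  have "inv x = inv v \<otimes> inv y" using yv c by (simp add: inv_mult_group)
  moreover have "inv v \<otimes> inv y \<in> set_power G V 1 <#> set_power G V n"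
    unfolding one using yv V(2) Suc.IH by (auto simp: set_mult_def)
  ultimately show ?case using set_power_add[OF V(1), of 1 n] by simp
qed

end

section \<open>Growth and C*-seminorms\<close>

text \<open>\<open>Z\<close> is an abstract copy of \<open>p C_c p\<close>, later the Hecke algebra;
  the growth argument can then ignore double cosets.\<close>

locale perm_hecke = perm_haar H T \<mu> act S b
  for H :: "('g, 'm) monoid_scheme" (structure) and T :: "'g topology" and \<mu> :: "'g measure"
    and act :: "'g \<Rightarrow> 's \<Rightarrow> 's" and S :: "'s set" and b :: 's +
  fixes Z :: "'z star_alg" and i :: "'z \<Rightarrow> 'g \<Rightarrow> complex"
  assumes i_bij: "bij_betw i (carrier Z) binv"
    and Z_add: "a \<in> carrier Z \<Longrightarrow> c \<in> carrier Z \<Longrightarrow> vadd Z a c \<in> carrier Z \<and> i (vadd Z a c) = (\<lambda>x. i a x + i c x)"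
    and Z_scal: "a \<in> carrier Z \<Longrightarrow> scal Z k a \<in> carrier Z \<and> i (scal Z k a) = (\<lambda>x. k * i a x)"
    and Z_mul: "a \<in> carrier Z \<Longrightarrow> c \<in> carrier Z \<Longrightarrow> vmul Z a c \<in> carrier Z \<and> i (vmul Z a c) = conv (i a) (i c)"
    and Z_star: "a \<in> carrier Z \<Longrightarrow> star Z a \<in> carrier Z \<and> i (star Z a) = star Cc (i a)"
    and Z_nrm: "a \<in> carrier Z \<Longrightarrow> nrm Z a = (\<integral>x. cmod (i a x) \<partial>\<mu>)"
begin

lemma i_in: "a \<in> carrier Z \<Longrightarrow> i a \<in> binv"
  using i_bij by (auto simp: bij_betw_def)

lemma i_inj: "a \<in> carrier Z \<Longrightarrow> c \<in> carrier Z \<Longrightarrow> i a = i c \<Longrightarrow> a = c"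
  using i_bij by (auto simp: bij_betw_def inj_on_def)

lemma i_surj: "f \<in> binv \<Longrightarrow> \<exists>a\<in>carrier Z. i a = f"
  using i_bij by (metis bij_betw_def imageE)

lemma i_Cc: "a \<in> carrier Z \<Longrightarrow> i a \<in> carrier Cc"
  using i_in binvD by blast

lemmas Z_in = Z_add[THEN conjunct1] Z_scal[THEN conjunct1] Z_mul[THEN conjunct1] Z_star[THEN conjunct1]
lemmas i_ops = Z_add[THEN conjunct2] Z_scal[THEN conjunct2] Z_mul[THEN conjunct2] Z_star[THEN conjunct2]

lemma star_hom_i: "star_hom Z Cc i"
  by (auto simp: star_hom_def i_Cc i_ops Cc_ops)

lemma i_ops': 
  "a \<in> carrier Z \<Longrightarrow> c \<in> carrier Z \<Longrightarrow> i (vadd Z a c) = vadd Cc (i a) (i c)"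
  "a \<in> carrier Z \<Longrightarrow> i (scal Z k a) = scal Cc k (i a)"
  "a \<in> carrier Z \<Longrightarrow> c \<in> carrier Z \<Longrightarrow> i (vmul Z a c) = vmul Cc (i a) (i c)"
  "a \<in> carrier Z \<Longrightarrow> i (star Z a) = star Cc (i a)"
  "a \<in> carrier Z \<Longrightarrow> nrm Z a = nrm Cc (i a)"
  by (auto simp: i_ops Cc_ops Z_nrm)

lemma star_nalg_Z: "star_nalg Z"
proof -
  interpret C: star_nalg Cc by (rule star_nalg_Cc)
  note I = i_ops' Z_in i_Cc
  show ?thesis
  proof (unfold_locales, goal_cases)
    case 1
    show ?case using i_surj[OF unit_proj_binv] by blast
  next
    case (6 a b c) then show ?case by (intro i_inj) (simp_all add: I C.add_assoc)
  next
    case (7 a b) then show ?case by (intro i_inj) (simp_all add: I C.add_comm)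
  next
    case (8 a b) then show ?case by (intro i_inj) (simp_all add: I C.add_zero)
  next
    case (9 c a b) then show ?case by (intro i_inj) (simp_all add: I C.scal_add)
  next
    case (10 c d a) then show ?case by (intro i_inj) (simp_all add: I C.add_scal)
  next
    case (11 c d a) then show ?case by (intro i_inj) (simp_all add: I C.scal_scal)
  next
    case (12 a) then show ?case by (intro i_inj) (simp_all add: I C.scal_one)
  next
    case (13 a b c) then show ?case by (intro i_inj) (simp_all add: I C.mul_add_left)
  next
    case (14 a b c) then show ?case by (intro i_inj) (simp_all add: I C.mul_add_right)
  next
    case (15 k a b) then show ?case by (intro i_inj) (simp_all add: I C.mul_scal_left)
  next
    case (16 k a b) then show ?case by (intro i_inj) (simp_all add: I C.mul_scal_right)
  next
    case (17 a b) then show ?case by (intro i_inj) (simp_all add: I C.star_add)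
  next
    case (18 c a) then show ?case by (intro i_inj) (simp_all add: I C.star_scal)
  next
    case (19 a) then show ?case by (intro i_inj) (simp_all add: I C.star_star)
  qed (simp_all add: I C.nrm_add C.nrm_scal C.nrm_mul C.nrm_star)
qed

lemma cstar_seminorm_ker: "cstar_seminorm Z (\<lambda>a. mnorm (ker (i a)))"
proof (rule cstar_seminorm_mnorm[OF star_nalg_Z])
  fix a assume a: "a \<in> carrier Z"
  show "mbound (ker (i a)) (nrm Z a)" using mbound_ker[OF i_in[OF a]] by (simp add: Z_nrm[OF a])
  show "colfin (ker (i a))" using ker_supp(1)[OF i_Cc[OF a]] by (simp add: colfin_def)
  show "ker (i (star Z a)) = (\<lambda>s t. cnj (ker (i a) t s))" using a ker_star[OF i_Cc[OF a]] by (auto simp: i_ops)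
  show "ker (i (scal Z c a)) = (\<lambda>s t. c * ker (i a) s t)" for c
    using a by (intro ext) (simp add: i_ops ker_def)
  fix c assume c: "c \<in> carrier Z"
  show "ker (i (vadd Z a c)) = (\<lambda>s t. ker (i a) s t + ker (i c) s t)"
    using a c by (intro ext) (simp add: i_ops ker_def distrib_right)
  show "ker (i (vmul Z a c)) = mprod (ker (i a)) (ker (i c))"
    using a c ker_conv[OF i_in i_in] by (simp add: i_ops)
qed

text \<open>The vector that a produces from the point mass at \<open>b\<close>, equivalently the
  \<open>b\<close>-column of \<open>mat (i a)\<close>. Its \<ell>^1-norm is \<open>nrm Z a\<close>,
  while \<open>mat\<close> controls its \<ell>^2-norm under multiplication.\<close>

definition coef :: "'z \<Rightarrow> 's \<Rightarrow> complex" where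
  "coef a s = (if s \<in> S then i a (sect s) else 0)"

lemma coef:
  assumes a: "a \<in> carrier Z"
  shows "i a = lift (coef a)" "finite {s. coef a s \<noteq> 0}" "{s. coef a s \<noteq> 0} \<subseteq> S"
    "x \<in> carrier H \<Longrightarrow> coef a (act x b) = i a x" "coef a s \<noteq> 0 \<longleftrightarrow> (\<exists>x\<in>carrier H. s = act x b \<and> i a x \<noteq> 0)"
proof -
  note B = binv_lift[OF i_in[OF a]]
  have c: "coef a = (\<lambda>s. if s \<in> S then i a (sect s) else 0)" by (auto simp: coef_def)
  show "i a = lift (coef a)" unfolding c by (rule B(1))
  show "x \<in> carrier H \<Longrightarrow> coef a (act x b) = i a x" unfolding c by (rule B(5))
  have e: "{s. coef a s \<noteq> 0} = {act x b |x. i a x \<noteq> 0}" unfolding c using B(4) by blast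
  show "finite {s. coef a s \<noteq> 0}" "{s. coef a s \<noteq> 0} \<subseteq> S" unfolding e by (rule B(2), rule B(3))
  show "coef a s \<noteq> 0 \<longleftrightarrow> (\<exists>x\<in>carrier H. s = act x b \<and> i a x \<noteq> 0)"
    using e CcD0[OF i_Cc[OF a]] by blast
qed

lemma nrm_coef:
  assumes a: "a \<in> carrier Z" shows "nrm Z a = (\<Sum>s | coef a s \<noteq> 0. cmod (coef a s))"
proof -
  note C = coef[OF a]
  have ci: "integrable \<mu> (cabs (i a))" by (rule Cc_integrable[OF cabs_Cc[OF i_Cc[OF a]]])
  have "complex_of_real (nrm Z a) = (\<integral>x. cabs (i a) x \<partial>\<mu>)" by (simp add: Z_nrm[OF a] nrm_cabs)
  also have "\<dots> = (\<Sum>s | coef a s \<noteq> 0. cabs (i a) (sect s))"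
    using C(4) binvD(2)[OF i_in[OF a]] by (intro integral_right_inv ci C(2,3)) (auto simp: cabs_def)
  also have "\<dots> = (\<Sum>s | coef a s \<noteq> 0. complex_of_real (cmod (coef a s)))"
    using C(3) by (intro sum.cong) (auto simp: cabs_def coef_def)
  finally show ?thesis by (simp flip: of_real_sum)
qed

lemma coef_mul:
  assumes a: "a \<in> carrier Z" and c: "c \<in> carrier Z" and s: "s \<in> S"
  shows "coef (vmul Z a c) s = (\<Sum>t | coef c t \<noteq> 0. mat (i a) s t * coef c t)"
proof -
  have x: "sect s \<in> carrier H" "act (sect s) b = s" using sect[OF s] by auto
  have "coef (vmul Z a c) s = conv (i a) (lift (coef c)) (sect s)"
    using a c s by (simp add: coef_def[of "vmul Z a c"] i_ops coef(1)[OF c, symmetric])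
  also have "\<dots> = (\<Sum>t | coef c t \<noteq> 0. mat (i a) (act (sect s) b) t * coef c t)"
    using coef[OF c] by (intro conv_lift i_Cc a x) auto
  finally show ?thesis by (simp add: x)
qed

abbreviation "mat_norm a \<equiv> mnorm (mat (i a))"

lemma cstar_seminorm_mat_norm: "cstar_seminorm Z (\<lambda>a. mat_norm a)"
  using cstar_seminorm_comp[OF star_hom_i _ cstar_seminorm_mat] Z_in i_ops'(5) by simp

lemma L2_coef_mul:
  assumes a: "a \<in> carrier Z" and c: "c \<in> carrier Z"
  shows "L2_set (\<lambda>s. cmod (coef (vmul Z a c) s)) {s. coef (vmul Z a c) s \<noteq> 0}
    \<le> mat_norm a * L2_set (\<lambda>s. cmod (coef c s)) {s. coef c s \<noteq> 0}"
proof -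
  let ?F = "{s. coef (vmul Z a c) s \<noteq> 0}"
  have ac: "vmul Z a c \<in> carrier Z" using a c Z_in by blast
  have "L2_set (\<lambda>s. cmod (coef (vmul Z a c) s)) ?F = L2_set (\<lambda>s. cmod (\<Sum>t | coef c t \<noteq> 0. mat (i a) s t * coef c t)) ?F"
    using coef(3)[OF ac] by (intro L2_set_cong refl) (auto simp: coef_mul[OF a c])
  also have "\<dots> \<le> mat_norm a * L2_set (\<lambda>s. cmod (coef c s)) {s. coef c s \<noteq> 0}"
    by (rule mboundD[OF mbound_mnorm[OF mbound_mat[OF i_Cc[OF a]]] coef(2)[OF ac] coef(2)[OF c]])
  finally show ?thesis .
qed

fun iter_sq :: "'z \<Rightarrow> nat \<Rightarrow> 'z" where
  "iter_sq a 0 = a"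
| "iter_sq a (Suc n) = vmul Z (star Z (iter_sq a n)) (iter_sq a n)"

lemma iter_sq_in: "a \<in> carrier Z \<Longrightarrow> iter_sq a n \<in> carrier Z"
  by (induction n) (auto simp: Z_in)

lemma cstar_iter_sq: "cstar_seminorm Z N \<Longrightarrow> a \<in> carrier Z \<Longrightarrow> N (iter_sq a n) = N a ^ (2 ^ n)"
proof (induction n)
  case (Suc n)
  have "N (iter_sq a (Suc n)) = (N (iter_sq a n))\<^sup>2" using Suc.prems iter_sq_in by (simp add: cstar_seminorm_def)
  then show ?case using Suc by (simp add: power_mult[symmetric] mult.commute)
qed simp

lemma L2_iter_sq:
  assumes a: "a \<in> carrier Z"
  shows "L2_set (\<lambda>s. cmod (coef (iter_sq a n) s)) {s. coef (iter_sq a n) s \<noteq> 0}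
    \<le> mat_norm a ^ (2 ^ n - 1) * L2_set (\<lambda>s. cmod (coef a s)) {s. coef a s \<noteq> 0}"
proof (induction n)
  case (Suc n)
  let ?L = "\<lambda>a. L2_set (\<lambda>s. cmod (coef a s)) {s. coef a s \<noteq> 0}"
  have p: "iter_sq a n \<in> carrier Z" by (rule iter_sq_in[OF a])
  have M0: "0 \<le> mat_norm a" by (rule mnorm_nonneg[OF mbound_mat[OF i_Cc[OF a]]])
  \<comment> \<open>The outer factor contributes 2^n to the exponent by the C*-identity for
    \<open>mat_norm\<close>; the induction hypothesis adds 2^n - 1.\<close>
  have "mat_norm (star Z (iter_sq a n)) = mat_norm (iter_sq a n)"
    using star_nalg.cstar_seminorm_star[OF star_nalg_Z cstar_seminorm_mat_norm p] .
  also have "\<dots> = mat_norm a ^ (2 ^ n)" by (rule cstar_iter_sq[OF cstar_seminorm_mat_norm a])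
  finally have "?L (iter_sq a (Suc n)) \<le> mat_norm a ^ (2 ^ n) * ?L (iter_sq a n)"
    using L2_coef_mul[OF _ p, of "star Z (iter_sq a n)"] p Z_in by simp
  also have "\<dots> \<le> mat_norm a ^ (2 ^ n) * (mat_norm a ^ (2 ^ n - 1) * ?L a)" using Suc M0 by (intro mult_left_mono) auto
  also have "\<dots> = mat_norm a ^ (2 ^ n + (2 ^ n - 1)) * ?L a" by (simp only: power_add mult.assoc)
  also have "(2 ^ n + (2 ^ n - 1) :: nat) = 2 ^ Suc n - 1" by simp
  finally show ?case .
qed simp

text \<open>The involution inverts the support, which symmetry of V absorbs; the product then
  doubles the word length.\<close>

lemma iter_sq_supp:
  assumes a: "a \<in> carrier Z" and V: "V \<subseteq> carrier H" "\<And>x. x \<in> V \<Longrightarrow> inv x \<in> V" "\<And>x. i a x \<noteq> 0 \<Longrightarrow> x \<in> V"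
  shows "i (iter_sq a n) x \<noteq> 0 \<Longrightarrow> x \<in> set_power H V (2 ^ n)"
proof (induction n arbitrary: x)
  case 0
  have "set_power H V 1 = V" using V(1) by (force simp: set_mult_def)
  then show ?case using 0 V by simp
next
  case (Suc n)
  have p: "iter_sq a n \<in> carrier Z" by (rule iter_sq_in[OF a])
  have xc: "x \<in> carrier H" using Suc.prems CcD0[OF i_Cc[OF iter_sq_in[OF a]]] by metis
  have "conv (star Cc (i (iter_sq a n))) (i (iter_sq a n)) x \<noteq> 0"
    using Suc.prems p Z_in by (simp add: i_ops)
  then have "\<exists>y. star Cc (i (iter_sq a n)) y * i (iter_sq a n) (inv y \<otimes> x) \<noteq> 0"
    unfolding conv_in[OF xc] by (metis (mono_tags, lifting) Bochner_Integration.integral_zero Bochner_Integration.integral_cong)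
  then obtain y where y: "star Cc (i (iter_sq a n)) y \<noteq> 0" "i (iter_sq a n) (inv y \<otimes> x) \<noteq> 0" by auto
  have yc: "y \<in> carrier H" "i (iter_sq a n) (inv y) \<noteq> 0" using y(1) by (auto simp: Cc_star split: if_splits)
  have "inv (inv y) \<in> set_power H V (2 ^ n)" by (rule set_power_inv[OF V(1,2) Suc.IH[OF yc(2)]])
  then have "y \<in> set_power H V (2 ^ n)" using yc by simp
  moreover have "inv y \<otimes> x \<in> set_power H V (2 ^ n)" by (rule Suc.IH[OF y(2)])
  moreover have "x = y \<otimes> (inv y \<otimes> x)" using yc xc by simp
  ultimately have "x \<in> set_power H V (2 ^ n) <#> set_power H V (2 ^ n)" unfolding set_mult_def by blast
  then show ?case using set_power_add[OF V(1), of "2 ^ n" "2 ^ n"] by (simp add: mult_2)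
qed

text \<open>Subexponential growth, measured by the number of left cosets of the compact open subgroup.\<close>

definition slow_growth :: bool where
  "slow_growth \<longleftrightarrow> (\<forall>V. CO V \<and> \<one> \<in> V \<and> (\<forall>x\<in>V. \<forall>k\<in>tr b b. x \<otimes> k \<in> V \<and> k \<otimes> x \<in> V) \<longrightarrow>
     (\<forall>e>0. \<exists>c>0. \<forall>n. real (card ((\<lambda>x. act x b) ` set_power H V n)) \<le> c * (1 + e) ^ n))"

text \<open>Produces the symmetric neighbourhood to which \<open>slow_growth\<close> is applied.
  Adjoining the stabiliser puts the identity into it, and bi-invariance of \<open>i a\<close> gives
  invariance under the stabiliser on both sides.\<close>

lemma support_nbhd:
  assumes a: "a \<in> carrier Z"
  defines "V \<equiv> {x \<in> carrier H. i a x \<noteq> 0 \<or> i a (inv x) \<noteq> 0} \<union> tr b b"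
  shows "CO V" "\<one> \<in> V" "\<forall>x\<in>V. \<forall>k\<in>tr b b. x \<otimes> k \<in> V \<and> k \<otimes> x \<in> V" "\<And>x. x \<in> V \<Longrightarrow> inv x \<in> V"
proof -
  define E where "E = {act x b |x. i a x \<noteq> 0}"
  have E: "finite E" "E \<subseteq> S" unfolding E_def using Cc_supp(1)[OF i_Cc[OF a] b_in] Cc_supp_sub[OF i_Cc[OF a] b_in] by auto
  have "{x \<in> carrier H. i a x \<noteq> 0} = (\<Union>s\<in>E. tr b s)"
  proof
    show "{x \<in> carrier H. i a x \<noteq> 0} \<subseteq> (\<Union>s\<in>E. tr b s)" by (auto simp: E_def tr_def)
    show "(\<Union>s\<in>E. tr b s) \<subseteq> {x \<in> carrier H. i a x \<noteq> 0}"
    proof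
      fix x assume "x \<in> (\<Union>s\<in>E. tr b s)"
      then obtain y where y: "i a y \<noteq> 0" "x \<in> carrier H" "act x b = act y b" by (auto simp: E_def tr_def)
      then have "y \<in> carrier H" using CcD0[OF i_Cc[OF a]] by blast
      then show "x \<in> {x \<in> carrier H. i a x \<noteq> 0}" using binv_eq[OF i_in[OF a] y(2) _ y(3)] y by simp
    qed
  qed
  then have U: "CO {x \<in> carrier H. i a x \<noteq> 0}" using E by (auto intro!: CO_UN CO_tr)
  have "{x \<in> carrier H. i a (inv x) \<noteq> 0} = (\<lambda>x. inv x) ` {x \<in> carrier H. i a x \<noteq> 0}"
  proof safe
    fix x assume "x \<in> carrier H" "i a (inv x) \<noteq> 0"
    then show "x \<in> (\<lambda>x. inv x) ` {x \<in> carrier H. i a x \<noteq> 0}" by (intro image_eqI[of _ _ "inv x"]) auto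
  qed auto
  then have U2: "CO {x \<in> carrier H. i a (inv x) \<noteq> 0}" using CO_inv[OF U] by simp
  have "V = {x \<in> carrier H. i a x \<noteq> 0} \<union> {x \<in> carrier H. i a (inv x) \<noteq> 0} \<union> tr b b" by (auto simp: V_def)
  then show "CO V" using U U2 CO_stab by (simp add: CO_Un)
  show "\<one> \<in> V" by (auto simp: V_def tr_def)
  show "inv x \<in> V" if "x \<in> V" for x using that stabD(3) by (auto simp: V_def)
  show "\<forall>x\<in>V. \<forall>k\<in>tr b b. x \<otimes> k \<in> V \<and> k \<otimes> x \<in> V"
  proof (intro ballI)
    fix x k assume x: "x \<in> V" and k: "k \<in> tr b b"
    note k' = stabD[OF k] and B = binvD[OF i_in[OF a]]
    have xc: "x \<in> carrier H" using x k' by (auto simp: V_def tr_def)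
    have e: "i a (x \<otimes> k) = i a x" "i a (k \<otimes> x) = i a x" "i a (inv (x \<otimes> k)) = i a (inv x)" "i a (inv (k \<otimes> x)) = i a (inv x)"
      using B(2)[OF xc k] B(3)[OF xc k] B(2)[OF inv_closed[OF xc] k'(3)] B(3)[OF inv_closed[OF xc] k'(3)] xc k'
      by (simp_all add: inv_mult_group)
    show "x \<otimes> k \<in> V \<and> k \<otimes> x \<in> V" using x xc k' e by (auto simp: V_def tr_def act_mult)
  qed
qed

lemma CO_orbit: "CO A \<Longrightarrow> finite ((\<lambda>x. act x b) ` A)"
  using compact_orbit(1) by (auto simp: CO_def)

text \<open>Left invariance of V allows each left factor to be replaced by the representative of its
  coset, so the product is a finite union of translates of V.\<close>

lemma CO_set_mult:
  assumes A: "CO A" and V: "CO V"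
    and inv: "\<forall>x\<in>A. \<forall>k\<in>tr b b. x \<otimes> k \<in> A" "\<forall>x\<in>V. \<forall>k\<in>tr b b. k \<otimes> x \<in> V"
  shows "CO (A <#> V)"
proof -
  define R where "R = sect ` (\<lambda>x. act x b) ` A"
  have R: "finite R" "R \<subseteq> carrier H" using CO_orbit[OF A] CO_sub[OF A] sect by (auto simp: R_def subset_iff)
  have "A <#> V = (\<Union>r\<in>R. (\<lambda>y. r \<otimes> y) ` V)"
  proof
    show "A <#> V \<subseteq> (\<Union>r\<in>R. (\<lambda>y. r \<otimes> y) ` V)"
    proof
      fix z assume "z \<in> A <#> V"
      then obtain x v where xv: "x \<in> A" "v \<in> V" "z = x \<otimes> v" by (auto simp: set_mult_def)
      define r where "r = sect (act x b)"
      have c: "x \<in> carrier H" "v \<in> carrier H" using xv CO_sub A V by auto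
      have r: "r \<in> R" "r \<in> carrier H" "act x b = act r b" using xv c sect[of "act x b"] by (auto simp: r_def R_def)
      have k: "inv r \<otimes> x \<in> tr b b" by (rule tr_b_eq(1)[OF c(1) r(2,3)])
      have "z = r \<otimes> ((inv r \<otimes> x) \<otimes> v)" using xv c r by (simp add: m_assoc)
      moreover have "(inv r \<otimes> x) \<otimes> v \<in> V" using inv(2) k xv by blast
      ultimately show "z \<in> (\<Union>r\<in>R. (\<lambda>y. r \<otimes> y) ` V)" using r by blast
    qed
    show "(\<Union>r\<in>R. (\<lambda>y. r \<otimes> y) ` V) \<subseteq> A <#> V"
    proof
      fix z assume "z \<in> (\<Union>r\<in>R. (\<lambda>y. r \<otimes> y) ` V)"
      then obtain x v where xv: "x \<in> A" "v \<in> V" "z = sect (act x b) \<otimes> v" by (auto simp: R_def)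
      define r where "r = sect (act x b)"
      have c: "x \<in> carrier H" using xv CO_sub A by auto
      have r: "r \<in> carrier H" "act r b = act x b" using c sect[of "act x b"] by (auto simp: r_def)
      have "r = x \<otimes> (inv x \<otimes> r)" "inv x \<otimes> r \<in> tr b b" using tr_b_eq[OF r(1) c r(2)] c r by auto
      then have "r \<in> A" using inv(1) xv by metis
      then show "z \<in> A <#> V" using xv by (auto simp: set_mult_def r_def)
    qed
  qed
  then show ?thesis using R V by (auto intro!: CO_UN CO_left)
qed

text \<open>The exponent starts at 1: power 0 is the trivial subgroup, which is invariant under the
  stabiliser only if the stabiliser is trivial.\<close>

lemma set_power_CO:
  assumes V: "CO V" "\<one> \<in> V" "\<forall>x\<in>V. \<forall>k\<in>tr b b. x \<otimes> k \<in> V \<and> k \<otimes> x \<in> V"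
  shows "CO (set_power H V (Suc n)) \<and> (\<forall>x\<in>set_power H V (Suc n). \<forall>k\<in>tr b b. x \<otimes> k \<in> set_power H V (Suc n))"
proof -
  have one: "set_power H V (Suc 0) = V" using CO_sub[OF V(1)] by (force simp: set_mult_def)
  have Vc: "V \<subseteq> carrier H" by (rule CO_sub[OF V(1)])
  show ?thesis
  proof (induction n)
    case 0 show ?case unfolding one using V by blast
  next
    case (Suc n)
    let ?W = "set_power H V (Suc n)"
    have W: "CO ?W" "\<forall>x\<in>?W. \<forall>k\<in>tr b b. x \<otimes> k \<in> ?W" using Suc by auto
    have eq: "set_power H V (Suc (Suc n)) = ?W <#> V" by simp
    have "x \<otimes> k \<in> ?W <#> V" if "x \<in> ?W <#> V" "k \<in> tr b b" for x k
    proof -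
      obtain y v where yv: "y \<in> ?W" "v \<in> V" "x = y \<otimes> v" using \<open>x \<in> _\<close> unfolding set_mult_def by blast
      have "y \<in> carrier H" "v \<in> carrier H" using yv CO_sub[OF W(1)] Vc by auto
      then have "x \<otimes> k = y \<otimes> (v \<otimes> k)" using yv stabD[OF that(2)] by (simp add: m_assoc)
      moreover have "v \<otimes> k \<in> V" using V(3) yv that by blast
      ultimately show ?thesis using yv unfolding set_mult_def by blast
    qed
    moreover have "CO (?W <#> V)" using W V by (intro CO_set_mult) auto
    ultimately show ?case unfolding eq by blast
  qed
qed

lemma seminorm_le_mat_norm:
  assumes slow: slow_growth and N: "cstar_seminorm Z N" and a: "a \<in> carrier Z"
  shows "N a \<le> mat_norm a"
proof -
  define V where "V = {x \<in> carrier H. i a x \<noteq> 0 \<or> i a (inv x) \<noteq> 0} \<union> tr b b"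
  note V = support_nbhd[OF a, folded V_def]
  have Vc: "V \<subseteq> carrier H" by (rule CO_sub[OF V(1)])
  let ?L = "L2_set (\<lambda>s. cmod (coef a s)) {s. coef a s \<noteq> 0}"
  have M0: "0 \<le> mat_norm a" by (rule mnorm_nonneg[OF mbound_mat[OF i_Cc[OF a]]])
  have N0: "0 \<le> N a" using N a by (simp add: cstar_seminorm_def)
  \<comment> \<open>A number m strictly above \<open>mat_norm a\<close> is used because
    \<open>mat_norm a\<close> may be 0 and a division follows.\<close>
  have le: "N a \<le> sqrt (1 + e) * m" if e: "e > 0" and m: "m > mat_norm a" for e m
  proof -
    obtain c where c: "c > 0" "\<And>n. real (card ((\<lambda>x. act x b) ` set_power H V n)) \<le> c * (1 + e) ^ n"
    proof -
      have "CO V \<and> \<one> \<in> V \<and> (\<forall>x\<in>V. \<forall>k\<in>tr b b. x \<otimes> k \<in> V \<and> k \<otimes> x \<in> V) \<longrightarrow>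
         (\<forall>e>0. \<exists>c>0. \<forall>n. real (card ((\<lambda>x. act x b) ` set_power H V n)) \<le> c * (1 + e) ^ n)"
        using slow unfolding slow_growth_def by (rule spec)
      then have "\<exists>c>0. \<forall>n. real (card ((\<lambda>x. act x b) ` set_power H V n)) \<le> c * (1 + e) ^ n"
        using V(1-3) e by simp
      then show ?thesis using that by blast
    qed
    have mp: "m > 0" using m M0 by simp
    \<comment> \<open>The factor 1/m repairs the exponent 2^k - 1 of \<open>L2_iter_sq\<close>. The
      summand 1 makes the constant positive even if the \<ell>^2-norm of \<open>coef a\<close>
      vanishes.\<close>
    have pow: "N a ^ (2 ^ k) \<le> (sqrt c * ?L / m + 1) * (sqrt (1 + e) * m) ^ (2 ^ k)" for k
    proof -
      let ?n = "2 ^ k :: nat"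
      have p: "iter_sq a k \<in> carrier Z" by (rule iter_sq_in[OF a])
      let ?A = "{s. coef (iter_sq a k) s \<noteq> 0}"
      have n1: "?n = Suc (?n - 1)" by simp
      have fin: "finite ((\<lambda>x. act x b) ` set_power H V ?n)"
        using set_power_CO[OF V(1,2,3), of "?n - 1"] n1 CO_orbit by metis
      have "?A \<subseteq> (\<lambda>x. act x b) ` set_power H V ?n"
        using coef(5)[OF p] iter_sq_supp[OF a Vc V(4), of k] CcD0[OF i_Cc[OF a]] by (fastforce simp: V_def)
      then have "real (card ?A) \<le> c * (1 + e) ^ ?n" using card_mono[OF fin] c(2)[of ?n] by (meson of_nat_mono order_trans)
      then have sq: "sqrt (card ?A) \<le> sqrt c * sqrt (1 + e) ^ ?n"
        by (metis real_sqrt_le_mono real_sqrt_mult real_sqrt_power)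
      have "N a ^ ?n = N (iter_sq a k)" by (rule cstar_iter_sq[OF N a, symmetric])
      also have "\<dots> \<le> nrm Z (iter_sq a k)" using N p by (simp add: cstar_seminorm_def)
      also have "\<dots> = (\<Sum>s\<in>?A. cmod (coef (iter_sq a k) s))" by (rule nrm_coef[OF p])
      also have "\<dots> \<le> sqrt (card ?A) * L2_set (\<lambda>s. cmod (coef (iter_sq a k) s)) ?A"
        using coef(2)[OF p] by (rule sum_le_sqrt_card) simp
      also have "\<dots> \<le> (sqrt c * sqrt (1 + e) ^ ?n) * (mat_norm a ^ (?n - 1) * ?L)"
        using sq L2_iter_sq[OF a, of k] c e by (intro mult_mono) auto
      also have "\<dots> \<le> (sqrt c * sqrt (1 + e) ^ ?n) * (m ^ (?n - 1) * ?L)"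
        using m M0 c e by (intro mult_left_mono mult_right_mono power_mono) auto
      also have "\<dots> = (sqrt c * ?L / m) * (sqrt (1 + e) * m) ^ ?n"
      proof -
        have "m ^ ?n = m * m ^ (?n - 1)" by (rule HOL.trans[OF power_eq_if]) simp
        then show ?thesis using mp by (simp add: power_mult_distrib)
      qed
      also have "\<dots> \<le> (sqrt c * ?L / m + 1) * (sqrt (1 + e) * m) ^ ?n"
        using mp e by (intro mult_right_mono) auto
      finally show ?thesis .
    qed
    have "sqrt c * ?L / m + 1 > 0" using c mp by (intro add_nonneg_pos) auto
    moreover have "sqrt (1 + e) * m > 0" using mp e by simp
    ultimately show ?thesis using lim_root_le[OF N0 _ _ pow] by blast
  qed
  have le2: "N a \<le> m" if m: "m > mat_norm a" for m
  proof (rule field_le_epsilon)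
    fix e :: real assume e: "e > 0"
    have mp: "m > 0" using m M0 by simp
    \<comment> \<open>The growth tolerance 2 (e/m) is chosen so that its square root costs at most
      the factor 1 + e/m, that is, an error e after multiplication by m.\<close>
    have "sqrt (1 + (2 * (e/m))) \<le> 1 + e / m"
      using e mp by (intro real_le_lsqrt) (auto simp: power2_eq_square algebra_simps)
    moreover have "N a \<le> sqrt (1 + 2 * (e/m)) * m" using e mp by (intro le m) auto
    ultimately have "N a \<le> (1 + e / m) * m" using mp by (meson mult_right_mono less_imp_le order_trans)
    also have "(1 + e / m) * m = m + e" using mp by (simp add: distrib_right)
    finally show "N a \<le> m + e" .
  qed
  show ?thesis
  proof (rule field_le_epsilon)
    fix e :: real assume "e > 0" then show "N a \<le> mat_norm a + e" by (intro le2) simp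
  qed
qed

end

section \<open>The regular representation\<close>

lemma bounded_partial_sums_countable:
  fixes f :: "'s \<Rightarrow> real"
  assumes pos: "\<And>s. s \<in> A \<Longrightarrow> 0 \<le> f s" and C: "\<And>F. finite F \<Longrightarrow> F \<subseteq> A \<Longrightarrow> (\<Sum>s\<in>F. f s) \<le> C"
  shows "countable {s \<in> A. f s \<noteq> 0}"
proof -
  have "f summable_on A" using pos C by (intro nonneg_bdd_above_summable_on bdd_aboveI[of _ C]) auto
  then show ?thesis using pos by (intro summable_countable_real) auto
qed

context perm_haar
begin

lemma tr_measure_w: "s \<in> S \<Longrightarrow> emeasure \<mu> (tr s b) = ennreal (w s)"
  unfolding w_def using CO_finite[OF CO_tr[of s b]] by (simp add: emeasure_eq_ennreal_measure)

text \<open>S may be uncountable, but bounded partial sums of nonnegative terms have countable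
  support, so monotone convergence along an enumeration of that support applies.\<close>

lemma integral_right_cosets_le:
  fixes g :: "'s \<Rightarrow> real"
  assumes g: "\<And>s. s \<in> S \<Longrightarrow> 0 \<le> g s" and C: "\<And>F. finite F \<Longrightarrow> F \<subseteq> S \<Longrightarrow> (\<Sum>s\<in>F. w s * g s) \<le> C"
  shows "(\<integral>x. g (act (inv x) b) \<partial>\<mu>) \<le> C"
proof (cases "integrable \<mu> (\<lambda>x. g (act (inv x) b))")
  \<comment> \<open>The integral of a non-integrable function is 0 by convention, and C is
    nonnegative by the empty sum.\<close>
  case False
  then show ?thesis using C[of "{}"] by (simp add: not_integrable_integral_eq)
next
  case True
  define A where "A = {s \<in> S. w s * g s \<noteq> 0}"
  have A: "countable A" unfolding A_def
    by (rule bounded_partial_sums_countable[where C = C]) (use g w_pos C in \<open>auto simp: less_imp_le\<close>)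
  have C0: "0 \<le> C" using C[of "{}"] by simp
  have AE0: "AE x in \<mu>. 0 \<le> g (act (inv x) b)" using g by (intro AE_I2) auto
  have "ennreal (\<integral>x. g (act (inv x) b) \<partial>\<mu>) = (\<integral>\<^sup>+x. ennreal (g (act (inv x) b)) \<partial>\<mu>)"
    by (rule nn_integral_eq_integral[OF True AE0, symmetric])
  also have "\<dots> \<le> ennreal C"
  proof -
    \<comment> \<open>Finite initial segments of the enumeration; they exhaust the right cosets on
      which the integrand is nonzero.\<close>
    define An where "An n = {s \<in> A. to_nat_on A s < n}" for n
    have fin: "finite (An n)" for n
    proof (rule finite_imageD)
      show "finite (to_nat_on A ` An n)" by (rule finite_subset[of _ "{..<n}"]) (auto simp: An_def)
      show "inj_on (to_nat_on A) (An n)" using inj_on_to_nat_on[OF A] by (rule inj_on_subset) (auto simp: An_def)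
    qed
    have AS: "An n \<subseteq> S" for n by (auto simp: An_def A_def)
    define h where "h n x = (\<Sum>s\<in>An n. ennreal (g s) * indicator (tr s b) x)" for n x
    have hm: "h n \<in> borel_measurable \<mu>" for n
      unfolding h_def[abs_def] using AS
      by (intro borel_measurable_sum borel_measurable_times_ennreal borel_measurable_const borel_measurable_indicator tr_sets) auto
    have mono: "incseq h"
      unfolding incseq_def le_fun_def h_def
      by (intro allI impI sum_mono2 fin) (auto simp: An_def)
    have le: "ennreal (g (act (inv x) b)) \<le> (SUP n. h n x)" if x: "x \<in> carrier H" for x
    proof (cases "act (inv x) b \<in> A")
      case True
      let ?s = "act (inv x) b"
      have "?s \<in> An (Suc (to_nat_on A ?s))" using True by (simp add: An_def)
      then have "ennreal (g ?s) * indicator (tr ?s b) x \<le> h (Suc (to_nat_on A ?s)) x"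
        unfolding h_def using fin by (intro member_le_sum) auto
      moreover have "x \<in> tr ?s b" using x by (auto simp: tr_def)
      ultimately have "ennreal (g ?s) \<le> h (Suc (to_nat_on A ?s)) x" by simp
      also have "\<dots> \<le> (SUP n. h n x)" by (rule SUP_upper) simp
      finally show ?thesis .
    next
      case False
      then have "g (act (inv x) b) = 0" using x w_pos[of "act (inv x) b"] by (auto simp: A_def)
      then show ?thesis by simp
    qed
    have "(\<integral>\<^sup>+x. ennreal (g (act (inv x) b)) \<partial>\<mu>) \<le> (\<integral>\<^sup>+x. (SUP n. h n x) \<partial>\<mu>)"
      using le by (intro nn_integral_mono) simp
    also have "\<dots> = (SUP n. \<integral>\<^sup>+x. h n x \<partial>\<mu>)" by (rule nn_integral_monotone_convergence_SUP[OF mono hm])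
    also have "\<dots> \<le> ennreal C"
    proof (rule SUP_least)
      fix n
      have "(\<integral>\<^sup>+x. h n x \<partial>\<mu>) = (\<Sum>s\<in>An n. \<integral>\<^sup>+x. ennreal (g s) * indicator (tr s b) x \<partial>\<mu>)"
        unfolding h_def using AS
        by (intro nn_integral_sum borel_measurable_times_ennreal borel_measurable_const borel_measurable_indicator tr_sets) auto
      also have "\<dots> = (\<Sum>s\<in>An n. ennreal (w s * g s))"
      proof (rule sum.cong[OF refl])
        fix s assume "s \<in> An n"
        then have s: "s \<in> S" using AS by auto
        show "(\<integral>\<^sup>+x. ennreal (g s) * indicator (tr s b) x \<partial>\<mu>) = ennreal (w s * g s)"
          using s g[OF s] w_pos[OF s]
          by (simp add: nn_integral_cmult_indicator tr_measure_w ennreal_mult less_imp_le mult.commute)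
      qed
      also have "\<dots> = ennreal (\<Sum>s\<in>An n. w s * g s)"
        using AS g by (intro sum_ennreal mult_nonneg_nonneg) (auto simp: w_def)
      also have "\<dots> \<le> ennreal C" using C[OF fin AS] by (rule ennreal_leI)
      finally show "(\<integral>\<^sup>+x. h n x \<partial>\<mu>) \<le> ennreal C" .
    qed
    finally show ?thesis .
  qed
  finally show ?thesis using C0 by simp
qed

text \<open>Cauchy-Schwarz against the indicator of A, from nonnegativity in c of the integral over
  A of the square of |\<xi>| - c.\<close>

lemma integral_cauchy_schwarz:
  fixes \<xi> :: "'g \<Rightarrow> complex"
  assumes \<xi>: "\<xi> \<in> borel_measurable \<mu>" "integrable \<mu> (\<lambda>x. (cmod (\<xi> x))\<^sup>2)" and A: "A \<in> sets \<mu>" "emeasure \<mu> A < \<infinity>"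
  shows "integrable \<mu> (\<lambda>x. indicator A x *\<^sub>R \<xi> x)"
    "(cmod (\<integral>x. indicator A x *\<^sub>R \<xi> x \<partial>\<mu>))\<^sup>2 \<le> measure \<mu> A * (\<integral>x. indicator A x * (cmod (\<xi> x))\<^sup>2 \<partial>\<mu>)"
proof -
  have iA: "integrable \<mu> (indicator A :: 'g \<Rightarrow> real)" using A by (intro integrable_real_indicator) auto
  have i2: "integrable \<mu> (\<lambda>x. indicator A x * (cmod (\<xi> x))\<^sup>2)"
    using integrable_mult_indicator[OF A(1) \<xi>(2)] by simp
  have i1: "integrable \<mu> (\<lambda>x. indicator A x * cmod (\<xi> x))"
  proof (rule Bochner_Integration.integrable_bound[OF Bochner_Integration.integrable_add[OF iA i2]])
    show "(\<lambda>x. indicator A x * cmod (\<xi> x)) \<in> borel_measurable \<mu>"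
      using A \<xi>(1) by (intro borel_measurable_times borel_measurable_indicator measurable_compose[OF \<xi>(1) borel_measurable_norm])
    have "r \<le> 1 + r\<^sup>2" for r :: real
      using zero_le_square[of "r - 1/2"] by (simp add: power2_eq_square algebra_simps)
    then show "AE x in \<mu>. norm (indicator A x * cmod (\<xi> x)) \<le> norm (indicator A x + indicator A x * (cmod (\<xi> x))\<^sup>2)"
      by (intro AE_I2) (auto simp: indicator_def)
  qed
  show "integrable \<mu> (\<lambda>x. indicator A x *\<^sub>R \<xi> x)"
    by (rule Bochner_Integration.integrable_bound[OF i1])
      (use A \<xi> in \<open>auto intro!: borel_measurable_scaleR borel_measurable_indicator\<close>)
  define I where "I = (\<integral>x. indicator A x * cmod (\<xi> x) \<partial>\<mu>)"
  define J where "J = (\<integral>x. indicator A x * (cmod (\<xi> x))\<^sup>2 \<partial>\<mu>)"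
  define M where "M = measure \<mu> A"
  have MA: "(\<integral>x. indicator A x \<partial>\<mu>) = M" using sets.sets_into_space[OF A(1)] by (simp add: M_def Int_absorb2)
  have q: "0 \<le> J - 2 * c * I + c\<^sup>2 * M" for c
  proof -
    have "0 \<le> (\<integral>x. indicator A x * (cmod (\<xi> x) - c)\<^sup>2 \<partial>\<mu>)" by (intro Bochner_Integration.integral_nonneg) auto
    also have "(\<lambda>x. indicator A x * (cmod (\<xi> x) - c)\<^sup>2) =
        (\<lambda>x. indicator A x * (cmod (\<xi> x))\<^sup>2 - (2 * c) * (indicator A x * cmod (\<xi> x)) + c\<^sup>2 * indicator A x)"
      by (intro ext) (simp add: power2_diff algebra_simps)
    also have "integral\<^sup>L \<mu> \<dots> = J - 2 * c * I + c\<^sup>2 * M"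
      using i1 i2 iA MA by (simp add: I_def J_def)
    finally show ?thesis .
  qed
  have M0: "0 \<le> M" by (simp add: M_def)
  have I0: "0 \<le> I" by (simp add: I_def Bochner_Integration.integral_nonneg)
  have "I\<^sup>2 \<le> M * J"
  proof (cases "M = 0")
    case True
    have "I = 0"
    proof (rule ccontr)
      assume "I \<noteq> 0"
      \<comment> \<open>For M = 0 the quadratic is affine in c; this value of c makes it equal to
        -1.\<close>
      then show False using q[of "(J + 1) / (2 * I)"] True by simp
    qed
    then show ?thesis using True by simp
  next
    case False
    then have "0 \<le> J - I\<^sup>2 / M" using q[of "I / M"] by (simp add: power2_eq_square field_simps)
    then show ?thesis using False M0 by (simp add: field_simps)
  qed
  moreover have "cmod (\<integral>x. indicator A x *\<^sub>R \<xi> x \<partial>\<mu>) \<le> I"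
    unfolding I_def by (rule order_trans[OF integral_norm_bound]) simp
  ultimately show "(cmod (\<integral>x. indicator A x *\<^sub>R \<xi> x \<partial>\<mu>))\<^sup>2 \<le> measure \<mu> A * (\<integral>x. indicator A x * (cmod (\<xi> x))\<^sup>2 \<partial>\<mu>)"
    by (smt (verit) I_def J_def M_def norm_ge_zero power_mono)
qed

text \<open>The mean of \<xi> over the right coset \<open>tr t b\<close>, written with the variable
  inverted because left cosets carry measure 1. These are the coordinates of p applied to
  \<xi>.\<close>

definition zeta :: "('g \<Rightarrow> complex) \<Rightarrow> 's \<Rightarrow> complex" where
  "zeta \<xi> t = (\<integral>y. indicator (tr b t) y *\<^sub>R \<xi> (inv y) \<partial>\<mu>)"

text \<open>Cauchy-Schwarz on a right coset of measure \<open>w t\<close>. Summed over t, it says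
  that averaging over right cosets does not increase the L^2-norm.\<close>

lemma zeta_bound:
  assumes \<xi>: "\<xi> \<in> borel_measurable \<mu>" "integrable \<mu> (\<lambda>x. (cmod (\<xi> x))\<^sup>2)" and t: "t \<in> S"
  shows "w t * (cmod (zeta \<xi> t))\<^sup>2 \<le> (\<integral>x. indicator (tr t b) x * (cmod (\<xi> x))\<^sup>2 \<partial>\<mu>)"
proof -
  note s = sect[OF t]
  have y: "inv (sect t) \<in> tr t b" using s t by (auto simp: tr_def act_inv_eq)
  have dlw: "modulus (sect t) = 1 / w t" using w_act[OF s(1)] modulus_inv[OF s(1)] s modulus_pos[OF s(1)] by simp
  have "zeta \<xi> t = (1 / w t) *\<^sub>R (\<integral>x. indicator (tr t b) x *\<^sub>R \<xi> x \<partial>\<mu>)"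
    unfolding zeta_def integral_inv[OF t b_in y \<xi>(1)] using s by (simp add: dlw)
  then have "(cmod (zeta \<xi> t))\<^sup>2 = (1 / w t)\<^sup>2 * (cmod (\<integral>x. indicator (tr t b) x *\<^sub>R \<xi> x \<partial>\<mu>))\<^sup>2"
    using w_pos[OF t] by (simp add: power_mult_distrib power_divide norm_divide)
  also have "\<dots> \<le> (1 / w t)\<^sup>2 * (w t * (\<integral>x. indicator (tr t b) x * (cmod (\<xi> x))\<^sup>2 \<partial>\<mu>))"
    using integral_cauchy_schwarz(2)[OF \<xi> tr_sets[OF t] CO_finite[OF CO_tr[OF t b_in]]]
    by (intro mult_left_mono) (auto simp: w_def)
  finally show ?thesis using w_pos[OF t] by (simp add: power2_eq_square field_simps)
qed

text \<open>Right invariance of f makes the convolution depend only on the means of \<xi>, and left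
  invariance makes it constant on right cosets. In coordinates scaled by the square root of
  \<open>w\<close> it is the matrix \<open>ker f\<close>.\<close>

lemma conv_zeta:
  assumes f: "f \<in> binv" and \<xi>: "\<xi> \<in> borel_measurable \<mu>" "integrable \<mu> (\<lambda>x. (cmod (\<xi> x))\<^sup>2)" and x: "x \<in> carrier H"
    and r: "r = act (inv x) b" and Tr: "finite Tr" "Tr \<subseteq> S" "\<And>t. ker f r t \<noteq> 0 \<Longrightarrow> t \<in> Tr"
  shows "of_real (sqrt (w r)) * conv f \<xi> x = (\<Sum>t\<in>Tr. ker f r t * (of_real (sqrt (w t)) * zeta \<xi> t))"
proof -
  have rS: "r \<in> S" using x r by simp
  note sr = sect[OF rS]
  note fC = binvD(1)[OF f]
  have k: "inv (inv x) \<otimes> sect r \<in> tr b b" using tr_b_eq(1)[of "sect r" "inv x"] sr x r by auto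
  \<comment> \<open>The product of x and \<open>sect r\<close> lies in the stabiliser, so left
    invariance replaces x by the inverse of \<open>sect r\<close>.\<close>
  have fx: "f (x \<otimes> sect t) = f (inv (sect r) \<otimes> sect t)" if t: "t \<in> S" for t
  proof -
    have "x \<otimes> sect r \<in> tr b b" using k x by simp
    then have "f ((x \<otimes> sect r) \<otimes> (inv (sect r) \<otimes> sect t)) = f (inv (sect r) \<otimes> sect t)"
      using sr sect[OF t] by (intro binvD(3)[OF f]) auto
    then show ?thesis using x sr sect[OF t] by (simp add: m_assoc)
  qed
  have pt: "f (x \<otimes> y) * \<xi> (inv y) = (\<Sum>t\<in>Tr. f (x \<otimes> sect t) * (indicator (tr b t) y *\<^sub>R \<xi> (inv y)))"
    if y: "y \<in> carrier H" for y
  proof -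
    let ?t = "act y b"
    have t: "?t \<in> S" using y by simp
    have e: "f (x \<otimes> sect ?t) = f (x \<otimes> y)"
      using binv_eq[OF f, of "x \<otimes> sect ?t" "x \<otimes> y"] x y sect[OF t] by (simp add: act_mult)
    have "(\<Sum>t\<in>Tr. f (x \<otimes> sect t) * (indicator (tr b t) y *\<^sub>R \<xi> (inv y)))
        = (\<Sum>t\<in>Tr. if t = ?t then f (x \<otimes> y) * \<xi> (inv y) else 0)"
      using y e by (intro sum.cong refl) (auto simp: tr_def indicator_def)
    also have "\<dots> = f (x \<otimes> y) * \<xi> (inv y)"
    proof (cases "?t \<in> Tr")
      case False
      then have "ker f r ?t = 0" using Tr(3) by blast
      then have "f (inv (sect r) \<otimes> sect ?t) = 0" using rS t w_pos[OF rS] w_pos[OF t] by (simp add: ker_def)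
      then show ?thesis using False e fx[OF t] Tr(1) by simp
    qed (use Tr in simp)
    finally show ?thesis by simp
  qed
  have mi: "(\<lambda>y. \<xi> (inv y)) \<in> borel_measurable \<mu>" by (rule measurable_compose[OF measurable_cont[OF cont_inv] \<xi>(1)])
  have zi: "integrable \<mu> (\<lambda>y. indicator (tr b t) y *\<^sub>R \<xi> (inv y))" if t: "t \<in> S" for t
  proof -
    have "integrable \<mu> (\<lambda>x. indicator (tr t b) x *\<^sub>R \<xi> x)"
      by (rule integral_cauchy_schwarz(1)[OF \<xi> tr_sets[OF t] CO_finite[OF CO_tr[OF t b_in]]])
    then have "integrable (density \<mu> (\<lambda>x. ennreal (modulus (sect t) * indicator (tr t b) x))) \<xi>"
      using t \<xi>(1) by (subst integrable_density) (auto intro!: borel_measurable_times borel_measurable_indicator simp flip: scaleR_scaleR)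
    moreover have "inv (sect t) \<in> tr t b" using sect[OF t] t by (auto simp: tr_def act_inv_eq)
    ultimately have "integrable (distr (density \<mu> (indicator (tr b t))) \<mu> (\<lambda>y. inv y)) \<xi>"
      using distr_inv[OF t b_in, of "inv (sect t)"] sect[OF t] by (simp add: ennreal_mult ennreal_indicator)
    then have "integrable (density \<mu> (\<lambda>x. ennreal (indicator (tr b t) x))) (\<lambda>y. \<xi> (inv y))"
      using measurable_cont[OF cont_inv] \<xi>(1) by (subst (asm) integrable_distr_eq) (auto simp: ennreal_indicator)
    then show ?thesis using mi b_in by (subst (asm) integrable_density) (auto intro!: borel_measurable_indicator)
  qed
  have fm: "(\<lambda>y. f y * \<xi> (inv y \<otimes> x)) \<in> borel_measurable \<mu>"
    using Cc_measurable[OF fC] translate_measurable[OF \<xi>(1) x] by (rule borel_measurable_times)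
  have "conv f \<xi> x = (\<integral>y. f y * \<xi> (inv y \<otimes> x) \<partial>\<mu>)" by (rule conv_in[OF x])
  also have "\<dots> = (\<integral>y. f (x \<otimes> y) * \<xi> (inv (x \<otimes> y) \<otimes> x) \<partial>\<mu>)"
    using integral_left[OF x fm] by simp
  also have "\<dots> = (\<integral>y. f (x \<otimes> y) * \<xi> (inv y) \<partial>\<mu>)"
    using x by (intro Bochner_Integration.integral_cong) (auto simp: inv_mult_group m_assoc)
  also have "\<dots> = (\<integral>y. (\<Sum>t\<in>Tr. f (x \<otimes> sect t) * (indicator (tr b t) y *\<^sub>R \<xi> (inv y))) \<partial>\<mu>)"
    by (rule Bochner_Integration.integral_cong[OF refl]) (simp only: pt space_mu)
  also have "\<dots> = (\<Sum>t\<in>Tr. \<integral>y. f (x \<otimes> sect t) * (indicator (tr b t) y *\<^sub>R \<xi> (inv y)) \<partial>\<mu>)"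
    using zi Tr by (intro Bochner_Integration.integral_sum integrable_mult_right) auto
  also have "\<dots> = (\<Sum>t\<in>Tr. f (x \<otimes> sect t) * zeta \<xi> t)" by (simp only: integral_mult_right_zero zeta_def)
  finally have "of_real (sqrt (w r)) * conv f \<xi> x = (\<Sum>t\<in>Tr. of_real (sqrt (w r)) * (f (x \<otimes> sect t) * zeta \<xi> t))"
    by (simp add: sum_distrib_left)
  also have "\<dots> = (\<Sum>t\<in>Tr. ker f r t * (of_real (sqrt (w t)) * zeta \<xi> t))"
  proof (rule sum.cong[OF refl])
    fix t assume "t \<in> Tr"
    then have t: "t \<in> S" using Tr by auto
    have "sqrt (w r / w t) * sqrt (w t) = sqrt (w r)" using w_pos[OF t] by (simp flip: real_sqrt_mult)
    then have "complex_of_real (sqrt (w r)) = of_real (sqrt (w r / w t)) * of_real (sqrt (w t))" by (simp flip: of_real_mult)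
    then show "of_real (sqrt (w r)) * (f (x \<otimes> sect t) * zeta \<xi> t) = ker f r t * (of_real (sqrt (w t)) * zeta \<xi> t)"
      using t rS fx[OF t] by (simp add: ker_def)
  qed
  finally show ?thesis .
qed

text \<open>The convolution is constant on right cosets, so its squared norm is a sum over S
  weighted by \<open>w\<close>. Finite parts of the sum are bounded by the operator norm of
  \<open>ker f\<close> together with \<open>zeta_bound\<close>, and
  \<open>integral_right_cosets_le\<close> passes to the integral.\<close>

lemma regular_le_ker:
  assumes f: "f \<in> binv" and \<xi>: "\<xi> \<in> L2_functions \<mu>"
  shows "L2_norm_fun \<mu> (conv f \<xi>) \<le> mnorm (ker f) * L2_norm_fun \<mu> \<xi>"
proof -
  have \<xi>': "\<xi> \<in> borel_measurable \<mu>" "integrable \<mu> (\<lambda>x. (cmod (\<xi> x))\<^sup>2)" using \<xi> by (auto simp: L2_functions_def)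
  note fC = binvD(1)[OF f]
  let ?C = "mnorm (ker f)"
  have C0: "0 \<le> ?C" by (rule mnorm_nonneg[OF mbound_ker[OF f]])
  define I where "I = (\<integral>x. (cmod (\<xi> x))\<^sup>2 \<partial>\<mu>)"
  have I0: "0 \<le> I" by (simp add: I_def Bochner_Integration.integral_nonneg)
  define g where "g r = (cmod (conv f \<xi> (inv (sect r))))\<^sup>2" for r
  have gx: "(cmod (conv f \<xi> x))\<^sup>2 = g (act (inv x) b)" if x: "x \<in> carrier H" for x
  proof -
    let ?r = "act (inv x) b"
    have r: "?r \<in> S" using x by simp
    note s = sect[OF r]
    define Tr where "Tr = {t. ker f ?r t \<noteq> 0}"
    have Tr: "finite Tr" "Tr \<subseteq> S" using ker_supp(2)[OF fC] by (auto simp: Tr_def ker_def split: if_splits)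
    have "of_real (sqrt (w ?r)) * conv f \<xi> x = of_real (sqrt (w ?r)) * conv f \<xi> (inv (sect ?r))"
      using conv_zeta[OF f \<xi>' x refl Tr] conv_zeta[OF f \<xi>' inv_closed[OF s(1)] _ Tr, of ?r] s by (simp add: Tr_def)
    then show ?thesis using w_pos[OF r] by (simp add: g_def)
  qed
  have part: "(\<Sum>r\<in>U. w r * g r) \<le> ?C\<^sup>2 * I" if U: "finite U" "U \<subseteq> S" for U
  proof -
    define Tr where "Tr = (\<Union>r\<in>U. {t. ker f r t \<noteq> 0})"
    have Tr: "finite Tr" "Tr \<subseteq> S" using U ker_supp(2)[OF fC] by (auto simp: Tr_def ker_def split: if_splits)
    let ?z = "\<lambda>t. of_real (sqrt (w t)) * zeta \<xi> t"
    have "(\<Sum>r\<in>U. w r * g r) = (\<Sum>r\<in>U. (cmod (\<Sum>t\<in>Tr. ker f r t * ?z t))\<^sup>2)"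
    proof (rule sum.cong[OF refl])
      fix r assume r: "r \<in> U"
      then have rS: "r \<in> S" using U by auto
      have "of_real (sqrt (w r)) * conv f \<xi> (inv (sect r)) = (\<Sum>t\<in>Tr. ker f r t * ?z t)"
        using sect[OF rS] r by (intro conv_zeta[OF f \<xi>' _ _ Tr]) (auto simp: Tr_def)
      then have "(cmod (\<Sum>t\<in>Tr. ker f r t * ?z t))\<^sup>2 = (cmod (of_real (sqrt (w r)) * conv f \<xi> (inv (sect r))))\<^sup>2" by simp
      also have "\<dots> = w r * g r" using w_pos[OF rS] by (simp add: norm_mult power_mult_distrib g_def)
      finally show "w r * g r = (cmod (\<Sum>t\<in>Tr. ker f r t * ?z t))\<^sup>2" by simp
    qed
    also have "\<dots> = (L2_set (\<lambda>r. cmod (\<Sum>t\<in>Tr. ker f r t * ?z t)) U)\<^sup>2" by (simp add: L2_set_sq)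
    also have "\<dots> \<le> (?C * L2_set (\<lambda>t. cmod (?z t)) Tr)\<^sup>2"
      by (intro power_mono mboundD[OF mbound_mnorm[OF mbound_ker[OF f]] U(1) Tr(1)]) simp
    also have "\<dots> = ?C\<^sup>2 * (\<Sum>t\<in>Tr. (cmod (?z t))\<^sup>2)" by (simp only: power_mult_distrib L2_set_sq)
    also have "\<dots> \<le> ?C\<^sup>2 * I"
    proof (rule mult_left_mono)
      have ii: "integrable \<mu> (\<lambda>x. indicator (tr t b) x * (cmod (\<xi> x))\<^sup>2)" if "t \<in> Tr" for t
        using integrable_mult_indicator[OF tr_sets \<xi>'(2), of t b] that Tr by auto
      have "(\<Sum>t\<in>Tr. (cmod (?z t))\<^sup>2) \<le> (\<Sum>t\<in>Tr. \<integral>x. indicator (tr t b) x * (cmod (\<xi> x))\<^sup>2 \<partial>\<mu>)"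
      proof (rule sum_mono)
        fix t assume "t \<in> Tr"
        then have t: "t \<in> S" using Tr by auto
        have "(cmod (?z t))\<^sup>2 = w t * (cmod (zeta \<xi> t))\<^sup>2"
          using w_pos[OF t] by (simp add: norm_mult power_mult_distrib)
        then show "(cmod (?z t))\<^sup>2 \<le> (\<integral>x. indicator (tr t b) x * (cmod (\<xi> x))\<^sup>2 \<partial>\<mu>)" using zeta_bound[OF \<xi>' t] by simp
      qed
      also have "\<dots> = (\<integral>x. (\<Sum>t\<in>Tr. indicator (tr t b) x * (cmod (\<xi> x))\<^sup>2) \<partial>\<mu>)"
        by (rule Bochner_Integration.integral_sum[symmetric]) (rule ii)
      also have "\<dots> \<le> I"
        unfolding I_def
      proof (rule integral_mono)
        show "integrable \<mu> (\<lambda>x. \<Sum>t\<in>Tr. indicator (tr t b) x * (cmod (\<xi> x))\<^sup>2)"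
          by (rule Bochner_Integration.integrable_sum) (rule ii)
        show "integrable \<mu> (\<lambda>x. (cmod (\<xi> x))\<^sup>2)" by (rule \<xi>'(2))
        fix x assume "x \<in> space \<mu>"
        then have x: "x \<in> carrier H" by simp
        have "(\<Sum>t\<in>Tr. indicator (tr t b) x * (cmod (\<xi> x))\<^sup>2) = (\<Sum>t\<in>Tr. if t = act (inv x) b then (cmod (\<xi> x))\<^sup>2 else 0)"
        proof (rule sum.cong[OF refl])
          fix t assume "t \<in> Tr"
          then have "x \<in> tr t b \<longleftrightarrow> t = act (inv x) b" using Tr by (intro tr_iff x) auto
          then show "indicator (tr t b) x * (cmod (\<xi> x))\<^sup>2 = (if t = act (inv x) b then (cmod (\<xi> x))\<^sup>2 else 0)"
            by (auto simp: indicator_def)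
        qed
        also have "\<dots> \<le> (cmod (\<xi> x))\<^sup>2" using Tr(1) by simp
        finally show "(\<Sum>t\<in>Tr. indicator (tr t b) x * (cmod (\<xi> x))\<^sup>2) \<le> (cmod (\<xi> x))\<^sup>2" .
      qed
      finally show "(\<Sum>t\<in>Tr. (cmod (?z t))\<^sup>2) \<le> I" .
    qed simp
    finally show ?thesis .
  qed
  have "(\<integral>x. (cmod (conv f \<xi> x))\<^sup>2 \<partial>\<mu>) = (\<integral>x. g (act (inv x) b) \<partial>\<mu>)"
    by (rule Bochner_Integration.integral_cong[OF refl]) (simp add: gx)
  also have "\<dots> \<le> ?C\<^sup>2 * I" by (rule integral_right_cosets_le[OF _ part]) (auto simp: g_def)
  finally have "sqrt (\<integral>x. (cmod (conv f \<xi> x))\<^sup>2 \<partial>\<mu>) \<le> sqrt (?C\<^sup>2 * I)" by (rule real_sqrt_le_mono)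
  then show ?thesis using C0 by (simp add: L2_norm_fun_def I_def real_sqrt_mult)
qed

lemma L2_norm_nonneg: "0 \<le> L2_norm_fun \<mu> \<xi>"
  by (simp add: L2_norm_fun_def Bochner_Integration.integral_nonneg)

text \<open>A real supremum bounds its members only if the set is bounded above; \<open>ker\<close>
  supplies such a bound, and so both halves come from it.\<close>

lemma regular_bdd:
  assumes f: "f \<in> binv"
  shows "regular_rep_norm H \<mu> f \<le> mnorm (ker f)"
    "\<And>\<xi>. \<xi> \<in> L2_functions \<mu> \<Longrightarrow> L2_norm_fun \<mu> \<xi> \<le> 1 \<Longrightarrow> L2_norm_fun \<mu> (conv f \<xi>) \<le> regular_rep_norm H \<mu> f"
proof -
  let ?X = "{L2_norm_fun \<mu> (conv f \<xi>) | \<xi>. \<xi> \<in> L2_functions \<mu> \<and> L2_norm_fun \<mu> \<xi> \<le> 1}"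
  have up: "y \<le> mnorm (ker f)" if "y \<in> ?X" for y
  proof -
    obtain \<xi> where y: "y = L2_norm_fun \<mu> (conv f \<xi>)" "\<xi> \<in> L2_functions \<mu>" "L2_norm_fun \<mu> \<xi> \<le> 1"
      using \<open>y \<in> ?X\<close> by blast
    have "mnorm (ker f) * L2_norm_fun \<mu> \<xi> \<le> mnorm (ker f)"
      using y(3) mnorm_nonneg[OF mbound_ker[OF f]] L2_norm_nonneg[of \<xi>] by (simp add: mult_left_le)
    then show ?thesis using regular_le_ker[OF f y(2)] y(1) by simp
  qed
  have "(\<lambda>_. 0) \<in> L2_functions \<mu>" "L2_norm_fun \<mu> (\<lambda>_. 0) \<le> 1" by (simp_all add: L2_functions_def L2_norm_fun_def)
  then have ne: "?X \<noteq> {}" by blast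
  show "regular_rep_norm H \<mu> f \<le> mnorm (ker f)"
    unfolding regular_rep_norm_def by (rule cSup_least[OF ne up])
  have bdd: "bdd_above ?X" using up by (rule bdd_aboveI)
  show "L2_norm_fun \<mu> (conv f \<xi>) \<le> regular_rep_norm H \<mu> f" if "\<xi> \<in> L2_functions \<mu>" "L2_norm_fun \<mu> \<xi> \<le> 1" for \<xi>
    unfolding regular_rep_norm_def using that by (intro cSup_upper bdd) blast
qed

lemma L2_lift:
  assumes E: "finite E" "E \<subseteq> S" "\<And>s. \<phi> s \<noteq> 0 \<Longrightarrow> s \<in> E"
  shows "lift \<phi> \<in> L2_functions \<mu>" "L2_norm_fun \<mu> (lift \<phi>) = L2_set (\<lambda>s. cmod (\<phi> s)) E"
proof -
  define \<psi> where "\<psi> s = complex_of_real ((cmod (\<phi> s))\<^sup>2)" for s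
  have \<psi>E: "s \<in> E" if "\<psi> s \<noteq> 0" for s using that E(3) by (auto simp: \<psi>_def)
  have L: "lift \<phi> \<in> carrier Cc" and Q: "lift \<psi> \<in> carrier Cc"
    using lift_Cc[OF E] lift_Cc[OF E(1,2) \<psi>E] by auto
  have eq: "lift \<psi> x = complex_of_real ((cmod (lift \<phi> x))\<^sup>2)" for x by (simp add: lift_def \<psi>_def)
  have i: "integrable \<mu> (\<lambda>x. complex_of_real ((cmod (lift \<phi> x))\<^sup>2))"
    using Cc_integrable[OF Q] unfolding eq[abs_def] .
  then have i': "integrable \<mu> (\<lambda>x. (cmod (lift \<phi> x))\<^sup>2)" by (simp only: complex_of_real_integrable_eq)
  show "lift \<phi> \<in> L2_functions \<mu>" using i' Cc_measurable[OF L] by (simp add: L2_functions_def)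
  have "complex_of_real (\<integral>x. (cmod (lift \<phi> x))\<^sup>2 \<partial>\<mu>) = (\<integral>x. lift \<psi> x \<partial>\<mu>)"
    unfolding eq[abs_def] by (rule integral_complex_of_real[symmetric])
  also have "\<dots> = (\<Sum>s\<in>E. lift \<psi> (sect s))"
    using \<psi>E stabD by (intro integral_right_inv Cc_integrable Q E(1,2)) (auto simp: lift_def act_mult)
  also have "\<dots> = complex_of_real (\<Sum>s\<in>E. (cmod (\<phi> s))\<^sup>2)"
    unfolding of_real_sum
  proof (rule sum.cong[OF refl])
    fix s assume "s \<in> E"
    then have "sect s \<in> carrier H" "act (sect s) b = s" using sect E by auto
    then show "lift \<psi> (sect s) = complex_of_real ((cmod (\<phi> s))\<^sup>2)" by (simp add: lift_def \<psi>_def)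
  qed
  finally have "(\<integral>x. (cmod (lift \<phi> x))\<^sup>2 \<partial>\<mu>) = (\<Sum>s\<in>E. (cmod (\<phi> s))\<^sup>2)" by (simp only: of_real_eq_iff)
  then show "L2_norm_fun \<mu> (lift \<phi>) = L2_set (\<lambda>s. cmod (\<phi> s)) E" by (simp add: L2_norm_fun_def L2_set_def)
qed

text \<open>The supremum defining the regular norm is tested on lifted vectors, on which convolution
  is \<open>mat f\<close>.\<close>

lemma mat_le_regular:
  assumes f: "f \<in> binv" shows "mnorm (mat f) \<le> regular_rep_norm H \<mu> f"
proof (rule mnorm_le)
  let ?R = "regular_rep_norm H \<mu> f"
  note fC = binvD(1)[OF f]
  have z: "L2_norm_fun \<mu> (\<lambda>_. 0) \<le> 1" "(\<lambda>_. 0) \<in> L2_functions \<mu>" by (simp_all add: L2_functions_def L2_norm_fun_def)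
  have R0: "0 \<le> ?R" using regular_bdd(2)[OF f z(2,1)] L2_norm_nonneg order_trans by blast
  show "mbound (mat f) ?R"
    unfolding mbound_def
  proof (intro conjI allI impI R0)
    fix F F' :: "'s set" and \<xi> :: "'s \<Rightarrow> complex" assume F: "finite F" "finite F'"
    let ?X = "L2_set (\<lambda>t. cmod (\<xi> t)) F'" and ?Y = "L2_set (\<lambda>s. cmod (\<Sum>t\<in>F'. mat f s t * \<xi> t)) F"
    show "?Y \<le> ?R * ?X"
    proof (cases "?X = 0")
      case True
      then have "\<forall>t\<in>F'. \<xi> t = 0" using F by (simp add: L2_set_eq_0_iff)
      then show ?thesis using True by (simp add: L2_set_0')
    next
      case False
      then have X: "?X > 0" by (simp add: less_le)
      define E where "E = F' \<inter> S"
      have E: "finite E" "E \<subseteq> S" using F by (auto simp: E_def)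
      \<comment> \<open>The vector is cut to S, where \<open>mat f\<close> has its entries, and
        divided by its norm, so that its lift is admissible in the supremum.\<close>
      define \<phi> where "\<phi> t = (if t \<in> E then \<xi> t / of_real ?X else 0)" for t
      have \<phi>E: "t \<in> E" if "\<phi> t \<noteq> 0" for t using that by (auto simp: \<phi>_def split: if_splits)
      have "L2_set (\<lambda>t. cmod (\<phi> t)) E = (1 / ?X) * L2_set (\<lambda>t. cmod (\<xi> t)) E"
        using X by (subst L2_set_right_distrib) (auto simp: \<phi>_def norm_divide intro!: L2_set_cong)
      moreover have "L2_set (\<lambda>t. cmod (\<xi> t)) E \<le> ?X"
        unfolding L2_set_def E_def using F by (intro real_sqrt_le_mono sum_mono2) auto
      ultimately have "L2_set (\<lambda>t. cmod (\<phi> t)) E \<le> 1" using X by (simp only: divide_le_eq_1 times_divide_eq_left mult_1_left) simp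
      moreover have "L2_norm_fun \<mu> (lift \<phi>) = L2_set (\<lambda>t. cmod (\<phi> t)) E"
        by (rule L2_lift(2)[OF E]) (rule \<phi>E)
      ultimately have n1: "L2_norm_fun \<mu> (lift \<phi>) \<le> 1" by simp
      define \<eta> where "\<eta> s = (if s \<in> S then (\<Sum>t\<in>E. mat f s t * \<phi> t) else 0)" for s
      \<comment> \<open>D holds the whole support of \<eta>, so that its norm over D is that of the
        lift, and also the part of F that matters.\<close>
      define D where "D = (F \<inter> S) \<union> (\<Union>t\<in>E. {s. mat f s t \<noteq> 0})"
      have D: "finite D" "D \<subseteq> S" using F E mat_col[OF fC] mat_nonzero[of f] by (auto simp: D_def)
      have \<eta>D: "s \<in> D" if "\<eta> s \<noteq> 0" for s
      proof (rule ccontr)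
        assume "s \<notin> D"
        then have "\<eta> s = 0" by (auto simp: \<eta>_def D_def intro!: sum.neutral)
        then show False using that by simp
      qed
      have "conv f (lift \<phi>) = lift \<eta>"
      proof
        fix x show "conv f (lift \<phi>) x = lift \<eta> x"
        proof (cases "x \<in> carrier H")
          case True
          then show ?thesis by (simp add: conv_lift[OF fC E \<phi>E] lift_def \<eta>_def)
        qed (simp add: convolution_def lift_def)
      qed
      then have "L2_set (\<lambda>s. cmod (\<eta> s)) D \<le> ?R"
        using regular_bdd(2)[OF f L2_lift(1)[OF E, of \<phi>, OF \<phi>E] n1] L2_lift(2)[OF D, of \<eta>, OF \<eta>D] by simp
      moreover have "?Y = ?X * L2_set (\<lambda>s. cmod (\<eta> s)) F"
      proof -
        have "(\<Sum>t\<in>F'. mat f s t * \<xi> t) = of_real ?X * \<eta> s" for s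
        proof (cases "s \<in> S")
          case True
          have "(\<Sum>t\<in>F'. mat f s t * \<xi> t) = (\<Sum>t\<in>E. mat f s t * \<xi> t)"
            using F by (intro sum.mono_neutral_right) (auto simp: E_def mat_def)
          also have "\<dots> = of_real ?X * \<eta> s"
            using X True by (simp add: \<eta>_def \<phi>_def sum_distrib_left)
          finally show ?thesis .
        qed (simp add: mat_def \<eta>_def)
        then show ?thesis by (simp add: norm_mult L2_set_right_distrib)
      qed
      moreover have "L2_set (\<lambda>s. cmod (\<eta> s)) F \<le> L2_set (\<lambda>s. cmod (\<eta> s)) D"
      proof -
        have "(\<Sum>s\<in>F. (cmod (\<eta> s))\<^sup>2) = (\<Sum>s\<in>F \<inter> S. (cmod (\<eta> s))\<^sup>2)"
          using F by (intro sum.mono_neutral_right) (auto simp: \<eta>_def)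
        also have "\<dots> \<le> (\<Sum>s\<in>D. (cmod (\<eta> s))\<^sup>2)" using D by (intro sum_mono2) (auto simp: D_def)
        finally show ?thesis unfolding L2_set_def by (rule real_sqrt_le_mono)
      qed
      ultimately have "L2_set (\<lambda>s. cmod (\<eta> s)) F \<le> ?R" by linarith
      then have "?X * L2_set (\<lambda>s. cmod (\<eta> s)) F \<le> ?X * ?R" by (rule mult_left_mono) simp
      then show ?thesis using \<open>?Y = _\<close> by (simp add: mult.commute)
    qed
  qed
qed

end

section \<open>Equality of the norms and the isomorphisms of the completions\<close>

context perm_hecke
begin

interpretation C: star_nalg Cc by (rule star_nalg_Cc)
interpretation Z: star_nalg Z by (rule star_nalg_Z)

abbreviation "reg_norm a \<equiv> regular_rep_norm H \<mu> (i a)"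

text \<open>Two cycles of inequalities start and end at \<open>mat_norm a\<close>: one through the
  largest seminorm of \<open>Cc\<close>, the other through the regular norm and \<open>ker\<close>.
  Growth closes both, by bounding the largest seminorm of \<open>Z\<close>.\<close>

lemma norms_eq:
  assumes slow: slow_growth and a: "a \<in> carrier Z"
  shows "Z.max_seminorm a = mat_norm a" "C.max_seminorm (i a) = mat_norm a" "reg_norm a = mat_norm a"
proof -
  have 1: "Z.max_seminorm a \<le> mat_norm a" by (rule Z.max_seminorm_least) (rule seminorm_le_mat_norm[OF slow _ a])
  have 2: "mat_norm a \<le> C.max_seminorm (i a)" by (rule C.max_seminorm_upper[OF cstar_seminorm_mat i_Cc[OF a]])
  have 3: "C.max_seminorm (i a) \<le> Z.max_seminorm a"
  proof (rule C.max_seminorm_least)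
    fix N assume N: "cstar_seminorm Cc N"
    have "cstar_seminorm Z (\<lambda>a. N (i a))"
    proof (rule cstar_seminorm_comp[OF star_hom_i _ N])
      show "nrm Cc (i a) \<le> nrm Z a" if "a \<in> carrier Z" for a using i_ops'(5)[OF that] by simp
      show "star Z a \<in> carrier Z" if "a \<in> carrier Z" for a by (rule Z_in(4)[OF that])
    qed
    then show "N (i a) \<le> Z.max_seminorm a" using a by (rule Z.max_seminorm_upper)
  qed
  have 4: "mat_norm a \<le> reg_norm a" by (rule mat_le_regular[OF i_in[OF a]])
  have 5: "reg_norm a \<le> mnorm (ker (i a))" by (rule regular_bdd(1)[OF i_in[OF a]])
  have 6: "mnorm (ker (i a)) \<le> Z.max_seminorm a" by (rule Z.max_seminorm_upper[OF cstar_seminorm_ker a])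
  show "Z.max_seminorm a = mat_norm a" "C.max_seminorm (i a) = mat_norm a" "reg_norm a = mat_norm a" using 1 2 3 4 5 6 by linarith+
qed

abbreviation "full_alg \<equiv> enveloping_cstar (completion Z)"
abbreviation "corner_alg \<equiv> corner (C.emb unit_proj) (enveloping_cstar (completion Cc))"
abbreviation "reduced_alg \<equiv> Z\<lparr>nrm := \<lambda>a. reg_norm a\<rparr>"
abbreviation "to_corner \<equiv> \<lambda>a. C.emb (i a)"

lemma to_corner_hom: "star_hom Z C.E to_corner"
  by (rule star_hom_comp[OF star_hom_i C.star_hom_emb])

text \<open>Compression by p is Lipschitz, maps the dense image of \<open>Cc\<close> into the image
  of \<open>Z\<close>, and fixes the image of \<open>Z\<close>. Its range is therefore the closure
  of that image.\<close>

lemma corner_eq: "corner_alg = C.E\<lparr>carrier := closed_image.cl C.E Z to_corner\<rparr>"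
proof -
  interpret E: banach_star C.E by (rule C.banach_E)
  interpret I: closed_image C.E Z to_corner by unfold_locales (rule to_corner_hom)
  let ?p = "C.emb unit_proj" and ?m = "vmul C.E"
  have emb: "C.emb f \<in> carrier C.E" if "f \<in> carrier Cc" for f
    using C.star_hom_emb that by (simp add: star_hom_def)
  have embm: "C.emb (conv f h) = ?m (C.emb f) (C.emb h)" if "f \<in> carrier Cc" "h \<in> carrier Cc" for f h
    using C.star_hom_emb that by (simp add: star_hom_def Cc_ops)
  have p: "?p \<in> carrier C.E" by (rule emb[OF unit_proj_Cc])
  \<comment> \<open>A Lipschitz constant for compression by p. Tolerances below are divided by K +
    1, which is positive even for K = 0.\<close>
  define K where "K = nrm C.E ?p * nrm C.E ?p"
  have K0: "K \<ge> 0" using p by (simp add: K_def)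
  have cut: "nrm C.E (vdiff C.E (?m (?m ?p a) ?p) (?m (?m ?p c) ?p)) \<le> K * nrm C.E (vdiff C.E a c)"
    if a: "a \<in> carrier C.E" and c: "c \<in> carrier C.E" for a c
  proof -
    have 1: "nrm C.E (vdiff C.E (?m ?p a) (?m ?p c)) \<le> nrm C.E ?p * nrm C.E (vdiff C.E a c)"
      using E.dist_mul[OF p a p c] p by (simp add: E.dist_self)
    have "nrm C.E (vdiff C.E (?m (?m ?p a) ?p) (?m (?m ?p c) ?p)) \<le> nrm C.E (vdiff C.E (?m ?p a) (?m ?p c)) * nrm C.E ?p"
      using E.dist_mul[of "?m ?p a" ?p "?m ?p c" ?p] p a c by (simp add: E.dist_self)
    also have "\<dots> \<le> (nrm C.E ?p * nrm C.E (vdiff C.E a c)) * nrm C.E ?p"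
      using 1 p by (intro mult_right_mono) auto
    finally show ?thesis by (simp add: K_def ac_simps)
  qed
  have j_in: "to_corner z \<in> carrier C.E" if "z \<in> carrier Z" for z by (rule emb[OF i_Cc[OF that]])
  have fix_j: "?m (?m ?p (to_corner z)) ?p = to_corner z" if z: "z \<in> carrier Z" for z
  proof -
    have "?m (?m ?p (to_corner z)) ?p = C.emb (conv (conv unit_proj (i z)) unit_proj)"
      using embm[OF conv_Cc[OF unit_proj_Cc i_Cc[OF z]] unit_proj_Cc] embm[OF unit_proj_Cc i_Cc[OF z]] by simp
    then show ?thesis by (simp add: conv_unit_proj_left[OF i_in[OF z]] conv_unit_proj_right[OF i_in[OF z]])
  qed
  have "(\<lambda>a. ?m (?m ?p a) ?p) ` carrier C.E = I.cl"
  proof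
    show "(\<lambda>a. ?m (?m ?p a) ?p) ` carrier C.E \<subseteq> I.cl"
    proof
      fix y assume "y \<in> (\<lambda>a. ?m (?m ?p a) ?p) ` carrier C.E"
      then obtain a where a: "a \<in> carrier C.E" "y = ?m (?m ?p a) ?p" by blast
      show "y \<in> I.cl"
        unfolding I.cl_def
      proof (intro CollectI conjI allI impI)
        show "y \<in> carrier C.E" using a p by simp
        fix e :: real assume e: "e > 0"
        then have d: "e / (K + 1) > 0" using K0 by simp
        obtain f where f: "f \<in> carrier Cc" "nrm C.E (vdiff C.E (C.emb f) a) < e / (K + 1)"
          using C.emb_dense[OF a(1) d] by blast
        obtain z where z: "z \<in> carrier Z" "i z = conv (conv unit_proj f) unit_proj" using i_surj[OF unit_proj_conv_unit_proj[OF f(1)]] by blast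
        have "to_corner z = ?m (?m ?p (C.emb f)) ?p"
          using embm[OF conv_Cc[OF unit_proj_Cc f(1)] unit_proj_Cc] embm[OF unit_proj_Cc f(1)] z(2) by simp
        then have "nrm C.E (vdiff C.E (to_corner z) y) \<le> K * nrm C.E (vdiff C.E (C.emb f) a)"
          using cut[OF emb[OF f(1)] a(1)] a(2) by simp
        also have "\<dots> \<le> K * (e / (K + 1))" using f(2) K0 by (intro mult_left_mono) auto
        also have "\<dots> < e" using K0 e by (simp add: field_simps)
        finally show "\<exists>z\<in>carrier Z. nrm C.E (vdiff C.E (to_corner z) y) < e" using z by blast
      qed
    qed
    show "I.cl \<subseteq> (\<lambda>a. ?m (?m ?p a) ?p) ` carrier C.E"
    proof
      fix y assume "y \<in> I.cl"
      then have y: "y \<in> carrier C.E" "\<And>e. e > 0 \<Longrightarrow> \<exists>z\<in>carrier Z. nrm C.E (vdiff C.E (to_corner z) y) < e"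
        by (auto simp: I.cl_def)
      let ?y = "?m (?m ?p y) ?p"
      have yc: "?y \<in> carrier C.E" using y p by simp
      have "nrm C.E (vdiff C.E y ?y) \<le> 0"
      proof (rule field_le_epsilon)
        fix e :: real assume e: "e > 0"
        then have d: "e / (K + 1) > 0" using K0 by simp
        obtain z where z: "z \<in> carrier Z" "nrm C.E (vdiff C.E (to_corner z) y) < e / (K + 1)" using y(2)[OF d] by blast
        have "nrm C.E (vdiff C.E y ?y) \<le> nrm C.E (vdiff C.E y (to_corner z)) + nrm C.E (vdiff C.E (to_corner z) ?y)"
          by (rule E.dist_tri[OF y(1) j_in[OF z(1)] yc])
        also have "nrm C.E (vdiff C.E y (to_corner z)) = nrm C.E (vdiff C.E (to_corner z) y)" by (rule E.dist_sym[OF y(1) j_in[OF z(1)]])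
        also have "nrm C.E (vdiff C.E (to_corner z) ?y) \<le> K * nrm C.E (vdiff C.E (to_corner z) y)"
          using cut[OF j_in[OF z(1)] y(1)] fix_j[OF z(1)] by simp
        finally have "nrm C.E (vdiff C.E y ?y) \<le> (K + 1) * nrm C.E (vdiff C.E (to_corner z) y)" by (simp add: algebra_simps)
        also have "\<dots> \<le> (K + 1) * (e / (K + 1))" using z(2) K0 by (intro mult_left_mono) auto
        finally show "nrm C.E (vdiff C.E y ?y) \<le> 0 + e" using K0 by simp
      qed
      moreover have "0 \<le> nrm C.E (vdiff C.E y ?y)" using y(1) yc by simp
      ultimately have "y = ?y" using E.hausdorff[OF y(1) yc] by simp
      then show "y \<in> (\<lambda>a. ?m (?m ?p a) ?p) ` carrier C.E" using y(1) by blast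
    qed
  qed
  then show ?thesis by (simp add: corner_def)
qed

lemma corner_alg_simps: "vadd corner_alg = vadd C.E" "scal corner_alg = scal C.E" "vmul corner_alg = vmul C.E" "star corner_alg = star C.E" "nrm corner_alg = nrm C.E"
  "vdiff corner_alg = vdiff C.E"
  by (simp_all add: corner_def vdiff_def[abs_def])

lemma closed_image_to_corner: "closed_image C.E Z to_corner"
proof -
  interpret E: banach_star C.E by (rule C.banach_E)
  show ?thesis by unfold_locales (rule to_corner_hom)
qed

lemma corner_alg_carrier: "carrier corner_alg = closed_image.cl C.E Z to_corner"
  by (simp add: corner_eq)

lemma banach_corner_alg: "banach_star corner_alg"
  unfolding corner_eq by (rule closed_image.banach_star_cl[OF closed_image_to_corner])

lemma corner_alg_map: "star_hom Z corner_alg to_corner" "\<And>a e. a \<in> carrier corner_alg \<Longrightarrow> e > 0 \<Longrightarrow> \<exists>z\<in>carrier Z. nrm corner_alg (vdiff corner_alg (to_corner z) a) < e"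
  "\<And>a. a \<in> carrier Z \<Longrightarrow> nrm corner_alg (to_corner a) = C.max_seminorm (i a)"
proof -
  interpret E: banach_star C.E by (rule C.banach_E)
  interpret I: closed_image C.E Z to_corner by (rule closed_image_to_corner)
  have "to_corner z \<in> I.cl" if "z \<in> carrier Z" for z
    unfolding I.cl_def using that I.j_in[OF that] by (auto simp: E.dist_self intro!: bexI[of _ z])
  then show "star_hom Z corner_alg to_corner" using to_corner_hom by (simp add: star_hom_def corner_alg_simps corner_alg_carrier)
  show "\<And>a e. a \<in> carrier corner_alg \<Longrightarrow> e > 0 \<Longrightarrow> \<exists>z\<in>carrier Z. nrm corner_alg (vdiff corner_alg (to_corner z) a) < e"
    by (simp add: corner_alg_carrier corner_alg_simps I.cl_def)
  show "\<And>a. a \<in> carrier Z \<Longrightarrow> nrm corner_alg (to_corner a) = C.max_seminorm (i a)"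
    by (simp add: corner_alg_simps C.nrm_emb i_Cc)
qed

text \<open>Under slow growth the regular norm equals the largest C*-seminorm, and the required norm
  laws are read off from the latter.\<close>

lemma star_nalg_reduced_alg: assumes slow: slow_growth shows "star_nalg reduced_alg"
proof -
  interpret M: star_nalg "with_max_cstar_norm Z" by (rule Z.star_nalg_max)
  have e: "reg_norm a = Z.max_seminorm a" if "a \<in> carrier Z" for a using norms_eq[OF slow that] by simp
  show ?thesis
  proof (rule Z.star_nalg_nrm)
    fix a assume a: "a \<in> carrier Z"
    show "0 \<le> reg_norm a" using M.nrm_nonneg[of a] a by (simp add: e)
    show "reg_norm (scal Z c a) = cmod c * reg_norm a" for c using M.nrm_scal[of a c] a by (simp add: e)
    show "reg_norm (star Z a) = reg_norm a" using M.nrm_star[of a] a by (simp add: e)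
    fix c assume c: "c \<in> carrier Z"
    show "reg_norm (vadd Z a c) \<le> reg_norm a + reg_norm c" using M.nrm_add[of a c] a c by (simp add: e)
    show "reg_norm (vmul Z a c) \<le> reg_norm a * reg_norm c" using M.nrm_mul[of a c] a c by (simp add: e)
  qed
qed

lemma star_nalg_dense:
  assumes "star_nalg A" "X \<in> carrier (completion A)" "e > 0"
  shows "\<exists>a\<in>carrier A. nrm (completion A) (vdiff (completion A) (completion_map A a) X) < e"
proof -
  interpret star_nalg A by (rule assms(1))
  obtain s where s: "cauchy_in A s" "X = cauchy_class A s" by (rule completion_cases[OF assms(2)])
  obtain m where "norm (nrm (completion A) (vdiff (completion A) (completion_map A (s m)) X) - 0) < e"
    using LIMSEQ_D[OF completion_approx[OF s(1)] assms(3)] s(2) by blast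
  then have "nrm (completion A) (vdiff (completion A) (completion_map A (s m)) X) < e" by auto
  then show ?thesis using cauchy_in_carrier[OF s(1)] by blast
qed

lemma dense_pair_corner: assumes slow: slow_growth shows "dense_pair full_alg corner_alg Z Z.emb to_corner"
proof -
  interpret full_alg: banach_star full_alg by (rule Z.banach_E)
  interpret corner_alg: banach_star corner_alg by (rule banach_corner_alg)
  show ?thesis
  proof
    show "star_hom Z full_alg Z.emb" by (rule Z.star_hom_emb)
    show "star_hom Z corner_alg to_corner" by (rule corner_alg_map(1))
    show "\<exists>z\<in>carrier Z. nrm full_alg (vdiff full_alg (Z.emb z) a) < e" if "a \<in> carrier full_alg" "e > 0" for a e
      by (rule Z.emb_dense[OF that])
    show "\<exists>z\<in>carrier Z. nrm corner_alg (vdiff corner_alg (to_corner z) a) < e" if "a \<in> carrier corner_alg" "e > 0" for a e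
      by (rule corner_alg_map(2)[OF that])
    show "nrm full_alg (Z.emb z) = nrm corner_alg (to_corner z)" if z: "z \<in> carrier Z" for z
      using norms_eq[OF slow z] by (simp add: Z.nrm_emb[OF z] corner_alg_map(3)[OF z])
  qed
qed

lemma dense_pair_reduced: assumes slow: slow_growth shows "dense_pair corner_alg (completion reduced_alg) Z to_corner (completion_map reduced_alg)"
proof -
  interpret reduced_alg: star_nalg reduced_alg by (rule star_nalg_reduced_alg[OF slow])
  interpret corner_alg: banach_star corner_alg by (rule banach_corner_alg)
  interpret A3: banach_star "completion reduced_alg" by (rule reduced_alg.banach_star_completion)
  show ?thesis
  proof
    show "star_hom Z corner_alg to_corner" by (rule corner_alg_map(1))
    show "star_hom Z (completion reduced_alg) (completion_map reduced_alg)"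
      using reduced_alg.star_hom_completion_map by (simp add: star_hom_def)
    show "\<exists>z\<in>carrier Z. nrm corner_alg (vdiff corner_alg (to_corner z) a) < e" if "a \<in> carrier corner_alg" "e > 0" for a e
      by (rule corner_alg_map(2)[OF that])
    show "\<exists>z\<in>carrier Z. nrm (completion reduced_alg) (vdiff (completion reduced_alg) (completion_map reduced_alg z) a) < e"
      if "a \<in> carrier (completion reduced_alg)" "e > 0" for a e
      using star_nalg_dense[OF reduced_alg.star_nalg_axioms that] by simp
    show "nrm corner_alg (to_corner z) = nrm (completion reduced_alg) (completion_map reduced_alg z)" if z: "z \<in> carrier Z" for z
      using norms_eq[OF slow z] z by (simp add: corner_alg_map(3)[OF z] reduced_alg.completion_map_ops(6))
  qed
qed

theorem cstar_completions:
  assumes slow: slow_growth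
  shows "\<exists>\<Phi>. canonical_surjection (carrier Z) Z.emb full_alg to_corner corner_alg \<Phi>"
    "canonical_surjection (carrier Z) Z.emb full_alg to_corner corner_alg \<Phi> \<Longrightarrow> star_iso full_alg corner_alg \<Phi>"
    "\<exists>\<Psi>. canonical_surjection (carrier Z) to_corner corner_alg (completion_map reduced_alg) (completion reduced_alg) \<Psi>"
    "canonical_surjection (carrier Z) to_corner corner_alg (completion_map reduced_alg) (completion reduced_alg) \<Psi> \<Longrightarrow> star_iso corner_alg (completion reduced_alg) \<Psi>"
  using dense_pair.canonical_surjection_exists[OF dense_pair_corner[OF slow]] dense_pair.canonical_surjection_iso[OF dense_pair_corner[OF slow]]
    dense_pair.canonical_surjection_exists[OF dense_pair_reduced[OF slow]] dense_pair.canonical_surjection_iso[OF dense_pair_reduced[OF slow]]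
  by blast+

end

section \<open>Growth conditions\<close>

text \<open>The limsup bounds the roots from some index on by 1 + e; a larger constant takes care of
  the finitely many earlier terms.\<close>

lemma growth_of_limsup:
  fixes a :: "nat \<Rightarrow> nat" and c :: real
  assumes c: "c > 0" and ls: "limsup (\<lambda>n. ereal (root n (c * real (a n)))) = 1" and e: "e > 0"
  shows "\<exists>C>0. \<forall>n. real (a n) \<le> C * (1 + e) ^ n"
proof -
  have "limsup (\<lambda>n. ereal (root n (c * real (a n)))) < ereal (1 + e)" using ls e by (simp add: one_ereal_def)
  then have "\<forall>\<^sub>F n in sequentially. ereal (root n (c * real (a n))) < ereal (1 + e)" by (rule Limsup_lessD)
  then obtain N where N: "\<And>n. n \<ge> N \<Longrightarrow> root n (c * real (a n)) < 1 + e" by (auto simp: eventually_sequentially)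
  \<comment> \<open>1/c serves the indices above N. The sum serves those up to N, among them 0,
    where the root carries no information.\<close>
  define C where "C = 1 / c + (\<Sum>n<Suc N. real (a n))"
  have s0: "0 \<le> (\<Sum>n<Suc N. real (a n))" by (rule sum_nonneg) simp
  have C: "C > 0" "1 / c \<le> C" using divide_pos_pos[OF zero_less_one c] s0 unfolding C_def by linarith+
  have "real (a n) \<le> C * (1 + e) ^ n" for n
  proof (cases "n < Suc N")
    case True
    then have "real (a n) \<le> (\<Sum>n<Suc N. real (a n))" by (intro member_le_sum) auto
    also have "\<dots> \<le> C" using c unfolding C_def by (intro le_add_same_cancel2[THEN iffD2]) simp
    also have "\<dots> \<le> C * (1 + e) ^ n" using C e by (simp add: one_le_power)
    finally show ?thesis .
  next
    case False
    then have n: "n \<ge> N" "n > 0" by auto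
    have "c * real (a n) = root n (c * real (a n)) ^ n" using n c by (simp add: real_root_pow_pos2)
    also have "\<dots> \<le> (1 + e) ^ n" using N[OF n(1)] c by (intro power_mono) (auto simp: real_root_ge_zero)
    finally have "real (a n) \<le> 1 / c * (1 + e) ^ n" using c by (simp add: field_simps)
    also have "\<dots> \<le> C * (1 + e) ^ n" using e C by (intro mult_right_mono) auto
    finally show ?thesis .
  qed
  then show ?thesis using C by blast
qed

text \<open>If all compact sets were null, inner regularity would make the whole space null. This
  shows below that points of a discrete group, and the stabiliser, have positive measure.\<close>

lemma haar_open_pos:
  assumes h: "left_haar_measure H T \<nu>" and K0: "\<And>K. compactin T K \<Longrightarrow> emeasure \<nu> K = 0" shows False
proof -
  obtain E where E: "E \<in> sets \<nu>" "emeasure \<nu> E \<noteq> 0" using h by (auto simp: left_haar_measure_def)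
  have "emeasure \<nu> (topspace T) = Sup {emeasure \<nu> K | K. compactin T K \<and> K \<subseteq> topspace T}"
    using h unfolding left_haar_measure_def by (elim conjE) (rule mp, erule spec, rule openin_topspace)
  also have "\<dots> \<le> 0" using K0 by (intro Sup_least) auto
  finally have 0: "emeasure \<nu> (space \<nu>) = 0" using h by (simp add: left_haar_measure_def)
  have "emeasure \<nu> E \<le> emeasure \<nu> (space \<nu>)" by (rule emeasure_space)
  then show False using E 0 by simp
qed

lemma haar_left:
  assumes "left_haar_measure H T \<nu>" "x \<in> carrier H" "E \<in> sets \<nu>"
  shows "emeasure \<nu> (x <#\<^bsub>H\<^esub> E) = emeasure \<nu> E"
proof -
  have "\<forall>x\<in>carrier H. \<forall>E\<in>sets \<nu>. emeasure \<nu> (x <#\<^bsub>H\<^esub> E) = emeasure \<nu> E"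
    using assms(1) unfolding left_haar_measure_def by (elim conjE)
  then show ?thesis using assms(2,3) by blast
qed

lemma haar_compact:
  assumes "left_haar_measure H T \<nu>" "compactin T K" shows "emeasure \<nu> K < \<infinity>"
proof -
  have "\<forall>K. compactin T K \<longrightarrow> emeasure \<nu> K < \<infinity>"
    using assms(1) unfolding left_haar_measure_def by (elim conjE)
  then show ?thesis using assms(2) by blast
qed

text \<open>Left invariance gives all singletons the same mass, finite by compactness and nonzero by
  \<open>haar_open_pos\<close>.\<close>

lemma (in group) discrete_haar:
  assumes h: "left_haar_measure G (discrete_topology (carrier G)) \<nu>"
  shows "\<exists>c>0. \<forall>F. finite F \<longrightarrow> F \<subseteq> carrier G \<longrightarrow> measure \<nu> F = c * real (card F)"
proof -
  have sets: "F \<in> sets \<nu>" if "F \<subseteq> carrier G" for F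
    using h that by (auto simp: left_haar_measure_def intro: sigma_sets.Basic)
  have one: "emeasure \<nu> {x} = emeasure \<nu> {\<one>}" if x: "x \<in> carrier G" for x
  proof -
    have "emeasure \<nu> (x <# {\<one>}) = emeasure \<nu> {\<one>}" using haar_left[OF h x sets[of "{\<one>}"]] by simp
    then show ?thesis using x by (simp add: l_coset_def)
  qed
  have fin: "emeasure \<nu> F = of_nat (card F) * emeasure \<nu> {\<one>}" if F: "finite F" "F \<subseteq> carrier G" for F
  proof -
    have "emeasure \<nu> F = (\<Sum>x\<in>F. emeasure \<nu> {x})" using F sets by (intro emeasure_eq_sum_singleton) auto
    also have "\<dots> = (\<Sum>x\<in>F. emeasure \<nu> {\<one>})"
      by (rule sum.cong[OF refl]) (rule one[OF subsetD[OF F(2)]])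
    finally show ?thesis by simp
  qed
  have "compactin (discrete_topology (carrier G)) {\<one>}" by simp
  then have lt: "emeasure \<nu> {\<one>} < \<infinity>" by (rule haar_compact[OF h])
  have "emeasure \<nu> {\<one>} \<noteq> 0"
  proof
    assume "emeasure \<nu> {\<one>} = 0"
    then have "emeasure \<nu> K = 0" if "compactin (discrete_topology (carrier G)) K" for K
      using that fin[of K] by (simp add: compactin_discrete_topology)
    then show False using haar_open_pos[OF h] by blast
  qed
  then have "measure \<nu> {\<one>} > 0" using lt by (simp add: measure_def enn2real_positive_iff zero_less_iff_neq_zero)
  moreover have "measure \<nu> F = measure \<nu> {\<one>} * real (card F)" if F: "finite F" "F \<subseteq> carrier G" for F
    using fin[OF F] by (simp add: measure_def enn2real_mult mult.commute)
  ultimately show ?thesis by blast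
qed

context perm_hecke
begin

text \<open>The hypothesis speaks of some Haar measure \<nu>, not of the normalised \<mu>. The
  positive powers of V are unions of left cosets of the stabiliser, so \<nu> counts these cosets up
  to the factor r, and \<open>growth_of_limsup\<close> absorbs r.\<close>

lemma slow_growth_completion:
  assumes sub: "subexponential_growth H T" shows slow_growth
  unfolding slow_growth_def
proof (intro allI impI)
  fix V and e :: real
  assume "CO V \<and> \<one> \<in> V \<and> (\<forall>x\<in>V. \<forall>k\<in>tr b b. x \<otimes> k \<in> V \<and> k \<otimes> x \<in> V)" and e: "e > 0"
  then have V: "CO V" "\<one> \<in> V" "\<forall>x\<in>V. \<forall>k\<in>tr b b. x \<otimes> k \<in> V \<and> k \<otimes> x \<in> V" by auto
  obtain \<nu> where \<nu>: "left_haar_measure H T \<nu>"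
    "\<forall>V. compactin T V \<and> \<one> \<in> T interior_of V \<longrightarrow> limsup (\<lambda>n. ereal (root n (measure \<nu> (set_power H V n)))) = 1"
    using sub unfolding subexponential_growth_def by blast
  define c where "c = emeasure \<nu> (tr b b)"
  have ops: "U \<in> sets \<nu>" if "openin T U" for U
    using \<nu>(1) that openin_subset[OF that] by (auto simp: left_haar_measure_def intro: sigma_sets.Basic)
  have tb: "emeasure \<nu> (tr b s) = c" if s: "s \<in> S" for s
  proof -
    have "sect s <# tr b b = tr b s"
      using tr_left[OF sect(1)[OF s] b_in b_in] sect[OF s] by (auto simp: l_coset_def)
    then show ?thesis using haar_left[OF \<nu>(1) sect(1)[OF s] ops[OF open_tr[OF b_in]], of b] by (simp add: c_def)
  qed
  have un: "emeasure \<nu> (\<Union>s\<in>F. tr b s) = of_nat (card F) * c" if F: "finite F" "F \<subseteq> S" for F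
  proof -
    have "emeasure \<nu> (\<Union>s\<in>F. tr b s) = (\<Sum>s\<in>F. emeasure \<nu> (tr b s))"
      using F ops open_tr by (intro sum_emeasure[symmetric]) (auto simp: disjoint_family_on_def tr_def)
    also have "\<dots> = (\<Sum>s\<in>F. c)" using tb F by (intro sum.cong) auto
    finally show ?thesis by simp
  qed
  have cf: "c < \<infinity>" unfolding c_def using CO_stab by (intro haar_compact[OF \<nu>(1)]) (simp add: CO_def)
  have cover: "A \<subseteq> (\<Union>s\<in>(\<lambda>x. act x b) ` A. tr b s)" if "A \<subseteq> carrier H" for A using that by (auto simp: tr_def)
  have c0: "c \<noteq> 0"
  proof
    assume z: "c = 0"
    have "emeasure \<nu> K = 0" if K: "compactin T K" for K
    proof -
      let ?F = "(\<lambda>x. act x b) ` K"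
      have Kc: "K \<subseteq> carrier H" using compactin_subset_topspace[OF K] by simp
      have F: "finite ?F" "?F \<subseteq> S" using compact_orbit(1)[OF K b_in] Kc by auto
      have "(\<Union>s\<in>?F. tr b s) \<in> sets \<nu>" using F by (intro ops openin_Union) (auto intro: open_tr)
      then have "emeasure \<nu> K \<le> emeasure \<nu> (\<Union>s\<in>?F. tr b s)" by (rule emeasure_mono[OF cover[OF Kc]])
      then show ?thesis using un[OF F] z by simp
    qed
    then show False using haar_open_pos[OF \<nu>(1)] by blast
  qed
  define r where "r = enn2real c"
  have r: "r > 0" using c0 cf by (simp add: r_def enn2real_positive_iff zero_less_iff_neq_zero)
  let ?a = "\<lambda>n. card ((\<lambda>x. act x b) ` set_power H V n)"
  have Vc: "V \<subseteq> carrier H" by (rule CO_sub[OF V(1)])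
  have m: "measure \<nu> (set_power H V n) = r * real (?a n)" if n: "n > 0" for n
  proof -
    let ?W = "set_power H V n"
    obtain k where "n = Suc k" using n by (cases n) auto
    then have W: "CO ?W" "\<forall>x\<in>?W. \<forall>k\<in>tr b b. x \<otimes> k \<in> ?W" using set_power_CO[OF V, of k] by auto
    have Wc: "?W \<subseteq> carrier H" by (rule CO_sub[OF W(1)])
    let ?F = "(\<lambda>x. act x b) ` ?W"
    have F: "finite ?F" "?F \<subseteq> S" using CO_orbit[OF W(1)] Wc by auto
    have "?W = (\<Union>s\<in>?F. tr b s)"
    proof
      show "?W \<subseteq> (\<Union>s\<in>?F. tr b s)" by (rule cover[OF Wc])
      show "(\<Union>s\<in>?F. tr b s) \<subseteq> ?W"
      proof
        fix x assume "x \<in> (\<Union>s\<in>?F. tr b s)"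
        then obtain y where y: "y \<in> ?W" "x \<in> carrier H" "act x b = act y b" by (auto simp: tr_def)
        then have "inv y \<otimes> x \<in> tr b b" "x = y \<otimes> (inv y \<otimes> x)" using tr_b_eq[of x y] Wc by auto
        then show "x \<in> ?W" using W(2) y(1) by metis
      qed
    qed
    then have "emeasure \<nu> ?W = of_nat (card ?F) * c" using un[OF F] by simp
    then show ?thesis by (simp add: measure_def r_def enn2real_mult mult.commute)
  qed
  have "limsup (\<lambda>n. ereal (root n (measure \<nu> (set_power H V n)))) = 1"
    using \<nu>(2) V by (simp add: CO_def interior_of_openin)
  \<comment> \<open>At n = 0 the measure is not a coset count, but \<open>root 0\<close> is 0 on
    both sides.\<close>
  moreover have "root n (measure \<nu> (set_power H V n)) = root n (r * real (?a n))" for n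
    using m[of n] by (cases "n = 0") auto
  ultimately have "limsup (\<lambda>n. ereal (root n (r * real (?a n)))) = 1" by simp
  then show "\<exists>c>0. \<forall>n. real (?a n) \<le> c * (1 + e) ^ n" by (rule growth_of_limsup[OF r _ e])
qed

end

section \<open>The Schlichting completion\<close>

text \<open>Brings the product topology into the form of \<open>open_iff\<close>, agreement at
  finitely many points. It serves \<open>Bij S\<close>, the completion, and the full product in
  which compactness is proved.\<close>

lemma openin_pointwise:
  assumes C: "C \<subseteq> PiE S (\<lambda>_. S)"
  shows "openin (subtopology (product_topology (\<lambda>_. discrete_topology S) S) C) U \<longleftrightarrow>
    U \<subseteq> C \<and> (\<forall>x\<in>U. \<exists>F\<subseteq>S. finite F \<and> (\<forall>y\<in>C. (\<forall>s\<in>F. y s = x s) \<longrightarrow> y \<in> U))"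
    (is "?L \<longleftrightarrow> ?R")
proof
  let ?P = "product_topology (\<lambda>_. discrete_topology S) S"
  assume ?L
  then obtain V where V: "openin ?P V" "U = V \<inter> C" by (auto simp: openin_subtopology)
  have "\<exists>F\<subseteq>S. finite F \<and> (\<forall>y\<in>C. (\<forall>s\<in>F. y s = x s) \<longrightarrow> y \<in> U)" if x: "x \<in> U" for x
  proof -
    obtain W where W: "finite {i \<in> S. W i \<noteq> topspace (discrete_topology S)}" "x \<in> PiE S W" "PiE S W \<subseteq> V"
      using V x unfolding openin_product_topology_alt by (metis IntD1)
    define F where "F = {i \<in> S. W i \<noteq> S}"
    have "y \<in> U" if y: "y \<in> C" "\<forall>s\<in>F. y s = x s" for y
    proof -
      have yP: "y \<in> PiE S (\<lambda>_. S)" using y C by blast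
      have "y i \<in> W i" if i: "i \<in> S" for i
        using y(2) i W(2) yP by (cases "i \<in> F") (auto simp: F_def PiE_iff)
      then have "y \<in> PiE S W" using yP by (auto simp: PiE_iff)
      then show ?thesis using W V y by blast
    qed
    then show ?thesis using W(1) by (intro exI[of _ F]) (auto simp: F_def)
  qed
  then show ?R using V by auto
next
  let ?P = "product_topology (\<lambda>_. discrete_topology S) S"
  assume R: ?R
  then obtain f where f: "\<And>x. x \<in> U \<Longrightarrow> f x \<subseteq> S \<and> finite (f x) \<and> (\<forall>y\<in>C. (\<forall>s\<in>f x. y s = x s) \<longrightarrow> y \<in> U)"
    by metis
  define V where "V = (\<Union>x\<in>U. {y \<in> PiE S (\<lambda>_. S). \<forall>s\<in>f x. y s = x s})"
  have "openin ?P V"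
    unfolding openin_product_topology_alt
  proof
    fix y assume "y \<in> V"
    then obtain x where x: "x \<in> U" "y \<in> PiE S (\<lambda>_. S)" "\<forall>s\<in>f x. y s = x s" by (auto simp: V_def)
    define W where "W i = (if i \<in> f x then {x i} else S)" for i
    have xP: "x \<in> PiE S (\<lambda>_. S)" using x R C by blast
    have "{i \<in> S. W i \<noteq> topspace (discrete_topology S)} \<subseteq> f x" by (auto simp: W_def)
    then have "finite {i \<in> S. W i \<noteq> topspace (discrete_topology S)}" using f[OF x(1)] finite_subset by blast
    moreover have "\<forall>i\<in>S. openin (discrete_topology S) (W i)" using xP by (auto simp: W_def PiE_iff)
    moreover have "y \<in> PiE S W" using x by (auto simp: W_def PiE_iff)
    moreover have "PiE S W \<subseteq> V"
    proof
      fix z assume z: "z \<in> PiE S W"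
      have "z i \<in> S" if "i \<in> S" for i using z that xP by (auto simp: W_def PiE_iff split: if_splits)
      then have "z \<in> PiE S (\<lambda>_. S)" using z by (auto simp: PiE_iff)
      moreover have "\<forall>s\<in>f x. z s = x s"
      proof
        fix s assume s: "s \<in> f x"
        then have "z s \<in> W s" using z f[OF x(1)] by (auto simp: PiE_iff)
        then show "z s = x s" using s by (simp add: W_def)
      qed
      ultimately show "z \<in> V" using x(1) unfolding V_def by blast
    qed
    ultimately show "\<exists>W. finite {i \<in> S. W i \<noteq> topspace (discrete_topology S)} \<and>
       (\<forall>i\<in>S. openin (discrete_topology S) (W i)) \<and> y \<in> PiE S W \<and> PiE S W \<subseteq> V" by blast
  qed
  moreover have "U = V \<inter> C"
  proof
    show "U \<subseteq> V \<inter> C"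
    proof
      fix x assume x: "x \<in> U"
      then have "x \<in> C" using R by blast
      then show "x \<in> V \<inter> C" using x C by (auto simp: V_def)
    qed
    show "V \<inter> C \<subseteq> U"
    proof
      fix y assume "y \<in> V \<inter> C"
      then obtain x where "x \<in> U" "\<forall>s\<in>f x. y s = x s" "y \<in> C" by (auto simp: V_def)
      then show "y \<in> U" using f[of x] by blast
    qed
  qed
  ultimately show ?L by (auto simp: openin_subtopology)
qed

lemma Bij_PiE: "Bij S \<subseteq> PiE S (\<lambda>_. S)"
  by (auto simp: Bij_def PiE_iff bij_betw_def extensional_def)

lemma openin_perm: "openin (perm_topology S) U \<longleftrightarrow>
    U \<subseteq> Bij S \<and> (\<forall>x\<in>U. \<exists>F\<subseteq>S. finite F \<and> (\<forall>y\<in>Bij S. (\<forall>s\<in>F. y s = x s) \<longrightarrow> y \<in> U))"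
  unfolding perm_topology_def by (rule openin_pointwise[OF Bij_PiE])

lemma topspace_perm: "topspace (perm_topology S) = Bij S"
  using Bij_PiE[of S] by (auto simp: perm_topology_def)

lemma closure_perm:
  assumes "A \<subseteq> Bij S"
  shows "x \<in> perm_topology S closure_of A \<longleftrightarrow> x \<in> Bij S \<and> (\<forall>F\<subseteq>S. finite F \<longrightarrow> (\<exists>a\<in>A. \<forall>s\<in>F. a s = x s))"
    (is "?L \<longleftrightarrow> ?R")
proof
  assume L: ?L
  then have x: "x \<in> Bij S" by (auto simp: in_closure_of topspace_perm)
  have "\<exists>a\<in>A. \<forall>s\<in>F. a s = x s" if F: "F \<subseteq> S" "finite F" for F
  proof -
    have "openin (perm_topology S) {y \<in> Bij S. \<forall>s\<in>F. y s = x s}"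
      unfolding openin_perm using F by (auto intro!: exI[of _ F])
    moreover have "x \<in> {y \<in> Bij S. \<forall>s\<in>F. y s = x s}" using x by simp
    ultimately have "\<exists>y. y \<in> A \<and> y \<in> {y \<in> Bij S. \<forall>s\<in>F. y s = x s}"
      using L unfolding in_closure_of by (elim conjE allE[of _ "{y \<in> Bij S. \<forall>s\<in>F. y s = x s}"]) simp
    then show ?thesis by blast
  qed
  then show ?R using x by blast
next
  assume R: ?R
  show ?L
    unfolding in_closure_of
  proof (intro conjI allI impI)
    show "x \<in> topspace (perm_topology S)" using R by (simp add: topspace_perm)
    fix U assume U: "x \<in> U \<and> openin (perm_topology S) U"
    then have "\<forall>x\<in>U. \<exists>F\<subseteq>S. finite F \<and> (\<forall>y\<in>Bij S. (\<forall>s\<in>F. y s = x s) \<longrightarrow> y \<in> U)"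
      unfolding openin_perm by (elim conjE)
    from bspec[OF this] U
    have "\<exists>F\<subseteq>S. finite F \<and> (\<forall>y\<in>Bij S. (\<forall>s\<in>F. y s = x s) \<longrightarrow> y \<in> U)" by simp
    then obtain F where F: "F \<subseteq> S" "finite F" "\<forall>y\<in>Bij S. (\<forall>s\<in>F. y s = x s) \<longrightarrow> y \<in> U" by (elim exE conjE)
    moreover obtain a where a: "a \<in> A" "\<forall>s\<in>F. a s = x s"
    proof -
      have "\<forall>F\<subseteq>S. finite F \<longrightarrow> (\<exists>a\<in>A. \<forall>s\<in>F. a s = x s)" using R by (rule conjunct2)
      then show ?thesis using F(1,2) that by meson
    qed
    moreover have "a \<in> Bij S" using a(1) assms by (rule rev_subsetD)
    ultimately show "\<exists>y. y \<in> A \<and> y \<in> U" by (intro exI[of _ a]) simp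
  qed
qed

lemma BijGroup_simps: "carrier (BijGroup S) = Bij S" "\<one>\<^bsub>BijGroup S\<^esub> = (\<lambda>s\<in>S. s)"
  "x \<in> Bij S \<Longrightarrow> y \<in> Bij S \<Longrightarrow> x \<otimes>\<^bsub>BijGroup S\<^esub> y = compose S x y"
  by (simp_all add: BijGroup_def)

locale hecke = group G for G :: "('a, 'm) monoid_scheme" (structure) +
  fixes \<Gamma> :: "'a set"
  assumes hecke: "hecke_pair G \<Gamma>"
begin

lemma \<Gamma>: "subgroup \<Gamma> G"
  using hecke by (simp add: hecke_pair_def)

lemma \<Gamma>_sub: "g \<in> \<Gamma> \<Longrightarrow> g \<in> carrier G"
  using subgroup.mem_carrier[OF \<Gamma>] .

abbreviation "S \<equiv> lcosets\<^bsub>G\<^esub> \<Gamma>"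
abbreviation "ca \<equiv> coset_action G \<Gamma>"

lemma S_iff: "C \<in> S \<longleftrightarrow> (\<exists>g\<in>carrier G. C = g <# \<Gamma>)"
  by (auto simp: LCOSETS_def)

lemma S_I [intro]: "g \<in> carrier G \<Longrightarrow> g <# \<Gamma> \<in> S"
  by (auto simp: S_iff)

lemma \<Gamma>_S: "\<Gamma> \<in> S" "\<one> <# \<Gamma> = \<Gamma>"
proof -
  show e: "\<one> <# \<Gamma> = \<Gamma>" using \<Gamma>_sub by (force simp: l_coset_def)
  show "\<Gamma> \<in> S" using S_I[OF one_closed] e by simp
qed

lemma lc_assoc: "g \<in> carrier G \<Longrightarrow> h \<in> carrier G \<Longrightarrow> g <# (h <# \<Gamma>) = (g \<otimes> h) <# \<Gamma>"
  using \<Gamma>_sub by (intro lcos_m_assoc) auto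

lemma lc_sub: "C \<in> S \<Longrightarrow> C \<subseteq> carrier G"
  using \<Gamma>_sub by (auto simp: S_iff l_coset_def)

lemma lc_assoc': "C \<in> S \<Longrightarrow> g \<in> carrier G \<Longrightarrow> h \<in> carrier G \<Longrightarrow> g <# (h <# C) = (g \<otimes> h) <# C"
  by (intro lcos_m_assoc lc_sub)

lemma lc_one: "C \<in> S \<Longrightarrow> \<one> <# C = C"
  using lc_sub by (force simp: l_coset_def)

lemma lc_in: "C \<in> S \<Longrightarrow> g \<in> carrier G \<Longrightarrow> g <# C \<in> S"
  by (auto simp: S_iff lc_assoc)

lemma lc_eq_iff: "g \<in> carrier G \<Longrightarrow> h \<in> carrier G \<Longrightarrow> g <# \<Gamma> = h <# \<Gamma> \<longleftrightarrow> inv h \<otimes> g \<in> \<Gamma>"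
proof
  assume g: "g \<in> carrier G" and h: "h \<in> carrier G" and e: "g <# \<Gamma> = h <# \<Gamma>"
  have "g \<in> g <# \<Gamma>" using g subgroup.one_closed[OF \<Gamma>] by (force simp: l_coset_def)
  then obtain k where "k \<in> \<Gamma>" "g = h \<otimes> k" unfolding e by (auto simp: l_coset_def)
  then show "inv h \<otimes> g \<in> \<Gamma>" using h \<Gamma>_sub by (simp add: m_assoc[symmetric])
next
  assume g: "g \<in> carrier G" and h: "h \<in> carrier G" and k: "inv h \<otimes> g \<in> \<Gamma>"
  have "g <# \<Gamma> = h <# ((inv h \<otimes> g) <# \<Gamma>)" using g h by (simp add: lc_assoc m_assoc[symmetric])
  also have "(inv h \<otimes> g) <# \<Gamma> = \<Gamma>"
  proof
    show "(inv h \<otimes> g) <# \<Gamma> \<subseteq> \<Gamma>" using k subgroup.m_closed[OF \<Gamma>] by (auto simp: l_coset_def)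
    show "\<Gamma> \<subseteq> (inv h \<otimes> g) <# \<Gamma>"
    proof
      fix x assume x: "x \<in> \<Gamma>"
      have "x = (inv h \<otimes> g) \<otimes> (inv (inv h \<otimes> g) \<otimes> x)" using k x \<Gamma>_sub by (simp add: m_assoc[symmetric])
      moreover have "inv (inv h \<otimes> g) \<otimes> x \<in> \<Gamma>" using k x subgroup.m_closed[OF \<Gamma>] subgroup.m_inv_closed[OF \<Gamma>] by blast
      ultimately show "x \<in> (inv h \<otimes> g) <# \<Gamma>" unfolding l_coset_def by blast
    qed
  qed
  finally show "g <# \<Gamma> = h <# \<Gamma>" .
qed

lemma lc_\<Gamma>: "k \<in> \<Gamma> \<Longrightarrow> k <# \<Gamma> = \<Gamma>"
  using lc_eq_iff[of k "\<one>"] \<Gamma>_sub \<Gamma>_S by simp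

lemma ca_apply: "C \<in> S \<Longrightarrow> ca g C = g <# C"
  by (simp add: coset_action_def)

lemma ca_Bij: assumes g: "g \<in> carrier G" shows "ca g \<in> Bij S"
proof -
  have "bij_betw (ca g) S S"
  proof (rule bij_betw_byWitness[where f' = "ca (inv g)"])
    show "\<forall>C\<in>S. ca (inv g) (ca g C) = C" "\<forall>C\<in>S. ca g (ca (inv g) C) = C"
      using g by (auto simp: ca_apply lc_in lc_assoc' lc_one)
    show "ca g ` S \<subseteq> S" "ca (inv g) ` S \<subseteq> S" using g by (auto simp: ca_apply lc_in)
  qed
  then show ?thesis by (auto simp: Bij_def coset_action_def)
qed

section \<open>The completion as a transitive permutation group\<close>

abbreviation "Hg \<equiv> schlichting_group G \<Gamma>"
abbreviation "HT \<equiv> schlichting_topology G \<Gamma>"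
abbreviation "HK \<equiv> schlichting_subgroup G \<Gamma>"

lemma ca_agree: "F \<subseteq> S \<Longrightarrow> (\<forall>s\<in>F. ca g s = x s) \<longleftrightarrow> (\<forall>s\<in>F. x s = g <# s)"
  by (metis ca_apply subsetD)

lemma H_iff: "x \<in> carrier Hg \<longleftrightarrow> x \<in> Bij S \<and> (\<forall>F\<subseteq>S. finite F \<longrightarrow> (\<exists>g\<in>carrier G. \<forall>s\<in>F. x s = g <# s))"
proof -
  have "ca ` carrier G \<subseteq> Bij S" using ca_Bij by auto
  then have "x \<in> carrier Hg \<longleftrightarrow> x \<in> Bij S \<and> (\<forall>F\<subseteq>S. finite F \<longrightarrow> (\<exists>a\<in>ca ` carrier G. \<forall>s\<in>F. a s = x s))"
    unfolding schlichting_group_def by (simp add: closure_perm)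
  also have "\<dots> \<longleftrightarrow> x \<in> Bij S \<and> (\<forall>F\<subseteq>S. finite F \<longrightarrow> (\<exists>g\<in>carrier G. \<forall>s\<in>F. x s = g <# s))"
    using ca_agree[of _ _ x] by (intro conj_cong refl all_cong imp_cong) simp
  finally show ?thesis .
qed

lemma K_iff: "x \<in> HK \<longleftrightarrow> x \<in> Bij S \<and> (\<forall>F\<subseteq>S. finite F \<longrightarrow> (\<exists>g\<in>\<Gamma>. \<forall>s\<in>F. x s = g <# s))"
proof -
  have "ca ` \<Gamma> \<subseteq> Bij S" using ca_Bij \<Gamma>_sub by auto
  then have "x \<in> HK \<longleftrightarrow> x \<in> Bij S \<and> (\<forall>F\<subseteq>S. finite F \<longrightarrow> (\<exists>a\<in>ca ` \<Gamma>. \<forall>s\<in>F. a s = x s))"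
    unfolding schlichting_subgroup_def by (simp add: closure_perm)
  also have "\<dots> \<longleftrightarrow> x \<in> Bij S \<and> (\<forall>F\<subseteq>S. finite F \<longrightarrow> (\<exists>g\<in>\<Gamma>. \<forall>s\<in>F. x s = g <# s))"
    using ca_agree[of _ _ x] by (intro conj_cong refl all_cong imp_cong) simp
  finally show ?thesis .
qed

lemma H_approx: "x \<in> carrier Hg \<Longrightarrow> F \<subseteq> S \<Longrightarrow> finite F \<Longrightarrow> \<exists>g\<in>carrier G. \<forall>s\<in>F. x s = g <# s"
  by (simp add: H_iff)

lemma K_approx: "x \<in> HK \<Longrightarrow> F \<subseteq> S \<Longrightarrow> finite F \<Longrightarrow> \<exists>g\<in>\<Gamma>. \<forall>s\<in>F. x s = g <# s"
  by (simp add: K_iff)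

lemma H_Bij: "x \<in> carrier Hg \<Longrightarrow> x \<in> Bij S"
  by (simp add: H_iff)

lemma H_app: "x \<in> carrier Hg \<Longrightarrow> s \<in> S \<Longrightarrow> x s \<in> S"
  using H_Bij Bij_imp_funcset by blast

text \<open>The point \<Gamma> is added to the finite set of approximation: an approximating g that
  fixes the coset \<Gamma> lies in \<Gamma>. So the closure of \<Gamma> is the stabiliser of the
  base point.\<close>

lemma K_eq: "HK = {x \<in> carrier Hg. x \<Gamma> = \<Gamma>}"
proof (rule subset_antisym; rule subsetI)
  fix x assume x: "x \<in> HK"
  have "{\<Gamma>} \<subseteq> S" "finite {\<Gamma>}" using \<Gamma>_S by auto
  from K_approx[OF x this] obtain g where "g \<in> \<Gamma>" "x \<Gamma> = g <# \<Gamma>" by auto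
  then have "x \<Gamma> = \<Gamma>" by (simp add: lc_\<Gamma>)
  moreover have "x \<in> carrier Hg"
    unfolding H_iff
  proof (intro conjI allI impI)
    show "x \<in> Bij S" using x by (simp add: K_iff)
    fix F assume "F \<subseteq> S" "finite F"
    from K_approx[OF x this] obtain g where "g \<in> \<Gamma>" "\<forall>s\<in>F. x s = g <# s" by (rule bexE)
    then show "\<exists>g\<in>carrier G. \<forall>s\<in>F. x s = g <# s" using \<Gamma>_sub by blast
  qed
  ultimately show "x \<in> {x \<in> carrier Hg. x \<Gamma> = \<Gamma>}" by simp
next
  fix x assume x: "x \<in> {x \<in> carrier Hg. x \<Gamma> = \<Gamma>}"
  have "\<exists>g\<in>\<Gamma>. \<forall>s\<in>F. x s = g <# s" if F: "F \<subseteq> S" "finite F" for F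
  proof -
    have xH: "x \<in> carrier Hg" and x\<Gamma>: "x \<Gamma> = \<Gamma>" using x by auto
    have "insert \<Gamma> F \<subseteq> S" "finite (insert \<Gamma> F)" using F \<Gamma>_S by auto
    from H_approx[OF xH this]
    obtain g where g: "g \<in> carrier G" "\<forall>s\<in>insert \<Gamma> F. x s = g <# s" by (rule bexE)
    then have "g <# \<Gamma> = \<one> <# \<Gamma>" using x\<Gamma> \<Gamma>_S by simp
    then have "g \<in> \<Gamma>" using lc_eq_iff[OF g(1) one_closed] g(1) by simp
    moreover have "\<forall>s\<in>F. x s = g <# s" using g(2) by simp
    ultimately show ?thesis by (rule rev_bexI)
  qed
  then show "x \<in> HK" using x H_Bij[of x] unfolding K_iff by simp
qed

text \<open>To approximate an inverse on F, approximate x on the preimage of F; to approximate a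
  product, approximate y on F and x on the image of F under y.\<close>

lemma H_subgroup: "subgroup (carrier Hg) (BijGroup S)"
proof (rule group.subgroupI[OF group_BijGroup])
  show "carrier Hg \<subseteq> carrier (BijGroup S)" by (auto simp: H_iff BijGroup_simps)
  have "ca \<one> \<in> carrier Hg" unfolding H_iff by (auto simp: ca_apply ca_Bij subset_iff intro!: bexI[of _ "\<one>"])
  then show "carrier Hg \<noteq> {}" by blast
  fix x assume x: "x \<in> carrier Hg"
  show "inv\<^bsub>BijGroup S\<^esub> x \<in> carrier Hg"
    unfolding H_iff
  proof (intro conjI allI impI)
    have xB: "x \<in> Bij S" by (rule H_Bij[OF x])
    show "inv\<^bsub>BijGroup S\<^esub> x \<in> Bij S" using xB by (simp add: inv_BijGroup restrict_inv_into_Bij)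
    fix F assume F: "F \<subseteq> S" "finite F"
    let ?y = "inv_into S x"
    have y: "?y s \<in> S" "x (?y s) = s" if "s \<in> S" for s
      using xB that by (auto simp: Bij_def bij_betw_def inv_into_into f_inv_into_f)
    have "?y ` F \<subseteq> S" "finite (?y ` F)" using F y by auto
    from H_approx[OF x this] obtain g where g: "g \<in> carrier G" "\<forall>s\<in>?y ` F. x s = g <# s" by (rule bexE)
    have "(inv\<^bsub>BijGroup S\<^esub> x) s = inv g <# s" if s: "s \<in> F" for s
    proof -
      have sS: "s \<in> S" using s F by blast
      have "s = g <# ?y s" using g(2) s y[OF sS] by auto
      then have "inv g <# s = inv g <# (g <# ?y s)" by simp
      also have "\<dots> = ?y s" using g(1) y[OF sS] by (simp add: lc_assoc' lc_one)
      finally show ?thesis using sS xB by (simp add: inv_BijGroup)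
    qed
    then show "\<exists>g\<in>carrier G. \<forall>s\<in>F. (inv\<^bsub>BijGroup S\<^esub> x) s = g <# s" using g(1) by blast
  qed
  fix y assume y: "y \<in> carrier Hg"
  show "x \<otimes>\<^bsub>BijGroup S\<^esub> y \<in> carrier Hg"
    unfolding H_iff BijGroup_simps(3)[OF H_Bij[OF x] H_Bij[OF y]]
  proof (intro conjI allI impI)
    show "compose S x y \<in> Bij S" by (intro compose_Bij H_Bij x y)
    fix F assume F: "F \<subseteq> S" "finite F"
    from H_approx[OF y F] obtain h where h: "h \<in> carrier G" "\<forall>s\<in>F. y s = h <# s" by (rule bexE)
    have "y ` F \<subseteq> S" "finite (y ` F)" using F H_app[OF y] by auto
    from H_approx[OF x this] obtain g where g: "g \<in> carrier G" "\<forall>s\<in>y ` F. x s = g <# s" by (rule bexE)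
    have "compose S x y s = (g \<otimes> h) <# s" if "s \<in> F" for s
      using that F g h by (auto simp: compose_def lc_assoc' subset_iff)
    then show "\<exists>g\<in>carrier G. \<forall>s\<in>F. compose S x y s = g <# s" using g h by blast
  qed
qed

lemma H_eq: "Hg = BijGroup S\<lparr>carrier := carrier Hg\<rparr>"
  by (simp add: schlichting_group_def)

lemma group_H: "group Hg"
  by (subst H_eq) (rule subgroup.subgroup_is_group[OF H_subgroup group_BijGroup])

lemma H_mult: "x \<in> carrier Hg \<Longrightarrow> y \<in> carrier Hg \<Longrightarrow> s \<in> S \<Longrightarrow> (x \<otimes>\<^bsub>Hg\<^esub> y) s = x (y s)"
proof -
  assume h: "x \<in> carrier Hg" "y \<in> carrier Hg" "s \<in> S"
  have "x \<otimes>\<^bsub>Hg\<^esub> y = x \<otimes>\<^bsub>BijGroup S\<^esub> y" by (subst H_eq) simp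
  then show ?thesis using h H_Bij by (simp add: BijGroup_simps compose_def)
qed

lemma H_one: "\<one>\<^bsub>Hg\<^esub> = (\<lambda>s\<in>S. s)"
  by (subst H_eq) (simp add: BijGroup_simps)

lemma ca_H: "g \<in> carrier G \<Longrightarrow> ca g \<in> carrier Hg"
  unfolding H_iff by (auto simp: ca_apply ca_Bij subset_iff intro!: bexI[of _ g])

lemma H_openin: "openin HT U \<longleftrightarrow> U \<subseteq> carrier Hg \<and>
    (\<forall>x\<in>U. \<exists>F\<subseteq>S. finite F \<and> (\<forall>y\<in>carrier Hg. (\<forall>s\<in>F. y s = x s) \<longrightarrow> y \<in> U))"
proof -
  have sub: "carrier Hg \<subseteq> Bij S" using H_Bij by blast
  have "HT = subtopology (product_topology (\<lambda>_. discrete_topology S) S) (carrier Hg)"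
    unfolding schlichting_topology_def perm_topology_def subtopology_subtopology using sub
    by (simp add: Int_absorb1)
  then show ?thesis using openin_pointwise[of "carrier Hg" S U] sub Bij_PiE[of S] by simp
qed

text \<open>\<open>dc C\<close> is the double coset containing the left coset \<open>C\<close>.\<close>

definition dc :: "'a set \<Rightarrow> 'a set" where "dc C = \<Gamma> <#> C"

lemma double_coset_dc: "double_coset G \<Gamma> g = dc (g <# \<Gamma>)"
  by (simp add: double_coset_def dc_def)

lemma dc_Un: "dc C = (\<Union>k\<in>\<Gamma>. k <# C)"
  by (auto simp: dc_def set_mult_def l_coset_def)

lemma dc_left: assumes "k \<in> \<Gamma>" "C \<in> S" shows "dc (k <# C) = dc C"
proof -
  have 1: "dc (k <# C) \<subseteq> dc C" if "k \<in> \<Gamma>" "C \<in> S" for k C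
    unfolding dc_Un using that \<Gamma>_sub subgroup.m_closed[OF \<Gamma>] by (auto simp: lc_assoc')
  have "dc C = dc (inv k <# (k <# C))" using assms \<Gamma>_sub by (simp add: lc_assoc' lc_one)
  also have "\<dots> \<subseteq> dc (k <# C)"
    using assms \<Gamma>_sub by (intro 1 subgroup.m_inv_closed[OF \<Gamma>] lc_in) auto
  finally show ?thesis using 1[OF assms] by blast
qed

lemma lc_self: "C \<in> S \<Longrightarrow> g \<in> C \<Longrightarrow> C = g <# \<Gamma>"
proof -
  assume "C \<in> S" "g \<in> C"
  then obtain h k where h: "h \<in> carrier G" "C = h <# \<Gamma>" "k \<in> \<Gamma>" "g = h \<otimes> k" by (auto simp: S_iff l_coset_def)
  then show ?thesis using lc_assoc[of h k] \<Gamma>_sub lc_\<Gamma> by simp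
qed

lemma lc_ne: "C \<in> S \<Longrightarrow> C \<noteq> {}"
  using subgroup.one_closed[OF \<Gamma>] by (auto simp: S_iff l_coset_def)

lemma dc_sub_iff: assumes C: "C \<in> S" and D: "D \<in> S" shows "C \<subseteq> dc D \<longleftrightarrow> (\<exists>k\<in>\<Gamma>. C = k <# D)" "C \<subseteq> dc D \<longleftrightarrow> dc C = dc D"
proof -
  show 1: "C \<subseteq> dc D \<longleftrightarrow> (\<exists>k\<in>\<Gamma>. C = k <# D)"
  proof
    assume s: "C \<subseteq> dc D"
    obtain g where g: "g \<in> C" using lc_ne[OF C] by blast
    then obtain k where k: "k \<in> \<Gamma>" "g \<in> k <# D" using s unfolding dc_Un by blast
    have "k <# D \<in> S" using k D \<Gamma>_sub by (intro lc_in) auto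
    then show "\<exists>k\<in>\<Gamma>. C = k <# D" using lc_self[OF C g] lc_self[OF _ k(2)] k(1) by metis
  next
    assume "\<exists>k\<in>\<Gamma>. C = k <# D" then show "C \<subseteq> dc D" unfolding dc_Un by blast
  qed
  show "C \<subseteq> dc D \<longleftrightarrow> dc C = dc D"
  proof
    assume "C \<subseteq> dc D" then show "dc C = dc D" using 1 dc_left D by auto
  next
    assume e: "dc C = dc D"
    have "C \<subseteq> dc C" unfolding dc_Un using subgroup.one_closed[OF \<Gamma>] lc_one[OF C] by blast
    then show "C \<subseteq> dc D" using e by simp
  qed
qed

lemma coset_rep: assumes "C \<in> S" shows "coset_rep C \<in> C" "coset_rep C \<in> carrier G" "coset_rep C <# \<Gamma> = C"
proof -
  show 1: "coset_rep C \<in> C" unfolding coset_rep_def using lc_ne[OF assms] by (metis ex_in_conv someI_ex)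
  then show "coset_rep C \<in> carrier G" using lc_sub[OF assms] by blast
  show "coset_rep C <# \<Gamma> = C" using lc_self[OF assms 1] by simp
qed

lemma double_coset_rep:
  assumes "D \<in> double_cosets G \<Gamma>"
  shows "coset_rep D \<in> carrier G" "dc (coset_rep D <# \<Gamma>) = D"
proof -
  obtain g where g: "g \<in> carrier G" "D = dc (g <# \<Gamma>)" using assms by (auto simp: double_cosets_def double_coset_dc)
  have "g <# \<Gamma> \<subseteq> D" using dc_sub_iff(2)[of "g <# \<Gamma>" "g <# \<Gamma>"] g by auto
  then have "D \<noteq> {}" using lc_ne[of "g <# \<Gamma>"] g by blast
  then have d: "coset_rep D \<in> D" unfolding coset_rep_def by (metis ex_in_conv someI_ex)
  then obtain k where k: "k \<in> \<Gamma>" "coset_rep D \<in> k <# (g <# \<Gamma>)" using g unfolding dc_Un by blast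
  have kS: "k <# (g <# \<Gamma>) \<in> S" by (rule lc_in[OF S_I[OF g(1)] \<Gamma>_sub[OF k(1)]])
  show "coset_rep D \<in> carrier G" using lc_sub[OF kS] k by blast
  have "coset_rep D <# \<Gamma> = k <# (g <# \<Gamma>)" using lc_self[OF kS k(2)] by simp
  then show "dc (coset_rep D <# \<Gamma>) = D" using dc_left[OF k(1) S_I[OF g(1)]] g(2) by simp
qed

lemma dc_double: "C \<in> S \<Longrightarrow> dc C \<in> double_cosets G \<Gamma>"
  by (auto simp: S_iff double_cosets_def double_coset_dc)

text \<open>The finiteness in the Hecke condition enters here: a double coset contains finitely many
  left cosets, so \<Gamma> has finite orbits on S.\<close>

lemma orbit_finite: assumes C: "C \<in> S" shows "finite {D \<in> S. dc D = dc C}"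
proof -
  have "\<forall>D\<in>double_cosets G \<Gamma>. (\<exists>F\<subseteq>S. finite F \<and> D = \<Union>F) \<and> (\<exists>F\<subseteq>rcosets \<Gamma>. finite F \<and> D = \<Union>F)"
    using hecke unfolding hecke_pair_def by (elim conjE)
  from bspec[OF this dc_double[OF C]]
  obtain F where F: "F \<subseteq> S" "finite F" "dc C = \<Union>F" by (elim exE conjE)
  have "{D \<in> S. dc D = dc C} \<subseteq> F"
  proof
    fix D assume "D \<in> {D \<in> S. dc D = dc C}"
    then have D: "D \<in> S" "D \<subseteq> dc C" using dc_sub_iff(2)[OF _ C] by auto
    obtain g where g: "g \<in> D" using lc_ne[OF D(1)] by blast
    then obtain E where E: "E \<in> F" "g \<in> E" using D F by blast
    then have "D = E" using lc_self[OF D(1) g] lc_self[of E g] F by auto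
    then show "D \<in> F" using E by simp
  qed
  then show ?thesis using F finite_subset by blast
qed

text \<open>Functions approximable by \<Gamma> map every coset into its finite orbit, so they form a
  closed subset of a product of finite sets, compact by Tychonoff.\<close>

lemma stab_compact: "compactin HT {x \<in> carrier Hg. x \<Gamma> = \<Gamma>}"
proof -
  let ?P = "product_topology (\<lambda>_. discrete_topology S) S"
  define Orb where "Orb C = {D \<in> S. dc D = dc C}" for C
  define B where "B = PiE S Orb"
  have Bsub: "B \<subseteq> PiE S (\<lambda>_. S)" unfolding B_def Orb_def by (auto simp: PiE_iff)
  have cB: "compactin ?P B"
    unfolding B_def compactin_PiE using orbit_finite by (auto simp: Orb_def compactin_discrete_topology)
  define X where "X = {x \<in> PiE S (\<lambda>_. S). \<forall>F\<subseteq>S. finite F \<longrightarrow> (\<exists>g\<in>\<Gamma>. \<forall>s\<in>F. x s = g <# s)}"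
  have Xapp: "\<exists>g\<in>\<Gamma>. \<forall>s\<in>F. x s = g <# s" if "x \<in> X" "F \<subseteq> S" "finite F" for x F
    using that by (simp add: X_def)
  have XB: "X \<subseteq> B"
  proof
    fix x assume x: "x \<in> X"
    have "x s \<in> Orb s" if s: "s \<in> S" for s
    proof -
      have "\<exists>g\<in>\<Gamma>. \<forall>s\<in>{s}. x s = g <# s" using Xapp[OF x, of "{s}"] s by simp
      then obtain g where "g \<in> \<Gamma>" "x s = g <# s" by auto
      then show ?thesis using s dc_left lc_in \<Gamma>_sub by (simp add: Orb_def)
    qed
    then show "x \<in> B" using x by (auto simp: X_def B_def PiE_iff)
  qed
  have "openin ?P (PiE S (\<lambda>_. S) - X)"
  proof -
    have P: "?P = subtopology ?P (PiE S (\<lambda>_. S))" using subtopology_topspace[of ?P] by simp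
    have "\<exists>F\<subseteq>S. finite F \<and> (\<forall>y\<in>PiE S (\<lambda>_. S). (\<forall>s\<in>F. y s = x s) \<longrightarrow> y \<in> PiE S (\<lambda>_. S) - X)"
      if x: "x \<in> PiE S (\<lambda>_. S) - X" for x
    proof -
      obtain F where F: "F \<subseteq> S" "finite F" "\<not> (\<exists>g\<in>\<Gamma>. \<forall>s\<in>F. x s = g <# s)" using x unfolding X_def by blast
      have "y \<in> PiE S (\<lambda>_. S) - X" if "y \<in> PiE S (\<lambda>_. S)" "\<forall>s\<in>F. y s = x s" for y
        using F that unfolding X_def by auto
      then show ?thesis using F by blast
    qed
    then have "openin (subtopology ?P (PiE S (\<lambda>_. S))) (PiE S (\<lambda>_. S) - X)"
      unfolding openin_pointwise[OF subset_refl] by blast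
    then show ?thesis using P by simp
  qed
  then have "closedin ?P X" using XB Bsub by (simp add: closedin_def)
  then have cX: "compactin ?P X" using closed_compactin[OF cB XB] by blast
  \<comment> \<open>A pointwise limit of permutations need not be surjective in general. Here it is
    injective by approximation at two points, it preserves each finite orbit, and an injection of a
    finite set into itself is onto.\<close>
  have XBij: "X \<subseteq> Bij S"
  proof
    fix x assume x: "x \<in> X"
    then have xP: "x \<in> PiE S (\<lambda>_. S)" by (simp add: X_def)
    have inj: "inj_on x S"
    proof (rule inj_onI)
      fix s t assume st: "s \<in> S" "t \<in> S" "x s = x t"
      have "{s, t} \<subseteq> S" "finite {s, t}" using st by auto
      from Xapp[OF x this] obtain g where g: "g \<in> \<Gamma>" "x s = g <# s" "x t = g <# t" by auto
      then have "inv g <# (g <# s) = inv g <# (g <# t)" using st by simp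
      then show "s = t" using g st \<Gamma>_sub by (simp add: lc_assoc' lc_one)
    qed
    have "t \<in> x ` S" if t: "t \<in> S" for t
    proof -
      have fin: "finite (Orb t)" using orbit_finite[OF t] by (simp add: Orb_def)
      have "x ` Orb t \<subseteq> Orb t"
      proof
        fix s assume "s \<in> x ` Orb t"
        then obtain r where r: "r \<in> Orb t" "s = x r" by blast
        then have rS: "r \<in> S" by (simp add: Orb_def)
        have "x r \<in> Orb r" using x XB rS unfolding B_def by (auto simp: PiE_iff)
        then show "s \<in> Orb t" using r by (simp add: Orb_def)
      qed
      moreover have "inj_on x (Orb t)" using inj by (rule inj_on_subset) (auto simp: Orb_def)
      ultimately have "x ` Orb t = Orb t" using fin by (intro endo_inj_surj)
      moreover have "t \<in> Orb t" using t by (simp add: Orb_def)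
      ultimately have "t \<in> x ` Orb t" by simp
      then show ?thesis by (auto simp: Orb_def)
    qed
    then have "x ` S = S" using xP by (auto simp: PiE_iff)
    then show "x \<in> Bij S" using inj xP by (auto simp: Bij_def bij_betw_def PiE_iff)
  qed
  have "x \<in> X \<longleftrightarrow> x \<in> HK" for x
  proof
    assume x: "x \<in> X"
    show "x \<in> HK" unfolding K_iff using subsetD[OF XBij x] Xapp[OF x] by (intro conjI allI impI)
  next
    assume x: "x \<in> HK"
    then have "x \<in> Bij S" unfolding K_iff by (rule conjunct1)
    then have "x \<in> PiE S (\<lambda>_. S)" using Bij_PiE by (rule subsetD[rotated])
    then show "x \<in> X" unfolding X_def using K_approx[OF x] by (intro CollectI conjI allI impI)
  qed
  then have "X = HK" by (rule Set.set_eqI)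
  then have XK: "X = {x \<in> carrier Hg. x \<Gamma> = \<Gamma>}" by (simp add: K_eq)
  have sub: "carrier Hg \<subseteq> Bij S" using H_Bij by (rule subsetI)
  have "HT = subtopology ?P (carrier Hg)"
    unfolding schlichting_topology_def perm_topology_def subtopology_subtopology
    using sub by (simp add: Int_absorb1)
  moreover have "{x \<in> carrier Hg. x \<Gamma> = \<Gamma>} \<subseteq> carrier Hg" by simp
  ultimately show ?thesis using cX XK by (simp add: compactin_subtopology)
qed

end

section \<open>The Hecke algebra inside the completion\<close>

locale hecke_haar = hecke G \<Gamma> for G :: "('a, 'm) monoid_scheme" (structure) and \<Gamma> :: "'a set" +
  fixes \<mu> :: "('a set \<Rightarrow> 'a set) measure"
  assumes haar_mu: "left_haar_measure (schlichting_group G \<Gamma>) (schlichting_topology G \<Gamma>) \<mu>"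
    and mu_norm: "emeasure \<mu> (schlichting_subgroup G \<Gamma>) = 1"
begin

lemma H_trans: assumes "s \<in> S" shows "\<exists>x\<in>carrier Hg. x \<Gamma> = s"
proof -
  obtain g where g: "g \<in> carrier G" "s = g <# \<Gamma>" using assms by (auto simp: S_iff)
  then show ?thesis using ca_H[OF g(1)] ca_apply[OF \<Gamma>_S(1)] by blast
qed

text \<open>Elements of the completion are permutations of S themselves, so the action is
  application; the base point is the coset \<Gamma>.\<close>

sublocale PH: perm_haar Hg HT \<mu> "\<lambda>x. x" S \<Gamma>
proof -
  interpret g: group Hg by (rule group_H)
  show "perm_haar Hg HT \<mu> (\<lambda>x. x) S \<Gamma>"
  proof
    show "s \<in> S \<Longrightarrow> \<one>\<^bsub>Hg\<^esub> s = s" for s by (simp add: H_one)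
    show "emeasure \<mu> {x \<in> carrier Hg. x \<Gamma> = \<Gamma>} = 1" using mu_norm by (simp add: K_eq)
  qed (fact H_app H_mult \<Gamma>_S(1) H_trans H_openin stab_compact haar_mu)+
qed

lemma K_tr: "HK = PH.tr \<Gamma> \<Gamma>"
  by (auto simp: K_eq PH.tr_def)

lemma ca_mult: assumes "g \<in> carrier G" "h \<in> carrier G" shows "ca (g \<otimes> h) = ca g \<otimes>\<^bsub>Hg\<^esub> ca h"
proof
  fix C
  have e: "ca g \<otimes>\<^bsub>Hg\<^esub> ca h \<in> extensional S" using H_Bij[OF PH.m_closed[OF ca_H ca_H]] assms by (auto simp: Bij_def)
  show "ca (g \<otimes> h) C = (ca g \<otimes>\<^bsub>Hg\<^esub> ca h) C"
  proof (cases "C \<in> S")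
    case True
    then show ?thesis using assms by (simp add: H_mult ca_H ca_apply lc_in lc_assoc')
  next
    case False
    then show ?thesis using e by (simp add: coset_action_def extensional_def)
  qed
qed

lemma ca_one: "ca \<one> = \<one>\<^bsub>Hg\<^esub>"
  by (auto simp: H_one coset_action_def lc_one intro!: ext)

lemma ca_inv: assumes "g \<in> carrier G" shows "ca (inv g) = inv\<^bsub>Hg\<^esub> (ca g)"
  using assms ca_mult[of "inv g" g] by (intro PH.inv_equality[symmetric]) (simp_all add: ca_H ca_one)

lemma ca_\<Gamma>: "g \<in> carrier G \<Longrightarrow> ca g \<Gamma> = g <# \<Gamma>"
  by (simp add: ca_apply \<Gamma>_S)

lemma ca_stab: "k \<in> \<Gamma> \<Longrightarrow> ca k \<in> PH.tr \<Gamma> \<Gamma>"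
  using \<Gamma>_sub ca_H by (auto simp: PH.tr_def ca_\<Gamma> lc_\<Gamma>)

lemma K_dc: assumes k: "k \<in> PH.tr \<Gamma> \<Gamma>" and C: "C \<in> S" shows "dc (k C) = dc C"
proof -
  have "\<exists>g\<in>\<Gamma>. \<forall>s\<in>{C}. k s = g <# s" using K_approx[of k "{C}"] k C by (simp add: K_tr)
  then show ?thesis using dc_left[OF _ C] by auto
qed

text \<open>Removes the choice from \<open>hecke_to_Cc\<close>: for any admissible g, the coset that
  x makes of \<Gamma> lies in the double coset of g, because the stabiliser acts inside
  \<Gamma>-orbits.\<close>

lemma hecke_to_Cc_eq:
  assumes x: "x \<in> carrier Hg" shows "hecke_to_Cc G \<Gamma> f x = f (dc (x \<Gamma>))"
proof -
  let ?P = "\<lambda>g. g \<in> carrier G \<and> x \<in> double_coset Hg HK (ca g)"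
  have xS: "x \<Gamma> \<in> S" using x H_app \<Gamma>_S by blast
  obtain g where g: "g \<in> carrier G" "x \<Gamma> = g <# \<Gamma>" using xS by (auto simp: S_iff)
  have e: "ca g \<Gamma> = x \<Gamma>" using g by (simp add: ca_\<Gamma>)
  have k: "inv\<^bsub>Hg\<^esub> (ca g) \<otimes>\<^bsub>Hg\<^esub> x \<in> HK" and xe: "x = ca g \<otimes>\<^bsub>Hg\<^esub> (inv\<^bsub>Hg\<^esub> (ca g) \<otimes>\<^bsub>Hg\<^esub> x)"
    using PH.tr_b_eq[OF x ca_H[OF g(1)]] e by (auto simp: K_tr)
  have "x \<in> ca g <#\<^bsub>Hg\<^esub> HK" using k xe unfolding l_coset_def by blast
  moreover have "\<one>\<^bsub>Hg\<^esub> \<Gamma> = \<Gamma>" using \<Gamma>_S by (simp add: H_one)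
  then have "\<one>\<^bsub>Hg\<^esub> \<in> HK" by (simp add: K_eq)
  moreover have "x = \<one>\<^bsub>Hg\<^esub> \<otimes>\<^bsub>Hg\<^esub> x" using x by simp
  ultimately have "?P g" using g(1) unfolding double_coset_def set_mult_def by blast
  then have "?P (SOME g. ?P g)" by (rule someI)
  then obtain h where h: "h = (SOME g. ?P g)" "h \<in> carrier G" "x \<in> double_coset Hg HK (ca h)" by blast
  then obtain k1 k2 where kk: "k1 \<in> HK" "k2 \<in> HK" "x = k1 \<otimes>\<^bsub>Hg\<^esub> (ca h \<otimes>\<^bsub>Hg\<^esub> k2)"
    unfolding double_coset_def set_mult_def l_coset_def by blast
  have k': "k1 \<in> carrier Hg" "k2 \<in> carrier Hg" "k2 \<Gamma> = \<Gamma>" using kk by (auto simp: K_eq)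
  have "x \<Gamma> = k1 (h <# \<Gamma>)"
    using kk(3) k' ca_H[OF h(2)] \<Gamma>_S(1) h(2) by (simp add: H_mult H_app ca_\<Gamma>)
  then have "dc (x \<Gamma>) = dc (h <# \<Gamma>)" using K_dc[of k1 "h <# \<Gamma>"] kk(1) h(2) by (simp add: K_tr S_I)
  then show ?thesis using x h(1) by (simp add: hecke_to_Cc_def double_coset_dc)
qed

lemma hecke_to_Cc_zero: "x \<notin> carrier Hg \<Longrightarrow> hecke_to_Cc G \<Gamma> f x = 0"
  by (simp add: hecke_to_Cc_def)

section \<open>The Hecke algebra as bi-invariant functions\<close>

abbreviation "ZZ \<equiv> hecke_alg G \<Gamma>"
abbreviation "ii \<equiv> hecke_to_Cc G \<Gamma>"

lemma ZZ_carrier: "f \<in> carrier ZZ \<longleftrightarrow> finite {D. f D \<noteq> 0} \<and> {D. f D \<noteq> 0} \<subseteq> double_cosets G \<Gamma>"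
  by (simp add: hecke_alg_def)

lemma ZZ_supp: assumes f: "f \<in> carrier ZZ" shows "finite {C \<in> S. f (dc C) \<noteq> 0}"
proof -
  have "{C \<in> S. f (dc C) \<noteq> 0} = (\<Union>D\<in>{D. f D \<noteq> 0}. {C \<in> S. dc C = D})" by auto
  moreover have "finite {C \<in> S. dc C = D}" for D
  proof (cases "\<exists>C\<in>S. dc C = D")
    case True then show ?thesis using orbit_finite by auto
  next
    case False then have "{C \<in> S. dc C = D} = {}" by auto
    then show ?thesis by (metis finite.emptyI)
  qed
  ultimately show ?thesis using f by (simp add: ZZ_carrier)
qed

lemma ii_lift: "ii f = PH.lift (\<lambda>C. if C \<in> S then f (dc C) else 0)"
proof
  fix x show "ii f x = PH.lift (\<lambda>C. if C \<in> S then f (dc C) else 0) x"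
    using H_app[of x \<Gamma>] \<Gamma>_S(1) hecke_to_Cc_eq[of x f] hecke_to_Cc_zero[of x f] by (auto simp: PH.lift_def)
qed

lemma ii_binv: assumes f: "f \<in> carrier ZZ" shows "ii f \<in> PH.binv"
  unfolding PH.binv_def
proof (intro CollectI conjI ballI)
  show "ii f \<in> carrier PH.Cc"
    unfolding ii_lift by (rule PH.lift_Cc[OF ZZ_supp[OF f]]) (auto split: if_splits)
  fix x k assume x: "x \<in> carrier Hg" and k: "k \<in> PH.tr \<Gamma> \<Gamma>"
  note k' = PH.stabD[OF k]
  show "ii f (x \<otimes>\<^bsub>Hg\<^esub> k) = ii f x"
    using x k' \<Gamma>_S(1) by (simp add: hecke_to_Cc_eq H_mult)
  show "ii f (k \<otimes>\<^bsub>Hg\<^esub> x) = ii f x"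
    using x k' \<Gamma>_S(1) K_dc[OF k, of "x \<Gamma>"] by (simp add: hecke_to_Cc_eq H_mult H_app)
qed

lemma ii_rep: assumes "D \<in> double_cosets G \<Gamma>" shows "ii f (ca (coset_rep D)) = f D"
  using double_coset_rep[OF assms] by (simp add: hecke_to_Cc_eq ca_H ca_\<Gamma>)

lemma ii_inj: assumes "f \<in> carrier ZZ" "h \<in> carrier ZZ" "ii f = ii h" shows "f = h"
proof
  fix D show "f D = h D"
  proof (cases "D \<in> double_cosets G \<Gamma>")
    case True then show ?thesis using ii_rep assms(3) by metis
  next
    case False
    then have "f D = 0" "h D = 0" using assms(1,2) unfolding ZZ_carrier by blast+
    then show ?thesis by simp
  qed
qed

lemma ii_surj:
  assumes F: "F \<in> PH.binv"
  defines "f \<equiv> (\<lambda>D. if D \<in> double_cosets G \<Gamma> then F (ca (coset_rep D)) else 0)"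
  shows "f \<in> carrier ZZ" "ii f = F"
proof -
  note FC = PH.binvD(1)[OF F]
  show "f \<in> carrier ZZ"
    unfolding ZZ_carrier
  proof
    have "{D. f D \<noteq> 0} \<subseteq> dc ` {x \<Gamma> |x. F x \<noteq> 0}"
    proof
      fix D assume "D \<in> {D. f D \<noteq> 0}"
      then have D: "D \<in> double_cosets G \<Gamma>" "F (ca (coset_rep D)) \<noteq> 0" by (auto simp: f_def split: if_splits)
      have "D = dc (ca (coset_rep D) \<Gamma>)" using double_coset_rep[OF D(1)] by (simp add: ca_\<Gamma>)
      then show "D \<in> dc ` {x \<Gamma> |x. F x \<noteq> 0}" using D(2) by blast
    qed
    then show "finite {D. f D \<noteq> 0}" using PH.Cc_supp(1)[OF FC \<Gamma>_S(1)] finite_surj by blast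
    show "{D. f D \<noteq> 0} \<subseteq> double_cosets G \<Gamma>" by (auto simp: f_def)
  qed
  show "ii f = F"
  proof
    fix x show "ii f x = F x"
    proof (cases "x \<in> carrier Hg")
      case x: True
      have xS: "x \<Gamma> \<in> S" using x H_app \<Gamma>_S by blast
      obtain g where g: "g \<in> carrier G" "x \<Gamma> = g <# \<Gamma>" using xS by (auto simp: S_iff)
      let ?D = "dc (x \<Gamma>)" and ?d = "coset_rep (dc (x \<Gamma>))"
      have D: "?D \<in> double_cosets G \<Gamma>" by (rule dc_double[OF xS])
      note d = double_coset_rep[OF D]
      have "?d <# \<Gamma> \<subseteq> ?D" using dc_sub_iff(2)[OF S_I[OF d(1)] xS] d(2) by simp
      then obtain k where k: "k \<in> \<Gamma>" "?d <# \<Gamma> = k <# (x \<Gamma>)" using dc_sub_iff(1)[OF S_I[OF d(1)] xS] by blast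
      have kc: "ca k \<in> carrier Hg" using k \<Gamma>_sub ca_H by blast
      have "F (ca ?d) = F (ca k \<otimes>\<^bsub>Hg\<^esub> x)"
        by (rule PH.binv_eq[OF F ca_H[OF d(1)] PH.m_closed[OF kc x]])
          (use k kc x xS d(1) \<Gamma>_S(1) in \<open>simp add: H_mult ca_\<Gamma> ca_apply\<close>)
      also have "\<dots> = F x" by (rule PH.binvD(3)[OF F x ca_stab[OF k(1)]])
      finally show ?thesis using x D by (simp add: hecke_to_Cc_eq f_def)
    next
      case False then show ?thesis using PH.CcD0[OF FC] by (simp add: hecke_to_Cc_zero)
    qed
  qed
qed

lemma sect_rep: assumes C: "C \<in> S" shows "ca (coset_rep C) \<in> carrier Hg" "ca (coset_rep C) \<Gamma> = C"
  using coset_rep[OF C] by (simp_all add: ca_H ca_\<Gamma>)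

text \<open>A bi-invariant function is recovered from its values at representatives of double cosets
  (\<open>ii_surj\<close>). At such a point the convolution integrand is constant on left cosets,
  and its integral becomes the Hecke sum over G/\<Gamma>, of which only the finite set E
  contributes.\<close>

lemma ii_mul:
  assumes f: "f \<in> carrier ZZ" and h: "h \<in> carrier ZZ"
  shows "vmul ZZ f h \<in> carrier ZZ \<and> ii (vmul ZZ f h) = PH.conv (ii f) (ii h)"
proof -
  have F: "PH.conv (ii f) (ii h) \<in> PH.binv" by (rule PH.conv_binv[OF ii_binv[OF f] ii_binv[OF h]])
  have "vmul ZZ f h = (\<lambda>D. if D \<in> double_cosets G \<Gamma> then PH.conv (ii f) (ii h) (ca (coset_rep D)) else 0)"
  proof
    fix D
    show "vmul ZZ f h D = (if D \<in> double_cosets G \<Gamma> then PH.conv (ii f) (ii h) (ca (coset_rep D)) else 0)"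
    proof (cases "D \<in> double_cosets G \<Gamma>")
      case D: True
      let ?d = "coset_rep D"
      have d: "?d \<in> carrier G" "ca ?d \<in> carrier Hg" using double_coset_rep[OF D] ca_H by auto
      define E where "E = {C \<in> S. f (dc C) \<noteq> 0}"
      have E: "finite E" "E \<subseteq> S" using ZZ_supp[OF f] by (auto simp: E_def)
      let ?t = "\<lambda>C. f (double_coset G \<Gamma> (coset_rep C)) * h (double_coset G \<Gamma> (inv (coset_rep C) \<otimes> ?d))"
      define g where "g y = ii f y * ii h (inv\<^bsub>Hg\<^esub> y \<otimes>\<^bsub>Hg\<^esub> ca ?d)" for y
      have gi: "integrable \<mu> g"
        unfolding g_def[abs_def] by (rule PH.conv_integrable[OF PH.binvD(1)[OF ii_binv[OF f]] PH.binvD(1)[OF ii_binv[OF h]] d(2)])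
      have ginv: "g (y \<otimes>\<^bsub>Hg\<^esub> k) = g y" if "y \<in> carrier Hg" "k \<in> PH.tr \<Gamma> \<Gamma>" for y k
        using that d(2) PH.binvD(2)[OF ii_binv[OF f] that] PH.stabD[OF that(2)]
          PH.binvD(3)[OF ii_binv[OF h], of "inv\<^bsub>Hg\<^esub> y \<otimes>\<^bsub>Hg\<^esub> ca ?d" "inv\<^bsub>Hg\<^esub> k"]
        by (simp add: g_def PH.inv_mult_group PH.m_assoc)
      have gt: "g (PH.sect C) = ?t C" if C: "C \<in> S" for C
      proof -
        note s = PH.sect[OF C] and r = sect_rep[OF C] and c = coset_rep[OF C]
        have "g (PH.sect C) = g (ca (coset_rep C))"
          using PH.tr_b_eq[OF s(1) r(1)] s r ginv[OF r(1)] by metis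
        also have "\<dots> = ii f (ca (coset_rep C)) * ii h (ca (inv (coset_rep C) \<otimes> ?d))"
          using c d by (simp add: g_def ca_mult ca_inv)
        also have "\<dots> = ?t C" using c d by (simp add: hecke_to_Cc_eq ca_H ca_\<Gamma> double_coset_dc)
        finally show ?thesis .
      qed
      have supp: "y \<Gamma> \<in> E" if "y \<in> carrier Hg" "g y \<noteq> 0" for y
        using that H_app[OF that(1) \<Gamma>_S(1)] by (auto simp: g_def E_def hecke_to_Cc_eq)
      have "PH.conv (ii f) (ii h) (ca ?d) = (\<integral>y. g y \<partial>\<mu>)" unfolding g_def by (rule PH.conv_in[OF d(2)])
      also have "\<dots> = (\<Sum>C\<in>E. g (PH.sect C))" by (rule PH.integral_right_inv[OF gi E]) (rule supp ginv; assumption)+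
      also have "\<dots> = (\<Sum>C\<in>E. ?t C)" using E gt by (intro sum.cong) auto
      also have "\<dots> = (\<Sum>\<^sub>\<infinity>C\<in>E. ?t C)" using E(1) by simp
      also have "\<dots> = (\<Sum>\<^sub>\<infinity>C\<in>S. ?t C)"
      proof (rule infsum_cong_neutral)
        show "?t C = 0" if "C \<in> S - E" for C
          using that coset_rep[of C] by (auto simp: E_def double_coset_dc)
      qed (use E in auto)
      finally show ?thesis using D by (simp add: hecke_alg_def)
    qed (simp add: hecke_alg_def)
  qed
  then show ?thesis using ii_surj[OF F] by simp
qed

lemma hecke_L_eq: assumes g: "g \<in> carrier G" shows "hecke_L G \<Gamma> g = card {C \<in> S. dc C = dc (g <# \<Gamma>)}"
proof -
  have "{C \<in> S. C \<subseteq> double_coset G \<Gamma> g} = {C \<in> S. dc C = dc (g <# \<Gamma>)}"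
    unfolding double_coset_dc using dc_sub_iff(2)[OF _ S_I[OF g]] by blast
  then show ?thesis by (simp add: hecke_L_def)
qed

lemma inv_double: assumes g: "g \<in> carrier G" shows "(\<lambda>x. inv x) ` double_coset G \<Gamma> g = double_coset G \<Gamma> (inv g)"
proof -
  have sub: "(\<lambda>x. inv x) ` double_coset G \<Gamma> g \<subseteq> double_coset G \<Gamma> (inv g)" if g: "g \<in> carrier G" for g
  proof
    fix y assume "y \<in> (\<lambda>x. inv x) ` double_coset G \<Gamma> g"
    then obtain k l where kl: "k \<in> \<Gamma>" "l \<in> \<Gamma>" "y = inv (k \<otimes> (g \<otimes> l))"
      unfolding double_coset_def set_mult_def l_coset_def by blast
    then have "y = inv l \<otimes> (inv g \<otimes> inv k)" using g \<Gamma>_sub by (simp add: inv_mult_group m_assoc)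
    moreover have "inv l \<in> \<Gamma>" "inv k \<in> \<Gamma>" using kl subgroup.m_inv_closed[OF \<Gamma>] by auto
    ultimately show "y \<in> double_coset G \<Gamma> (inv g)"
      unfolding double_coset_def set_mult_def l_coset_def by blast
  qed
  have dG: "double_coset G \<Gamma> h \<subseteq> carrier G" if "h \<in> carrier G" for h
    using that \<Gamma>_sub by (auto simp: double_coset_def set_mult_def l_coset_def)
  show ?thesis
  proof
    show "double_coset G \<Gamma> (inv g) \<subseteq> (\<lambda>x. inv x) ` double_coset G \<Gamma> g"
    proof
      fix y assume y: "y \<in> double_coset G \<Gamma> (inv g)"
      then have "inv y \<in> double_coset G \<Gamma> g" using sub[OF inv_closed[OF g]] g by auto
      moreover have "y = inv (inv y)" using y dG[OF inv_closed[OF g]] by auto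
      ultimately show "y \<in> (\<lambda>x. inv x) ` double_coset G \<Gamma> g" by blast
    qed
  qed (rule sub[OF g])
qed

lemma rcos_inv: assumes h: "h \<in> carrier G" shows "(\<lambda>x. inv x) ` (\<Gamma> #> h) = inv h <# \<Gamma>"
proof
  show "(\<lambda>x. inv x) ` (\<Gamma> #> h) \<subseteq> inv h <# \<Gamma>"
    using h \<Gamma>_sub subgroup.m_inv_closed[OF \<Gamma>] by (auto simp: r_coset_def l_coset_def inv_mult_group)
  show "inv h <# \<Gamma> \<subseteq> (\<lambda>x. inv x) ` (\<Gamma> #> h)"
  proof
    fix y assume "y \<in> inv h <# \<Gamma>"
    then obtain k where k: "k \<in> \<Gamma>" "y = inv h \<otimes> k" by (auto simp: l_coset_def)
    then have "y = inv (inv k \<otimes> h)" using h \<Gamma>_sub by (simp add: inv_mult_group)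
    then show "y \<in> (\<lambda>x. inv x) ` (\<Gamma> #> h)"
      using k subgroup.m_inv_closed[OF \<Gamma>] by (auto simp: r_coset_def)
  qed
qed

text \<open>Inversion exchanges right cosets in a double coset with left cosets in the inverse
  double coset.\<close>

lemma hecke_R_eq: assumes g: "g \<in> carrier G" shows "hecke_R G \<Gamma> g = hecke_L G \<Gamma> (inv g)"
  unfolding hecke_R_def hecke_L_def
proof (rule bij_betw_same_card)
  let ?i = "\<lambda>X. (\<lambda>x. inv x) ` X"
  have ii: "?i (?i X) = X" if "X \<subseteq> carrier G" for X using that by (force simp: image_image)
  have rc: "?i C \<in> S \<and> C \<subseteq> carrier G" if C: "C \<in> rcosets \<Gamma>" for C
  proof -
    obtain h where h: "h \<in> carrier G" "C = \<Gamma> #> h" using C by (auto simp: RCOSETS_def)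
    then show ?thesis using rcos_inv[OF h(1)] S_I[OF inv_closed[OF h(1)]] \<Gamma>_sub by (auto simp: r_coset_def)
  qed
  have lcr: "?i C \<in> rcosets \<Gamma>" if C: "C \<in> S" for C
  proof -
    obtain h where h: "h \<in> carrier G" "C = h <# \<Gamma>" using C by (auto simp: S_iff)
    then have "C = ?i (\<Gamma> #> inv h)" using rcos_inv[of "inv h"] by simp
    moreover have "\<Gamma> #> inv h \<subseteq> carrier G" using h \<Gamma>_sub by (auto simp: r_coset_def)
    ultimately have "?i C = \<Gamma> #> inv h" using ii by simp
    then show ?thesis using h by (auto simp: RCOSETS_def)
  qed
  show "bij_betw ?i {C \<in> rcosets \<Gamma>. C \<subseteq> double_coset G \<Gamma> g} {C \<in> S. C \<subseteq> double_coset G \<Gamma> (inv g)}"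
  proof (rule bij_betw_byWitness[where f' = ?i])
    show "\<forall>a\<in>{C \<in> rcosets \<Gamma>. C \<subseteq> double_coset G \<Gamma> g}. ?i (?i a) = a" using ii rc by auto
    show "\<forall>a\<in>{C \<in> S. C \<subseteq> double_coset G \<Gamma> (inv g)}. ?i (?i a) = a" using ii lc_sub by auto
    show "?i ` {C \<in> rcosets \<Gamma>. C \<subseteq> double_coset G \<Gamma> g} \<subseteq> {C \<in> S. C \<subseteq> double_coset G \<Gamma> (inv g)}"
      using rc inv_double[OF g] by blast
    show "?i ` {C \<in> S. C \<subseteq> double_coset G \<Gamma> (inv g)} \<subseteq> {C \<in> rcosets \<Gamma>. C \<subseteq> double_coset G \<Gamma> g}"
      using lcr inv_double[OF inv_closed[OF g]] g by (auto simp: subset_iff)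
  qed
qed

text \<open>Compare the measures of a double coset and its inverse.\<close>

lemma modulus_ca: assumes g: "g \<in> carrier G" shows "PH.modulus (ca g) = hecke_modular G \<Gamma> g"
proof -
  define Og where "Og = {C \<in> S. dc C = dc (g <# \<Gamma>)}"
  define Oi where "Oi = {C \<in> S. dc C = dc (inv g <# \<Gamma>)}"
  have fin: "finite Og" "finite Oi" "Og \<subseteq> S" "Oi \<subseteq> S"
    using orbit_finite[OF S_I[OF g]] orbit_finite[OF S_I[OF inv_closed[OF g]]] by (auto simp: Og_def Oi_def)
  have gH: "ca g \<in> carrier Hg" by (rule ca_H[OF g])
  \<comment> \<open>Every C in the double coset of g is the image of \<Gamma> under k g with k in
    \<Gamma>, and the modulus is 1 on the stabiliser.\<close>
  have wOg: "PH.w C = PH.modulus (inv\<^bsub>Hg\<^esub> (ca g))" if C: "C \<in> Og" for C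
  proof -
    have CS: "C \<in> S" using C fin by auto
    have "C \<subseteq> dc (g <# \<Gamma>)" using C dc_sub_iff(2)[OF CS S_I[OF g]] by (simp add: Og_def)
    then obtain k where k: "k \<in> \<Gamma>" "C = k <# (g <# \<Gamma>)" using dc_sub_iff(1)[OF CS S_I[OF g]] by blast
    have kH: "ca k \<in> carrier Hg" "ca k \<in> PH.tr \<Gamma> \<Gamma>" using k \<Gamma>_sub ca_H ca_stab by auto
    have "(ca k \<otimes>\<^bsub>Hg\<^esub> ca g) \<Gamma> = C" using k kH gH g \<Gamma>_S(1) by (simp add: H_mult ca_\<Gamma> ca_apply S_I)
    then have "PH.w C = PH.modulus (inv\<^bsub>Hg\<^esub> (ca k \<otimes>\<^bsub>Hg\<^esub> ca g))" using PH.w_act[OF PH.m_closed[OF kH(1) gH]] by simp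
    also have "\<dots> = PH.modulus (inv\<^bsub>Hg\<^esub> (ca g))"
      using kH gH PH.modulus_tr_b[OF PH.stabD(3)[OF kH(2)]] by (simp add: PH.inv_mult_group PH.modulus_mult)
    finally show ?thesis .
  qed
  \<comment> \<open>One set, the inverse of the double coset of g, cut into right cosets of measure
    \<open>modulus (inv (ca g))\<close> and into left cosets of measure 1. Comparing measures
    expresses the modulus as a quotient of coset counts.\<close>
  have eqs: "(\<Union>C\<in>Og. PH.tr C \<Gamma>) = (\<Union>C\<in>Oi. PH.tr \<Gamma> C)"
  proof -
    have main: "dc ((inv\<^bsub>Hg\<^esub> x) \<Gamma>) = dc (inv h <# \<Gamma>)" if x: "x \<in> carrier Hg" "dc (x \<Gamma>) = dc (h <# \<Gamma>)" and h: "h \<in> carrier G" for x h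
    proof -
      have xS: "x \<Gamma> \<in> S" using x H_app \<Gamma>_S by blast
      have "x \<Gamma> \<subseteq> dc (h <# \<Gamma>)" using dc_sub_iff(2)[OF xS S_I[OF h]] x(2) by simp
      then obtain k where k: "k \<in> \<Gamma>" "x \<Gamma> = k <# (h <# \<Gamma>)" using dc_sub_iff(1)[OF xS S_I[OF h]] by blast
      have kc: "k \<in> carrier G" using k \<Gamma>_sub by blast
      have e: "x \<Gamma> = ca (k \<otimes> h) \<Gamma>" using k kc h by (simp add: ca_\<Gamma> lc_assoc)
      have kh: "ca (k \<otimes> h) \<in> carrier Hg" using kc h by (intro ca_H) simp
      define l where "l = inv\<^bsub>Hg\<^esub> (ca (k \<otimes> h)) \<otimes>\<^bsub>Hg\<^esub> x"
      have l: "l \<in> PH.tr \<Gamma> \<Gamma>" "x = ca (k \<otimes> h) \<otimes>\<^bsub>Hg\<^esub> l"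
        unfolding l_def using PH.tr_b_eq[OF x(1) kh e] by auto
      note l' = PH.stabD[OF l(1)]
      have "inv\<^bsub>Hg\<^esub> x = inv\<^bsub>Hg\<^esub> (ca (k \<otimes> h) \<otimes>\<^bsub>Hg\<^esub> l)" using l(2) by simp
      also have "\<dots> = inv\<^bsub>Hg\<^esub> l \<otimes>\<^bsub>Hg\<^esub> inv\<^bsub>Hg\<^esub> (ca (k \<otimes> h))" by (rule PH.inv_mult_group[OF kh l'(1)])
      also have "inv\<^bsub>Hg\<^esub> (ca (k \<otimes> h)) = ca (inv h \<otimes> inv k)" using kc h by (simp add: inv_mult_group flip: ca_inv)
      finally have "inv\<^bsub>Hg\<^esub> x = inv\<^bsub>Hg\<^esub> l \<otimes>\<^bsub>Hg\<^esub> ca (inv h \<otimes> inv k)" .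
      then have "(inv\<^bsub>Hg\<^esub> x) \<Gamma> = (inv\<^bsub>Hg\<^esub> l) (ca (inv h \<otimes> inv k) \<Gamma>)"
        using PH.stabD(1)[OF l'(3)] kc h \<Gamma>_S(1) by (simp add: H_mult ca_H)
      also have "ca (inv h \<otimes> inv k) \<Gamma> = inv h <# \<Gamma>"
        using kc h lc_\<Gamma>[OF subgroup.m_inv_closed[OF \<Gamma> k(1)]] by (simp add: ca_\<Gamma> flip: lc_assoc)
      finally show ?thesis using K_dc[OF l'(3) S_I[OF inv_closed[OF h]]] by simp
    qed
    show ?thesis
    proof
      show "(\<Union>C\<in>Og. PH.tr C \<Gamma>) \<subseteq> (\<Union>C\<in>Oi. PH.tr \<Gamma> C)"
      proof
        fix x assume "x \<in> (\<Union>C\<in>Og. PH.tr C \<Gamma>)"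
        then obtain C where C: "C \<in> Og" "x \<in> carrier Hg" "x C = \<Gamma>" by (auto simp: PH.tr_def)
        have ix: "(inv\<^bsub>Hg\<^esub> x) \<Gamma> = C" using C fin PH.act_inv[of x C] by auto
        then have "dc (x \<Gamma>) = dc (inv g <# \<Gamma>)" using main[OF PH.inv_closed[OF C(2)] _ g] C by (simp add: Og_def)
        then show "x \<in> (\<Union>C\<in>Oi. PH.tr \<Gamma> C)" using C H_app[OF C(2) \<Gamma>_S(1)] by (auto simp: Oi_def PH.tr_def)
      qed
      show "(\<Union>C\<in>Oi. PH.tr \<Gamma> C) \<subseteq> (\<Union>C\<in>Og. PH.tr C \<Gamma>)"
      proof
        fix x assume "x \<in> (\<Union>C\<in>Oi. PH.tr \<Gamma> C)"
        then have x: "x \<in> carrier Hg" "dc (x \<Gamma>) = dc (inv g <# \<Gamma>)" by (auto simp: PH.tr_def Oi_def)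
        have "dc ((inv\<^bsub>Hg\<^esub> x) \<Gamma>) = dc (g <# \<Gamma>)" using main[OF x inv_closed[OF g]] g by simp
        then have "(inv\<^bsub>Hg\<^esub> x) \<Gamma> \<in> Og" using H_app[OF PH.inv_closed[OF x(1)] \<Gamma>_S(1)] by (simp add: Og_def)
        moreover have "x \<in> PH.tr ((inv\<^bsub>Hg\<^esub> x) \<Gamma>) \<Gamma>" using x \<Gamma>_S(1) by (auto simp: PH.tr_def)
        ultimately show "x \<in> (\<Union>C\<in>Og. PH.tr C \<Gamma>)" by blast
      qed
    qed
  qed
  have "emeasure \<mu> (\<Union>C\<in>Og. PH.tr C \<Gamma>) = (\<Sum>C\<in>Og. emeasure \<mu> (PH.tr C \<Gamma>))"
  proof (rule sum_emeasure[symmetric])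
    show "(\<lambda>C. PH.tr C \<Gamma>) ` Og \<subseteq> sets \<mu>" using fin by auto
    show "disjoint_family_on (\<lambda>C. PH.tr C \<Gamma>) Og"
      unfolding disjoint_family_on_def
    proof (intro ballI impI)
      fix C D assume CD: "C \<in> Og" "D \<in> Og" "C \<noteq> D"
      then have "C \<in> S" "D \<in> S" using fin by auto
      then show "PH.tr C \<Gamma> \<inter> PH.tr D \<Gamma> = {}" using CD(3) PH.act_inj by (auto simp: PH.tr_def)
    qed
  qed (rule fin)
  also have "\<dots> = (\<Sum>C\<in>Og. ennreal (PH.modulus (inv\<^bsub>Hg\<^esub> (ca g))))"
    using fin wOg by (intro sum.cong) (auto simp: PH.tr_measure_w subset_iff)
  also have "\<dots> = ennreal (real (card Og) * PH.modulus (inv\<^bsub>Hg\<^esub> (ca g)))"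
    by (simp add: ennreal_mult ennreal_of_nat_eq_real_of_nat)
  finally have 1: "emeasure \<mu> (\<Union>C\<in>Og. PH.tr C \<Gamma>) = ennreal (real (card Og) * PH.modulus (inv\<^bsub>Hg\<^esub> (ca g)))" .
  have "emeasure \<mu> (\<Union>C\<in>Oi. PH.tr \<Gamma> C) = (\<Sum>C\<in>Oi. emeasure \<mu> (PH.tr \<Gamma> C))"
    using fin by (intro sum_emeasure[symmetric]) (auto simp: disjoint_family_on_def PH.tr_def[of \<Gamma>] intro!: PH.tr_sets[of \<Gamma>, unfolded PH.tr_def[of \<Gamma>]] \<Gamma>_S)
  also have "\<dots> = (\<Sum>C\<in>Oi. 1)" using fin by (intro sum.cong) (auto simp: PH.emeasure_tr_b subset_iff)
  also have "\<dots> = ennreal (real (card Oi))" by (simp add: ennreal_of_nat_eq_real_of_nat)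
  finally have "ennreal (real (card Og) * PH.modulus (inv\<^bsub>Hg\<^esub> (ca g))) = ennreal (real (card Oi))"
    using 1 eqs by simp
  then have "real (card Og) * PH.modulus (inv\<^bsub>Hg\<^esub> (ca g)) = real (card Oi)" by simp
  then have m: "real (card Og) = real (card Oi) * PH.modulus (ca g)"
    using PH.modulus_inv[OF gH] PH.modulus_pos[OF gH] by (simp add: field_simps)
  have "inv g <# \<Gamma> \<in> Oi" using g by (auto simp: Oi_def)
  then have "card Oi > 0" using fin by (auto simp: card_gt_0_iff)
  then show ?thesis
    using m g by (simp add: hecke_modular_def hecke_R_eq hecke_L_eq Og_def[symmetric] Oi_def[symmetric] field_simps)
qed

lemma ii_star:
  assumes f: "f \<in> carrier ZZ"
  shows "star ZZ f \<in> carrier ZZ \<and> ii (star ZZ f) = star PH.Cc (ii f)"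
proof -
  have F: "star PH.Cc (ii f) \<in> PH.binv" by (rule PH.star_binv[OF ii_binv[OF f]])
  have "star ZZ f = (\<lambda>D. if D \<in> double_cosets G \<Gamma> then star PH.Cc (ii f) (ca (coset_rep D)) else 0)"
  proof
    fix D
    show "star ZZ f D = (if D \<in> double_cosets G \<Gamma> then star PH.Cc (ii f) (ca (coset_rep D)) else 0)"
    proof (cases "D \<in> double_cosets G \<Gamma>")
      case D: True
      have d: "coset_rep D \<in> carrier G" "ca (coset_rep D) \<in> carrier Hg" using double_coset_rep[OF D] ca_H by auto
      have "star PH.Cc (ii f) (ca (coset_rep D)) = of_real (PH.modulus (ca (inv (coset_rep D)))) * cnj (ii f (ca (inv (coset_rep D))))"
        using d by (simp add: PH.Cc_star PH.w_act flip: ca_inv)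
      also have "\<dots> = of_real (hecke_modular G \<Gamma> (inv (coset_rep D))) * cnj (f (double_coset G \<Gamma> (inv (coset_rep D))))"
        using d by (simp add: modulus_ca hecke_to_Cc_eq ca_H ca_\<Gamma> double_coset_dc)
      finally show ?thesis using D by (simp add: hecke_alg_def)
    qed (simp add: hecke_alg_def)
  qed
  then show ?thesis using ii_surj[OF F] by simp
qed

lemma ii_nrm: assumes f: "f \<in> carrier ZZ" shows "nrm ZZ f = (\<integral>x. cmod (ii f x) \<partial>\<mu>)"
proof -
  define E where "E = {C \<in> S. f (dc C) \<noteq> 0}"
  have E: "finite E" "E \<subseteq> S" using ZZ_supp[OF f] by (auto simp: E_def)
  have c: "integrable \<mu> (PH.cabs (ii f))" by (rule PH.Cc_integrable[OF PH.cabs_Cc[OF PH.binvD(1)[OF ii_binv[OF f]]]])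
  have supp: "x \<Gamma> \<in> E" if "x \<in> carrier Hg" "PH.cabs (ii f) x \<noteq> 0" for x
    using that H_app[OF that(1) \<Gamma>_S(1)] by (auto simp: PH.cabs_def E_def hecke_to_Cc_eq)
  have "complex_of_real (\<integral>x. cmod (ii f x) \<partial>\<mu>) = (\<integral>x. PH.cabs (ii f) x \<partial>\<mu>)" by (rule PH.nrm_cabs)
  also have "\<dots> = (\<Sum>C\<in>E. PH.cabs (ii f) (PH.sect C))"
    using PH.binvD(2)[OF ii_binv[OF f]] by (intro PH.integral_right_inv[OF c E]) (rule supp; assumption | simp add: PH.cabs_def)+
  also have "\<dots> = (\<Sum>C\<in>E. complex_of_real (cmod (f (dc C))))"
    using E PH.sect by (intro sum.cong refl) (auto simp: PH.cabs_def hecke_to_Cc_eq subset_iff)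
  finally have 1: "(\<integral>x. cmod (ii f x) \<partial>\<mu>) = (\<Sum>C\<in>E. cmod (f (dc C)))" by (simp flip: of_real_sum)
  \<comment> \<open>Left cosets are grouped by double coset; the size of a group is
    \<open>hecke_L\<close>.\<close>
  also have "\<dots> = (\<Sum>D\<in>{D. f D \<noteq> 0}. \<Sum>C\<in>{C \<in> E. dc C = D}. cmod (f (dc C)))"
    using f E by (intro sum.group[symmetric]) (auto simp: ZZ_carrier E_def)
  also have "\<dots> = (\<Sum>D | f D \<noteq> 0. cmod (f D) * real (hecke_L G \<Gamma> (coset_rep D)))"
  proof (rule sum.cong[OF refl])
    fix D assume D: "D \<in> {D. f D \<noteq> 0}"
    then have DD: "D \<in> double_cosets G \<Gamma>" using f by (auto simp: ZZ_carrier)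
    note d = double_coset_rep[OF DD]
    have "{C \<in> E. dc C = D} = {C \<in> S. dc C = dc (coset_rep D <# \<Gamma>)}" using D d(2) by (auto simp: E_def)
    then show "(\<Sum>C\<in>{C \<in> E. dc C = D}. cmod (f (dc C))) = cmod (f D) * real (hecke_L G \<Gamma> (coset_rep D))"
      by (simp add: hecke_L_eq[OF d(1)] d(2))
  qed
  finally show ?thesis by (simp add: hecke_alg_def)
qed

sublocale PHecke: perm_hecke Hg HT \<mu> "\<lambda>x. x" S \<Gamma> ZZ ii
proof
  show "bij_betw ii (carrier ZZ) PH.binv"
    unfolding bij_betw_def
  proof
    show "inj_on ii (carrier ZZ)" using ii_inj by (rule inj_onI)
    show "ii ` carrier ZZ = PH.binv"
    proof
      show "ii ` carrier ZZ \<subseteq> PH.binv" using ii_binv by blast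
      show "PH.binv \<subseteq> ii ` carrier ZZ"
      proof
        fix F assume F: "F \<in> PH.binv"
        show "F \<in> ii ` carrier ZZ" by (rule image_eqI[where f = ii, OF ii_surj(2)[OF F, symmetric] ii_surj(1)[OF F]])
      qed
    qed
  qed
  fix f h k assume f: "f \<in> carrier ZZ"
  show "scal ZZ k f \<in> carrier ZZ \<and> ii (scal ZZ k f) = (\<lambda>x. k * ii f x)"
  proof
    have "{D. scal ZZ k f D \<noteq> 0} \<subseteq> {D. f D \<noteq> 0}" by (auto simp: hecke_alg_def)
    then show "scal ZZ k f \<in> carrier ZZ" using f finite_subset unfolding ZZ_carrier by blast
    show "ii (scal ZZ k f) = (\<lambda>x. k * ii f x)" by (auto simp: hecke_to_Cc_def hecke_alg_def)
  qed
  show "star ZZ f \<in> carrier ZZ \<and> ii (star ZZ f) = star PH.Cc (ii f)" by (rule ii_star[OF f])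
  show "nrm ZZ f = (\<integral>x. cmod (ii f x) \<partial>\<mu>)" by (rule ii_nrm[OF f])
  assume h: "h \<in> carrier ZZ"
  show "vmul ZZ f h \<in> carrier ZZ \<and> ii (vmul ZZ f h) = PH.conv (ii f) (ii h)" by (rule ii_mul[OF f h])
  show "vadd ZZ f h \<in> carrier ZZ \<and> ii (vadd ZZ f h) = (\<lambda>x. ii f x + ii h x)"
  proof
    have "{D. vadd ZZ f h D \<noteq> 0} \<subseteq> {D. f D \<noteq> 0} \<union> {D. h D \<noteq> 0}" by (auto simp: hecke_alg_def)
    then show "vadd ZZ f h \<in> carrier ZZ" using f h finite_subset[OF _ finite_UnI] unfolding ZZ_carrier by blast
    show "ii (vadd ZZ f h) = (\<lambda>x. ii f x + ii h x)" by (auto simp: hecke_to_Cc_def hecke_alg_def)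
  qed
qed

text \<open>Treats G and its reduction together: q is the identity or the quotient map, and r says
  that q g still determines the coset of g. Cosets reached by powers of V are then counted by powers
  of a finite set in Q.\<close>

lemma slow_growth_of_quotient:
  fixes Q :: "('q, 'k) monoid_scheme" and q :: "'a \<Rightarrow> 'q" and r :: "'q \<Rightarrow> 'a set"
  assumes Q: "group Q"
    and q: "\<And>g. g \<in> carrier G \<Longrightarrow> q g \<in> carrier Q"
      "\<And>g h. g \<in> carrier G \<Longrightarrow> h \<in> carrier G \<Longrightarrow> q (g \<otimes> h) = q g \<otimes>\<^bsub>Q\<^esub> q h"
    and r: "\<And>g. g \<in> carrier G \<Longrightarrow> r (q g) = g <# \<Gamma>"
    and sub: "subexponential_growth Q (discrete_topology (carrier Q))"
  shows PHecke.slow_growth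
  unfolding PHecke.slow_growth_def
proof (intro allI impI)
  interpret Q: group Q by (rule Q)
  fix V and e :: real
  assume "PH.CO V \<and> \<one>\<^bsub>Hg\<^esub> \<in> V \<and> (\<forall>x\<in>V. \<forall>k\<in>PH.tr \<Gamma> \<Gamma>. x \<otimes>\<^bsub>Hg\<^esub> k \<in> V \<and> k \<otimes>\<^bsub>Hg\<^esub> x \<in> V)" and e: "e > 0"
  then have V: "PH.CO V" "\<And>x k. x \<in> V \<Longrightarrow> k \<in> PH.tr \<Gamma> \<Gamma> \<Longrightarrow> k \<otimes>\<^bsub>Hg\<^esub> x \<in> V" by auto
  have Vc: "V \<subseteq> carrier Hg" by (rule PH.CO_sub[OF V(1)])
  \<comment> \<open>V moves the base point to finitely many cosets, whose representatives F
    collects. The identity is added so that the image of F is a neighbourhood of the identity in the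
    discrete group.\<close>
  define F where "F = insert \<one> (coset_rep ` (\<lambda>x. x \<Gamma>) ` V)"
  have VS: "x \<Gamma> \<in> S" if "x \<in> V" for x using that Vc H_app[OF _ \<Gamma>_S(1)] by blast
  have F: "finite F" "F \<subseteq> carrier G" "\<one> \<in> F"
    using PHecke.CO_orbit[OF V(1)] coset_rep(2)[OF VS] by (auto simp: F_def)
  \<comment> \<open>A product y over V differs from an element of G by a factor k of the stabiliser.
    Left invariance of V lets k be absorbed into the next letter, so words over V and over F reach
    the same cosets.\<close>
  have claim: "\<exists>g\<in>set_power G F n. x \<Gamma> = g <# \<Gamma>" if "x \<in> set_power Hg V n" for x n
    using that
  proof (induction n arbitrary: x)
    case 0
    then show ?case using \<Gamma>_S by (simp add: H_one)
  next
    case (Suc n)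
    then obtain y v where yv: "y \<in> set_power Hg V n" "v \<in> V" "x = y \<otimes>\<^bsub>Hg\<^esub> v" by (auto simp: set_mult_def)
    obtain g where g: "g \<in> set_power G F n" "y \<Gamma> = g <# \<Gamma>" using Suc.IH[OF yv(1)] by blast
    have yc: "y \<in> carrier Hg" and vc: "v \<in> carrier Hg" and gc: "g \<in> carrier G"
      using yv g PH.set_power_in[OF Vc] set_power_in[OF F(2)] Vc by blast+
    have cg: "ca g \<in> carrier Hg" by (rule ca_H[OF gc])
    define k where "k = inv\<^bsub>Hg\<^esub> (ca g) \<otimes>\<^bsub>Hg\<^esub> y"
    have k: "k \<in> PH.tr \<Gamma> \<Gamma>" "y = ca g \<otimes>\<^bsub>Hg\<^esub> k"
      unfolding k_def using PH.tr_b_eq[OF yc cg] g(2) gc by (auto simp: ca_\<Gamma>)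
    have kc: "k \<in> carrier Hg" by (rule PH.stabD(1)[OF k(1)])
    have kv: "k \<otimes>\<^bsub>Hg\<^esub> v \<in> V" by (rule V(2)[OF yv(2) k(1)])
    define C where "C = (k \<otimes>\<^bsub>Hg\<^esub> v) \<Gamma>"
    have C: "C \<in> S" "coset_rep C \<in> F" unfolding C_def F_def using VS[OF kv] kv by auto
    have "x = ca g \<otimes>\<^bsub>Hg\<^esub> (k \<otimes>\<^bsub>Hg\<^esub> v)" using yv(3) k(2) cg kc vc by (simp add: PH.m_assoc)
    then have "x \<Gamma> = g <# C"
      using H_mult[OF cg PH.m_closed[OF kc vc] \<Gamma>_S(1)] ca_apply[OF C(1)] by (simp add: C_def)
    also have "\<dots> = (g \<otimes> coset_rep C) <# \<Gamma>"
      using coset_rep[OF C(1)] gc lc_assoc by metis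
    finally show ?case using g(1) C(2) by (auto simp: set_mult_def)
  qed
  have qF: "q ` F \<subseteq> carrier Q" using F q(1) by blast
  have q1: "q \<one> = \<one>\<^bsub>Q\<^esub>"
    using q(2)[of \<one> \<one>] Q.l_cancel_one[OF q(1)[OF one_closed] q(1)[OF one_closed]] by simp
  have qp: "q g \<in> set_power Q (q ` F) n" if "g \<in> set_power G F n" for g n
    using that
  proof (induction n arbitrary: g)
    case 0 then show ?case by (simp add: q1)
  next
    case (Suc n)
    then obtain a h where ah: "a \<in> set_power G F n" "h \<in> F" "g = a \<otimes> h" by (auto simp: set_mult_def)
    have "a \<in> carrier G" "h \<in> carrier G" using ah F set_power_in[OF F(2)] by blast+
    then have "q g = q a \<otimes>\<^bsub>Q\<^esub> q h" using ah q(2) by simp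
    then show ?case using Suc.IH[OF ah(1)] ah(2) by (auto simp: set_mult_def)
  qed
  have fin: "finite (set_power Q (q ` F) n)" for n
    using F(1) by (induction n) (auto simp: set_mult_def)
  have card: "card ((\<lambda>x. x \<Gamma>) ` set_power Hg V n) \<le> card (set_power Q (q ` F) n)" for n
  proof -
    have "(\<lambda>x. x \<Gamma>) ` set_power Hg V n \<subseteq> r ` set_power Q (q ` F) n"
    proof
      fix C assume "C \<in> (\<lambda>x. x \<Gamma>) ` set_power Hg V n"
      then obtain g where g: "g \<in> set_power G F n" "C = g <# \<Gamma>" using claim by blast
      then have "C = r (q g)" using r set_power_in[OF F(2)] by auto
      then show "C \<in> r ` set_power Q (q ` F) n" using qp[OF g(1)] by blast
    qed
    then show ?thesis using surj_card_le[OF fin] by blast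
  qed
  obtain \<nu> where \<nu>: "left_haar_measure Q (discrete_topology (carrier Q)) \<nu>"
    "\<forall>V. compactin (discrete_topology (carrier Q)) V \<and> \<one>\<^bsub>Q\<^esub> \<in> discrete_topology (carrier Q) interior_of V \<longrightarrow>
       limsup (\<lambda>n. ereal (root n (measure \<nu> (set_power Q V n)))) = 1"
    using sub unfolding subexponential_growth_def by blast
  obtain c where c: "c > 0" "\<And>F. finite F \<Longrightarrow> F \<subseteq> carrier Q \<Longrightarrow> measure \<nu> F = c * real (card F)"
    using Q.discrete_haar[OF \<nu>(1)] by blast
  have "compactin (discrete_topology (carrier Q)) (q ` F)"
    using qF F(1) by (simp add: compactin_discrete_topology)
  moreover have "\<one>\<^bsub>Q\<^esub> \<in> discrete_topology (carrier Q) interior_of (q ` F)"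
    using qF F(3) q1 by (metis image_eqI interior_of_openin openin_discrete_topology)
  ultimately have "limsup (\<lambda>n. ereal (root n (measure \<nu> (set_power Q (q ` F) n)))) = 1"
    using \<nu>(2) by blast
  then have "limsup (\<lambda>n. ereal (root n (c * real (card (set_power Q (q ` F) n))))) = 1"
    using c(2)[OF fin Q.set_power_in[OF qF]] by simp
  from growth_of_limsup[OF c(1) this e]
  obtain B where B: "B > 0" "\<And>n. real (card (set_power Q (q ` F) n)) \<le> B * (1 + e) ^ n" by blast
  have "real (card ((\<lambda>x. x \<Gamma>) ` set_power Hg V n)) \<le> B * (1 + e) ^ n" for n
    using card[of n] B(2)[of n] by (meson of_nat_le_iff order_trans)
  then show "\<exists>c>0. \<forall>n. real (card ((\<lambda>x. x \<Gamma>) ` set_power Hg V n)) \<le> c * (1 + e) ^ n" using B(1) by blast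
qed

section \<open>The reduction kernel and the three growth hypotheses\<close>

abbreviation (input) "N\<Gamma> \<equiv> reduction_kernel G \<Gamma>"

lemma reduction_kernel_iff: "x \<in> N\<Gamma> \<longleftrightarrow> x \<in> carrier G \<and> (\<forall>g\<in>carrier G. inv g \<otimes> x \<otimes> g \<in> \<Gamma>)"
proof
  assume x: "x \<in> N\<Gamma>"
  have g: "x \<in> carrier G \<and> inv g \<otimes> x \<otimes> g \<in> \<Gamma>" if g: "g \<in> carrier G" for g
  proof -
    obtain k where k: "k \<in> \<Gamma>" "x = g \<otimes> k \<otimes> inv g" using x g unfolding reduction_kernel_def by blast
    have kc: "k \<in> carrier G" using k \<Gamma>_sub by blast
    have "inv g \<otimes> x \<otimes> g = k" using k(2) g kc by (simp add: m_assoc) (simp flip: m_assoc)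
    then show ?thesis using k g kc by simp
  qed
  then show "x \<in> carrier G \<and> (\<forall>g\<in>carrier G. inv g \<otimes> x \<otimes> g \<in> \<Gamma>)" using one_closed by blast
next
  assume x: "x \<in> carrier G \<and> (\<forall>g\<in>carrier G. inv g \<otimes> x \<otimes> g \<in> \<Gamma>)"
  show "x \<in> N\<Gamma>"
    unfolding reduction_kernel_def
  proof
    fix g assume g: "g \<in> carrier G"
    have "x = g \<otimes> (inv g \<otimes> x \<otimes> g) \<otimes> inv g" using x g by (simp add: m_assoc) (simp flip: m_assoc)
    then show "x \<in> (\<lambda>x. g \<otimes> x \<otimes> inv g) ` \<Gamma>" using x g by blast
  qed
qed

lemma reduction_kernel_sub: "N\<Gamma> \<subseteq> \<Gamma>"
proof
  fix x assume "x \<in> N\<Gamma>"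
  then have "x \<in> carrier G" "inv \<one> \<otimes> x \<otimes> \<one> \<in> \<Gamma>" using reduction_kernel_iff by blast+
  then show "x \<in> \<Gamma>" by simp
qed

lemma reduction_kernel_normal: "N\<Gamma> \<lhd> G"
  unfolding normal_inv_iff
proof
  show "subgroup N\<Gamma> G"
  proof
    show "N\<Gamma> \<subseteq> carrier G" using reduction_kernel_iff by blast
    show "\<one> \<in> N\<Gamma>" using subgroup.one_closed[OF \<Gamma>] by (simp add: reduction_kernel_iff)
    fix x assume x: "x \<in> N\<Gamma>"
    then have xc: "x \<in> carrier G" using reduction_kernel_iff by blast
    have "inv g \<otimes> inv x \<otimes> g \<in> \<Gamma>" if g: "g \<in> carrier G" for g
    proof -
      have "inv g \<otimes> x \<otimes> g \<in> \<Gamma>" using x g reduction_kernel_iff by blast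
      then have "inv (inv g \<otimes> x \<otimes> g) \<in> \<Gamma>" by (rule subgroup.m_inv_closed[OF \<Gamma>])
      then show ?thesis using g xc by (simp add: inv_mult_group m_assoc)
    qed
    then show "inv x \<in> N\<Gamma>" using xc by (simp add: reduction_kernel_iff)
    fix y assume y: "y \<in> N\<Gamma>"
    then have yc: "y \<in> carrier G" using reduction_kernel_iff by blast
    have "inv g \<otimes> (x \<otimes> y) \<otimes> g \<in> \<Gamma>" if g: "g \<in> carrier G" for g
    proof -
      have "inv g \<otimes> x \<otimes> g \<in> \<Gamma>" "inv g \<otimes> y \<otimes> g \<in> \<Gamma>" using x y g reduction_kernel_iff by blast+
      then have "(inv g \<otimes> x \<otimes> g) \<otimes> (inv g \<otimes> y \<otimes> g) \<in> \<Gamma>" by (rule subgroup.m_closed[OF \<Gamma>])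
      moreover have "(inv g \<otimes> x \<otimes> g) \<otimes> (inv g \<otimes> y \<otimes> g) = inv g \<otimes> (x \<otimes> y) \<otimes> g"
      proof -
        have "g \<otimes> (inv g \<otimes> (y \<otimes> g)) = y \<otimes> g" using g yc by (simp flip: m_assoc)
        then show ?thesis using g xc yc by (simp add: m_assoc)
      qed
      ultimately show ?thesis by simp
    qed
    then show "x \<otimes> y \<in> N\<Gamma>" using xc yc by (simp add: reduction_kernel_iff)
  qed
  show "\<forall>x\<in>carrier G. \<forall>h\<in>N\<Gamma>. x \<otimes> h \<otimes> inv x \<in> N\<Gamma>"
  proof (intro ballI)
    fix x h assume x: "x \<in> carrier G" and h: "h \<in> N\<Gamma>"
    have hc: "h \<in> carrier G" using h reduction_kernel_iff by blast
    have "inv g \<otimes> (x \<otimes> h \<otimes> inv x) \<otimes> g \<in> \<Gamma>" if g: "g \<in> carrier G" for g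
    proof -
      have "inv (inv x \<otimes> g) \<otimes> h \<otimes> (inv x \<otimes> g) \<in> \<Gamma>" using x g h reduction_kernel_iff by blast
      then show ?thesis using x g hc by (simp add: inv_mult_group m_assoc)
    qed
    then show "x \<otimes> h \<otimes> inv x \<in> N\<Gamma>" using x hc by (simp add: reduction_kernel_iff)
  qed
qed

lemma slow_growth:
  assumes "subexponential_growth G (discrete_topology (carrier G)) \<or>
    subexponential_growth (reduction_group G \<Gamma>) (discrete_topology (carrier (reduction_group G \<Gamma>))) \<or>
    subexponential_growth Hg HT"
  shows PHecke.slow_growth
  using assms
proof (elim disjE)
  assume "subexponential_growth G (discrete_topology (carrier G))"
  then show ?thesis by (intro slow_growth_of_quotient[of G "\<lambda>g. g" "\<lambda>g. g <# \<Gamma>"]) (simp_all add: is_group)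
next
  assume sub: "subexponential_growth (reduction_group G \<Gamma>) (discrete_topology (carrier (reduction_group G \<Gamma>)))"
  have N: "subgroup N\<Gamma> G" by (rule normal_imp_subgroup[OF reduction_kernel_normal])
  \<comment> \<open>The kernel is normal and contained in \<Gamma>, so multiplying its coset by
    \<Gamma> recovers the left coset of g; this is the map r for the reduction.\<close>
  have "(N\<Gamma> #> g) <#> \<Gamma> = g <# \<Gamma>" if g: "g \<in> carrier G" for g
  proof -
    have "N\<Gamma> #> g = g <# N\<Gamma>" using normal.coset_eq[OF reduction_kernel_normal] g by blast
    moreover have "(g <# N\<Gamma>) <#> \<Gamma> = g <# \<Gamma>"
    proof
      show "(g <# N\<Gamma>) <#> \<Gamma> \<subseteq> g <# \<Gamma>"
      proof
        fix x assume "x \<in> (g <# N\<Gamma>) <#> \<Gamma>"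
        then obtain n k where nk: "n \<in> N\<Gamma>" "k \<in> \<Gamma>" "x = (g \<otimes> n) \<otimes> k"
          unfolding set_mult_def l_coset_def by blast
        have n\<Gamma>: "n \<in> \<Gamma>" using nk(1) reduction_kernel_sub by blast
        then have "x = g \<otimes> (n \<otimes> k)" using nk g \<Gamma>_sub by (simp add: m_assoc)
        then show "x \<in> g <# \<Gamma>" using subgroup.m_closed[OF \<Gamma> n\<Gamma> nk(2)] unfolding l_coset_def by blast
      qed
      show "g <# \<Gamma> \<subseteq> (g <# N\<Gamma>) <#> \<Gamma>"
      proof
        fix x assume "x \<in> g <# \<Gamma>"
        then obtain k where k: "k \<in> \<Gamma>" "x = (g \<otimes> \<one>) \<otimes> k" using g unfolding l_coset_def by auto
        then show "x \<in> (g <# N\<Gamma>) <#> \<Gamma>" using subgroup.one_closed[OF N] unfolding set_mult_def l_coset_def by blast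
      qed
    qed
    ultimately show ?thesis by simp
  qed
  then show ?thesis
    using sub normal.factorgroup_is_group[OF reduction_kernel_normal] normal.rcos_sum[OF reduction_kernel_normal]
    by (intro slow_growth_of_quotient[of "reduction_group G \<Gamma>" "\<lambda>g. N\<Gamma> #> g" "\<lambda>X. X <#> \<Gamma>"])
      (auto simp: reduction_group_def FactGroup_def RCOSETS_def)
next
  assume "subexponential_growth Hg HT"
  then show ?thesis by (rule PHecke.slow_growth_completion)
qed

end

theorem corollary3:
  fixes G :: "('a, 'm) monoid_scheme" and \<Gamma> :: "'a set"
    and \<mu> :: "('a set \<Rightarrow> 'a set) measure"
  assumes "hecke_pair G \<Gamma>"
    and "left_haar_measure (schlichting_group G \<Gamma>) (schlichting_topology G \<Gamma>) \<mu>"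
    and "emeasure \<mu> (schlichting_subgroup G \<Gamma>) = 1"
    and "subexponential_growth G (discrete_topology (carrier G)) \<or>
         subexponential_growth (reduction_group G \<Gamma>)
           (discrete_topology (carrier (reduction_group G \<Gamma>))) \<or>
         subexponential_growth (schlichting_group G \<Gamma>) (schlichting_topology G \<Gamma>)"
  shows "((\<exists>\<Phi>. canonical_surjection (carrier (hecke_alg G \<Gamma>))
                 (hecke_to_cstar_L1 G \<Gamma>) (cstar_L1_hecke G \<Gamma>)
                 (hecke_to_corner G \<Gamma> \<mu>) (cstar_corner G \<Gamma> \<mu>) \<Phi>) \<and>
          (\<forall>\<Phi>. canonical_surjection (carrier (hecke_alg G \<Gamma>))
                 (hecke_to_cstar_L1 G \<Gamma>) (cstar_L1_hecke G \<Gamma>)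
                 (hecke_to_corner G \<Gamma> \<mu>) (cstar_corner G \<Gamma> \<mu>) \<Phi> \<longrightarrow>
               star_iso (cstar_L1_hecke G \<Gamma>) (cstar_corner G \<Gamma> \<mu>) \<Phi>)) \<and>
         ((\<exists>\<Psi>. canonical_surjection (carrier (hecke_alg G \<Gamma>))
                 (hecke_to_corner G \<Gamma> \<mu>) (cstar_corner G \<Gamma> \<mu>)
                 (hecke_to_reduced G \<Gamma> \<mu>) (cstar_reduced_hecke G \<Gamma> \<mu>) \<Psi>) \<and>
          (\<forall>\<Psi>. canonical_surjection (carrier (hecke_alg G \<Gamma>))
                 (hecke_to_corner G \<Gamma> \<mu>) (cstar_corner G \<Gamma> \<mu>)
                 (hecke_to_reduced G \<Gamma> \<mu>) (cstar_reduced_hecke G \<Gamma> \<mu>) \<Psi> \<longrightarrow>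
               star_iso (cstar_corner G \<Gamma> \<mu>) (cstar_reduced_hecke G \<Gamma> \<mu>) \<Psi>))"
proof -
  have "group G" using assms(1) by (simp add: hecke_pair_def)
  then interpret hecke_haar G \<Gamma> \<mu>
    using assms(1-3) by (intro hecke_haar.intro hecke.intro hecke_axioms.intro hecke_haar_axioms.intro)
  \<comment> \<open>The maps in the statement are \<open>emb\<close> for the Hecke algebra and for
    \<open>Cc\<close>, with the L^1-completions given their own names.\<close>
  have emb: "hecke_to_cstar_L1 G \<Gamma> = star_nalg.emb ZZ"
    by (rule ext) (simp add: star_nalg.emb_def[OF PHecke.star_nalg_Z] hecke_to_cstar_L1_def L1_hecke_def)
  have CC: "Cc_to_cstar Hg HT \<mu> = star_nalg.emb PH.Cc"
    by (rule ext) (simp add: star_nalg.emb_def[OF PH.star_nalg_Cc] Cc_to_cstar_def L1_group_def)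
  have to_corner: "hecke_to_corner G \<Gamma> \<mu> = (\<lambda>f. star_nalg.emb PH.Cc (ii f))"
    by (rule ext) (simp add: hecke_to_corner_def CC)
  have full_alg: "cstar_L1_hecke G \<Gamma> = enveloping_cstar (completion ZZ)"
    by (simp add: cstar_L1_hecke_def L1_hecke_def)
  have corner_alg: "cstar_corner G \<Gamma> \<mu> =
      corner (star_nalg.emb PH.Cc PH.unit_proj) (enveloping_cstar (completion PH.Cc))"
    by (simp add: cstar_corner_def CC schlichting_proj_def K_tr cstar_group_def L1_group_def PH.unit_proj_def)
  show ?thesis
    unfolding emb to_corner full_alg corner_alg cstar_reduced_hecke_def hecke_to_reduced_def reduced_hecke_alg_def
    using PHecke.cstar_completions[OF slow_growth[OF assms(4)]] by (intro conjI allI impI)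
qed

end
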